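(* Let $n\ge 2$, let $G\le\mathrm{Out}(F_n)$ be a finite subgroup, let $E$ be the full preimage of $G$ in $\mathrm{Aut}(F_n)$, and let $\alpha\colon G\to\mathrm{Out}(F_n)$ be the inclusion. Let $\mathrm{Aut}^0(E)$ be the subgroup of $\mathrm{Aut}(E)$ consisting of automorphisms leaving $F_n\cong\mathrm{Inn}(F_n)\le E$ invariant, and let $\mathrm{Out}^0(E)$ be its image in $\mathrm{Out}(E)$. Then: (i) The isometry $i\colon\mathscr{PT}(E)\to\mathscr{PT}(F_n)$ induces a simplicial isomorphism $L(E)\to L_\alpha$. (ii) The normalizer $N(G)$ of $G$ in $\mathrm{Out}(F_n)$ leaves $L_\alpha$ invariant. (iii) There is a short exact sequence $1\to G\to N(G)\to\mathrm{Out}^0(E)\to 1$.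
   Context: $F_n$ is the free group of rank $n$. For a finitely generated virtually non-abelian free group $F$ (such as $E$ or $F_n$), $\mathscr{T}(F)$ is the set of minimal isometric actions of $F$ on simplicial $\mathbb{R}$-trees with finite stabilizers, up to $F$-equivariant isometry. $\mathscr{PT}(F)\subset\mathscr{T}(F)$ consists of trees of volume $1$, where $\mathrm{vol}(\Gamma)=\sum_e \ell(e)/|\mathrm{Stab}(e)|$, the sum running over representatives of $F$-orbits of edges (after subdividing at midpoints of inverted edges). For $H\le F$ of finite index $m$, the map $i\colon\mathscr{PT}(F)\to\mathscr{PT}(H)$ restricts the action to $H$ and scales lengths by $1/m$; it is distance-preserving for the Lipschitz metric. $\mathrm{Aut}(F)$ acts on trees on the right by precomposing the action with an automorphism, and this gives an action of $\mathrm{Out}(F)$. Spine. Forget metrics and consider trees in $\mathscr{T}(F)$ up to $F$-equivariant homeomorphism. (The simplicial structure is the natural one: valence-two vertices occur only as midpoints of inverted edges.) If equivariantly collapsing an orbit of edges of $\Gamma$ yields a tree $\Gamma'\in\mathscr{T}(F)$, then $\Gamma'$ is obtained from $\Gamma$ by forest collapse. This generates a partial order on the set of classes of trees, and the spine $K(F)$ is the geometric realization of this poset. A tree is reduced if it is minimal in the poset. An edge of $\Gamma$ is surviving if there is a reduced collapse of $\Gamma$ in which it is not collapsed. The reduced spine $L(F)$ is the subcomplex of $K(F)$ spanned by trees all of whose edges are surviving. $L_\alpha$. For a homomorphism $\alpha\colon G\to\mathrm{Out}(F_n)$ with $G$ finite, $K_\alpha\subset K(F_n)$ is the fixed-point subcomplex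 of $\alpha(G)$. A vertex $\Gamma$ of $K(F_n)$ lies in $K_\alpha$ when the quotient graph $F_n\backslash\Gamma$ carries a $G$-action realizing $\alpha$ on $\pi_1$. $L_\alpha\subset K_\alpha$ is the subcomplex spanned by those $\Gamma$ for which every edge of $F_n\backslash\Gamma$ is essential, i.e. not contained in every maximal $G$-invariant forest of $F_n\backslash\Gamma$. The map induced by $i$ sends the vertex represented by an $E$-tree $\Gamma$ to the vertex represented by the same tree with action restricted to $F_n\cong\mathrm{Inn}(F_n)\le E$. *)

theory Defs
  imports "HOL-Algebra.Group_Action" "HOL-Algebra.Generated_Groups" Complex_Main
begin

section \<open>Groups\<close>

text \<open>A word is a list of letters \<open>(b, s)\<close>, standing for \<open>b\<close> if \<open>s\<close> holds and for the inverse of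
  \<open>b\<close> otherwise.\<close>

fun eval_word :: "('a, 'b) monoid_scheme \<Rightarrow> ('a \<times> bool) list \<Rightarrow> 'a" where
  "eval_word F [] = \<one>\<^bsub>F\<^esub>"
| "eval_word F ((b, s) # w) = (if s then b else inv\<^bsub>F\<^esub> b) \<otimes>\<^bsub>F\<^esub> eval_word F w"

definition reduced_word :: "('a \<times> bool) list \<Rightarrow> bool" where
  "reduced_word w \<longleftrightarrow>
     (\<forall>i. Suc i < length w \<longrightarrow> \<not> (fst (w ! i) = fst (w ! Suc i) \<and> snd (w ! i) \<noteq> snd (w ! Suc i)))"

definition free_basis :: "('a, 'b) monoid_scheme \<Rightarrow> 'a set \<Rightarrow> bool" where
  "free_basis F B \<longleftrightarrow> B \<subseteq> carrier F \<and> generate F B = carrier F \<and>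
     (\<forall>w. fst ` set w \<subseteq> B \<and> reduced_word w \<and> w \<noteq> [] \<longrightarrow> eval_word F w \<noteq> \<one>\<^bsub>F\<^esub>)"

definition free_group_of_rank :: "('a, 'b) monoid_scheme \<Rightarrow> nat \<Rightarrow> bool" where
  "free_group_of_rank F n \<longleftrightarrow> group F \<and> (\<exists>B. finite B \<and> card B = n \<and> free_basis F B)"

definition inner :: "('a, 'b) monoid_scheme \<Rightarrow> 'a \<Rightarrow> 'a \<Rightarrow> 'a" where
  "inner F x = (\<lambda>y\<in>carrier F. x \<otimes>\<^bsub>F\<^esub> y \<otimes>\<^bsub>F\<^esub> inv\<^bsub>F\<^esub> x)"

definition Inn :: "('a, 'b) monoid_scheme \<Rightarrow> ('a \<Rightarrow> 'a) set" where
  "Inn F = inner F ` carrier F"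

definition OutGroup :: "('a, 'b) monoid_scheme \<Rightarrow> ('a \<Rightarrow> 'a) set monoid" where
  "OutGroup F = AutoGroup F Mod Inn F"

definition out_class :: "('a, 'b) monoid_scheme \<Rightarrow> ('a \<Rightarrow> 'a) \<Rightarrow> ('a \<Rightarrow> 'a) set" where
  "out_class F \<phi> = Inn F #>\<^bsub>AutoGroup F\<^esub> \<phi>"

definition full_preimage :: "('a, 'b) monoid_scheme \<Rightarrow> ('a \<Rightarrow> 'a) set set \<Rightarrow> ('a \<Rightarrow> 'a) monoid" where
  "full_preimage F G = (AutoGroup F)\<lparr>carrier := {\<phi> \<in> auto F. out_class F \<phi> \<in> G}\<rparr>"

text \<open>Automorphisms of \<open>E\<close> leaving a subset \<open>I\<close> invariant, and their image in the outer
  automorphism group of \<open>E\<close>.\<close>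

definition Aut0 :: "('a, 'b) monoid_scheme \<Rightarrow> 'a set \<Rightarrow> ('a \<Rightarrow> 'a) set" where
  "Aut0 E I = {\<theta> \<in> auto E. \<theta> ` I = I}"

definition Out0 :: "('a, 'b) monoid_scheme \<Rightarrow> 'a set \<Rightarrow> ('a \<Rightarrow> 'a) set monoid" where
  "Out0 E I = (OutGroup E)\<lparr>carrier := out_class E ` Aut0 E I\<rparr>"

text \<open>The library's \<open>short_exact_sequence\<close> forces the three groups to have the same element type;
  this is the heterogeneous version, for \<open>1 \<rightarrow> A \<rightarrow> B \<rightarrow> C \<rightarrow> 1\<close>.\<close>

definition short_exact ::
    "('a, 'x) monoid_scheme \<Rightarrow> ('a \<Rightarrow> 'b) \<Rightarrow> ('b, 'y) monoid_scheme \<Rightarrow> ('b \<Rightarrow> 'c)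
       \<Rightarrow> ('c, 'z) monoid_scheme \<Rightarrow> bool" where
  "short_exact A f B g C \<longleftrightarrow> group_hom A B f \<and> group_hom B C g \<and>
     inj_on f (carrier A) \<and> g ` carrier B = carrier C \<and> f ` carrier A = kernel B C g"


section \<open>Graphs\<close>

text \<open>Graphs in the sense of Serre: every edge consists of two oriented edges \<open>a\<close> and \<open>rev a\<close>.
  Loops and multiple edges are allowed.\<close>

record ('v, 'e) sgraph =
  nodes :: "'v set"
  darts :: "'e set"
  src :: "'e \<Rightarrow> 'v"
  rev_dart :: "'e \<Rightarrow> 'e"

abbreviation tgt :: "('v, 'e) sgraph \<Rightarrow> 'e \<Rightarrow> 'v" where
  "tgt X a \<equiv> src X (rev_dart X a)"

definition circuit :: "('v, 'e) sgraph \<Rightarrow> 'e list \<Rightarrow> bool" where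
  "circuit X p \<longleftrightarrow> p \<noteq> [] \<and> distinct (map (src X) p) \<and>
     (\<forall>i<length p. let next = p ! (Suc i mod length p)
        in tgt X (p ! i) = src X next \<and> next \<noteq> rev_dart X (p ! i))"

text \<open>A forest is a set of unoriented edges, represented by a set of oriented edges that is closed
  under reversal.\<close>

definition forest :: "('v, 'e) sgraph \<Rightarrow> 'e set \<Rightarrow> bool" where
  "forest X S \<longleftrightarrow> S \<subseteq> darts X \<and> rev_dart X ` S = S \<and> \<not> (\<exists>p. set p \<subseteq> S \<and> circuit X p)"


section \<open>Trees with an action\<close>

text \<open>A simplicial tree is given by its vertices and its oriented edges, the latter as ordered pairs
  of vertices. The trees considered here are countable (vertex stabilizers are finite and the acting
  group is finitely generated), so natural numbers suffice as vertices.

  The vertices are the branch points of the tree. Group elements may invert edges; the midpoints of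
  inverted edges, which are the only possible vertices of valence two, are determined by the action
  and are not recorded as vertices. Consequently the simplicial structure does not depend on
  the acting group, and restricting the action to a subgroup leaves it unchanged. Collapsing the
  orbit of an inverted edge is the same as collapsing the orbit of either of its halves.\<close>

record 'g gtree =
  verts :: "nat set"
  arcs :: "(nat \<times> nat) set"
  act :: "'g \<Rightarrow> nat \<Rightarrow> nat"

definition tree_graph :: "'g gtree \<Rightarrow> (nat, nat \<times> nat) sgraph" where
  "tree_graph \<Gamma> = \<lparr>nodes = verts \<Gamma>, darts = arcs \<Gamma>, src = fst, rev_dart = prod.swap\<rparr>"

definition edges :: "'g gtree \<Rightarrow> nat set set" where
  "edges \<Gamma> = (\<lambda>(u, v). {u, v}) ` arcs \<Gamma>"

definition simplicial_tree :: "'g gtree \<Rightarrow> bool" where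
  "simplicial_tree \<Gamma> \<longleftrightarrow> verts \<Gamma> \<noteq> {} \<and> arcs \<Gamma> \<subseteq> verts \<Gamma> \<times> verts \<Gamma> \<and>
     (\<forall>u\<in>verts \<Gamma>. \<forall>v\<in>verts \<Gamma>. (u, v) \<in> (arcs \<Gamma>)\<^sup>*) \<and> forest (tree_graph \<Gamma>) (arcs \<Gamma>)"

definition acts_simplicially :: "('g, 'b) monoid_scheme \<Rightarrow> 'g gtree \<Rightarrow> bool" where
  "acts_simplicially F \<Gamma> \<longleftrightarrow> group_action F (verts \<Gamma>) (act \<Gamma>) \<and>
     (\<forall>x\<in>carrier F. \<forall>(u, v)\<in>arcs \<Gamma>. (act \<Gamma> x u, act \<Gamma> x v) \<in> arcs \<Gamma>)"

text \<open>There is no proper invariant subtree.\<close>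

definition minimal_action :: "('g, 'b) monoid_scheme \<Rightarrow> 'g gtree \<Rightarrow> bool" where
  "minimal_action F \<Gamma> \<longleftrightarrow>
     (\<forall>W. W \<subseteq> verts \<Gamma> \<and> W \<noteq> {} \<and> (\<forall>x\<in>carrier F. act \<Gamma> x ` W \<subseteq> W) \<and>
          (\<forall>u\<in>W. \<forall>v\<in>W. (u, v) \<in> (arcs \<Gamma> \<inter> W \<times> W)\<^sup>*) \<longrightarrow> W = verts \<Gamma>)"

definition finite_stabilizers :: "('g, 'b) monoid_scheme \<Rightarrow> 'g gtree \<Rightarrow> bool" where
  "finite_stabilizers F \<Gamma> \<longleftrightarrow>
     (\<forall>v\<in>verts \<Gamma>. finite (stabilizer F (act \<Gamma>) v)) \<and>
     (\<forall>e\<in>edges \<Gamma>. finite (stabilizer F (\<lambda>x. image (act \<Gamma> x)) e))"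

definition branching :: "'g gtree \<Rightarrow> bool" where
  "branching \<Gamma> \<longleftrightarrow> (\<forall>v\<in>verts \<Gamma>. finite (arcs \<Gamma> `` {v}) \<longrightarrow> 3 \<le> card (arcs \<Gamma> `` {v}))"

text \<open>The elements of \<open>\<T>(F)\<close> with metrics forgotten, before passing to equivalence classes.\<close>

definition Trees :: "('g, 'b) monoid_scheme \<Rightarrow> 'g gtree set" where
  "Trees F = {\<Gamma>. simplicial_tree \<Gamma> \<and> acts_simplicially F \<Gamma> \<and> minimal_action F \<Gamma> \<and>
                 finite_stabilizers F \<Gamma> \<and> branching \<Gamma>}"

definition equivariant ::
    "('g, 'b) monoid_scheme \<Rightarrow> 'g gtree \<Rightarrow> 'g gtree \<Rightarrow> (nat \<Rightarrow> nat) \<Rightarrow> bool" where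
  "equivariant F \<Gamma> \<Gamma>' p \<longleftrightarrow> (\<forall>x\<in>carrier F. \<forall>v\<in>verts \<Gamma>. p (act \<Gamma> x v) = act \<Gamma>' x (p v))"

definition tree_iso :: "'g gtree \<Rightarrow> 'h gtree \<Rightarrow> (nat \<Rightarrow> nat) \<Rightarrow> bool" where
  "tree_iso \<Gamma> \<Gamma>' h \<longleftrightarrow> bij_betw h (verts \<Gamma>) (verts \<Gamma>') \<and>
     (\<forall>u\<in>verts \<Gamma>. \<forall>v\<in>verts \<Gamma>. (u, v) \<in> arcs \<Gamma> \<longleftrightarrow> (h u, h v) \<in> arcs \<Gamma>')"

text \<open>Equivariant homeomorphisms preserve branch points, hence the simplicial structure; so
  the equivalence class of a tree consists of all trees with an equivariant simplicial isomorphism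
  to it.\<close>

definition tree_class :: "('g, 'b) monoid_scheme \<Rightarrow> 'g gtree \<Rightarrow> 'g gtree set" where
  "tree_class F \<Gamma> = {\<Gamma>' \<in> Trees F. \<exists>h. tree_iso \<Gamma> \<Gamma>' h \<and> equivariant F \<Gamma> \<Gamma>' h}"

text \<open>Pulling an action back along a homomorphism covers both the action of automorphisms by
  precomposition and the restriction to a subgroup.\<close>

definition pullback :: "('h \<Rightarrow> 'g) \<Rightarrow> 'g gtree \<Rightarrow> 'h gtree" where
  "pullback f \<Gamma> = \<lparr>verts = verts \<Gamma>, arcs = arcs \<Gamma>, act = (\<lambda>x. act \<Gamma> (f x))\<rparr>"


section \<open>Metric trees\<close>

type_synonym 'g metric_tree = "'g gtree \<times> (nat set \<Rightarrow> real)"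

definition edge_lengths :: "('g, 'b) monoid_scheme \<Rightarrow> 'g gtree \<Rightarrow> (nat set \<Rightarrow> real) \<Rightarrow> bool" where
  "edge_lengths F \<Gamma> len \<longleftrightarrow>
     (\<forall>e\<in>edges \<Gamma>. 0 < len e \<and> (\<forall>x\<in>carrier F. len (act \<Gamma> x ` e) = len e))"

definition pointwise_stabilizer :: "('g, 'b) monoid_scheme \<Rightarrow> 'g gtree \<Rightarrow> nat set \<Rightarrow> 'g set" where
  "pointwise_stabilizer F \<Gamma> e = {x \<in> carrier F. \<forall>v\<in>e. act \<Gamma> x v = v}"

definition inverted :: "('g, 'b) monoid_scheme \<Rightarrow> 'g gtree \<Rightarrow> nat set \<Rightarrow> bool" where
  "inverted F \<Gamma> e \<longleftrightarrow> pointwise_stabilizer F \<Gamma> e \<noteq> stabilizer F (\<lambda>x. image (act \<Gamma> x)) e"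

text \<open>Subdividing an inverted edge \<open>e\<close> at its midpoint replaces the orbit of \<open>e\<close> by a single orbit of
  edges, which have half the length of \<open>e\<close> and whose stabilizer is the pointwise stabilizer of \<open>e\<close>.\<close>

definition volume :: "('g, 'b) monoid_scheme \<Rightarrow> 'g metric_tree \<Rightarrow> real" where
  "volume F = (\<lambda>(\<Gamma>, len). \<Sum>orb\<in>orbits F (edges \<Gamma>) (\<lambda>x. image (act \<Gamma> x)).
     let e = SOME e. e \<in> orb
     in (if inverted F \<Gamma> e then len e / 2 else len e) / real (card (pointwise_stabilizer F \<Gamma> e)))"

definition metric_class :: "('g, 'b) monoid_scheme \<Rightarrow> 'g metric_tree \<Rightarrow> 'g metric_tree set" where
  "metric_class F = (\<lambda>(\<Gamma>, len). {(\<Gamma>', len'). \<Gamma>' \<in> Trees F \<and> edge_lengths F \<Gamma>' len' \<and>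
     (\<exists>h. tree_iso \<Gamma> \<Gamma>' h \<and> equivariant F \<Gamma> \<Gamma>' h \<and> (\<forall>e\<in>edges \<Gamma>. len' (h ` e) = len e))})"

definition PT :: "('g, 'b) monoid_scheme \<Rightarrow> 'g metric_tree set set" where
  "PT F = {metric_class F (\<Gamma>, len) | \<Gamma> len.
             \<Gamma> \<in> Trees F \<and> edge_lengths F \<Gamma> len \<and> volume F (\<Gamma>, len) = 1}"

text \<open>Here \<open>j\<close> is an injective homomorphism from \<open>H\<close> onto a subgroup of finite index of \<open>F\<close>.\<close>

definition restrict_metric ::
    "('g, 'b) monoid_scheme \<Rightarrow> ('h, 'c) monoid_scheme \<Rightarrow> ('h \<Rightarrow> 'g)
       \<Rightarrow> 'g metric_tree set \<Rightarrow> 'h metric_tree set" where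
  "restrict_metric F H j X =
     (let m = card (rcosets\<^bsub>F\<^esub> (j ` carrier H))
      in \<Union>(\<Gamma>, len)\<in>X. metric_class H (pullback j \<Gamma>, \<lambda>e. len e / real m))"

definition forget_metric ::
    "('g, 'b) monoid_scheme \<Rightarrow> 'g metric_tree set \<Rightarrow> 'g gtree set" where
  "forget_metric F X = (\<Union>(\<Gamma>, len)\<in>X. tree_class F \<Gamma>)"


section \<open>Forest collapses\<close>

definition collapsed_arcs :: "'g gtree \<Rightarrow> (nat \<Rightarrow> nat) \<Rightarrow> (nat \<times> nat) set" where
  "collapsed_arcs \<Gamma> p = {(u, v) \<in> arcs \<Gamma>. p u = p v}"

text \<open>The map \<open>p\<close> exhibits \<open>\<Gamma>'\<close> as the tree obtained from \<open>\<Gamma>\<close> by collapsing each edge in one orbit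
  to a point: it identifies two vertices iff they are joined by a path of collapsed edges,
  and it is a bijection on the remaining edges.\<close>

definition orbit_collapse ::
    "('g, 'b) monoid_scheme \<Rightarrow> 'g gtree \<Rightarrow> 'g gtree \<Rightarrow> (nat \<Rightarrow> nat) \<Rightarrow> bool" where
  "orbit_collapse F \<Gamma> \<Gamma>' p \<longleftrightarrow> \<Gamma> \<in> Trees F \<and> \<Gamma>' \<in> Trees F \<and> p ` verts \<Gamma> = verts \<Gamma>' \<and>
     equivariant F \<Gamma> \<Gamma>' p \<and>
     (\<exists>(u, v)\<in>arcs \<Gamma>. collapsed_arcs \<Gamma> p =
        (\<Union>x\<in>carrier F. {(act \<Gamma> x u, act \<Gamma> x v), (act \<Gamma> x v, act \<Gamma> x u)})) \<and>
     (\<forall>u\<in>verts \<Gamma>. \<forall>v\<in>verts \<Gamma>. p u = p v \<longrightarrow> (u, v) \<in> (collapsed_arcs \<Gamma> p)\<^sup>*) \<and>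
     bij_betw (map_prod p p) (arcs \<Gamma> - collapsed_arcs \<Gamma> p) (arcs \<Gamma>')"

text \<open>The vertex map is kept in order to say which edges have been collapsed.\<close>

inductive collapses ::
    "('g, 'b) monoid_scheme \<Rightarrow> 'g gtree \<Rightarrow> 'g gtree \<Rightarrow> (nat \<Rightarrow> nat) \<Rightarrow> bool"
  for F :: "('g, 'b) monoid_scheme" and \<Gamma> :: "'g gtree" where
  iso: "\<lbrakk>\<Gamma> \<in> Trees F; \<Gamma>' \<in> Trees F; tree_iso \<Gamma> \<Gamma>' h; equivariant F \<Gamma> \<Gamma>' h\<rbrakk>
          \<Longrightarrow> collapses F \<Gamma> \<Gamma>' h"
| step: "\<lbrakk>collapses F \<Gamma> \<Gamma>' p; orbit_collapse F \<Gamma>' \<Gamma>'' q\<rbrakk> \<Longrightarrow> collapses F \<Gamma> \<Gamma>'' (q \<circ> p)"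


section \<open>The spine and the reduced spine\<close>

text \<open>Simplicial complexes are abstract: a complex is the set of its (nonempty, finite) simplices.\<close>

definition simplicial_iso :: "('a \<Rightarrow> 'b) \<Rightarrow> 'a set set \<Rightarrow> 'b set set \<Rightarrow> bool" where
  "simplicial_iso f K L \<longleftrightarrow> bij_betw f (\<Union>K) (\<Union>L) \<and> image f ` K = L"

definition spanned :: "'a set set \<Rightarrow> 'a set \<Rightarrow> 'a set set" where
  "spanned K V = {\<sigma> \<in> K. \<sigma> \<subseteq> V}"

definition order_complex :: "'a set \<Rightarrow> ('a \<Rightarrow> 'a \<Rightarrow> bool) \<Rightarrow> 'a set set" where
  "order_complex V R = {\<sigma>. \<sigma> \<subseteq> V \<and> finite \<sigma> \<and> \<sigma> \<noteq> {} \<and> (\<forall>a\<in>\<sigma>. \<forall>b\<in>\<sigma>. R a b \<or> R b a)}"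

definition spine_vertices :: "('g, 'b) monoid_scheme \<Rightarrow> 'g gtree set set" where
  "spine_vertices F = tree_class F ` Trees F"

definition spine_le :: "('g, 'b) monoid_scheme \<Rightarrow> 'g gtree set \<Rightarrow> 'g gtree set \<Rightarrow> bool" where
  "spine_le F C' C \<longleftrightarrow> (\<exists>\<Gamma>\<in>C. \<exists>\<Gamma>'\<in>C'. \<exists>p. collapses F \<Gamma> \<Gamma>' p)"

definition spine :: "('g, 'b) monoid_scheme \<Rightarrow> 'g gtree set set set" where
  "spine F = order_complex (spine_vertices F) (spine_le F)"

definition reduced :: "('g, 'b) monoid_scheme \<Rightarrow> 'g gtree \<Rightarrow> bool" where
  "reduced F \<Gamma> \<longleftrightarrow> \<Gamma> \<in> Trees F \<and>
     (\<forall>C\<in>spine_vertices F. spine_le F C (tree_class F \<Gamma>) \<longrightarrow> C = tree_class F \<Gamma>)"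

definition surviving :: "('g, 'b) monoid_scheme \<Rightarrow> 'g gtree \<Rightarrow> nat \<times> nat \<Rightarrow> bool" where
  "surviving F \<Gamma> a \<longleftrightarrow> (\<exists>\<Gamma>' p. collapses F \<Gamma> \<Gamma>' p \<and> reduced F \<Gamma>' \<and> p (fst a) \<noteq> p (snd a))"

definition reduced_spine :: "('g, 'b) monoid_scheme \<Rightarrow> 'g gtree set set set" where
  "reduced_spine F =
     spanned (spine F) {C \<in> spine_vertices F. \<forall>\<Gamma>\<in>C. \<forall>a\<in>arcs \<Gamma>. surviving F \<Gamma> a}"


section \<open>Fixed points of finite groups of outer automorphisms\<close>

text \<open>The right action of outer automorphisms on the vertices of the spine. An outer
  automorphism is a coset of automorphisms; any two members give isomorphic trees.\<close>

definition out_act :: "('g, 'b) monoid_scheme \<Rightarrow> ('g \<Rightarrow> 'g) set \<Rightarrow> 'g gtree set \<Rightarrow> 'g gtree set"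
  where "out_act F \<nu> C = (\<Union>\<phi>\<in>\<nu>. \<Union>\<Gamma>\<in>C. tree_class F (pullback \<phi> \<Gamma>))"

definition fixed_spine ::
    "('g, 'b) monoid_scheme \<Rightarrow> ('k, 'c) monoid_scheme \<Rightarrow> ('k \<Rightarrow> ('g \<Rightarrow> 'g) set)
       \<Rightarrow> 'g gtree set set set" where
  "fixed_spine F G \<alpha> = {\<sigma> \<in> spine F. \<forall>g\<in>carrier G. \<forall>C\<in>\<sigma>. out_act F (\<alpha> g) C = C}"

abbreviation act_arcs :: "'g gtree \<Rightarrow> 'g \<Rightarrow> nat \<times> nat \<Rightarrow> nat \<times> nat" where
  "act_arcs \<Gamma> x \<equiv> map_prod (act \<Gamma> x) (act \<Gamma> x)"

text \<open>The orbit of the arc \<open>(u, v)\<close> is a set of pairs whose first components form the orbit of \<open>u\<close>.\<close>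

definition quotient_graph ::
    "('g, 'b) monoid_scheme \<Rightarrow> 'g gtree \<Rightarrow> (nat set, (nat \<times> nat) set) sgraph" where
  "quotient_graph F \<Gamma> =
     \<lparr>nodes = orbits F (verts \<Gamma>) (act \<Gamma>), darts = orbits F (arcs \<Gamma>) (act_arcs \<Gamma>),
      src = image fst, rev_dart = image prod.swap\<rparr>"

definition graph_action ::
    "('k, 'c) monoid_scheme \<Rightarrow> ('v, 'e) sgraph \<Rightarrow> ('k \<Rightarrow> 'v \<Rightarrow> 'v) \<Rightarrow> ('k \<Rightarrow> 'e \<Rightarrow> 'e) \<Rightarrow> bool" where
  "graph_action G X \<theta>V \<theta>E \<longleftrightarrow> group_action G (nodes X) \<theta>V \<and> group_action G (darts X) \<theta>E \<and>
     (\<forall>g\<in>carrier G. \<forall>a\<in>darts X. src X (\<theta>E g a) = \<theta>V g (src X a) \<and>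
        rev_dart X (\<theta>E g a) = \<theta>E g (rev_dart X a))"

text \<open>For free \<open>F\<close> the action on \<open>\<Gamma>\<close> is free, so that \<open>\<Gamma>\<close> is the universal cover of the quotient graph
  and \<open>F\<close> is its fundamental group, acting by deck transformations. A graph automorphism
  induces the outer automorphism \<open>\<alpha> g\<close> on the fundamental group iff it has a lift to \<open>\<Gamma>\<close> that is
  equivariant with respect to some automorphism representing \<open>\<alpha> g\<close>.\<close>

definition realizes ::
    "('g, 'b) monoid_scheme \<Rightarrow> 'g gtree \<Rightarrow> ('k, 'c) monoid_scheme \<Rightarrow> ('k \<Rightarrow> ('g \<Rightarrow> 'g) set)
       \<Rightarrow> ('k \<Rightarrow> nat set \<Rightarrow> nat set) \<Rightarrow> ('k \<Rightarrow> (nat \<times> nat) set \<Rightarrow> (nat \<times> nat) set) \<Rightarrow> bool" where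
  "realizes F \<Gamma> G \<alpha> \<theta>V \<theta>E \<longleftrightarrow> graph_action G (quotient_graph F \<Gamma>) \<theta>V \<theta>E \<and>
     (\<forall>g\<in>carrier G. \<exists>h. \<exists>\<phi>\<in>\<alpha> g. tree_iso \<Gamma> \<Gamma> h \<and> equivariant F \<Gamma> (pullback \<phi> \<Gamma>) h \<and>
        (\<forall>v\<in>verts \<Gamma>. orbit F (act \<Gamma>) (h v) = \<theta>V g (orbit F (act \<Gamma>) v)) \<and>
        (\<forall>a\<in>arcs \<Gamma>. orbit F (act_arcs \<Gamma>) (map_prod h h a) = \<theta>E g (orbit F (act_arcs \<Gamma>) a)))"

definition invariant_forest ::
    "('k, 'c) monoid_scheme \<Rightarrow> ('v, 'e) sgraph \<Rightarrow> ('k \<Rightarrow> 'e \<Rightarrow> 'e) \<Rightarrow> 'e set \<Rightarrow> bool" where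
  "invariant_forest G X \<theta>E S \<longleftrightarrow> forest X S \<and> (\<forall>g\<in>carrier G. \<theta>E g ` S = S)"

definition maximal_invariant_forest ::
    "('k, 'c) monoid_scheme \<Rightarrow> ('v, 'e) sgraph \<Rightarrow> ('k \<Rightarrow> 'e \<Rightarrow> 'e) \<Rightarrow> 'e set \<Rightarrow> bool" where
  "maximal_invariant_forest G X \<theta>E S \<longleftrightarrow> invariant_forest G X \<theta>E S \<and>
     (\<forall>S'. invariant_forest G X \<theta>E S' \<and> S \<subseteq> S' \<longrightarrow> S' = S)"

definition essential ::
    "('k, 'c) monoid_scheme \<Rightarrow> ('v, 'e) sgraph \<Rightarrow> ('k \<Rightarrow> 'e \<Rightarrow> 'e) \<Rightarrow> 'e \<Rightarrow> bool" where
  "essential G X \<theta>E a \<longleftrightarrow> \<not> (\<forall>S. maximal_invariant_forest G X \<theta>E S \<longrightarrow> a \<in> S)"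

definition essential_fixed_spine ::
    "('g, 'b) monoid_scheme \<Rightarrow> ('k, 'c) monoid_scheme \<Rightarrow> ('k \<Rightarrow> ('g \<Rightarrow> 'g) set)
       \<Rightarrow> 'g gtree set set set" where
  "essential_fixed_spine F G \<alpha> =
     spanned (fixed_spine F G \<alpha>)
       {C \<in> spine_vertices F. \<forall>\<Gamma>\<in>C. \<exists>\<theta>V \<theta>E. realizes F \<Gamma> G \<alpha> \<theta>V \<theta>E \<and>
          (\<forall>a\<in>darts (quotient_graph F \<Gamma>). essential G (quotient_graph F \<Gamma>) \<theta>E a)}"

end

theory Submission
  imports Defs "HOL-Algebra.Multiplicative_Group"
begin

text \<open>
  Write \<open>E\<close> for the full preimage of \<open>G\<close>. The key point is rigidity: two \<open>F\<^sub>n\<close>-equivariant collapse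
  maps between the same trees coincide. Their displacement is bounded by cocompactness, while at a
  vertex where it is maximal and positive it can be increased by moving away along an infinite
  branch. Conjugating by elements of \<open>E\<close>, one sees that an \<open>F\<^sub>n\<close>-equivariant collapse
  between two \<open>E\<close>-trees is \<open>E\<close>-equivariant, and that lifts of a graph action realizing
  \<open>\<alpha>\<close> assemble to an action of \<open>E\<close> on the tree. This gives injectivity, surjectivity and the
  comparison of the two partial orders. An \<open>E\<close>-invariant set of edges can be collapsed iff its
  components have finite stabilizers, and, since \<open>F\<^sub>n\<close> is torsion-free, iff its image in the
  quotient graph by \<open>F\<^sub>n\<close> is a forest. Reduced collapses thus correspond to maximal invariant forests,
  and surviving edges to essential ones. The exact sequence sends the class of \<open>\<phi>\<close> to conjugation by
  \<open>\<phi>\<close> on \<open>E\<close>; it uses that the centre of \<open>F\<^sub>n\<close> is trivial, so that an automorphism is determined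
  by its action on \<open>Inn(F\<^sub>n)\<close>.

  The definition of trees admits loops \<open>(v, v)\<close>, since such an arc is its own reverse and so not a
  circuit. Loops never survive and are never essential, hence the restriction to loop-free trees.
\<close>

section \<open>Free groups\<close>

text \<open>Collapses are defined as chains of single-orbit collapses. This is awkward, because one
  orbit of edges under \<open>E\<close> splits into several under \<open>F\<close>, and a chain of
  \<open>F\<close>-collapses need not respect \<open>E\<close> at its intermediate stages. The
  working notion is therefore \<open>collapse_map\<close>, which collapses any number of orbits at
  once. It passes between \<open>E\<close> and \<open>F\<close> as it stands, and a chain is
  recovered by peeling off one orbit at a time, which ends because there are finitely many orbits of
  arcs. Rigidity is needed for collapse maps and not only for isomorphisms, since the order of the
  spine has to be transferred too. A second obstacle is minimality: an \<open>E\<close>-minimal tree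
  must be shown to be \<open>F\<close>-minimal, which is done by intersecting an
  \<open>F\<close>-invariant subtree with its translates by coset representatives. Valence at least
  three enters mainly through one count: a finite nonempty set of vertices has at least three
  boundary arcs. It shows that collapsing creates no vertices of valence below three, and that the
  branches used for rigidity are infinite.\<close>

definition cancelling :: "'a \<times> bool \<Rightarrow> 'a \<times> bool \<Rightarrow> bool" where
  "cancelling x y \<longleftrightarrow> fst x = fst y \<and> snd x \<noteq> snd y"

definition word_inv :: "('a \<times> bool) list \<Rightarrow> ('a \<times> bool) list" where
  "word_inv w = rev (map (\<lambda>(b, s). (b, \<not> s)) w)"

text \<open>With \<open>successively\<close> the library rules for append, reversal and map apply,
  so words can be cut and glued without indices.\<close>

lemma reduced_word_successively: "reduced_word w \<longleftrightarrow> successively (\<lambda>x y. \<not> cancelling x y) w"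
  unfolding reduced_word_def cancelling_def
proof (induction w)
  case (Cons a w)
  have "(\<forall>i. Suc i < length (a # w) \<longrightarrow> P ((a # w) ! i) ((a # w) ! Suc i)) \<longleftrightarrow>
        (w = [] \<or> P a (hd w)) \<and> (\<forall>i. Suc i < length w \<longrightarrow> P (w ! i) (w ! Suc i))" for P
    by (cases w) (auto simp: nth_Cons split: nat.splits)
  from this[of "\<lambda>x y. \<not> (fst x = fst y \<and> snd x \<noteq> snd y)"] Cons show ?case
    by (auto simp: successively_Cons)
qed auto

lemma reduced_word_append:
  "reduced_word (u @ w) \<longleftrightarrow> reduced_word u \<and> reduced_word w \<and>
     (u = [] \<or> w = [] \<or> \<not> cancelling (last u) (hd w))"
  by (auto simp: reduced_word_successively successively_append_iff)

lemma reduced_word_inv: "reduced_word (word_inv w) \<longleftrightarrow> reduced_word w"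
  by (auto simp: reduced_word_successively word_inv_def successively_map cancelling_def
      case_prod_beta eq_commute intro!: arg_cong2[where f = successively])

lemma reduced_word_Cons:
  "reduced_word (x # w) \<longleftrightarrow> reduced_word w \<and> (w = [] \<or> \<not> cancelling x (hd w))"
  by (auto simp: reduced_word_successively successively_Cons)

lemma reduced_word_singleton: "reduced_word [x]"
  by (simp add: reduced_word_def)

lemma letters_word_inv: "fst ` set (word_inv w) = fst ` set w"
  by (force simp: word_inv_def)

context group
begin

lemma eval_word_closed: "fst ` set w \<subseteq> carrier G \<Longrightarrow> eval_word G w \<in> carrier G"
  by (induction w) auto

lemma eval_word_append:
  "\<lbrakk>fst ` set u \<subseteq> carrier G; fst ` set w \<subseteq> carrier G\<rbrakk>
     \<Longrightarrow> eval_word G (u @ w) = eval_word G u \<otimes> eval_word G w"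
  by (induction u) (auto simp: eval_word_closed m_assoc)

lemma eval_word_inv:
  "fst ` set w \<subseteq> carrier G \<Longrightarrow> eval_word G (word_inv w) = inv (eval_word G w)"
proof (induction w)
  case (Cons x w)
  then have "eval_word G (word_inv (x # w)) =
      inv (eval_word G w) \<otimes> eval_word G [(fst x, \<not> snd x)]"
    by (subst eval_word_append[symmetric] Cons.IH[symmetric])+
       (use Cons in \<open>auto simp: word_inv_def case_prod_beta eval_word_append image_image\<close>)
  moreover obtain b s where "x = (b, s)" by (cases x)
  ultimately show ?case using Cons
    by (auto simp: inv_mult_group eval_word_closed split: if_splits)
qed (simp add: word_inv_def)

lemma eval_word_cancel:
  assumes "cancelling x y" "fst ` set (u @ [x, y] @ w) \<subseteq> carrier G"
  shows "eval_word G (u @ [x, y] @ w) = eval_word G (u @ w)"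
proof -
  obtain b s where [simp]: "x = (b, s)" "y = (b, \<not> s)"
    using assms(1) by (cases x; cases y) (auto simp: cancelling_def)
  have bw: "b \<in> carrier G" "eval_word G w \<in> carrier G"
    using assms(2) by (auto intro!: eval_word_closed)
  then have *: "eval_word G ([x, y] @ w) = eval_word G w"
    by (auto simp: m_assoc[symmetric])
  show ?thesis
    using assms(2) * eval_word_append[of u "[x, y] @ w"] eval_word_append[of u w]
    by (auto simp: image_Un simp del: eval_word.simps)
qed

lemma generate_eval_word:
  assumes "x \<in> generate G B" "B \<subseteq> carrier G"
  shows "\<exists>w. fst ` set w \<subseteq> B \<and> eval_word G w = x"
  using assms(1)
proof induction
  case one
  show ?case by (rule exI[of _ "[]"]) simp
next
  case (incl h)
  then show ?case using assms(2) by (intro exI[of _ "[(h, True)]"]) auto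
next
  case (inv h)
  then show ?case using assms(2) by (intro exI[of _ "[(h, False)]"]) auto
next
  case (eng h1 h2)
  then obtain u v where "fst ` set u \<subseteq> B \<and> eval_word G u = h1"
    "fst ` set v \<subseteq> B \<and> eval_word G v = h2" by blast
  then show ?case using assms(2)
    by (intro exI[of _ "u @ v"]) (auto simp: eval_word_append image_Un)
qed

text \<open>A shortest word representing \<open>x\<close> is reduced, since deleting a cancelling
  pair keeps the value and shortens the word.\<close>

lemma generate_reduced_word:
  assumes "x \<in> generate G B" "B \<subseteq> carrier G"
  obtains w where "fst ` set w \<subseteq> B" "reduced_word w" "eval_word G w = x"
proof -
  let ?P = "\<lambda>w. fst ` set w \<subseteq> B \<and> eval_word G w = x"
  obtain w where w: "?P w" "\<And>v. ?P v \<Longrightarrow> length w \<le> length v"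
  proof -
    obtain w0 where "?P w0" using generate_eval_word[OF assms] by blast
    from ex_has_least_nat[of ?P, OF this, of length] that show ?thesis by blast
  qed
  have "reduced_word w"
  proof (rule ccontr)
    assume "\<not> reduced_word w"
    then obtain i where i: "Suc i < length w" "cancelling (w ! i) (w ! Suc i)"
      by (auto simp: reduced_word_def cancelling_def)
    have dec: "w = take i w @ [w ! i, w ! Suc i] @ drop (Suc (Suc i)) w"
      using i(1) by (simp add: Cons_nth_drop_Suc)
    let ?v = "take i w @ drop (Suc (Suc i)) w"
    have "eval_word G ?v = x"
    proof -
      have "fst ` set w \<subseteq> carrier G" using w(1) assms(2) by blast
      then have "eval_word G w = eval_word G ?v"
        using eval_word_cancel[OF i(2), of "take i w" "drop (Suc (Suc i)) w"] by (metis dec)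
      with w(1) show ?thesis by simp
    qed
    moreover have "fst ` set ?v \<subseteq> B"
      using w(1) by (auto dest: in_set_takeD in_set_dropD)
    ultimately have "length w \<le> length ?v" using w(2) by blast
    then show False using i(1) by simp
  qed
  with w(1) that show ?thesis by blast
qed

section \<open>Torsion and centre of a free group\<close>

lemma eval_word_power:
  "fst ` set w \<subseteq> carrier G \<Longrightarrow> eval_word G (concat (replicate k w)) = eval_word G w [^] k"
proof (induction k)
  case (Suc k)
  have "fst ` set (concat (replicate k w)) \<subseteq> carrier G" using Suc.prems by force
  then show ?case using Suc
    by (simp add: eval_word_append nat_pow_Suc2[symmetric] eval_word_closed nat_pow_Suc2 del: nat_pow_Suc)
qed simp

lemma conj_nat_pow:
  assumes "x \<in> carrier G" "y \<in> carrier G"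
  shows "(x \<otimes> y \<otimes> inv x) [^] (k::nat) = x \<otimes> y [^] k \<otimes> inv x"
proof (induction k)
  case (Suc k)
  have "inv x \<otimes> (x \<otimes> (y \<otimes> inv x)) = y \<otimes> inv x"
    using assms by (simp add: m_assoc[symmetric])
  with Suc assms show ?case by (simp add: m_assoc)
qed (use assms in simp)

text \<open>If the last and first letters do not cancel, every power of \<open>w\<close> is itself a
  reduced word. Otherwise removing both letters conjugates the value by the first letter, which does
  not affect whether a power is trivial, and induction on the length applies.\<close>

lemma reduced_word_power_neq_one:
  assumes B: "free_basis G B" and k: "(k::nat) > 0"
  shows "\<lbrakk>fst ` set w \<subseteq> B; reduced_word w; w \<noteq> []\<rbrakk> \<Longrightarrow> eval_word G w [^] k \<noteq> \<one>"
proof (induction "length w" arbitrary: w rule: less_induct)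
  case less
  have BG: "B \<subseteq> carrier G" using B by (simp add: free_basis_def)
  show ?case
  proof (cases "cancelling (last w) (hd w)")
    case False
    \<comment> \<open>The clause on the head is what the append rule asks for at the junction with
      the next copy of \<open>w\<close>.\<close>
    have "reduced_word (concat (replicate j w)) \<and> (j > 0 \<longrightarrow> concat (replicate j w) \<noteq> [] \<and>
        hd (concat (replicate j w)) = hd w)" for j
      by (induction j) (use less.prems False in \<open>auto simp: reduced_word_append reduced_word_def[of "[]"]\<close>)
    moreover have "fst ` set (concat (replicate k w)) \<subseteq> B" using less.prems by force
    ultimately have "eval_word G (concat (replicate k w)) \<noteq> \<one>"
      using B k unfolding free_basis_def by blast
    then show ?thesis using less.prems BG by (subst (asm) eval_word_power) auto
  next
    case True
    obtain x v where xv: "w = x # v" using less.prems by (cases w) auto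
    with True have "v \<noteq> []" by (auto simp: cancelling_def)
    then obtain m y where my: "v = m @ [y]" by (cases v rule: rev_exhaust) auto
    have c: "cancelling y x" using True xv my by simp
    \<comment> \<open>With an empty middle, \<open>w\<close> would be a cancelling pair and not
      reduced.\<close>
    have m: "m \<noteq> []" using less.prems(2) c unfolding xv my
      by (auto simp: reduced_word_successively cancelling_def)
    have rm: "reduced_word m"
      using less.prems(2) unfolding xv my by (simp add: reduced_word_Cons reduced_word_append)
    have sm: "fst ` set m \<subseteq> B" using less.prems(1) unfolding xv my by auto
    have IH: "eval_word G m [^] k \<noteq> \<one>"
      by (rule less.hyps) (use m rm sm xv my in auto)
    let ?l = "eval_word G [x]"
    have l: "?l \<in> carrier G" using less.prems(1) BG unfolding xv by (intro eval_word_closed) auto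
    have em: "eval_word G m \<in> carrier G" using sm BG by (intro eval_word_closed) auto
    have "[y] = word_inv [x]" using c by (cases x; cases y) (auto simp: word_inv_def cancelling_def)
    then have "eval_word G [y] = inv ?l"
      using less.prems(1) BG unfolding xv by (simp only:) (intro eval_word_inv, auto)
    moreover have "eval_word G w = ?l \<otimes> (eval_word G m \<otimes> eval_word G [y])"
      using less.prems(1) BG eval_word_append[of "[x]" "m @ [y]"] eval_word_append[of m "[y]"]
      unfolding xv my by (auto simp del: eval_word.simps)
    ultimately have "eval_word G w [^] k = ?l \<otimes> eval_word G m [^] k \<otimes> inv ?l"
      using l em by (simp add: conj_nat_pow m_assoc[symmetric] del: eval_word.simps)
    moreover have "\<dots> \<noteq> \<one>"
    proof
      assume "?l \<otimes> eval_word G m [^] k \<otimes> inv ?l = \<one>"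
      then have "?l \<otimes> eval_word G m [^] k = ?l" using l em
        by (metis inv_closed inv_equality inv_inv m_closed nat_pow_closed)
      then show False using IH l em by (metis l_cancel_one nat_pow_closed)
    qed
    ultimately show ?thesis by simp
  qed
qed

lemma free_basis_torsion_free:
  assumes B: "free_basis G B" and x: "x \<in> carrier G" "x [^] k = \<one>" and k: "(k::nat) > 0"
  shows "x = \<one>"
proof -
  obtain w where "fst ` set w \<subseteq> B" "reduced_word w" "eval_word G w = x"
    using generate_reduced_word[of x B] B x(1) by (auto simp: free_basis_def)
  with reduced_word_power_neq_one[OF B k, of w] x(2) show ?thesis by (cases "w = []") auto
qed

text \<open>If \<open>w\<close> is reduced with first letter \<open>(a, s)\<close> and last letter on \<open>c\<close>, pick \<open>d \<noteq> c\<close>: then the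
  commutator word of \<open>w\<close> with \<open>(d, s)\<close> is again reduced.\<close>

lemma free_basis_center_trivial:
  assumes B: "free_basis G B" "finite B" "card B \<ge> 2" and x: "x \<in> carrier G"
    and comm: "\<And>y. y \<in> carrier G \<Longrightarrow> x \<otimes> y = y \<otimes> x"
  shows "x = \<one>"
proof (rule ccontr)
  assume "x \<noteq> \<one>"
  obtain w where w: "fst ` set w \<subseteq> B" "reduced_word w" "eval_word G w = x"
    using generate_reduced_word[of x B] B(1) x by (auto simp: free_basis_def)
  have BG: "B \<subseteq> carrier G" using B by (simp add: free_basis_def)
  have ne: "w \<noteq> []" using w(3) \<open>x \<noteq> \<one>\<close> by auto
  obtain d where d: "d \<in> B" "d \<noteq> fst (last w)"
  proof -
    have "\<not> B \<subseteq> {fst (last w)}"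
      using B(3) card_mono[of "{fst (last w)}" B] by auto
    then show ?thesis using that by auto
  qed
  let ?s = "snd (hd w)"
  have hd_inv: "hd (word_inv w) = (fst (last w), \<not> snd (last w))"
    using ne by (simp add: word_inv_def hd_rev last_map case_prod_beta)
  have last_inv: "last (word_inv w) = (fst (hd w), \<not> ?s)"
    using ne by (simp add: word_inv_def last_rev hd_map case_prod_beta)
  \<comment> \<open>The sign \<open>?s\<close> guards the last junction: \<open>word_inv w\<close>
    ends with sign \<open>\<not> ?s\<close>, the sign of the final letter, so the two cannot cancel
    even if \<open>d\<close> is the generator with which \<open>w\<close> starts. The other two
    junctions are safe because \<open>d\<close> differs from the last generator of
    \<open>w\<close>.\<close>
  let ?c = "w @ (d, ?s) # word_inv w @ [(d, \<not> ?s)]"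
  have "reduced_word ?c"
  proof -
    have "word_inv w \<noteq> []" using ne by (simp add: word_inv_def)
    then show ?thesis using w(2) d(2) ne
      by (auto simp: reduced_word_append reduced_word_Cons[of _ "_ @ _"] reduced_word_inv
          cancelling_def last_inv hd_inv reduced_word_singleton)
  qed
  moreover have sub: "fst ` set ?c \<subseteq> B"
    using w(1) d(1) letters_word_inv[of w] by (auto simp: image_Un)
  ultimately have "eval_word G ?c \<noteq> \<one>" using B(1) unfolding free_basis_def by blast
  moreover have "eval_word G ?c = \<one>"
  proof -
    define y where "y = (if ?s then d else inv d)"
    have y: "y \<in> carrier G" using d BG by (auto simp: y_def)
    have sw: "fst ` set w \<subseteq> carrier G" "fst ` set (word_inv w) \<subseteq> carrier G" "d \<in> carrier G"
      using w(1) BG d letters_word_inv[of w] by auto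
    have "eval_word G [(d, \<not> ?s)] = inv y" using sw by (auto simp: y_def)
    then have "eval_word G ?c = x \<otimes> (y \<otimes> (inv x \<otimes> inv y))"
      using sw w(3) by (simp add: eval_word_append image_Un eval_word_inv y_def del: eval_word.simps(1))
    also have "\<dots> = (x \<otimes> y) \<otimes> (inv x \<otimes> inv y)" using x y by (simp add: m_assoc)
    also have "\<dots> = (y \<otimes> x) \<otimes> (inv x \<otimes> inv y)" using comm[OF y] by simp
    also have "\<dots> = \<one>" using x y by (metis inv_mult_group m_closed r_inv)
    finally show ?thesis .
  qed
  ultimately show False by blast
qed

text \<open>By Lagrange every element of \<open>K\<close> raised to the order of \<open>K\<close> is
  trivial.\<close>

lemma torsion_free_finite_subgroup:
  assumes tf: "\<And>x k. \<lbrakk>x \<in> carrier G; x [^] (k::nat) = \<one>; k > 0\<rbrakk> \<Longrightarrow> x = \<one>"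
    and K: "subgroup K G" "finite K"
  shows "K = {\<one>}"
proof -
  have "x = \<one>" if x: "x \<in> K" for x
  proof -
    interpret K: group "G\<lparr>carrier := K\<rparr>" using K(1) by (rule subgroup_imp_group)
    have "x [^]\<^bsub>G\<lparr>carrier := K\<rparr>\<^esub> order (G\<lparr>carrier := K\<rparr>) = \<one>"
      using K.pow_order_eq_1[of x] x by simp
    then have "x [^] order (G\<lparr>carrier := K\<rparr>) = \<one>"
      using nat_pow_consistent[of x _ K] by simp
    moreover have "order (G\<lparr>carrier := K\<rparr>) > 0"
      using K.order_gt_0_iff_finite K(2) by simp
    ultimately show ?thesis by (rule tf[OF subgroup.mem_carrier[OF K(1) x]])
  qed
  then show ?thesis using subgroup.one_closed[OF K(1)] by blast
qed

end


section \<open>Bridges, half-trees and distances\<close>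

text \<open>This is the connectivity clause of \<open>minimal_action\<close>. In a tree it amounts
  to convexity, which is what makes \<open>subtree_Int\<close> true.\<close>

definition subtree :: "('v \<times> 'v) set \<Rightarrow> 'v set \<Rightarrow> bool" where
  "subtree A W \<longleftrightarrow> (\<forall>u\<in>W. \<forall>v\<in>W. (u, v) \<in> (A \<inter> W \<times> W)\<^sup>*)"

definition boundary :: "('v \<times> 'v) set \<Rightarrow> 'v set \<Rightarrow> ('v \<times> 'v) set" where
  "boundary A X = {(x, y) \<in> A. x \<in> X \<and> y \<notin> X}"

lemma rtrancl_sym_closed:
  "\<lbrakk>\<And>u v. (u, v) \<in> S \<Longrightarrow> (v, u) \<in> S; (x, y) \<in> S\<^sup>*\<rbrakk> \<Longrightarrow> (y, x) \<in> S\<^sup>*"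
  by (metis rtrancl_converseD converse_iff subsetI subset_antisym subrelI)

lemma rtrancl_last_exit:
  assumes "(w, w') \<in> A\<^sup>*" "w \<in> W" "w' \<notin> W"
  shows "\<exists>a a1. a \<in> W \<and> a1 \<notin> W \<and> (a, a1) \<in> A \<and> (a1, w') \<in> (A \<inter> (- W) \<times> (- W))\<^sup>*"
  using assms
proof (induction rule: rtrancl_induct)
  case (step y z)
  show ?case
  proof (cases "y \<in> W")
    case False
    with step obtain a a1 where "a \<in> W" "a1 \<notin> W" "(a, a1) \<in> A"
      "(a1, y) \<in> (A \<inter> (- W) \<times> (- W))\<^sup>*" by blast
    moreover have "(y, z) \<in> A \<inter> (- W) \<times> (- W)" using False step by simp
    ultimately show ?thesis by (meson rtrancl.rtrancl_into_rtrancl)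
  qed (use step in blast)
qed simp

text \<open>Acyclicity is expressed by bridges, that is, no arc can be bypassed. All later arguments
  produce or refute a bypass, and the condition also excludes loops, which \<open>forest\<close>
  tolerates.\<close>

locale tree_arcs =
  fixes V :: "'v set" and A :: "('v \<times> 'v) set"
  assumes arcs_sub: "A \<subseteq> V \<times> V"
    and arcs_sym: "(u, v) \<in> A \<Longrightarrow> (v, u) \<in> A"
    and connected: "\<lbrakk>u \<in> V; v \<in> V\<rbrakk> \<Longrightarrow> (u, v) \<in> A\<^sup>*"
    and bridge: "(u, v) \<in> A \<Longrightarrow> (v, u) \<notin> (A - {(u, v), (v, u)})\<^sup>*"
begin

text \<open>The half-tree beyond the oriented edge from \<open>u\<close> to \<open>v\<close>; it
  contains \<open>v\<close>, the second argument.\<close>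

definition half :: "'v \<Rightarrow> 'v \<Rightarrow> 'v set" where
  "half u v = {w. (v, w) \<in> (A - {(u, v), (v, u)})\<^sup>*}"

definition tdist :: "'v \<Rightarrow> 'v \<Rightarrow> nat" where
  "tdist x y = (LEAST k. (x, y) \<in> A ^^ k)"

lemma arcs_in: "(u, v) \<in> A \<Longrightarrow> u \<in> V \<and> v \<in> V"
  using arcs_sub by blast

lemma no_loop: "(v, v) \<notin> A"
  using bridge[of v v] by blast

lemma half_self: "v \<in> half u v"
  by (simp add: half_def)

lemma half_notin: "(u, v) \<in> A \<Longrightarrow> u \<notin> half u v"
  using bridge by (simp add: half_def)

text \<open>Every arc other than the cut edge survives the cut, so it preserves reachability from
  \<open>v\<close>.\<close>

lemma half_exit:
  assumes "(u, v) \<in> A" "x \<in> half u v" "(x, y) \<in> A" "y \<notin> half u v"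
  shows "x = v \<and> y = u"
proof -
  have "(x, y) \<notin> A - {(u, v), (v, u)}"
    using assms(2,4) unfolding half_def by (metis mem_Collect_eq rtrancl.rtrancl_into_rtrancl)
  with assms half_notin[of u v] show ?thesis by blast
qed

lemma half_enter:
  assumes "(u, v) \<in> A" "x \<notin> half u v" "(x, y) \<in> A" "y \<in> half u v"
  shows "x = u \<and> y = v"
  using half_exit[OF assms(1,4) arcs_sym[OF assms(3)] assms(2)] by simp

lemma half_cover:
  assumes "(u, v) \<in> A" "w \<in> V"
  shows "w \<in> half u v \<or> w \<in> half v u"
proof -
  have "(u, w) \<in> A\<^sup>*" using connected arcs_in assms by blast
  then show ?thesis
  proof induction
    case (step y z)
    then show ?case
      using half_exit[OF assms(1), of y z] half_exit[OF arcs_sym[OF assms(1)], of y z]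
        half_self by metis
  qed (simp add: half_self)
qed

lemma half_disjoint:
  assumes "(u, v) \<in> A" "w \<in> half u v"
  shows "w \<notin> half v u"
proof
  let ?R = "A - {(u, v), (v, u)}"
  assume "w \<in> half v u"
  then have "(u, w) \<in> ?R\<^sup>*" by (simp add: half_def insert_commute)
  then have "(w, u) \<in> ?R\<^sup>*" by (rule rtrancl_sym_closed[rotated]) (use arcs_sym in blast)
  with assms have "(v, u) \<in> ?R\<^sup>*" by (simp add: half_def)
  with bridge assms(1) show False by blast
qed

lemma half_compl:
  "\<lbrakk>(u, v) \<in> A; w \<in> V\<rbrakk> \<Longrightarrow> w \<in> half v u \<longleftrightarrow> w \<notin> half u v"
  using half_cover half_disjoint by blast

lemma half_subset: "(u, v) \<in> A \<Longrightarrow> half u v \<subseteq> V"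
proof
  fix w assume "(u, v) \<in> A" "w \<in> half u v"
  then have "(v, w) \<in> (A - {(u, v), (v, u)})\<^sup>*" "v \<in> V" using arcs_in by (auto simp: half_def)
  then show "w \<in> V" by induction (use arcs_in in auto)
qed

text \<open>After its last exit from \<open>W\<close> a path stays outside \<open>W\<close>. It
  therefore never reuses the exit arc, and its end lies in the half-tree beyond that arc.\<close>

lemma exit_half:
  assumes "(w, w') \<in> A\<^sup>*" "w \<in> W" "w' \<notin> W"
  obtains a a1 where "a \<in> W" "a1 \<notin> W" "(a, a1) \<in> A" "w' \<in> half a a1"
proof -
  obtain a a1 where *: "a \<in> W" "a1 \<notin> W" "(a, a1) \<in> A" "(a1, w') \<in> (A \<inter> (- W) \<times> (- W))\<^sup>*"
    using rtrancl_last_exit[OF assms] by blast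
  then have "A \<inter> (- W) \<times> (- W) \<subseteq> A - {(a, a1), (a1, a)}" by auto
  with * have "w' \<in> half a a1" unfolding half_def using rtrancl_mono by blast
  with * that show ?thesis by blast
qed

lemma first_step:
  assumes "a \<in> V" "b \<in> V" "a \<noteq> b"
  obtains a1 where "(a, a1) \<in> A" "b \<in> half a a1"
  using exit_half[of a b "{a}"] connected assms by (metis singleton_iff)

text \<open>The vertex \<open>a\<close> is not on the side of \<open>b\<close> when the edge from
  \<open>b\<close> to \<open>b1\<close> is cut. A walk from \<open>b\<close> on that side never
  meets \<open>a\<close>, the only way out of \<open>half a a1\<close>.\<close>

lemma half_nested:
  assumes "(a, a1) \<in> A" "(b, b1) \<in> A" "b \<in> half a a1" "a \<in> half b b1"
  shows "half b1 b \<subseteq> half a a1"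
proof
  fix y assume "y \<in> half b1 b"
  then have "(b, y) \<in> (A - {(b1, b), (b, b1)})\<^sup>*" by (simp add: half_def)
  then show "y \<in> half a a1"
  proof induction
    case (step z z')
    have "z' \<in> half b1 b"
      using step.hyps unfolding half_def by (auto intro: rtrancl.rtrancl_into_rtrancl)
    then have "z' \<noteq> a" using half_disjoint[OF arcs_sym[OF assms(2)]] assms(4) by blast
    then show ?case using half_exit[OF assms(1) step.IH, of z'] step.hyps by blast
  qed (use assms in simp)
qed

lemma subtree_half_disjoint:
  assumes "subtree A W" "a \<in> W" "a1 \<notin> W" "(a, a1) \<in> A" "w \<in> W"
  shows "w \<notin> half a a1"
proof -
  have "(a, w) \<in> (A \<inter> W \<times> W)\<^sup>*" using assms by (auto simp: subtree_def)
  then show ?thesis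
  proof induction
    case (step y z)
    then show ?case using half_enter[OF assms(4), of y z] assms(3) by blast
  qed (use half_notin assms in blast)
qed

text \<open>If a component of the intersection missed \<open>v\<close>, it would be left through an
  arc from \<open>a\<close> to \<open>a1\<close> with \<open>v\<close> beyond it. Both subtrees
  contain \<open>a\<close> and \<open>v\<close>, so by \<open>subtree_half_disjoint\<close> both
  contain \<open>a1\<close>, which extends the component.\<close>

lemma subtree_Int:
  assumes "subtree A W" "subtree A W'" "W \<subseteq> V"
  shows "subtree A (W \<inter> W')"
  unfolding subtree_def
proof (intro ballI, rule ccontr)
  fix u v assume u: "u \<in> W \<inter> W'" and v: "v \<in> W \<inter> W'"
  let ?R = "A \<inter> (W \<inter> W') \<times> (W \<inter> W')"
  let ?U = "{w. (u, w) \<in> ?R\<^sup>*}"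
  assume "(u, v) \<notin> ?R\<^sup>*"
  moreover have "(u, v) \<in> A\<^sup>*" using connected u v assms(3) by blast
  ultimately obtain a a1 where *: "a \<in> ?U" "a1 \<notin> ?U" "(a, a1) \<in> A" "v \<in> half a a1"
    using exit_half[of u v ?U] by auto
  have "?U \<subseteq> W \<inter> W'"
  proof
    fix w assume "w \<in> ?U"
    then have "(u, w) \<in> ?R\<^sup>*" by simp
    then show "w \<in> W \<inter> W'" by induction (use u in auto)
  qed
  with * have a: "a \<in> W" "a \<in> W'" by auto
  have "a1 \<in> W" "a1 \<in> W'"
    using subtree_half_disjoint[OF assms(1) a(1) _ *(3)] subtree_half_disjoint[OF assms(2) a(2) _ *(3)]
      *(4) v by auto
  with a *(3) have "(a, a1) \<in> ?R" by simp
  with *(1,2) show False by (simp add: rtrancl.rtrancl_into_rtrancl)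
qed

lemma subtree_in_half:
  assumes "subtree A W" "(a, a1) \<in> A" "a \<notin> W" "w \<in> W" "w \<in> half a a1"
  shows "W \<subseteq> half a a1"
proof
  fix z assume "z \<in> W"
  then have "(w, z) \<in> (A \<inter> W \<times> W)\<^sup>*" using assms by (auto simp: subtree_def)
  then show "z \<in> half a a1"
  proof induction
    case (step y z)
    then show ?case using half_exit[OF assms(2), of y z] assms(3) by blast
  qed (use assms in simp)
qed

text \<open>Uniqueness of the nearest-point projection of \<open>w\<close> to \<open>W\<close>. The
  path from \<open>w\<close> to \<open>a1\<close> stays in \<open>half a a1\<close>, which contains
  no vertex of \<open>W\<close>, in particular not \<open>b\<close>. Hence \<open>a1\<close> also
  lies in \<open>half b b1\<close> while \<open>a\<close> does not, and only the arc from
  \<open>b\<close> to \<open>b1\<close> enters that half-tree.\<close>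

lemma gate_unique:
  assumes "subtree A W" "a \<in> W" "a1 \<notin> W" "(a, a1) \<in> A" "b \<in> W" "b1 \<notin> W" "(b, b1) \<in> A"
    and "w \<in> half a a1" "w \<in> half b b1"
  shows "a = b \<and> a1 = b1"
proof -
  let ?R = "A - {(a, a1), (a1, a)}"
  have "(a1, w) \<in> ?R\<^sup>*" using assms(8) by (simp add: half_def)
  then have "(w, a1) \<in> ?R\<^sup>* \<and> (\<forall>z. (w, z) \<in> ?R\<^sup>* \<longrightarrow> z \<in> half a a1)"
    by (auto simp: half_def intro: rtrancl_trans rtrancl_sym_closed[rotated] dest: arcs_sym)
  then have wa1: "(w, a1) \<in> ?R\<^sup>*" and in_a: "\<And>z. (w, z) \<in> ?R\<^sup>* \<Longrightarrow> z \<in> half a a1" by auto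
  from wa1 have "a1 \<in> half b b1"
  proof induction
    case (step y z)
    have "z \<in> half a a1" using step.hyps in_a by (meson rtrancl.rtrancl_into_rtrancl)
    then have "z \<noteq> b" using subtree_half_disjoint[OF assms(1-4) assms(5)] by blast
    then show ?case using half_exit[OF assms(7) step.IH, of z] step.hyps by blast
  qed (use assms in simp)
  moreover have "a \<notin> half b b1" using subtree_half_disjoint[OF assms(1,5-7,2)] .
  ultimately show ?thesis using half_enter[OF assms(7) _ assms(4)] by blast
qed

section \<open>Path distance in a tree\<close>

lemma relpow_tdist: "\<lbrakk>x \<in> V; y \<in> V\<rbrakk> \<Longrightarrow> (x, y) \<in> A ^^ tdist x y"
  unfolding tdist_def using connected rtrancl_imp_relpow by (metis LeastI)

lemma tdist_le: "(x, y) \<in> A ^^ k \<Longrightarrow> tdist x y \<le> k"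
  unfolding tdist_def by (rule Least_le)

lemma relpow_sym: "(x, y) \<in> A ^^ k \<Longrightarrow> (y, x) \<in> A ^^ k"
proof (induction k arbitrary: y)
  case (Suc k)
  then obtain z where "(x, z) \<in> A ^^ k" "(z, y) \<in> A" by auto
  with Suc.IH arcs_sym show ?case by (metis relpow_Suc_I2)
qed simp

lemma tdist_sym: "tdist x y = tdist y x"
  unfolding tdist_def using relpow_sym by (metis (no_types, lifting))

lemma tdist_eq_0: "\<lbrakk>x \<in> V; y \<in> V\<rbrakk> \<Longrightarrow> tdist x y = 0 \<longleftrightarrow> x = y"
  using relpow_tdist[of x y] tdist_le[of x x 0] by (metis relpow_0_E relpow_0_I le_zero_eq)

text \<open>A path into the half-tree enters through the arc at \<open>a\<close>, so a shortest one
  splits there. This is the source of all lower bounds on distances.\<close>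

lemma tdist_through:
  assumes "(a, a1) \<in> A" "x \<in> V" "x \<notin> half a a1" "y \<in> half a a1"
  shows "tdist x a + tdist a y \<le> tdist x y"
proof -
  have "\<exists>i j. i + j = k \<and> (x, a) \<in> A ^^ i \<and> (a, y) \<in> A ^^ j"
    if "(x, y) \<in> A ^^ k" "y \<in> half a a1" for k y
    using that
  proof (induction k arbitrary: y)
    case 0
    then show ?case using assms(3) by simp
  next
    case (Suc k)
    then obtain z where z: "(x, z) \<in> A ^^ k" "(z, y) \<in> A" by auto
    show ?case
    proof (cases "z \<in> half a a1")
      case True
      then obtain i j where "i + j = k" "(x, a) \<in> A ^^ i" "(a, z) \<in> A ^^ j"
        using Suc.IH z by blast
      then show ?thesis using z by (intro exI[of _ i] exI[of _ "Suc j"]) auto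
    next
      case False
      with half_enter[OF assms(1) False z(2) Suc.prems(2)] z show ?thesis
        by (intro exI[of _ k] exI[of _ 1]) auto
    qed
  qed
  moreover have "y \<in> V" using half_subset assms by blast
  ultimately obtain i j where "i + j = tdist x y" "(x, a) \<in> A ^^ i" "(a, y) \<in> A ^^ j"
    using relpow_tdist assms by blast
  then show ?thesis using tdist_le by (metis add_mono)
qed

text \<open>A neighbour \<open>w\<close> of \<open>x\<close> that is not farther from
  \<open>r\<close> than \<open>x\<close> has \<open>r\<close> in \<open>half x w\<close>. Projection
  to the one-vertex subtree \<open>{x}\<close> is unique, so there is only one such
  neighbour.\<close>

lemma parent_unique:
  assumes "r \<in> V" "(x, y) \<in> A" "(x, z) \<in> A" "tdist r y \<le> tdist r x" "tdist r z \<le> tdist r x"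
  shows "y = z"
proof -
  have "r \<in> half x w" if w: "(x, w) \<in> A" "tdist r w \<le> tdist r x" for w
  proof (rule ccontr)
    assume "r \<notin> half x w"
    then have "tdist r x + tdist x w \<le> tdist r w"
      using tdist_through[OF w(1) assms(1)] half_self by blast
    then have "tdist x w = 0" using w(2) by simp
    then show False using tdist_eq_0 arcs_in[OF w(1)] no_loop w(1) by metis
  qed
  then show ?thesis
    using gate_unique[of "{x}" x y x z r] assms no_loop by (auto simp: subtree_def)
qed

text \<open>Removing from \<open>X\<close> a vertex farthest from a root loses at least two boundary arcs and
  gains at most the one to its parent.\<close>

lemma card_boundary_ge_3:
  assumes "finite X" "X \<noteq> {}" "X \<subseteq> V"
    and branch: "\<And>v. \<lbrakk>v \<in> X; finite (A `` {v})\<rbrakk> \<Longrightarrow> 3 \<le> card (A `` {v})"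
    and "finite (boundary A X)"
  shows "3 \<le> card (boundary A X)"
  using assms
proof (induction "card X" arbitrary: X rule: less_induct)
  case less
  obtain r where r: "r \<in> V" using less.prems by blast
  obtain x where x: "x \<in> X" "\<And>y. y \<in> X \<Longrightarrow> tdist r y \<le> tdist r x"
  proof -
    have "Max (tdist r ` X) \<in> tdist r ` X" using less.prems(1,2) by (intro Max_in) auto
    then obtain x where "x \<in> X" "tdist r x = Max (tdist r ` X)" by auto
    moreover have "tdist r y \<le> Max (tdist r ` X)" if "y \<in> X" for y
      using less.prems(1) that by simp
    ultimately show ?thesis using that by metis
  qed
  \<comment> \<open>If infinitely many neighbours of \<open>x\<close> existed, infinitely many would
    lie outside the finite set \<open>X\<close> and give boundary arcs. So the valence is finite and
    \<open>branch\<close> applies.\<close>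
  have "A `` {x} \<subseteq> X \<union> snd ` boundary A X" by (force simp: boundary_def x)
  then have fin: "finite (A `` {x})" using less.prems by (meson finite_UnI finite_imageI finite_subset)
  then have c3: "3 \<le> card (A `` {x})" using less.prems x by blast
  have bx: "Pair x ` (A `` {x} - X) \<subseteq> boundary A X" by (auto simp: boundary_def x)
  show ?case
  proof (cases "X = {x}")
    case True
    have "A `` {x} - X = A `` {x}" using True no_loop by auto
    then have "card (A `` {x}) \<le> card (boundary A X)"
      using card_mono[OF less.prems(5) bx] by (simp add: card_image inj_on_def)
    with c3 show ?thesis by simp
  next
    case False
    let ?X = "X - {x}"
    \<comment> \<open>Only the parent of a farthest vertex can lie in \<open>X\<close>; writing this
      as an inclusion also covers the case that no neighbour does.\<close>
    have "\<exists>p. A `` {x} \<inter> X \<subseteq> {p}"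
    proof (cases "A `` {x} \<inter> X = {}")
      case False
      then obtain p where "p \<in> A `` {x} \<inter> X" by blast
      then have "A `` {x} \<inter> X \<subseteq> {p}" using parent_unique[OF r, of x] x by auto
      then show ?thesis by blast
    qed auto
    then obtain p where p: "A `` {x} \<inter> X \<subseteq> {p}" by blast
    have "card (A `` {x}) \<le> card (A `` {x} - X) + card (A `` {x} \<inter> X)"
      using fin by (metis card_Diff_subset_Int card_Un_le Un_Diff_Int)
    moreover have "card (A `` {x} \<inter> X) \<le> 1" using card_mono[OF _ p] by simp
    ultimately have c2: "2 \<le> card (A `` {x} - X)" using c3 by simp
    have sub: "boundary A ?X \<subseteq> insert (p, x) (boundary A X - Pair x ` (A `` {x} - X))"
    proof
      fix e assume "e \<in> boundary A ?X"
      then obtain u v where e: "e = (u, v)" "(u, v) \<in> A" "u \<in> X" "u \<noteq> x" "v \<notin> X - {x}"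
        by (auto simp: boundary_def)
      show "e \<in> insert (p, x) (boundary A X - Pair x ` (A `` {x} - X))"
      proof (cases "v = x")
        case True
        then have "u \<in> A `` {x} \<inter> X" using e arcs_sym by auto
        then show ?thesis using p e True by auto
      qed (use e in \<open>auto simp: boundary_def\<close>)
    qed
    have fb: "finite (boundary A X - Pair x ` (A `` {x} - X))" using less.prems(5) by simp
    then have fin': "finite (boundary A ?X)" using sub finite_subset by blast
    have "3 \<le> card (boundary A ?X)"
    proof (rule less.hyps)
      show "card ?X < card X" using x(1) less.prems(1) by (rule card_Diff1_less[rotated])
    qed (use x less.prems False fin' in auto)
    also have "\<dots> \<le> Suc (card (boundary A X - Pair x ` (A `` {x} - X)))"
      using card_mono[OF _ sub] fb by (simp add: card_insert_if split: if_splits)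
    also have "card (boundary A X - Pair x ` (A `` {x} - X)) =
        card (boundary A X) - card (A `` {x} - X)"
      using bx less.prems(5) by (subst card_Diff_subset)
        (auto simp: card_image inj_on_def intro: finite_subset)
    finally show ?thesis using c2 by simp
  qed
qed

end

section \<open>Circuits, forests and bridges\<close>

definition loopfree :: "'g gtree \<Rightarrow> bool" where
  "loopfree \<Gamma> \<longleftrightarrow> (\<forall>v. (v, v) \<notin> arcs \<Gamma>)"

lemma circuit_tree_graph:
  "circuit (tree_graph \<Gamma>) p \<longleftrightarrow> p \<noteq> [] \<and> distinct (map fst p) \<and>
     (\<forall>i<length p. snd (p ! i) = fst (p ! (Suc i mod length p)) \<and>
        p ! (Suc i mod length p) \<noteq> prod.swap (p ! i))"
  by (simp add: circuit_def tree_graph_def Let_def)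

text \<open>Without its first arc \<open>(u, v)\<close> a circuit is a path from \<open>v\<close>
  back to \<open>u\<close>. Distinct sources keep \<open>(u, v)\<close> from recurring, and
  \<open>(v, u)\<close> could only be the second arc, where backtracking is forbidden.\<close>

lemma circuit_not_bridge:
  assumes p: "circuit (tree_graph \<Gamma>) p" "set p \<subseteq> A" and loop: "\<And>v. (v, v) \<notin> A"
  shows "\<exists>(u, v)\<in>A. (v, u) \<in> (A - {(u, v), (v, u)})\<^sup>*"
proof -
  let ?n = "length p"
  note c = p(1)[unfolded circuit_tree_graph]
  obtain u v where uv: "p ! 0 = (u, v)" by (cases "p ! 0") auto
  have uvA: "(u, v) \<in> A" using p(2) c uv by (metis length_greater_0_conv nth_mem subsetD)
  \<comment> \<open>A circuit of length one would be a loop.\<close>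
  have n2: "?n \<ge> 2"
  proof (rule ccontr)
    assume "\<not> ?n \<ge> 2"
    moreover have "?n > 0" using c by simp
    ultimately have "?n = 1" by linarith
    then have "snd (p ! 0) = fst (p ! 0)" using c by force
    then show False using uv uvA loop by simp
  qed
  let ?R = "A - {(u, v), (v, u)}"
  have src: "fst (p ! i) = fst (p ! j) \<longleftrightarrow> i = j" if "i < ?n" "j < ?n" for i j
    using c that by (metis length_map nth_eq_iff_index_eq nth_map)
  have p1: "fst (p ! 1) = v" "p ! 1 \<noteq> (v, u)"
    using c n2 uv by (auto dest!: spec[of _ 0])
  have R: "p ! i \<in> ?R" if i: "1 \<le> i" "i < ?n" for i
  proof -
    have "p ! i \<in> A" using p(2) i by auto
    moreover have "p ! i \<noteq> (u, v)"
    proof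
      assume "p ! i = (u, v)"
      then have "i = 0" using src[of i 0] i uv by force
      with i show False by simp
    qed
    moreover have "p ! i \<noteq> (v, u)"
    proof
      assume *: "p ! i = (v, u)"
      then have "i = 1" using src[of i 1] i n2 p1 by force
      with * p1 show False by simp
    qed
    ultimately show ?thesis by blast
  qed
  have path: "(v, fst (p ! i)) \<in> ?R\<^sup>*" if "1 \<le> i" "i < ?n" for i
    using that
  proof (induction i rule: dec_induct)
    case base
    then show ?case using p1 by simp
  next
    case (step i)
    have "snd (p ! i) = fst (p ! Suc i)" using c step.prems by (auto dest!: spec[of _ i])
    then have "(fst (p ! i), fst (p ! Suc i)) \<in> ?R" using R[of i] step by (metis Suc_lessD prod.collapse)
    then show ?case using step by (meson Suc_lessD rtrancl.rtrancl_into_rtrancl)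
  qed
  have "snd (p ! (?n - 1)) = u" using c n2 uv by (auto dest!: spec[of _ "?n - 1"])
  moreover have "p ! (?n - 1) \<in> ?R" by (rule R) (use n2 in linarith)+
  ultimately have "(fst (p ! (?n - 1)), u) \<in> ?R" by (metis prod.collapse)
  moreover have "(v, fst (p ! (?n - 1))) \<in> ?R\<^sup>*" using path[of "?n - 1"] n2 by simp
  ultimately have "(v, u) \<in> ?R\<^sup>*" by (rule rtrancl.rtrancl_into_rtrancl[rotated])
  with uvA show ?thesis by blast
qed

text \<open>A shortest bypass repeats no vertex, so closing it with \<open>(u, v)\<close> gives a
  circuit. It has at least two arcs because \<open>(v, u)\<close> itself was removed.\<close>

lemma not_bridge_circuit:
  assumes uv: "(u, v) \<in> A" "(v, u) \<in> (A - {(u, v), (v, u)})\<^sup>*" and ne: "u \<noteq> v"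
  shows "\<exists>p. set p \<subseteq> A \<and> circuit (tree_graph \<Gamma>) p"
proof -
  let ?R = "A - {(u, v), (v, u)}"
  define k where "k = (LEAST k. (v, u) \<in> ?R ^^ k)"
  have "\<exists>k. (v, u) \<in> ?R ^^ k" using uv(2) by (rule rtrancl_imp_relpow[THEN exE]) blast
  then have k: "(v, u) \<in> ?R ^^ k" and kmin: "\<And>j. (v, u) \<in> ?R ^^ j \<Longrightarrow> k \<le> j"
    unfolding k_def by (auto intro: LeastI_ex Least_le)
  obtain f where f: "f 0 = v" "f k = u" "\<And>i. i < k \<Longrightarrow> (f i, f (Suc i)) \<in> ?R"
    using k by (auto simp: relpow_fun_conv)
  have seg: "(f i, f (i + j)) \<in> ?R ^^ j" if "i + j \<le> k" for i j
  proof -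
    have "\<forall>m<j. (f (i + m), f (i + Suc m)) \<in> ?R" using f(3) that by simp
    then show ?thesis unfolding relpow_fun_conv by (intro exI[of _ "\<lambda>m. f (i + m)"]) simp
  qed
  have "i = j" if "i \<le> j" "j \<le> k" "f i = f j" for i j
  proof -
    have "(v, f i) \<in> ?R ^^ i" "(f j, u) \<in> ?R ^^ (k - j)"
      using seg[of 0 i] seg[of j "k - j"] that f by auto
    then have "(v, u) \<in> ?R ^^ (i + (k - j))" using that(3) by (metis relpow_trans)
    from kmin[OF this] that show ?thesis by simp
  qed
  then have inj: "i = j" if "i \<le> k" "j \<le> k" "f i = f j" for i j
    using that by (metis nle_le)
  have "k \<noteq> 0" using f ne by metis
  moreover have "k \<noteq> 1" using f(1,2) f(3)[of 0] by auto
  ultimately have k2: "k \<ge> 2" by simp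
  \<comment> \<open>The bypass has vertices \<open>f 0 = v\<close> up to \<open>f k = u\<close>; the
    arc that wraps around, from \<open>f k\<close> to \<open>f 0\<close>, is the removed
    \<open>(u, v)\<close>.\<close>
  define p where "p = map (\<lambda>i. (f i, f (Suc i mod Suc k))) [0..<Suc k]"
  have len: "length p = Suc k" by (simp add: p_def)
  have nth: "p ! i = (f i, f (Suc i mod Suc k))" if "i < Suc k" for i
    using that nth_map_upt[of i "Suc k" 0] by (simp add: p_def del: upt_Suc)
  have "distinct (map fst p)"
    unfolding p_def map_map comp_def fst_conv distinct_map
    using inj by (auto simp: inj_on_def less_Suc_eq_le simp del: upt_Suc)
  moreover have "p ! (Suc i mod Suc k) \<noteq> prod.swap (p ! i)" if i: "i < Suc k" for i
  proof
    assume "p ! (Suc i mod Suc k) = prod.swap (p ! i)"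
    then have "f (Suc (Suc i mod Suc k) mod Suc k) = f i" using nth i by simp
    then have "Suc (Suc i mod Suc k) mod Suc k = i" using inj i by (metis less_Suc_eq_le mod_less_divisor zero_less_Suc)
    \<comment> \<open>Two steps along a cycle with at least three vertices cannot return to the
      start.\<close>
    then have "Suc (Suc i) mod Suc k = i" by (simp add: mod_Suc_eq)
    then show False using i k2 by (cases "i = k"; cases "Suc i = k") (auto simp: mod_Suc split: if_splits)
  qed
  ultimately have "circuit (tree_graph \<Gamma>) p"
    unfolding circuit_tree_graph using nth len by auto
  moreover have "set p \<subseteq> A"
  proof
    fix e assume "e \<in> set p"
    then obtain i where "i < length p" "e = p ! i" by (metis in_set_conv_nth)
    then have i: "i < Suc k" "e = (f i, f (Suc i mod Suc k))" using len nth by simp_all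
    show "e \<in> A"
    proof (cases "i = k")
      case False
      then have "i < k" "Suc i mod Suc k = Suc i" using i by auto
      then show ?thesis using f(3) i by auto
    qed (use f uv(1) i in simp)
  qed
  ultimately show ?thesis by blast
qed

lemma simplicial_tree_iff_tree_arcs:
  assumes "loopfree \<Gamma>"
  shows "simplicial_tree \<Gamma> \<longleftrightarrow> verts \<Gamma> \<noteq> {} \<and> tree_arcs (verts \<Gamma>) (arcs \<Gamma>)"
proof
  assume s: "simplicial_tree \<Gamma>"
  have sw: "prod.swap ` arcs \<Gamma> = arcs \<Gamma>" and nc: "\<not> (\<exists>p. set p \<subseteq> arcs \<Gamma> \<and> circuit (tree_graph \<Gamma>) p)"
    using s unfolding simplicial_tree_def forest_def by (auto simp: tree_graph_def)
  have "tree_arcs (verts \<Gamma>) (arcs \<Gamma>)"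
  proof
    show "(v, u) \<in> arcs \<Gamma>" if "(u, v) \<in> arcs \<Gamma>" for u v
      using sw that by (metis image_eqI swap_simp)
    show "(v, u) \<notin> (arcs \<Gamma> - {(u, v), (v, u)})\<^sup>*" if "(u, v) \<in> arcs \<Gamma>" for u v
      using nc not_bridge_circuit[OF that] that assms by (metis loopfree_def)
  qed (use s in \<open>auto simp: simplicial_tree_def\<close>)
  with s show "verts \<Gamma> \<noteq> {} \<and> tree_arcs (verts \<Gamma>) (arcs \<Gamma>)" by (simp add: simplicial_tree_def)
next
  assume "verts \<Gamma> \<noteq> {} \<and> tree_arcs (verts \<Gamma>) (arcs \<Gamma>)"
  then interpret tree_arcs "verts \<Gamma>" "arcs \<Gamma>" by simp
  have "prod.swap ` arcs \<Gamma> = arcs \<Gamma>" by (force dest: arcs_sym)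
  moreover have "\<not> (\<exists>p. set p \<subseteq> arcs \<Gamma> \<and> circuit (tree_graph \<Gamma>) p)"
    using circuit_not_bridge[of \<Gamma> _ "arcs \<Gamma>"] bridge no_loop by blast
  ultimately have "forest (tree_graph \<Gamma>) (arcs \<Gamma>)" by (simp add: forest_def tree_graph_def)
  with \<open>verts \<Gamma> \<noteq> {} \<and> _\<close> arcs_sub connected show "simplicial_tree \<Gamma>"
    by (simp add: simplicial_tree_def)
qed


section \<open>Group actions on trees\<close>

definition translates :: "('g, 'b) monoid_scheme \<Rightarrow> 'g gtree \<Rightarrow> (nat \<times> nat) set \<Rightarrow> (nat \<times> nat) set" where
  "translates H \<Gamma> B = (\<Union>x\<in>carrier H. act_arcs \<Gamma> x ` B)"

definition invariant_arcs :: "('g, 'b) monoid_scheme \<Rightarrow> 'g gtree \<Rightarrow> (nat \<times> nat) set \<Rightarrow> bool" where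
  "invariant_arcs H \<Gamma> S \<longleftrightarrow>
     (\<forall>x\<in>carrier H. \<forall>u v. (u, v) \<in> S \<longrightarrow> (act \<Gamma> x u, act \<Gamma> x v) \<in> S)"

lemma rtrancl_finite_subset:
  "(a, b) \<in> R\<^sup>* \<Longrightarrow> \<exists>B. finite B \<and> B \<subseteq> R \<and> (a, b) \<in> B\<^sup>*"
proof (induction rule: rtrancl_induct)
  case (step y z)
  then obtain B where B: "finite B" "B \<subseteq> R" "(a, y) \<in> B\<^sup>*" by blast
  have "(a, y) \<in> (insert (y, z) B)\<^sup>*" using B(3) by (meson rtrancl_mono subset_insertI subsetD)
  then have "(a, z) \<in> (insert (y, z) B)\<^sup>*" by (meson insertI1 rtrancl.rtrancl_into_rtrancl)
  with B step.hyps show ?case by (intro exI[of _ "insert (y, z) B"]) auto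
qed auto

lemma rtrancl_stays:
  assumes "(a, b) \<in> R\<^sup>*" "\<And>z. (a, z) \<in> R\<^sup>* \<Longrightarrow> z \<in> W" "R \<subseteq> A"
  shows "(a, b) \<in> (A \<inter> W \<times> W)\<^sup>*"
  using assms(1)
proof (induction rule: rtrancl_induct)
  case (step y z)
  then have "(a, z) \<in> R\<^sup>*" by (meson rtrancl.rtrancl_into_rtrancl)
  with step assms have "(y, z) \<in> A \<inter> W \<times> W" by blast
  with step.IH show ?case by (rule rtrancl.rtrancl_into_rtrancl)
qed simp

lemma rtrancl_image:
  assumes "(a, b) \<in> R\<^sup>*" "\<And>x y. (x, y) \<in> R \<Longrightarrow> (f x, f y) \<in> S\<^sup>*"
  shows "(f a, f b) \<in> S\<^sup>*"
  using assms(1) by (induction rule: rtrancl_induct) (auto intro: rtrancl_trans assms(2))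

section \<open>Stabilizers and transporters\<close>

locale action_on = group H for H :: "('a, 'b) monoid_scheme" (structure) and V :: "nat set" and a :: "'a \<Rightarrow> nat \<Rightarrow> nat" +
  assumes ga: "group_action H V a"
begin

sublocale group_action H V a by (rule ga)

lemma act_closed: "\<lbrakk>x \<in> carrier H; v \<in> V\<rbrakk> \<Longrightarrow> a x v \<in> V"
  using surj_prop by blast

lemma act_one: "v \<in> V \<Longrightarrow> a \<one> v = v"
  using id_eq_one by (metis restrict_apply')

lemma act_mult: "\<lbrakk>x \<in> carrier H; y \<in> carrier H; v \<in> V\<rbrakk> \<Longrightarrow> a (x \<otimes> y) v = a x (a y v)"
  by (simp add: composition_rule)

lemma act_inv1: "\<lbrakk>x \<in> carrier H; v \<in> V\<rbrakk> \<Longrightarrow> a (inv x) (a x v) = v"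
  by (metis act_mult act_one inv_closed l_inv)

lemma act_inv2: "\<lbrakk>x \<in> carrier H; v \<in> V\<rbrakk> \<Longrightarrow> a x (a (inv x) v) = v"
  by (metis act_mult act_one inv_closed r_inv)

lemma act_inj: "\<lbrakk>x \<in> carrier H; u \<in> V; v \<in> V; a x u = a x v\<rbrakk> \<Longrightarrow> u = v"
  by (metis act_inv1)

text \<open>The set is empty or a coset of the stabilizer of \<open>u\<close>.\<close>

lemma finite_transporter:
  assumes "finite (stabilizer H a u)" "u \<in> V"
  shows "finite {x \<in> carrier H. a x u = w}"
proof (cases "\<exists>t\<in>carrier H. a t u = w")
  case True
  then obtain t where t: "t \<in> carrier H" "a t u = w" by blast
  have "{x \<in> carrier H. a x u = w} \<subseteq> (\<lambda>s. t \<otimes> s) ` stabilizer H a u"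
  proof
    fix x assume x: "x \<in> {x \<in> carrier H. a x u = w}"
    then have "inv t \<otimes> x \<in> stabilizer H a u"
      using t assms(2) by (auto simp: stabilizer_def act_mult act_inv1)
    moreover have "x = t \<otimes> (inv t \<otimes> x)" using x t by (simp add: m_assoc[symmetric])
    ultimately show "x \<in> (\<lambda>s. t \<otimes> s) ` stabilizer H a u" by blast
  qed
  then show ?thesis using assms finite_subset by blast
next
  case False
  then have "{x \<in> carrier H. a x u = w} = {}" by blast
  then show ?thesis by (metis finite.emptyI)
qed

end

text \<open>An element preserving the edge \<open>{u, v}\<close> sends \<open>u\<close> to
  \<open>u\<close> or to \<open>v\<close>, so edge stabilizers are covered by two
  transporters.\<close>

lemma finite_stabilizersI:
  assumes "group H" "group_action H (verts \<Gamma>) (act \<Gamma>)" "arcs \<Gamma> \<subseteq> verts \<Gamma> \<times> verts \<Gamma>"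
    and fin: "\<And>v. v \<in> verts \<Gamma> \<Longrightarrow> finite (stabilizer H (act \<Gamma>) v)"
  shows "finite_stabilizers H \<Gamma>"
proof -
  interpret action_on H "verts \<Gamma>" "act \<Gamma>"
    using assms by (simp add: action_on_def action_on_axioms_def)
  have "finite (stabilizer H (\<lambda>x. image (act \<Gamma> x)) e)" if "e \<in> edges \<Gamma>" for e
  proof -
    obtain u v where e: "e = {u, v}" "u \<in> verts \<Gamma>"
    proof -
      obtain u v where "(u, v) \<in> arcs \<Gamma>" "e = {u, v}" using \<open>e \<in> edges \<Gamma>\<close> by (auto simp: edges_def)
      with assms(3) that show ?thesis by blast
    qed
    have "stabilizer H (\<lambda>x. image (act \<Gamma> x)) e \<subseteq>
        {x \<in> carrier H. act \<Gamma> x u = u} \<union> {x \<in> carrier H. act \<Gamma> x u = v}"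
      using e by (auto simp: stabilizer_def)
    then show ?thesis using finite_transporter[OF fin[OF e(2)] e(2)] finite_subset by blast
  qed
  with fin show ?thesis by (simp add: finite_stabilizers_def)
qed

locale tree_action = group H for H :: "('a, 'b) monoid_scheme" (structure) and \<Gamma> :: "'a gtree" +
  assumes tree: "\<Gamma> \<in> Trees H" and loopfree: "loopfree \<Gamma>"
begin

sublocale action_on H "verts \<Gamma>" "act \<Gamma>"
proof -
  have "group_action H (verts \<Gamma>) (act \<Gamma>)" using tree by (simp add: Trees_def acts_simplicially_def)
  then show "action_on H (verts \<Gamma>) (act \<Gamma>)"
    by (simp add: action_on_def action_on_axioms_def is_group)
qed

sublocale tree_arcs "verts \<Gamma>" "arcs \<Gamma>"
  using tree simplicial_tree_iff_tree_arcs[OF loopfree] by (auto simp: Trees_def)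

lemma verts_nonempty: "verts \<Gamma> \<noteq> {}"
  using tree by (auto simp: Trees_def simplicial_tree_def)

lemma act_arcs_closed: "\<lbrakk>x \<in> carrier H; (u, v) \<in> arcs \<Gamma>\<rbrakk> \<Longrightarrow> (act \<Gamma> x u, act \<Gamma> x v) \<in> arcs \<Gamma>"
  using tree by (auto simp: Trees_def acts_simplicially_def)

lemma act_arcs_iff:
  assumes "x \<in> carrier H" "u \<in> verts \<Gamma>" "v \<in> verts \<Gamma>"
  shows "(act \<Gamma> x u, act \<Gamma> x v) \<in> arcs \<Gamma> \<longleftrightarrow> (u, v) \<in> arcs \<Gamma>"
  using act_arcs_closed[of x u v] act_arcs_closed[of "inv x" "act \<Gamma> x u" "act \<Gamma> x v"] assms
  by (auto simp: act_inv1)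

lemma finite_stabilizer: "v \<in> verts \<Gamma> \<Longrightarrow> finite (stabilizer H (act \<Gamma>) v)"
  using tree by (auto simp: Trees_def finite_stabilizers_def)

lemma minimal:
  assumes "W \<subseteq> verts \<Gamma>" "W \<noteq> {}" "\<And>x w. \<lbrakk>x \<in> carrier H; w \<in> W\<rbrakk> \<Longrightarrow> act \<Gamma> x w \<in> W"
    "subtree (arcs \<Gamma>) W"
  shows "W = verts \<Gamma>"
proof -
  have "minimal_action H \<Gamma>" using tree by (simp add: Trees_def)
  then show ?thesis using assms unfolding minimal_action_def subtree_def by (metis image_subsetI)
qed

lemma branch: "\<lbrakk>v \<in> verts \<Gamma>; finite (arcs \<Gamma> `` {v})\<rbrakk> \<Longrightarrow> 3 \<le> card (arcs \<Gamma> `` {v})"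
  using tree by (auto simp: Trees_def branching_def)

lemma has_arc:
  assumes "v \<in> verts \<Gamma>"
  obtains w where "(v, w) \<in> arcs \<Gamma>"
proof -
  have "arcs \<Gamma> `` {v} \<noteq> {}" using branch[OF assms] by auto
  then show ?thesis using that by auto
qed

lemma invariant_rtrancl:
  "\<lbrakk>invariant_arcs H \<Gamma> S; x \<in> carrier H; (u, v) \<in> S\<^sup>*\<rbrakk> \<Longrightarrow> (act \<Gamma> x u, act \<Gamma> x v) \<in> S\<^sup>*"
  by (rule rtrancl_image) (auto simp: invariant_arcs_def)

lemma invariant_arcs: "invariant_arcs H \<Gamma> (arcs \<Gamma>)"
  by (simp add: invariant_arcs_def act_arcs_closed)

lemma invariant_translates: "B \<subseteq> arcs \<Gamma> \<Longrightarrow> invariant_arcs H \<Gamma> (translates H \<Gamma> B)"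
  unfolding invariant_arcs_def translates_def
proof (intro ballI allI impI)
  fix x u v assume x: "x \<in> carrier H" and B: "B \<subseteq> arcs \<Gamma>"
    and "(u, v) \<in> (\<Union>y\<in>carrier H. act_arcs \<Gamma> y ` B)"
  then obtain y p q where y: "y \<in> carrier H" "(p, q) \<in> B" "u = act \<Gamma> y p" "v = act \<Gamma> y q" by auto
  then have "(act \<Gamma> x u, act \<Gamma> x v) = act_arcs \<Gamma> (x \<otimes> y) (p, q)"
    using x B arcs_in by (auto simp: act_mult)
  then show "(act \<Gamma> x u, act \<Gamma> x v) \<in> (\<Union>y\<in>carrier H. act_arcs \<Gamma> y ` B)"
    using x y by blast
qed

lemma translates_superset: "B \<subseteq> arcs \<Gamma> \<Longrightarrow> B \<subseteq> translates H \<Gamma> B"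
proof
  fix e assume "B \<subseteq> arcs \<Gamma>" "e \<in> B"
  then have "e = act_arcs \<Gamma> \<one> e" using arcs_in by (cases e) (auto simp: act_one)
  with \<open>e \<in> B\<close> show "e \<in> translates H \<Gamma> B" unfolding translates_def by blast
qed

lemma translates_subset:
  "\<lbrakk>invariant_arcs H \<Gamma> S; B \<subseteq> S\<rbrakk> \<Longrightarrow> translates H \<Gamma> B \<subseteq> S"
  by (auto simp: translates_def invariant_arcs_def)

lemma half_act:
  assumes "(u, v) \<in> arcs \<Gamma>" "x \<in> carrier H" "w \<in> half u v"
  shows "act \<Gamma> x w \<in> half (act \<Gamma> x u) (act \<Gamma> x v)"
proof -
  let ?R = "arcs \<Gamma> - {(u, v), (v, u)}"
  have "(v, w) \<in> ?R\<^sup>*" using assms by (simp add: half_def)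
  then show ?thesis unfolding half_def mem_Collect_eq
  proof (rule rtrancl_image, intro r_into_rtrancl)
    fix p q assume "(p, q) \<in> ?R"
    then show "(act \<Gamma> x p, act \<Gamma> x q) \<in> arcs \<Gamma> - {(act \<Gamma> x u, act \<Gamma> x v), (act \<Gamma> x v, act \<Gamma> x u)}"
      using assms act_inj[of x] arcs_in act_arcs_closed by blast
  qed
qed

lemma tdist_act:
  assumes "x \<in> carrier H" "u \<in> verts \<Gamma>" "v \<in> verts \<Gamma>"
  shows "tdist (act \<Gamma> x u) (act \<Gamma> x v) = tdist u v"
proof -
  have le: "tdist (act \<Gamma> x u) (act \<Gamma> x v) \<le> tdist u v"
    if "x \<in> carrier H" "u \<in> verts \<Gamma>" "v \<in> verts \<Gamma>" for x u v
  proof -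
    have "(act \<Gamma> x u, act \<Gamma> x w) \<in> arcs \<Gamma> ^^ k" if "(u, w) \<in> arcs \<Gamma> ^^ k" for k w
      using that
    proof (induction k arbitrary: w)
      case (Suc k)
      from Suc.prems obtain y where "(u, y) \<in> arcs \<Gamma> ^^ k" "(y, w) \<in> arcs \<Gamma>" by auto
      then have "(act \<Gamma> x u, act \<Gamma> x y) \<in> arcs \<Gamma> ^^ k" "(act \<Gamma> x y, act \<Gamma> x w) \<in> arcs \<Gamma>"
        using Suc.IH act_arcs_closed \<open>x \<in> carrier H\<close> by auto
      then show ?case by auto
    qed simp
    then show ?thesis using tdist_le relpow_tdist that by blast
  qed
  from le[OF assms] le[of "inv x" "act \<Gamma> x u" "act \<Gamma> x v"] assms show ?thesis
    by (simp add: act_closed act_inv1)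
qed

lemma subtree_act:
  assumes "subtree (arcs \<Gamma>) W" "x \<in> carrier H"
  shows "subtree (arcs \<Gamma>) (act \<Gamma> x ` W)"
  unfolding subtree_def
proof (intro ballI)
  fix u v assume "u \<in> act \<Gamma> x ` W" "v \<in> act \<Gamma> x ` W"
  then obtain p q where "p \<in> W" "q \<in> W" and [simp]: "u = act \<Gamma> x p" "v = act \<Gamma> x q" by blast
  then have "(p, q) \<in> (arcs \<Gamma> \<inter> W \<times> W)\<^sup>*" using assms by (simp add: subtree_def)
  then show "(u, v) \<in> (arcs \<Gamma> \<inter> act \<Gamma> x ` W \<times> act \<Gamma> x ` W)\<^sup>*"
    by simp (rule rtrancl_image, use assms(2) act_arcs_closed in auto)
qed

text \<open>The component of \<open>v0\<close> under \<open>C\<close> is an invariant subtree, hence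
  everything by minimality. An arc outside \<open>C\<close> would then be bypassed within
  \<open>C\<close>.\<close>

lemma invariant_connected_arcs:
  assumes C: "C \<subseteq> arcs \<Gamma>" "invariant_arcs H \<Gamma> C" and sym: "\<And>u v. (u, v) \<in> C \<Longrightarrow> (v, u) \<in> C"
    and v0: "v0 \<in> verts \<Gamma>" and orb: "\<And>x. x \<in> carrier H \<Longrightarrow> (v0, act \<Gamma> x v0) \<in> C\<^sup>*"
  shows "C = arcs \<Gamma>"
proof -
  let ?W = "{w. (v0, w) \<in> C\<^sup>*}"
  have "?W \<subseteq> verts \<Gamma>"
  proof
    fix w assume "w \<in> ?W"
    then have "(v0, w) \<in> C\<^sup>*" by simp
    then show "w \<in> verts \<Gamma>" by induction (use v0 C arcs_in in auto)
  qed
  moreover have "act \<Gamma> x w \<in> ?W" if "x \<in> carrier H" "w \<in> ?W" for x w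
    using invariant_rtrancl[OF C(2), of x v0 w] orb that by (auto intro: rtrancl_trans)
  moreover have "subtree (arcs \<Gamma>) ?W"
    unfolding subtree_def
  proof (intro ballI)
    fix u v assume u: "u \<in> ?W" and v: "v \<in> ?W"
    have "(u, v0) \<in> C\<^sup>*" using u rtrancl_sym_closed[of C] sym by blast
    then have "(u, v) \<in> C\<^sup>*" using v by (auto intro: rtrancl_trans)
    then show "(u, v) \<in> (arcs \<Gamma> \<inter> ?W \<times> ?W)\<^sup>*"
    proof (rule rtrancl_stays[OF _ _ C(1)])
      show "z \<in> ?W" if "(u, z) \<in> C\<^sup>*" for z
        using rtrancl_trans[of v0 u C z] u that by simp
    qed
  qed
  ultimately have W: "?W = verts \<Gamma>" by (intro minimal) auto
  have "(u, v) \<in> C" if uv: "(u, v) \<in> arcs \<Gamma>" for u v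
  proof (rule ccontr)
    assume n: "(u, v) \<notin> C"
    have "u \<in> ?W" "v \<in> ?W" using W uv arcs_in by auto
    then have "(v, u) \<in> C\<^sup>*" using sym rtrancl_sym_closed[of C v0 v] by (auto intro: rtrancl_trans)
    moreover have "C \<subseteq> arcs \<Gamma> - {(u, v), (v, u)}" using n C(1) sym by blast
    ultimately show False using bridge[OF uv] rtrancl_mono by blast
  qed
  with C(1) show ?thesis by auto
qed

text \<open>Join a base vertex to its image under each generator by finitely many arcs. The
  translates of these arcs connect the whole orbit of the base vertex, and minimality forces them to
  be all arcs.\<close>

lemma cocompact_if_finitely_generated:
  assumes "generate H S = carrier H" "S \<subseteq> carrier H" "finite S"
  shows "\<exists>B. finite B \<and> B \<subseteq> arcs \<Gamma> \<and> translates H \<Gamma> B = arcs \<Gamma>"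
proof -
  obtain v0 where v0: "v0 \<in> verts \<Gamma>" using verts_nonempty by blast
  have "\<forall>s\<in>S. \<exists>B. finite B \<and> B \<subseteq> arcs \<Gamma> \<and> (v0, act \<Gamma> s v0) \<in> B\<^sup>*"
  proof
    fix s assume "s \<in> S"
    then have "act \<Gamma> s v0 \<in> verts \<Gamma>" using assms(2) v0 act_closed by auto
    then show "\<exists>B. finite B \<and> B \<subseteq> arcs \<Gamma> \<and> (v0, act \<Gamma> s v0) \<in> B\<^sup>*"
      by (rule rtrancl_finite_subset[OF connected[OF v0]])
  qed
  then obtain f where f: "\<And>s. s \<in> S \<Longrightarrow> finite (f s) \<and> f s \<subseteq> arcs \<Gamma> \<and> (v0, act \<Gamma> s v0) \<in> (f s)\<^sup>*"
    by metis
  \<comment> \<open>The swapped copies make the set of translates symmetric, so that paths for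
    inverse generators can be reversed.\<close>
  define B where "B = \<Union>(f ` S) \<union> prod.swap ` \<Union>(f ` S)"
  have "\<Union>(f ` S) \<subseteq> arcs \<Gamma>" using f by blast
  then have "prod.swap ` \<Union>(f ` S) \<subseteq> arcs \<Gamma>" using arcs_sym by (auto simp: subset_iff)
  with \<open>\<Union>(f ` S) \<subseteq> arcs \<Gamma>\<close> have B: "finite B" "B \<subseteq> arcs \<Gamma>" using f assms(3) by (auto simp: B_def)
  let ?C = "translates H \<Gamma> B"
  have CA: "?C \<subseteq> arcs \<Gamma>" using translates_subset[OF invariant_arcs B(2)] .
  have inv: "invariant_arcs H \<Gamma> ?C" using B(2) by (rule invariant_translates)
  have swapB: "(v, u) \<in> B" if "(u, v) \<in> B" for u v
    using that unfolding B_def by force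
  have sym: "(v, u) \<in> ?C" if "(u, v) \<in> ?C" for u v
  proof -
    obtain x p q where "x \<in> carrier H" "(p, q) \<in> B" "u = act \<Gamma> x p" "v = act \<Gamma> x q"
      using \<open>(u, v) \<in> ?C\<close> unfolding translates_def by auto
    then show ?thesis using swapB unfolding translates_def by force
  qed
  have orb: "(v0, act \<Gamma> x v0) \<in> ?C\<^sup>*" if "x \<in> generate H S" for x
    using that
  proof induction
    case one
    then show ?case using act_one v0 by simp
  next
    case (incl s)
    have "f s \<subseteq> ?C" using translates_superset[OF B(2)] incl by (auto simp: B_def)
    then show ?case using f[OF incl] rtrancl_mono by blast
  next
    case (inv s)
    have "f s \<subseteq> ?C" using translates_superset[OF B(2)] inv by (auto simp: B_def)
    then have "(v0, act \<Gamma> s v0) \<in> ?C\<^sup>*" using f[OF inv] rtrancl_mono by blast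
    then have "(act \<Gamma> (inv s) v0, act \<Gamma> (inv s) (act \<Gamma> s v0)) \<in> ?C\<^sup>*"
      using \<open>invariant_arcs H \<Gamma> ?C\<close> inv assms(2) by (intro invariant_rtrancl) auto
    then show ?case using act_inv1 v0 inv assms(2) rtrancl_sym_closed[of ?C] sym
      by (metis subsetD)
  next
    case (eng x y)
    have c: "x \<in> carrier H" "y \<in> carrier H" using eng assms(1) by auto
    have "(act \<Gamma> x v0, act \<Gamma> x (act \<Gamma> y v0)) \<in> ?C\<^sup>*"
      using inv c(1) eng by (intro invariant_rtrancl) auto
    then show ?case using eng c v0 by (auto simp: act_mult intro: rtrancl_trans)
  qed
  have "?C = arcs \<Gamma>"
    by (rule invariant_connected_arcs[OF CA inv sym v0]) (simp_all add: orb assms(1))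
  with B show ?thesis by blast
qed

text \<open>Disjoint invariant subtrees would be joined by a bridge whose endpoint is fixed by the group.\<close>

lemma invariant_subtrees_meet:
  assumes inf: "infinite X" "X \<subseteq> carrier H"
    and W: "subtree (arcs \<Gamma>) W" "W \<subseteq> verts \<Gamma>" "W \<noteq> {}"
      "\<And>x w. \<lbrakk>x \<in> X; w \<in> W\<rbrakk> \<Longrightarrow> act \<Gamma> x w \<in> W" "\<And>x w. \<lbrakk>x \<in> X; w \<in> verts \<Gamma> - W\<rbrakk> \<Longrightarrow> act \<Gamma> x w \<notin> W"
    and W': "subtree (arcs \<Gamma>) W'" "W' \<subseteq> verts \<Gamma>" "W' \<noteq> {}"
      "\<And>x w. \<lbrakk>x \<in> X; w \<in> W'\<rbrakk> \<Longrightarrow> act \<Gamma> x w \<in> W'"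
  shows "W \<inter> W' \<noteq> {}"
proof
  assume dis: "W \<inter> W' = {}"
  obtain w w' where w: "w \<in> W" "w' \<in> W'" using W W' by blast
  then have "(w, w') \<in> (arcs \<Gamma>)\<^sup>*" using connected[of w w'] W(2) W'(2) by blast
  then obtain b b1 where b: "b \<in> W" "b1 \<notin> W" "(b, b1) \<in> arcs \<Gamma>" "w' \<in> half b b1"
    using exit_half[of w w' W] w dis by blast
  \<comment> \<open>The translate by \<open>x\<close> of the exit arc again leaves \<open>W\<close>
    towards \<open>W'\<close>, so \<open>gate_unique\<close> identifies it with the
    original.\<close>
  have "act \<Gamma> x b = b" if x: "x \<in> X" for x
  proof -
    have xc: "x \<in> carrier H" using x inf by blast
    let ?b = "act \<Gamma> x b" and ?b1 = "act \<Gamma> x b1"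
    have b': "?b \<in> W" "?b1 \<notin> W" "(?b, ?b1) \<in> arcs \<Gamma>"
      using x xc b W(4,5) act_arcs_closed arcs_in by auto
    have "?b \<notin> W'" using b' dis by blast
    moreover have "act \<Gamma> x w' \<in> half ?b ?b1" using half_act[OF b(3) xc b(4)] .
    ultimately have "W' \<subseteq> half ?b ?b1"
      using subtree_in_half[OF W'(1) b'(3)] W'(4)[OF x w(2)] by blast
    then have "w' \<in> half ?b ?b1" using w by blast
    then show ?thesis using gate_unique[OF W(1) b(1-3) b' b(4)] by simp
  qed
  then have "X \<subseteq> stabilizer H (act \<Gamma>) b" using inf by (auto simp: stabilizer_def)
  then show False using finite_stabilizer inf(1) b(1) W(2) finite_subset by blast
qed

end


section \<open>Restriction to, and extension from, a normal subgroup of finite index\<close>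

lemma group_action_hom:
  assumes "group_action E V a" "j \<in> hom F E" "group F"
  shows "group_action F V (\<lambda>x. a (j x))"
proof -
  have "a \<in> hom E (BijGroup V)" using assms(1) by (simp add: group_action_def group_hom_def group_hom_axioms_def)
  then have "a \<circ> j \<in> hom F (BijGroup V)" using assms(2) by (simp add: hom_def Pi_def)
  then show ?thesis
    using assms(3) by (simp add: group_action_def group_hom_def group_hom_axioms_def group_BijGroup comp_def)
qed

text \<open>\<open>j\<close> embeds \<open>F\<close> as a normal subgroup of finite index,
  \<open>c \<psi>\<close> is conjugation by \<open>\<psi>\<close> read on \<open>F\<close>, and
  \<open>T\<close> meets every coset. In the application \<open>j\<close> sends an element to its
  inner automorphism and \<open>c \<psi>\<close> is \<open>\<psi>\<close> itself.\<close>

locale normal_ext = F: group F + E: group E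
  for F :: "('a, 'b) monoid_scheme" and E :: "('e, 'c) monoid_scheme" +
  fixes j :: "'a \<Rightarrow> 'e" and c :: "'e \<Rightarrow> 'a \<Rightarrow> 'a" and T :: "'e set" and S0 :: "'a set"
  assumes j_hom: "j \<in> hom F E"
    and j_inj: "inj_on j (carrier F)"
    and conj_closed: "\<lbrakk>\<psi> \<in> carrier E; x \<in> carrier F\<rbrakk> \<Longrightarrow> c \<psi> x \<in> carrier F"
    and conj_eq: "\<lbrakk>\<psi> \<in> carrier E; x \<in> carrier F\<rbrakk> \<Longrightarrow> \<psi> \<otimes>\<^bsub>E\<^esub> j x = j (c \<psi> x) \<otimes>\<^bsub>E\<^esub> \<psi>"
    and T: "finite T" "T \<subseteq> carrier E"
    and cosets: "\<psi> \<in> carrier E \<Longrightarrow> \<exists>x\<in>carrier F. \<exists>t\<in>T. \<psi> = j x \<otimes>\<^bsub>E\<^esub> t"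
    and S0: "finite S0" "S0 \<subseteq> carrier F" "generate F S0 = carrier F"
    and infinite_F: "infinite (carrier F)"
    and torsion_free: "\<lbrakk>x \<in> carrier F; x [^]\<^bsub>F\<^esub> (k::nat) = \<one>\<^bsub>F\<^esub>; k > 0\<rbrakk> \<Longrightarrow> x = \<one>\<^bsub>F\<^esub>"
begin

text \<open>Agreement is required only at vertices and for elements of \<open>F\<close>, so
  \<open>\<Gamma>\<close> may be any suitable \<open>F\<close>-tree and not just the literal
  \<open>pullback j \<Delta>\<close>.\<close>

definition extends :: "'e gtree \<Rightarrow> 'a gtree \<Rightarrow> bool" where
  "extends \<Delta> \<Gamma> \<longleftrightarrow> verts \<Delta> = verts \<Gamma> \<and> arcs \<Delta> = arcs \<Gamma> \<and>
     (\<forall>x\<in>carrier F. \<forall>v\<in>verts \<Gamma>. act \<Delta> (j x) v = act \<Gamma> x v)"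

lemma j_closed [simp]: "x \<in> carrier F \<Longrightarrow> j x \<in> carrier E"
  using j_hom by (auto simp: hom_def)

lemma j_mult: "\<lbrakk>x \<in> carrier F; y \<in> carrier F\<rbrakk> \<Longrightarrow> j (x \<otimes>\<^bsub>F\<^esub> y) = j x \<otimes>\<^bsub>E\<^esub> j y"
  using j_hom by (auto simp: hom_def)

sublocale j: group_hom F E j
  by unfold_locales (rule j_hom)

text \<open>Each coset of \<open>F\<close> meets \<open>K\<close> in a translate of a subset of the
  preimage of \<open>K\<close>, and there are finitely many cosets.\<close>

lemma finite_if_finite_vimage:
  assumes K: "K \<subseteq> carrier E" "\<And>k l. \<lbrakk>k \<in> K; l \<in> K\<rbrakk> \<Longrightarrow> k \<otimes>\<^bsub>E\<^esub> inv\<^bsub>E\<^esub> l \<in> K"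
    and fin: "finite {x \<in> carrier F. j x \<in> K}"
  shows "finite K"
proof -
  let ?K = "\<lambda>t. {k \<in> K. \<exists>x\<in>carrier F. k = j x \<otimes>\<^bsub>E\<^esub> t}"
  have "finite (?K t)" if t: "t \<in> T" for t
  proof (cases "?K t = {}")
    case False
    have tE: "t \<in> carrier E" using t T by blast
    obtain k0 x0 where k0: "k0 \<in> K" "x0 \<in> carrier F" "k0 = j x0 \<otimes>\<^bsub>E\<^esub> t" using False by blast
    have "?K t \<subseteq> (\<lambda>y. j y \<otimes>\<^bsub>E\<^esub> k0) ` {x \<in> carrier F. j x \<in> K}"
    proof
      fix k assume "k \<in> ?K t"
      then obtain x where k: "k \<in> K" "x \<in> carrier F" "k = j x \<otimes>\<^bsub>E\<^esub> t" by blast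
      let ?y = "x \<otimes>\<^bsub>F\<^esub> inv\<^bsub>F\<^esub> x0"
      have y: "?y \<in> carrier F" using k k0 by simp
      have "j ?y = j x \<otimes>\<^bsub>E\<^esub> inv\<^bsub>E\<^esub> j x0" using k k0 by simp
      also have "\<dots> = k \<otimes>\<^bsub>E\<^esub> inv\<^bsub>E\<^esub> k0"
      proof -
        have "t \<otimes>\<^bsub>E\<^esub> (inv\<^bsub>E\<^esub> t \<otimes>\<^bsub>E\<^esub> inv\<^bsub>E\<^esub> j x0) = inv\<^bsub>E\<^esub> j x0"
          using k0 tE by (simp add: E.m_assoc[symmetric])
        then show ?thesis using k k0 tE by (simp add: E.inv_mult_group E.m_assoc)
      qed
      finally have jy: "j ?y = k \<otimes>\<^bsub>E\<^esub> inv\<^bsub>E\<^esub> k0" .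
      then have "j ?y \<in> K" using K(2) k k0 by simp
      moreover have "k = j ?y \<otimes>\<^bsub>E\<^esub> k0"
      proof -
        have "k \<in> carrier E" "k0 \<in> carrier E" using k k0 K by auto
        then show ?thesis unfolding jy by (simp add: E.m_assoc)
      qed
      ultimately show "k \<in> (\<lambda>y. j y \<otimes>\<^bsub>E\<^esub> k0) ` {x \<in> carrier F. j x \<in> K}" using y by blast
    qed
    then show ?thesis using fin finite_subset by blast
  next
    case True
    then show ?thesis by (metis finite.emptyI)
  qed
  moreover have "K = (\<Union>t\<in>T. ?K t)" using cosets K(1) by blast
  ultimately show ?thesis using T(1) by (metis (no_types, lifting) finite_UN)
qed

lemma finite_vimage: "finite K \<Longrightarrow> finite {x \<in> carrier F. j x \<in> K}"
proof -
  assume "finite K"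
  moreover have "j ` {x \<in> carrier F. j x \<in> K} \<subseteq> K" by blast
  moreover have "inj_on j {x \<in> carrier F. j x \<in> K}" using j_inj by (rule inj_on_subset) blast
  ultimately show ?thesis by (meson finite_imageD finite_subset)
qed

text \<open>Let \<open>W\<close> be an \<open>F\<close>-invariant subtree. By normality its
  translates by coset representatives are \<open>F\<close>-invariant too. As \<open>F\<close> is
  infinite and stabilizers are finite, \<open>invariant_subtrees_meet\<close> applies, so the finite
  intersection is a nonempty subtree. It is \<open>E\<close>-invariant, hence the whole tree, and so
  is \<open>W\<close>.\<close>

lemma minimal_restriction:
  assumes \<Delta>: "\<Delta> \<in> Trees E" "loopfree \<Delta>" and ext: "extends \<Delta> \<Gamma>"
  shows "minimal_action F \<Gamma>"
proof -
  interpret tree_action E \<Delta> by unfold_locales (rule \<Delta>)+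
  let ?A = "arcs \<Delta>" and ?V = "verts \<Delta>"
  define X where "X = j ` carrier F"
  have X: "infinite X" "X \<subseteq> carrier E" using infinite_F j_inj by (auto simp: X_def finite_image_iff)
  have XT: "\<exists>h\<in>X. \<exists>t\<in>T. \<psi> = h \<otimes>\<^bsub>E\<^esub> t" if "\<psi> \<in> carrier E" for \<psi>
    using cosets[OF that] by (auto simp: X_def)
  have X_inv: "inv\<^bsub>E\<^esub> h \<in> X" if "h \<in> X" for h
    using that by (auto simp: X_def simp flip: j.hom_inv)
  \<comment> \<open>Normality with the factors in the other order; it comes from
    \<open>conj_eq\<close> for the inverse of \<open>\<psi>\<close>.\<close>
  have X_conj: "\<exists>h'\<in>X. h \<otimes>\<^bsub>E\<^esub> \<psi> = \<psi> \<otimes>\<^bsub>E\<^esub> h'" if "h \<in> X" "\<psi> \<in> carrier E" for h \<psi>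
  proof -
    obtain x where x: "h = j x" "x \<in> carrier F" using \<open>h \<in> X\<close> unfolding X_def by blast
    let ?y = "c (inv\<^bsub>E\<^esub> \<psi>) x"
    have y: "?y \<in> carrier F" using x that conj_closed by simp
    have "inv\<^bsub>E\<^esub> \<psi> \<otimes>\<^bsub>E\<^esub> j x = j ?y \<otimes>\<^bsub>E\<^esub> inv\<^bsub>E\<^esub> \<psi>" using conj_eq x that by simp
    then have "\<psi> \<otimes>\<^bsub>E\<^esub> (inv\<^bsub>E\<^esub> \<psi> \<otimes>\<^bsub>E\<^esub> j x) \<otimes>\<^bsub>E\<^esub> \<psi> = \<psi> \<otimes>\<^bsub>E\<^esub> (j ?y \<otimes>\<^bsub>E\<^esub> inv\<^bsub>E\<^esub> \<psi>) \<otimes>\<^bsub>E\<^esub> \<psi>" by simp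
    moreover have "\<psi> \<otimes>\<^bsub>E\<^esub> (inv\<^bsub>E\<^esub> \<psi> \<otimes>\<^bsub>E\<^esub> j x) \<otimes>\<^bsub>E\<^esub> \<psi> = j x \<otimes>\<^bsub>E\<^esub> \<psi>"
      using x that by (simp add: E.m_assoc[symmetric])
    moreover have "\<psi> \<otimes>\<^bsub>E\<^esub> (j ?y \<otimes>\<^bsub>E\<^esub> inv\<^bsub>E\<^esub> \<psi>) \<otimes>\<^bsub>E\<^esub> \<psi> = \<psi> \<otimes>\<^bsub>E\<^esub> j ?y"
      using y that by (simp add: E.m_assoc)
    ultimately show ?thesis using x y unfolding X_def by auto
  qed
  have main: "W = ?V" if W: "W \<subseteq> ?V" "W \<noteq> {}" "subtree ?A W"
      and inv: "\<And>h w. \<lbrakk>h \<in> X; w \<in> W\<rbrakk> \<Longrightarrow> act \<Delta> h w \<in> W" for W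
  proof -
    let ?W = "\<lambda>t. act \<Delta> t ` W"
    have W_V: "?W t \<subseteq> ?V" if "t \<in> carrier E" for t using act_closed that W by blast
    have inv_t: "act \<Delta> h w \<in> ?W t" if t: "t \<in> carrier E" and h: "h \<in> X" and w: "w \<in> ?W t" for t h w
    proof -
      obtain w0 where w0: "w0 \<in> W" "w = act \<Delta> t w0" using w by blast
      obtain h' where h': "h' \<in> X" "h \<otimes>\<^bsub>E\<^esub> t = t \<otimes>\<^bsub>E\<^esub> h'" using X_conj h t by blast
      have "act \<Delta> h w = act \<Delta> t (act \<Delta> h' w0)"
        using act_mult[of h t w0] act_mult[of t h' w0] h'(2) t w0
          subsetD[OF X(2) h] subsetD[OF X(2) h'(1)] subsetD[OF W(1) w0(1)] by simp
      then show ?thesis using inv[OF h'(1) w0(1)] by blast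
    qed
    \<comment> \<open>\<open>W\<close> is kept as a separate factor so that the induction can start
      from the empty set of representatives.\<close>
    have meet: "finite T0 \<Longrightarrow> T0 \<subseteq> T \<Longrightarrow>
        W \<inter> (\<Inter>t\<in>T0. ?W t) \<noteq> {} \<and> subtree ?A (W \<inter> (\<Inter>t\<in>T0. ?W t))" for T0
    proof (induction T0 rule: finite_induct)
      case empty
      then show ?case using W by simp
    next
      case (insert t T0)
      let ?U = "W \<inter> (\<Inter>t\<in>T0. ?W t)"
      have tE: "t \<in> carrier E" using insert.prems T by blast
      have U: "?U \<noteq> {}" "subtree ?A ?U" using insert by auto
      have inv_U: "act \<Delta> h w \<in> ?U" if "h \<in> X" "w \<in> ?U" for h w
      proof -
        have "act \<Delta> h w \<in> ?W t'" if "t' \<in> T0" for t'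
          using inv_t[of t' h w] that \<open>h \<in> X\<close> \<open>w \<in> ?U\<close> insert.prems T(2) by auto
        then show ?thesis using inv[of h w] that by blast
      qed
      have "?W t \<inter> ?U \<noteq> {}"
      proof (rule invariant_subtrees_meet[OF X])
        show "subtree ?A (?W t)" using subtree_act W(3) tE by blast
        show "act \<Delta> h w \<notin> ?W t" if "h \<in> X" "w \<in> ?V - ?W t" for h w
        proof
          assume "act \<Delta> h w \<in> ?W t"
          then have "act \<Delta> (inv\<^bsub>E\<^esub> h) (act \<Delta> h w) \<in> ?W t" using inv_t[OF tE X_inv] that by blast
          then show False using act_inv1[of h w] that(2) subsetD[OF X(2) that(1)] by simp
        qed
      qed (use W U W_V tE inv_t inv_U in auto)
      moreover have "subtree ?A (?W t \<inter> ?U)"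
        using subtree_Int[OF subtree_act[OF W(3) tE] U(2)] W_V tE by blast
      moreover have "W \<inter> (\<Inter>t\<in>insert t T0. ?W t) = ?W t \<inter> ?U" by blast
      ultimately show ?case by simp
    qed
    let ?U = "W \<inter> (\<Inter>t\<in>T. ?W t)"
    \<comment> \<open>The intersection over representatives already lies in every translate of
      \<open>W\<close> by an element of \<open>E\<close>, because the translate by \<open>t\<close>
      does not change under \<open>F\<close>.\<close>
    have U_all: "w \<in> ?W \<psi>" if w: "w \<in> ?U" and \<psi>: "\<psi> \<in> carrier E" for w \<psi>
    proof -
      obtain h t where ht: "h \<in> X" "t \<in> T" "\<psi> = h \<otimes>\<^bsub>E\<^esub> t" using XT \<psi> by blast
      have c: "h \<in> carrier E" "t \<in> carrier E" "w \<in> ?V" using ht X T w W by auto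
      have "act \<Delta> (inv\<^bsub>E\<^esub> h) w \<in> ?W t" using inv_t[OF c(2) X_inv[OF ht(1)]] w ht by blast
      then obtain w0 where w0: "w0 \<in> W" "act \<Delta> (inv\<^bsub>E\<^esub> h) w = act \<Delta> t w0" by blast
      have "act \<Delta> \<psi> w0 = act \<Delta> h (act \<Delta> t w0)" using act_mult c w0 W ht by auto
      also have "\<dots> = w" using w0(2) act_inv2[OF c(1,3)] by simp
      finally show ?thesis using w0 by blast
    qed
    have "?U = ?V"
    proof (rule minimal)
      show "act \<Delta> \<psi> w \<in> ?U" if \<psi>: "\<psi> \<in> carrier E" and w: "w \<in> ?U" for \<psi> w
      proof -
        have *: "act \<Delta> \<psi> w \<in> ?W \<phi>" if \<phi>: "\<phi> \<in> carrier E" for \<phi>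
        proof -
          have "w \<in> ?W (inv\<^bsub>E\<^esub> \<psi> \<otimes>\<^bsub>E\<^esub> \<phi>)"            by (intro U_all[OF w] E.m_closed E.inv_closed \<psi> \<phi>)
          then obtain w0 where w0: "w0 \<in> W" "w = act \<Delta> (inv\<^bsub>E\<^esub> \<psi> \<otimes>\<^bsub>E\<^esub> \<phi>) w0" by blast
          then have "w0 \<in> ?V" using W by blast
          then have "act \<Delta> \<psi> w = act \<Delta> \<phi> w0"
            using w0(2) \<psi> \<phi> by (simp add: act_mult act_closed act_inv2)
          then show ?thesis using w0 by blast
        qed
        have "?W \<one>\<^bsub>E\<^esub> = W" using act_one W(1) by force
        then show ?thesis using *[OF E.one_closed] *[OF subsetD[OF T(2)]] by simp
      qed
    qed (use meet[OF T(1)] W in auto)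
    then show ?thesis using W(1) by blast
  qed
  have key: "W = ?V" if W:  "W \<subseteq> ?V \<and> W \<noteq> {} \<and> (\<forall>x\<in>carrier F. act \<Delta> (j x) ` W \<subseteq> W) \<and> subtree ?A W" for W
  proof (rule main)
    show "act \<Delta> h w \<in> W" if "h \<in> X" "w \<in> W" for h w
      using W that unfolding X_def by blast
  qed (use W in auto)
  show ?thesis unfolding minimal_action_def
  proof (intro allI impI, elim conjE)
    fix W assume W: "W \<subseteq> verts \<Gamma>" "W \<noteq> {}" "\<forall>x\<in>carrier F. act \<Gamma> x ` W \<subseteq> W"
      "\<forall>u\<in>W. \<forall>v\<in>W. (u, v) \<in> (arcs \<Gamma> \<inter> W \<times> W)\<^sup>*"
    have "act \<Delta> (j x) ` W = act \<Gamma> x ` W" if "x \<in> carrier F" for x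
      using ext that W(1) by (intro image_cong) (auto simp: extends_def)
    then show "W = verts \<Gamma>"
      using key[of W] W ext by (auto simp: extends_def subtree_def)
  qed
qed

lemma restriction_in_Trees:
  assumes \<Delta>: "\<Delta> \<in> Trees E" "loopfree \<Delta>" and ext: "extends \<Delta> \<Gamma>"
    and gaF: "group_action F (verts \<Gamma>) (act \<Gamma>)"
  shows "\<Gamma> \<in> Trees F"
proof -
  interpret tree_action E \<Delta> by unfold_locales (rule \<Delta>)+
  have e: "verts \<Gamma> = verts \<Delta>" "arcs \<Gamma> = arcs \<Delta>"
    "\<And>x v. \<lbrakk>x \<in> carrier F; v \<in> verts \<Delta>\<rbrakk> \<Longrightarrow> act \<Gamma> x v = act \<Delta> (j x) v"
    using ext by (auto simp: extends_def)
  have "simplicial_tree \<Gamma>" "branching \<Gamma>"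
    using \<Delta> e by (simp_all add: Trees_def simplicial_tree_def branching_def tree_graph_def)
  moreover have "acts_simplicially F \<Gamma>"
  proof -
    have "(act \<Gamma> x u, act \<Gamma> x v) \<in> arcs \<Gamma>" if x: "x \<in> carrier F" and uv: "(u, v) \<in> arcs \<Gamma>" for x u v
    proof -
      have "(u, v) \<in> arcs \<Delta>" using uv e(2) by simp
      then show ?thesis
        using act_arcs_closed[OF j_closed[OF x]] e(3)[OF x] arcs_in unfolding e(2) by metis
    qed
    then have "\<forall>x\<in>carrier F. \<forall>e\<in>arcs \<Gamma>. (act \<Gamma> x (fst e), act \<Gamma> x (snd e)) \<in> arcs \<Gamma>"
      by simp
    then show ?thesis using gaF by (simp add: acts_simplicially_def case_prod_beta)
  qed
  moreover have "finite_stabilizers F \<Gamma>"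
  proof (rule finite_stabilizersI[OF F.is_group gaF])
    fix v assume v: "v \<in> verts \<Gamma>"
    have "stabilizer F (act \<Gamma>) v \<subseteq> {x \<in> carrier F. j x \<in> stabilizer E (act \<Delta>) v}"
      using v e by (auto simp: stabilizer_def)
    then show "finite (stabilizer F (act \<Gamma>) v)"
      using finite_vimage[OF finite_stabilizer[of v]] v e finite_subset by auto
  qed (use arcs_sub e in simp)
  ultimately show ?thesis using minimal_restriction[OF assms(1-3)] by (simp add: Trees_def)
qed

lemma extends_pullback: "extends \<Delta> (pullback j \<Delta>)"
  by (simp add: extends_def pullback_def)

lemma pullback_in_Trees:
  assumes "\<Delta> \<in> Trees E" "loopfree \<Delta>"
  shows "pullback j \<Delta> \<in> Trees F"
proof (rule restriction_in_Trees[OF assms extends_pullback])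
  have "group_action E (verts \<Delta>) (act \<Delta>)" using assms by (simp add: Trees_def acts_simplicially_def)
  then show "group_action F (verts (pullback j \<Delta>)) (act (pullback j \<Delta>))"
    using group_action_hom[OF _ j_hom F.is_group] by (simp add: pullback_def)
qed

text \<open>Minimality passes up because \<open>E\<close>-invariant sets are
  \<open>F\<close>-invariant. Stabilizers stay finite because \<open>F\<close> meets each of them in
  a finite group and has finite index.\<close>

lemma extension_in_Trees:
  assumes \<Gamma>: "\<Gamma> \<in> Trees F" and ext: "extends \<Delta> \<Gamma>" and acts: "acts_simplicially E \<Delta>"
  shows "\<Delta> \<in> Trees E"
proof -
  have e: "verts \<Gamma> = verts \<Delta>" "arcs \<Gamma> = arcs \<Delta>"
    "\<And>x v. \<lbrakk>x \<in> carrier F; v \<in> verts \<Delta>\<rbrakk> \<Longrightarrow> act \<Gamma> x v = act \<Delta> (j x) v"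
    using ext by (auto simp: extends_def)
  have ga: "group_action E (verts \<Delta>) (act \<Delta>)" using acts by (simp add: acts_simplicially_def)
  interpret action_on E "verts \<Delta>" "act \<Delta>"
    using ga by (simp add: action_on_def action_on_axioms_def E.is_group)
  have st: "simplicial_tree \<Delta>" "branching \<Delta>"
    using \<Gamma> e by (simp_all add: Trees_def simplicial_tree_def branching_def tree_graph_def)
  moreover have "finite_stabilizers E \<Delta>"
  proof (rule finite_stabilizersI[OF E.is_group ga])
    show "arcs \<Delta> \<subseteq> verts \<Delta> \<times> verts \<Delta>" using st by (simp add: simplicial_tree_def)
    fix v assume v: "v \<in> verts \<Delta>"
    show "finite (stabilizer E (act \<Delta>) v)"
    proof (rule finite_if_finite_vimage)
      show "k \<otimes>\<^bsub>E\<^esub> inv\<^bsub>E\<^esub> l \<in> stabilizer E (act \<Delta>) v"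
        if "k \<in> stabilizer E (act \<Delta>) v" "l \<in> stabilizer E (act \<Delta>) v" for k l
        using that v by (auto simp: stabilizer_def act_mult) (metis act_inv1)
      have "{x \<in> carrier F. j x \<in> stabilizer E (act \<Delta>) v} = stabilizer F (act \<Gamma>) v"
        using e v by (auto simp: stabilizer_def)
      then show "finite {x \<in> carrier F. j x \<in> stabilizer E (act \<Delta>) v}"
        using \<Gamma> v e by (auto simp: Trees_def finite_stabilizers_def)
    qed (auto simp: stabilizer_def)
  qed
  moreover have "minimal_action E \<Delta>"
    unfolding minimal_action_def
  proof (intro allI impI, elim conjE)
    fix W assume W: "W \<subseteq> verts \<Delta>" "W \<noteq> {}" "\<forall>x\<in>carrier E. act \<Delta> x ` W \<subseteq> W"
      "\<forall>u\<in>W. \<forall>v\<in>W. (u, v) \<in> (arcs \<Delta> \<inter> W \<times> W)\<^sup>*"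
    have "\<forall>x\<in>carrier F. act \<Gamma> x ` W \<subseteq> W" using W(1,3) e j_closed by (smt (verit) image_subset_iff subsetD)
    moreover have "minimal_action F \<Gamma>" using \<Gamma> by (simp add: Trees_def)
    ultimately show "W = verts \<Delta>" using W e unfolding minimal_action_def by metis
  qed
  ultimately show ?thesis using acts by (simp add: Trees_def)
qed

lemma cocompact_F:
  assumes "\<Gamma> \<in> Trees F" "loopfree \<Gamma>"
  shows "\<exists>B. finite B \<and> B \<subseteq> arcs \<Gamma> \<and> translates F \<Gamma> B = arcs \<Gamma>"
proof -
  interpret tree_action F \<Gamma> by unfold_locales (rule assms)+
  show ?thesis using cocompact_if_finitely_generated S0 by blast
qed

text \<open>Finitely many \<open>F\<close>-orbits of arcs lie in finitely many
  \<open>E\<close>-orbits, so no generating set of \<open>E\<close> has to be constructed.\<close>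

lemma cocompact_E:
  assumes "\<Delta> \<in> Trees E" "loopfree \<Delta>"
  shows "\<exists>B. finite B \<and> B \<subseteq> arcs \<Delta> \<and> translates E \<Delta> B = arcs \<Delta>"
proof -
  interpret tree_action E \<Delta> by unfold_locales (rule assms)+
  have "loopfree (pullback j \<Delta>)" using assms(2) by (simp add: loopfree_def pullback_def)
  then obtain B where B: "finite B" "B \<subseteq> arcs \<Delta>" "translates F (pullback j \<Delta>) B = arcs \<Delta>"
    using cocompact_F[OF pullback_in_Trees[OF assms]] by (auto simp: pullback_def)
  have "translates F (pullback j \<Delta>) B \<subseteq> translates E \<Delta> B"
    by (auto simp: translates_def pullback_def intro!: bexI[of _ "j _"])
  then show ?thesis using B translates_subset[OF invariant_arcs B(2)] by blast
qed

end


section \<open>Collapse maps\<close>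

lemma group_actionI:
  assumes "group H" and ext: "\<And>x. x \<in> carrier H \<Longrightarrow> a x \<in> extensional V"
    and closed: "\<And>x v. \<lbrakk>x \<in> carrier H; v \<in> V\<rbrakk> \<Longrightarrow> a x v \<in> V"
    and one: "\<And>v. v \<in> V \<Longrightarrow> a \<one>\<^bsub>H\<^esub> v = v"
    and mult: "\<And>x y v. \<lbrakk>x \<in> carrier H; y \<in> carrier H; v \<in> V\<rbrakk> \<Longrightarrow> a (x \<otimes>\<^bsub>H\<^esub> y) v = a x (a y v)"
  shows "group_action H V a"
proof -
  interpret group H by fact
  have "bij_betw (a x) V V" if "x \<in> carrier H" for x
  proof (rule bij_betw_byWitness[where f' = "a (inv\<^bsub>H\<^esub> x)"])
    show "\<forall>v\<in>V. a (inv\<^bsub>H\<^esub> x) (a x v) = v" "\<forall>v\<in>V. a x (a (inv\<^bsub>H\<^esub> x) v) = v"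
      using that one by (simp_all flip: mult)
  qed (use closed that in auto)
  then have Bij: "a x \<in> Bij V" if "x \<in> carrier H" for x
    using that ext by (simp add: Bij_def)
  have "a \<in> hom H (BijGroup V)"
  proof (rule homI)
    fix x y assume xy: "x \<in> carrier H" "y \<in> carrier H"
    have "a (x \<otimes>\<^bsub>H\<^esub> y) = compose V (a x) (a y)"
    proof (rule extensionalityI)
      show "a (x \<otimes>\<^bsub>H\<^esub> y) \<in> extensional V" using xy ext by simp
    qed (use xy mult in \<open>auto simp: compose_def\<close>)
    then show "a (x \<otimes>\<^bsub>H\<^esub> y) = a x \<otimes>\<^bsub>BijGroup V\<^esub> a y" using Bij xy by (simp add: BijGroup_def)
  qed (use Bij in \<open>simp add: BijGroup_def\<close>)
  then show ?thesis
    by (simp add: group_action_def group_hom_def group_hom_axioms_def group_BijGroup is_group)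
qed

text \<open>This is \<open>orbit_collapse\<close> without the clause about a single orbit.
  Isomorphisms of loop-free trees are included, and the notion survives restriction to a subgroup,
  where an orbit may split.\<close>

definition collapse_map ::
    "('g, 'b) monoid_scheme \<Rightarrow> 'g gtree \<Rightarrow> 'g gtree \<Rightarrow> (nat \<Rightarrow> nat) \<Rightarrow> bool" where
  "collapse_map F \<Gamma> \<Gamma>' p \<longleftrightarrow> \<Gamma> \<in> Trees F \<and> \<Gamma>' \<in> Trees F \<and> p ` verts \<Gamma> = verts \<Gamma>' \<and>
     equivariant F \<Gamma> \<Gamma>' p \<and>
     (\<forall>u\<in>verts \<Gamma>. \<forall>v\<in>verts \<Gamma>. p u = p v \<longrightarrow> (u, v) \<in> (collapsed_arcs \<Gamma> p)\<^sup>*) \<and>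
     bij_betw (map_prod p p) (arcs \<Gamma> - collapsed_arcs \<Gamma> p) (arcs \<Gamma>')"

text \<open>The arcs that disappear when \<open>p\<close> is followed by the collapse of
  \<open>S'\<close>.\<close>

definition pull_arcs :: "'g gtree \<Rightarrow> (nat \<Rightarrow> nat) \<Rightarrow> (nat \<times> nat) set \<Rightarrow> (nat \<times> nat) set" where
  "pull_arcs \<Gamma> p S' = {(u, v) \<in> arcs \<Gamma>. p u = p v \<or> (p u, p v) \<in> S'}"

text \<open>The set of \<open>x\<close> in the last clause is the stabilizer of the component of
  \<open>v\<close> under \<open>S\<close>. These component stabilizers become the vertex stabilizers
  of the quotient, which must be finite.\<close>

definition collapsible :: "('g, 'b) monoid_scheme \<Rightarrow> 'g gtree \<Rightarrow> (nat \<times> nat) set \<Rightarrow> bool" where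
  "collapsible F \<Gamma> S \<longleftrightarrow> S \<subseteq> arcs \<Gamma> \<and> (\<forall>u v. (u, v) \<in> S \<longrightarrow> (v, u) \<in> S) \<and> invariant_arcs F \<Gamma> S \<and>
     (\<forall>v\<in>verts \<Gamma>. finite {x \<in> carrier F. (v, act \<Gamma> x v) \<in> S\<^sup>*})"

definition max_collapsible :: "('g, 'b) monoid_scheme \<Rightarrow> 'g gtree \<Rightarrow> (nat \<times> nat) set \<Rightarrow> bool" where
  "max_collapsible F \<Gamma> S \<longleftrightarrow> collapsible F \<Gamma> S \<and>
     (\<forall>S'. collapsible F \<Gamma> S' \<and> S \<subseteq> S' \<longrightarrow> S' = S)"

lemma collapsed_rtrancl: "(u, v) \<in> (collapsed_arcs \<Gamma> p)\<^sup>* \<Longrightarrow> p u = p v"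
  by (induction rule: rtrancl_induct) (auto simp: collapsed_arcs_def)

lemma Trees_arcs_sub: "\<Gamma> \<in> Trees F \<Longrightarrow> arcs \<Gamma> \<subseteq> verts \<Gamma> \<times> verts \<Gamma>"
  by (simp add: Trees_def simplicial_tree_def)

lemma Trees_act_closed: "\<lbrakk>\<Gamma> \<in> Trees F; x \<in> carrier F; v \<in> verts \<Gamma>\<rbrakk> \<Longrightarrow> act \<Gamma> x v \<in> verts \<Gamma>"
  by (auto simp: Trees_def acts_simplicially_def dest: group_action.surj_prop)

lemma collapse_map_in_Trees: "collapse_map F \<Gamma> \<Gamma>' p \<Longrightarrow> \<Gamma> \<in> Trees F \<and> \<Gamma>' \<in> Trees F"
  by (simp add: collapse_map_def)

lemma collapse_map_arcs_sub: "collapse_map F \<Gamma> \<Gamma>' p \<Longrightarrow> arcs \<Gamma> \<subseteq> verts \<Gamma> \<times> verts \<Gamma>"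
  by (erule collapse_map_in_Trees[THEN conjunct1, THEN Trees_arcs_sub])

lemma collapse_map_act_closed:
  "\<lbrakk>collapse_map F \<Gamma> \<Gamma>' p; x \<in> carrier F; v \<in> verts \<Gamma>\<rbrakk> \<Longrightarrow> act \<Gamma> x v \<in> verts \<Gamma>"
  by (rule Trees_act_closed) (simp_all add: collapse_map_def)

lemma collapse_map_loopfree: "collapse_map F \<Gamma> \<Gamma>' p \<Longrightarrow> loopfree \<Gamma>'"
  unfolding loopfree_def
proof (intro allI notI)
  fix v assume g: "collapse_map F \<Gamma> \<Gamma>' p" and "(v, v) \<in> arcs \<Gamma>'"
  then have "(v, v) \<in> map_prod p p ` (arcs \<Gamma> - collapsed_arcs \<Gamma> p)"
    by (simp add: collapse_map_def bij_betw_def)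
  then obtain a b where "(a, b) \<in> arcs \<Gamma> - collapsed_arcs \<Gamma> p" "p a = v" "p b = v" by auto
  then show False by (auto simp: collapsed_arcs_def)
qed

lemma collapse_map_iso:
  assumes "\<Gamma> \<in> Trees F" "\<Gamma>' \<in> Trees F" "tree_iso \<Gamma> \<Gamma>' h" "equivariant F \<Gamma> \<Gamma>' h" "loopfree \<Gamma>"
  shows "collapse_map F \<Gamma> \<Gamma>' h" "collapsed_arcs \<Gamma> h = {}"
proof -
  have sub: "arcs \<Gamma> \<subseteq> verts \<Gamma> \<times> verts \<Gamma>" "arcs \<Gamma>' \<subseteq> verts \<Gamma>' \<times> verts \<Gamma>'" using assms Trees_arcs_sub by blast+
  have inj: "inj_on h (verts \<Gamma>)" "h ` verts \<Gamma> = verts \<Gamma>'" using assms(3) by (auto simp: tree_iso_def bij_betw_def)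
  show e: "collapsed_arcs \<Gamma> h = {}"
    using inj sub assms(5) unfolding collapsed_arcs_def loopfree_def inj_on_def by fastforce
  have "inj_on (map_prod h h) (arcs \<Gamma>)"
    using map_prod_inj_on[OF inj(1) inj(1)] sub(1) inj_on_subset by blast
  moreover have "map_prod h h ` arcs \<Gamma> = arcs \<Gamma>'"
  proof
    show "map_prod h h ` arcs \<Gamma> \<subseteq> arcs \<Gamma>'" using assms(3) sub(1) by (auto simp: tree_iso_def)
    show "arcs \<Gamma>' \<subseteq> map_prod h h ` arcs \<Gamma>"
    proof
      fix e assume e: "e \<in> arcs \<Gamma>'"
      then obtain u v where "e = (h u, h v)" "u \<in> verts \<Gamma>" "v \<in> verts \<Gamma>" using sub(2) inj(2) by blast
      with e assms(3) show "e \<in> map_prod h h ` arcs \<Gamma>" by (force simp: tree_iso_def)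
    qed
  qed
  ultimately have "bij_betw (map_prod h h) (arcs \<Gamma>) (arcs \<Gamma>')" by (simp add: bij_betw_def)
  then show "collapse_map F \<Gamma> \<Gamma>' h"
    using assms e inj by (auto simp: collapse_map_def inj_on_def)
qed

lemma orbit_collapse_collapse_map: "orbit_collapse F \<Gamma> \<Gamma>' p \<Longrightarrow> collapse_map F \<Gamma> \<Gamma>' p"
  by (simp add: orbit_collapse_def collapse_map_def)

lemma collapse_map_arc:
  "\<lbrakk>collapse_map F \<Gamma> \<Gamma>' p; (u, v) \<in> arcs \<Gamma>; p u \<noteq> p v\<rbrakk> \<Longrightarrow> (p u, p v) \<in> arcs \<Gamma>'"
proof -
  assume g: "collapse_map F \<Gamma> \<Gamma>' p" and "(u, v) \<in> arcs \<Gamma>" "p u \<noteq> p v"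
  then have "map_prod p p (u, v) \<in> map_prod p p ` (arcs \<Gamma> - collapsed_arcs \<Gamma> p)"
    by (intro imageI) (simp add: collapsed_arcs_def)
  then show ?thesis using g by (simp add: collapse_map_def bij_betw_def)
qed

lemma collapse_map_lift_arc:
  assumes "collapse_map F \<Gamma> \<Gamma>' p" "(a, b) \<in> arcs \<Gamma>'"
  obtains u v where "(u, v) \<in> arcs \<Gamma>" "p u = a" "p v = b" "p u \<noteq> p v"
proof -
  have "(a, b) \<in> map_prod p p ` (arcs \<Gamma> - collapsed_arcs \<Gamma> p)"
    using assms by (simp add: collapse_map_def bij_betw_def)
  then show ?thesis using that by (auto simp: collapsed_arcs_def)
qed

lemma collapse_map_arc_inj:
  assumes "collapse_map F \<Gamma> \<Gamma>' p" "(u, v) \<in> arcs \<Gamma>" "(u', v') \<in> arcs \<Gamma>" "p u \<noteq> p v" "p u = p u'" "p v = p v'"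
  shows "u = u' \<and> v = v'"
proof -
  have "inj_on (map_prod p p) (arcs \<Gamma> - collapsed_arcs \<Gamma> p)"
    using assms(1) by (simp add: collapse_map_def bij_betw_def)
  from inj_onD[OF this, of "(u, v)" "(u', v')"] assms show ?thesis
    by (auto simp: collapsed_arcs_def)
qed

text \<open>Arcs of \<open>S'\<close> lift one at a time, and the gaps between consecutive lifts lie
  in fibres, where collapsed arcs join them. Quantifying over all \<open>v\<close> in the end fibre
  gives the induction the freedom to choose the lift.\<close>

lemma lift_path:
  assumes g: "collapse_map F \<Gamma> \<Gamma>' p" and S: "S' \<subseteq> arcs \<Gamma>'"
    and path: "(p u, b) \<in> S'\<^sup>*" and u: "u \<in> verts \<Gamma>"
  shows "\<forall>v\<in>verts \<Gamma>. p v = b \<longrightarrow> (u, v) \<in> (pull_arcs \<Gamma> p S')\<^sup>*"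
proof -
  note sub = collapse_map_arcs_sub[OF g]
  have fib: "(x, y) \<in> (pull_arcs \<Gamma> p S')\<^sup>*" if "x \<in> verts \<Gamma>" "y \<in> verts \<Gamma>" "p x = p y" for x y
  proof -
    have "(x, y) \<in> (collapsed_arcs \<Gamma> p)\<^sup>*" using g that by (simp add: collapse_map_def)
    moreover have "collapsed_arcs \<Gamma> p \<subseteq> pull_arcs \<Gamma> p S'"
      by (auto simp: collapsed_arcs_def pull_arcs_def)
    ultimately show ?thesis using rtrancl_mono by blast
  qed
  from path show ?thesis
  proof (induction rule: rtrancl_induct)
    case base
    then show ?case using fib u by simp
  next
    case (step y z)
    show ?case
    proof (intro ballI impI)
      fix v assume v: "v \<in> verts \<Gamma>" "p v = z"
      obtain c d where cd: "(c, d) \<in> arcs \<Gamma>" "p c = y" "p d = z"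
        using collapse_map_lift_arc[OF g] S step.hyps(2) by blast
      then have "(u, c) \<in> (pull_arcs \<Gamma> p S')\<^sup>*" using step.IH sub by blast
      moreover have "(c, d) \<in> pull_arcs \<Gamma> p S'" using cd step.hyps(2) by (simp add: pull_arcs_def)
      moreover have "(d, v) \<in> (pull_arcs \<Gamma> p S')\<^sup>*" using fib cd v sub by auto
      ultimately show "(u, v) \<in> (pull_arcs \<Gamma> p S')\<^sup>*" by auto
    qed
  qed
qed

lemma push_path: "(u, v) \<in> (pull_arcs \<Gamma> p S')\<^sup>* \<Longrightarrow> (p u, p v) \<in> S'\<^sup>*"
  by (erule rtrancl_image) (auto simp: pull_arcs_def)

lemma collapse_map_comp:
  assumes p: "collapse_map F \<Gamma> \<Gamma>1 p" and q: "collapse_map F \<Gamma>1 \<Gamma>2 q"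
  shows "collapse_map F \<Gamma> \<Gamma>2 (q \<circ> p)"
    and "collapsed_arcs \<Gamma> (q \<circ> p) = pull_arcs \<Gamma> p (collapsed_arcs \<Gamma>1 q)"
proof -
  show c: "collapsed_arcs \<Gamma> (q \<circ> p) = pull_arcs \<Gamma> p (collapsed_arcs \<Gamma>1 q)"
    using collapse_map_arc[OF p] by (auto simp: collapsed_arcs_def pull_arcs_def)
  have im: "p ` verts \<Gamma> = verts \<Gamma>1" "q ` verts \<Gamma>1 = verts \<Gamma>2" using p q by (simp_all add: collapse_map_def)
  note sub = collapse_map_arcs_sub[OF p]
  have "(u, v) \<in> (collapsed_arcs \<Gamma> (q \<circ> p))\<^sup>*"
    if uv: "u \<in> verts \<Gamma>" "v \<in> verts \<Gamma>" "(q \<circ> p) u = (q \<circ> p) v" for u v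
  proof -
    have "p u \<in> verts \<Gamma>1" "p v \<in> verts \<Gamma>1" using uv im by blast+
    then have "(p u, p v) \<in> (collapsed_arcs \<Gamma>1 q)\<^sup>*" using q uv by (simp add: collapse_map_def)
    then show ?thesis
      using lift_path[OF p, of "collapsed_arcs \<Gamma>1 q" u "p v"] uv
      unfolding c by (auto simp: collapsed_arcs_def)
  qed
  moreover have "bij_betw (map_prod (q \<circ> p) (q \<circ> p)) (arcs \<Gamma> - collapsed_arcs \<Gamma> (q \<circ> p)) (arcs \<Gamma>2)"
    unfolding bij_betw_def
  proof
    show "inj_on (map_prod (q \<circ> p) (q \<circ> p)) (arcs \<Gamma> - collapsed_arcs \<Gamma> (q \<circ> p))"
    proof (rule inj_onI, clarsimp)
      fix u v u' v' assume *: "(u, v) \<in> arcs \<Gamma>" "(u, v) \<notin> collapsed_arcs \<Gamma> (q \<circ> p)"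
        "(u', v') \<in> arcs \<Gamma>" "(u', v') \<notin> collapsed_arcs \<Gamma> (q \<circ> p)"
        "q (p u) = q (p u')" "q (p v) = q (p v')"
      then have n: "q (p u) \<noteq> q (p v)" "q (p u') \<noteq> q (p v')" by (auto simp: collapsed_arcs_def)
      then have "(p u, p v) \<in> arcs \<Gamma>1" "(p u', p v') \<in> arcs \<Gamma>1" using * collapse_map_arc[OF p] by metis+
      then have "p u = p u' \<and> p v = p v'" using collapse_map_arc_inj[OF q] * n by metis
      then show "u = u' \<and> v = v'" using collapse_map_arc_inj[OF p] * n by metis
    qed
    show "map_prod (q \<circ> p) (q \<circ> p) ` (arcs \<Gamma> - collapsed_arcs \<Gamma> (q \<circ> p)) = arcs \<Gamma>2"
    proof
      show "map_prod (q \<circ> p) (q \<circ> p) ` (arcs \<Gamma> - collapsed_arcs \<Gamma> (q \<circ> p)) \<subseteq> arcs \<Gamma>2"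
        using collapse_map_arc[OF p] collapse_map_arc[OF q] by (force simp: collapsed_arcs_def)
      show "arcs \<Gamma>2 \<subseteq> map_prod (q \<circ> p) (q \<circ> p) ` (arcs \<Gamma> - collapsed_arcs \<Gamma> (q \<circ> p))"
      proof
        fix e assume "e \<in> arcs \<Gamma>2"
        then obtain a b where ab: "e = (q a, q b)" "(a, b) \<in> arcs \<Gamma>1" "q a \<noteq> q b"
          using collapse_map_lift_arc[OF q] by (metis surj_pair)
        then obtain u v where "(u, v) \<in> arcs \<Gamma>" "p u = a" "p v = b" using collapse_map_lift_arc[OF p] by metis
        with ab show "e \<in> map_prod (q \<circ> p) (q \<circ> p) ` (arcs \<Gamma> - collapsed_arcs \<Gamma> (q \<circ> p))"
          by (intro image_eqI[of _ _ "(u, v)"]) (auto simp: collapsed_arcs_def)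
      qed
    qed
  qed
  moreover have "equivariant F \<Gamma> \<Gamma>2 (q \<circ> p)"
    using p q im unfolding collapse_map_def equivariant_def by (metis comp_apply imageI)
  moreover have "(q \<circ> p) ` verts \<Gamma> = verts \<Gamma>2" using im by (metis image_comp)
  ultimately show "collapse_map F \<Gamma> \<Gamma>2 (q \<circ> p)" using p q unfolding collapse_map_def by blast
qed

lemma collapses_collapse_map:
  "collapses F \<Gamma> \<Gamma>' p \<Longrightarrow> loopfree \<Gamma> \<Longrightarrow> collapse_map F \<Gamma> \<Gamma>' p"
proof (induction rule: collapses.induct)
  case (iso \<Gamma>' h)
  then show ?case by (intro collapse_map_iso(1))
next
  case (step \<Gamma>' p \<Gamma>'' q)
  then show ?case using collapse_map_comp(1) orbit_collapse_collapse_map by blast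
qed

text \<open>\<open>q\<close> is well defined because vertices identified by \<open>p0\<close> are
  joined by arcs which \<open>p\<close> collapses as well. The lemma is used to split one orbit off
  a collapse.\<close>

lemma collapse_map_factor:
  assumes p0: "collapse_map F \<Gamma> \<Gamma>0 p0" and p: "collapse_map F \<Gamma> \<Gamma>' p"
    and sub0: "collapsed_arcs \<Gamma> p0 \<subseteq> collapsed_arcs \<Gamma> p"
  obtains q where "collapse_map F \<Gamma>0 \<Gamma>' q" "\<And>v. v \<in> verts \<Gamma> \<Longrightarrow> q (p0 v) = p v"
    "collapsed_arcs \<Gamma>0 q = map_prod p0 p0 ` (collapsed_arcs \<Gamma> p - collapsed_arcs \<Gamma> p0)"
proof -
  define q where "q w = p (inv_into (verts \<Gamma>) p0 w)" for w
  have im: "p0 ` verts \<Gamma> = verts \<Gamma>0" "p ` verts \<Gamma> = verts \<Gamma>'" using p p0 by (simp_all add: collapse_map_def)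
  note sub = collapse_map_arcs_sub[OF p] and cl = collapse_map_act_closed[OF p]
  have q: "q (p0 v) = p v" if "v \<in> verts \<Gamma>" for v
  proof -
    let ?w = "inv_into (verts \<Gamma>) p0 (p0 v)"
    have "?w \<in> verts \<Gamma>" "p0 ?w = p0 v" using that by (auto intro: inv_into_into f_inv_into_f)
    then have "(?w, v) \<in> (collapsed_arcs \<Gamma> p0)\<^sup>*" using p0 that by (simp add: collapse_map_def)
    then have "(?w, v) \<in> (collapsed_arcs \<Gamma> p)\<^sup>*" using rtrancl_mono[OF sub0] by blast
    then show ?thesis unfolding q_def by (rule collapsed_rtrancl)
  qed
  have c: "collapsed_arcs \<Gamma>0 q = map_prod p0 p0 ` (collapsed_arcs \<Gamma> p - collapsed_arcs \<Gamma> p0)"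
  proof (rule subset_antisym; rule subsetI)
    fix e assume "e \<in> collapsed_arcs \<Gamma>0 q"
    then obtain a b where e: "e = (a, b)" "(a, b) \<in> arcs \<Gamma>0" "q a = q b" by (auto simp: collapsed_arcs_def)
    then obtain u v where "(u, v) \<in> arcs \<Gamma>" "p0 u = a" "p0 v = b" "p0 u \<noteq> p0 v"
      using collapse_map_lift_arc[OF p0] by metis
    with e q sub show "e \<in> map_prod p0 p0 ` (collapsed_arcs \<Gamma> p - collapsed_arcs \<Gamma> p0)"
      by (intro image_eqI[of _ _ "(u, v)"]) (auto simp: collapsed_arcs_def)
  next
    fix e assume "e \<in> map_prod p0 p0 ` (collapsed_arcs \<Gamma> p - collapsed_arcs \<Gamma> p0)"
    then obtain u v where "e = (p0 u, p0 v)" "(u, v) \<in> arcs \<Gamma>" "p u = p v" "p0 u \<noteq> p0 v"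
      by (auto simp: collapsed_arcs_def)
    with q sub collapse_map_arc[OF p0] show "e \<in> collapsed_arcs \<Gamma>0 q" by (auto simp: collapsed_arcs_def)
  qed
  have "collapse_map F \<Gamma>0 \<Gamma>' q"
    unfolding collapse_map_def
  proof (intro conjI)
    show "\<Gamma>0 \<in> Trees F" "\<Gamma>' \<in> Trees F" using p p0 by (simp_all add: collapse_map_def)
    show "q ` verts \<Gamma>0 = verts \<Gamma>'" unfolding im(1)[symmetric] im(2)[symmetric] image_image
      using q by (intro image_cong) auto
    show "equivariant F \<Gamma>0 \<Gamma>' q"
      unfolding equivariant_def im(1)[symmetric]
    proof (intro ballI, elim imageE)
      fix x w v assume x: "x \<in> carrier F" and v: "v \<in> verts \<Gamma>" and w: "w = p0 v"
      have "act \<Gamma>0 x w = p0 (act \<Gamma> x v)" using p0 x v w by (simp add: collapse_map_def equivariant_def)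
      then show "q (act \<Gamma>0 x w) = act \<Gamma>' x (q w)"
        using p x v w q cl by (simp add: collapse_map_def equivariant_def)
    qed
    show "\<forall>u\<in>verts \<Gamma>0. \<forall>v\<in>verts \<Gamma>0. q u = q v \<longrightarrow> (u, v) \<in> (collapsed_arcs \<Gamma>0 q)\<^sup>*"
      unfolding im(1)[symmetric]
    proof (intro ballI impI, elim imageE)
      fix u v u' v' assume *: "q u = q v" "u = p0 u'" "v = p0 v'" "u' \<in> verts \<Gamma>" "v' \<in> verts \<Gamma>"
      then have "(u', v') \<in> (collapsed_arcs \<Gamma> p)\<^sup>*" using q p by (simp add: collapse_map_def)
      then show "(u, v) \<in> (collapsed_arcs \<Gamma>0 q)\<^sup>*" unfolding *(2,3)
      proof (rule rtrancl_image)
        fix x y assume "(x, y) \<in> collapsed_arcs \<Gamma> p"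
        then show "(p0 x, p0 y) \<in> (collapsed_arcs \<Gamma>0 q)\<^sup>*"
        proof (cases "p0 x = p0 y")
          case False
          then have "map_prod p0 p0 (x, y) \<in> collapsed_arcs \<Gamma>0 q"
            unfolding c using \<open>(x, y) \<in> _\<close> by (intro imageI) (simp add: collapsed_arcs_def)
          then show ?thesis by auto
        qed simp
      qed
    qed
    show "bij_betw (map_prod q q) (arcs \<Gamma>0 - collapsed_arcs \<Gamma>0 q) (arcs \<Gamma>')"
      unfolding bij_betw_def
    proof
      show "inj_on (map_prod q q) (arcs \<Gamma>0 - collapsed_arcs \<Gamma>0 q)"
      proof (rule inj_onI, clarsimp)
        fix a b a' b' assume *: "(a, b) \<in> arcs \<Gamma>0" "(a, b) \<notin> collapsed_arcs \<Gamma>0 q"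
          "(a', b') \<in> arcs \<Gamma>0" "q a = q a'" "q b = q b'"
        obtain u v where uv: "(u, v) \<in> arcs \<Gamma>" "p0 u = a" "p0 v = b" using collapse_map_lift_arc[OF p0 *(1)] .
        obtain u' v' where uv': "(u', v') \<in> arcs \<Gamma>" "p0 u' = a'" "p0 v' = b'" using collapse_map_lift_arc[OF p0 *(3)] .
        have "q a \<noteq> q b" using * by (auto simp: collapsed_arcs_def)
        moreover have "q a = p u" "q b = p v" "q a' = p u'" "q b' = p v'" using uv uv' q sub by auto
        ultimately have "u = u' \<and> v = v'" using collapse_map_arc_inj[OF p] uv uv' * by metis
        then show "a = a' \<and> b = b'" using uv uv' by simp
      qed
      show "map_prod q q ` (arcs \<Gamma>0 - collapsed_arcs \<Gamma>0 q) = arcs \<Gamma>'"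
      proof (rule subset_antisym; rule subsetI)
        fix e assume "e \<in> map_prod q q ` (arcs \<Gamma>0 - collapsed_arcs \<Gamma>0 q)"
        then obtain a b where ab: "e = (q a, q b)" "(a, b) \<in> arcs \<Gamma>0" "q a \<noteq> q b" by (auto simp: collapsed_arcs_def)
        obtain u v where uv: "(u, v) \<in> arcs \<Gamma>" "p0 u = a" "p0 v = b" using collapse_map_lift_arc[OF p0 ab(2)] .
        then have "q a = p u" "q b = p v" using q sub by auto
        with ab uv collapse_map_arc[OF p] show "e \<in> arcs \<Gamma>'" by auto
      next
        fix e assume "e \<in> arcs \<Gamma>'"
        then obtain u v where uv: "e = (p u, p v)" "(u, v) \<in> arcs \<Gamma>" "p u \<noteq> p v"
          using collapse_map_lift_arc[OF p] by (metis surj_pair)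
        then have e: "e = (q (p0 u), q (p0 v))" "q (p0 u) \<noteq> q (p0 v)" using q sub by auto
        then have "(p0 u, p0 v) \<in> arcs \<Gamma>0" using collapse_map_arc[OF p0 uv(2)] by metis
        with e show "e \<in> map_prod q q ` (arcs \<Gamma>0 - collapsed_arcs \<Gamma>0 q)"
          by (intro image_eqI[of _ _ "(p0 u, p0 v)"]) (auto simp: collapsed_arcs_def)
      qed
    qed
  qed
  with q c that show ?thesis by blast
qed

section \<open>Classes of equivariantly isomorphic trees\<close>

lemma tree_iso_comp:
  "\<lbrakk>tree_iso \<Gamma> \<Gamma>' h; tree_iso \<Gamma>' \<Gamma>'' k\<rbrakk> \<Longrightarrow> tree_iso \<Gamma> \<Gamma>'' (k \<circ> h)"
  unfolding tree_iso_def using bij_betw_trans bij_betwE by (metis (no_types, lifting) comp_apply)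

lemma equivariant_comp:
  "\<lbrakk>equivariant F \<Gamma> \<Gamma>' h; equivariant F \<Gamma>' \<Gamma>'' k; h ` verts \<Gamma> \<subseteq> verts \<Gamma>'\<rbrakk> \<Longrightarrow> equivariant F \<Gamma> \<Gamma>'' (k \<circ> h)"
  by (auto simp: equivariant_def image_subset_iff)

lemma tree_iso_inv:
  assumes "tree_iso \<Gamma> \<Gamma>' h"
  shows "tree_iso \<Gamma>' \<Gamma> (inv_into (verts \<Gamma>) h)"
  using assms unfolding tree_iso_def
  by (smt (verit, ccfv_threshold) bij_betw_def bij_betw_inv_into f_inv_into_f inv_into_into)

lemma equivariant_inv:
  assumes "tree_iso \<Gamma> \<Gamma>' h" "equivariant F \<Gamma> \<Gamma>' h"
    and cl: "\<And>x v. \<lbrakk>x \<in> carrier F; v \<in> verts \<Gamma>\<rbrakk> \<Longrightarrow> act \<Gamma> x v \<in> verts \<Gamma>"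
  shows "equivariant F \<Gamma>' \<Gamma> (inv_into (verts \<Gamma>) h)"
  unfolding equivariant_def
proof (intro ballI)
  fix x v assume x: "x \<in> carrier F" and v: "v \<in> verts \<Gamma>'"
  have h: "inj_on h (verts \<Gamma>)" "h ` verts \<Gamma> = verts \<Gamma>'" using assms(1) by (auto simp: tree_iso_def bij_betw_def)
  then obtain u where u: "u \<in> verts \<Gamma>" "v = h u" using v by blast
  then have "act \<Gamma>' x v = h (act \<Gamma> x u)" using assms(2) x by (simp add: equivariant_def)
  with u h x cl show "inv_into (verts \<Gamma>) h (act \<Gamma>' x v) = act \<Gamma> x (inv_into (verts \<Gamma>) h v)"
    by (simp add: inv_into_f_f)
qed

lemma tree_iso_id: "(\<And>v. v \<in> verts \<Gamma> \<Longrightarrow> h v = v) \<Longrightarrow> verts \<Gamma>' = verts \<Gamma> \<Longrightarrow> arcs \<Gamma>' = arcs \<Gamma>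
   \<Longrightarrow> tree_iso \<Gamma> \<Gamma>' h"
  unfolding tree_iso_def by (auto simp: bij_betw_def inj_on_def)

lemma tree_class_self: "\<Gamma> \<in> Trees F \<Longrightarrow> \<Gamma> \<in> tree_class F \<Gamma>"
  unfolding tree_class_def using tree_iso_id[of \<Gamma> id \<Gamma>] by (auto simp: equivariant_def)

lemma tree_class_sym:
  assumes "\<Gamma> \<in> Trees F" "\<Gamma>' \<in> tree_class F \<Gamma>"
  shows "\<Gamma> \<in> tree_class F \<Gamma>'"
proof -
  obtain h where "tree_iso \<Gamma> \<Gamma>' h" "equivariant F \<Gamma> \<Gamma>' h" using assms by (auto simp: tree_class_def)
  then show ?thesis
    using tree_iso_inv equivariant_inv Trees_act_closed[OF assms(1)] assms(1)
    unfolding tree_class_def by blast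
qed

lemma tree_class_trans:
  assumes "\<Gamma>' \<in> tree_class F \<Gamma>" "\<Gamma>'' \<in> tree_class F \<Gamma>'"
  shows "\<Gamma>'' \<in> tree_class F \<Gamma>"
proof -
  obtain h k where hk: "tree_iso \<Gamma> \<Gamma>' h" "equivariant F \<Gamma> \<Gamma>' h" "tree_iso \<Gamma>' \<Gamma>'' k" "equivariant F \<Gamma>' \<Gamma>'' k"
    using assms by (auto simp: tree_class_def)
  then have "h ` verts \<Gamma> = verts \<Gamma>'" by (simp add: tree_iso_def bij_betw_def)
  then have "tree_iso \<Gamma> \<Gamma>'' (k \<circ> h)" "equivariant F \<Gamma> \<Gamma>'' (k \<circ> h)"
    using tree_iso_comp[OF hk(1,3)] equivariant_comp[OF hk(2,4)] by simp_all
  then show ?thesis using assms(2) by (auto simp: tree_class_def)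
qed

lemma tree_class_eq:
  assumes "\<Gamma> \<in> Trees F" "\<Gamma>' \<in> tree_class F \<Gamma>"
  shows "tree_class F \<Gamma>' = tree_class F \<Gamma>"
  using tree_class_trans tree_class_sym[OF assms] assms(2) by (metis (no_types, opaque_lifting) subsetI subset_antisym)

lemma tree_class_loopfree:
  assumes "\<Gamma>' \<in> tree_class F \<Gamma>" "loopfree \<Gamma>"
  shows "loopfree \<Gamma>'"
  unfolding loopfree_def
proof (intro allI notI)
  fix w assume w: "(w, w) \<in> arcs \<Gamma>'"
  obtain h where "tree_iso \<Gamma> \<Gamma>' h" "\<Gamma>' \<in> Trees F" using assms by (auto simp: tree_class_def)
  moreover from this w have "w \<in> verts \<Gamma>'" using Trees_arcs_sub by blast
  ultimately obtain v where "v \<in> verts \<Gamma>" "w = h v"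
    unfolding tree_iso_def bij_betw_def by (metis imageE)
  then have "(v, v) \<in> arcs \<Gamma>" using w \<open>tree_iso \<Gamma> \<Gamma>' h\<close> by (auto simp: tree_iso_def)
  with assms(2) show False by (simp add: loopfree_def)
qed

lemma spine_vertexD:
  assumes "C \<in> spine_vertices F" "\<Gamma> \<in> C"
  shows "\<Gamma> \<in> Trees F" "C = tree_class F \<Gamma>"
proof -
  obtain \<Gamma>0 where *: "\<Gamma>0 \<in> Trees F" "C = tree_class F \<Gamma>0" using assms by (auto simp: spine_vertices_def)
  then show "\<Gamma> \<in> Trees F" "C = tree_class F \<Gamma>"
    using assms(2) tree_class_eq[OF *(1)] by (auto simp: tree_class_def)
qed


section \<open>Collapsible edge sets and quotient trees\<close>

text \<open>Cocompactness is assumed of all loop-free trees at once, so that it is available for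
  collapsed trees too.\<close>

locale cocompact_group = group H for H :: "('a, 'b) monoid_scheme" (structure) +
  assumes cocompact: "\<lbrakk>\<Gamma> \<in> Trees H; loopfree \<Gamma>\<rbrakk>
    \<Longrightarrow> \<exists>B. finite B \<and> B \<subseteq> arcs \<Gamma> \<and> translates H \<Gamma> B = arcs \<Gamma>"

locale cocompact_tree = cocompact_group H + tree_action H \<Gamma>
  for H :: "('a, 'b) monoid_scheme" (structure) and \<Gamma> :: "'a gtree"
begin

lemma vertex_representatives:
  obtains R where "finite R" "R \<subseteq> verts \<Gamma>"
    "\<And>v. v \<in> verts \<Gamma> \<Longrightarrow> \<exists>x\<in>carrier H. \<exists>r\<in>R. v = act \<Gamma> x r"
proof -
  obtain B where B: "finite B" "B \<subseteq> arcs \<Gamma>" "translates H \<Gamma> B = arcs \<Gamma>"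
    using cocompact[OF tree loopfree] by blast
  have "\<exists>x\<in>carrier H. \<exists>r\<in>fst ` B. v = act \<Gamma> x r" if v: "v \<in> verts \<Gamma>" for v
  proof -
    obtain w where "(v, w) \<in> translates H \<Gamma> B" using has_arc[OF v] B(3) by metis
    then obtain x b where "x \<in> carrier H" "b \<in> B" "v = act \<Gamma> x (fst b)"
      by (force simp: translates_def)
    then show ?thesis by blast
  qed
  moreover have "fst ` B \<subseteq> verts \<Gamma>" using B(2) arcs_in by auto
  ultimately show ?thesis using that[of "fst ` B"] B(1) by blast
qed

text \<open>A fibre meets the orbit of each of finitely many representatives in the image of a
  transporter. The target is only assumed to carry an action with finite stabilizers, because the
  lemma is applied to a quotient before it is known to lie in \<open>Trees\<close>.\<close>

lemma finite_fiber:
  fixes V' :: "nat set"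
  assumes ga: "group_action H V' a'" and fin: "\<And>w. w \<in> V' \<Longrightarrow> finite (stabilizer H a' w)"
    and p: "\<And>v. v \<in> verts \<Gamma> \<Longrightarrow> p v \<in> V'"
      "\<And>x v. \<lbrakk>x \<in> carrier H; v \<in> verts \<Gamma>\<rbrakk> \<Longrightarrow> p (act \<Gamma> x v) = a' x (p v)"
  shows "finite {v \<in> verts \<Gamma>. p v = w}"
proof -
  interpret W: action_on H V' a' using ga by (simp add: action_on_def action_on_axioms_def is_group)
  obtain R where R: "finite R" "R \<subseteq> verts \<Gamma>"
    "\<And>v. v \<in> verts \<Gamma> \<Longrightarrow> \<exists>x\<in>carrier H. \<exists>r\<in>R. v = act \<Gamma> x r"
    using vertex_representatives by blast
  have "{v \<in> verts \<Gamma>. p v = w} \<subseteq> (\<Union>r\<in>R. (\<lambda>x. act \<Gamma> x r) ` {x \<in> carrier H. a' x (p r) = w})"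
  proof
    fix v assume v: "v \<in> {v \<in> verts \<Gamma>. p v = w}"
    then obtain x r where xr: "x \<in> carrier H" "r \<in> R" "v = act \<Gamma> x r" using R(3)[of v] by blast
    have "a' x (p r) = w" using v p(2)[OF xr(1) subsetD[OF R(2) xr(2)]] xr(3) by simp
    with xr show "v \<in> (\<Union>r\<in>R. (\<lambda>x. act \<Gamma> x r) ` {x \<in> carrier H. a' x (p r) = w})" by blast
  qed
  moreover have "finite {x \<in> carrier H. a' x (p r) = w}" if "r \<in> R" for r
    using W.finite_transporter[OF fin] p(1)[OF subsetD[OF R(2) that]] by blast
  ultimately show ?thesis using R(1) by (meson finite_UN finite_imageI finite_subset)
qed

lemma collapse_map_finite_fiber:
  assumes g: "collapse_map H \<Gamma> \<Gamma>' p"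
  shows "finite {v \<in> verts \<Gamma>. p v = w}"
proof (rule finite_fiber)
  have "\<Gamma>' \<in> Trees H" using g by (simp add: collapse_map_def)
  then show "group_action H (verts \<Gamma>') (act \<Gamma>')"
    and "\<And>w. w \<in> verts \<Gamma>' \<Longrightarrow> finite (stabilizer H (act \<Gamma>') w)"
    by (simp_all add: Trees_def acts_simplicially_def finite_stabilizers_def)
  show "p v \<in> verts \<Gamma>'" if "v \<in> verts \<Gamma>" for v using g that by (auto simp: collapse_map_def)
qed (use g in \<open>simp add: collapse_map_def equivariant_def\<close>)

lemma collapsibleD:
  assumes "collapsible H \<Gamma> S"
  shows "S \<subseteq> arcs \<Gamma>" "(u, v) \<in> S \<Longrightarrow> (v, u) \<in> S" "invariant_arcs H \<Gamma> S"
    "v \<in> verts \<Gamma> \<Longrightarrow> finite {x \<in> carrier H. (v, act \<Gamma> x v) \<in> S\<^sup>*}"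
  using assms by (auto simp: collapsible_def)

lemma collapsible_subset:
  assumes "collapsible H \<Gamma> S" "S1 \<subseteq> S" "invariant_arcs H \<Gamma> S1" "\<And>u v. (u, v) \<in> S1 \<Longrightarrow> (v, u) \<in> S1"
  shows "collapsible H \<Gamma> S1"
proof -
  have "finite {x \<in> carrier H. (v, act \<Gamma> x v) \<in> S1\<^sup>*}" if "v \<in> verts \<Gamma>" for v
    by (rule finite_subset[OF _ collapsibleD(4)[OF assms(1) that]])
       (use rtrancl_mono[OF assms(2)] in blast)
  then show ?thesis using assms collapsibleD[OF assms(1)] unfolding collapsible_def by blast
qed

text \<open>A component of collapsed arcs maps to one vertex, so its stabilizer is contained in the
  finite stabilizer of that vertex.\<close>

lemma collapsible_collapsed:
  assumes g: "collapse_map H \<Gamma> \<Gamma>' p"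
  shows "collapsible H \<Gamma> (collapsed_arcs \<Gamma> p)"
  unfolding collapsible_def
proof (intro conjI ballI allI impI)
  have eq: "p (act \<Gamma> x v) = act \<Gamma>' x (p v)" if "x \<in> carrier H" "v \<in> verts \<Gamma>" for x v
    using g that by (simp add: collapse_map_def equivariant_def)
  show "invariant_arcs H \<Gamma> (collapsed_arcs \<Gamma> p)"
    unfolding invariant_arcs_def
  proof (intro ballI allI impI)
    fix x u v assume x: "x \<in> carrier H" and "(u, v) \<in> collapsed_arcs \<Gamma> p"
    then have uv: "(u, v) \<in> arcs \<Gamma>" "p u = p v" by (auto simp: collapsed_arcs_def)
    then show "(act \<Gamma> x u, act \<Gamma> x v) \<in> collapsed_arcs \<Gamma> p"
      using eq[OF x] arcs_in[OF uv(1)] act_arcs_closed[OF x uv(1)] by (simp add: collapsed_arcs_def)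
  qed
  fix v assume v: "v \<in> verts \<Gamma>"
  have "finite (stabilizer H (act \<Gamma>') (p v))"
    using g v by (auto simp: collapse_map_def Trees_def finite_stabilizers_def)
  moreover have "{x \<in> carrier H. (v, act \<Gamma> x v) \<in> (collapsed_arcs \<Gamma> p)\<^sup>*} \<subseteq> stabilizer H (act \<Gamma>') (p v)"
  proof
    fix x assume "x \<in> {x \<in> carrier H. (v, act \<Gamma> x v) \<in> (collapsed_arcs \<Gamma> p)\<^sup>*}"
    then have "x \<in> carrier H" "p v = p (act \<Gamma> x v)" using collapsed_rtrancl by auto
    then show "x \<in> stabilizer H (act \<Gamma>') (p v)" using eq v by (simp add: stabilizer_def)
  qed
  ultimately show "finite {x \<in> carrier H. (v, act \<Gamma> x v) \<in> (collapsed_arcs \<Gamma> p)\<^sup>*}"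
    using finite_subset by blast
qed (auto simp: collapsed_arcs_def intro: arcs_sym)

lemma collapsible_pull:
  assumes g: "collapse_map H \<Gamma> \<Gamma>' p" and S': "collapsible H \<Gamma>' S'"
  shows "collapsible H \<Gamma> (pull_arcs \<Gamma> p S')"
  unfolding collapsible_def
proof (intro conjI ballI allI impI)
  have eq: "p (act \<Gamma> x v) = act \<Gamma>' x (p v)" if "x \<in> carrier H" "v \<in> verts \<Gamma>" for x v
    using g that by (simp add: collapse_map_def equivariant_def)
  show "(v, u) \<in> pull_arcs \<Gamma> p S'" if "(u, v) \<in> pull_arcs \<Gamma> p S'" for u v
    using that S' arcs_sym unfolding pull_arcs_def collapsible_def by auto
  show "invariant_arcs H \<Gamma> (pull_arcs \<Gamma> p S')"
    unfolding invariant_arcs_def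
  proof (intro ballI allI impI)
    fix x u v assume x: "x \<in> carrier H" and "(u, v) \<in> pull_arcs \<Gamma> p S'"
    then have uv: "(u, v) \<in> arcs \<Gamma>" "p u = p v \<or> (p u, p v) \<in> S'" by (auto simp: pull_arcs_def)
    moreover have "invariant_arcs H \<Gamma>' S'" using S' by (simp add: collapsible_def)
    ultimately show "(act \<Gamma> x u, act \<Gamma> x v) \<in> pull_arcs \<Gamma> p S'"
      using eq[OF x] arcs_in[OF uv(1)] act_arcs_closed[OF x uv(1)] x
      by (auto simp: pull_arcs_def invariant_arcs_def)
  qed
  fix v assume v: "v \<in> verts \<Gamma>"
  then have "p v \<in> verts \<Gamma>'" using g by (auto simp: collapse_map_def)
  then have "finite {x \<in> carrier H. (p v, act \<Gamma>' x (p v)) \<in> S'\<^sup>*}" using S' by (simp add: collapsible_def)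
  moreover have "{x \<in> carrier H. (v, act \<Gamma> x v) \<in> (pull_arcs \<Gamma> p S')\<^sup>*} \<subseteq>
      {x \<in> carrier H. (p v, act \<Gamma>' x (p v)) \<in> S'\<^sup>*}"
  proof
    fix x assume "x \<in> {x \<in> carrier H. (v, act \<Gamma> x v) \<in> (pull_arcs \<Gamma> p S')\<^sup>*}"
    then have "x \<in> carrier H" "(p v, p (act \<Gamma> x v)) \<in> S'\<^sup>*" using push_path by auto
    then show "x \<in> {x \<in> carrier H. (p v, act \<Gamma>' x (p v)) \<in> S'\<^sup>*}" using eq v by simp
  qed
  ultimately show "finite {x \<in> carrier H. (v, act \<Gamma> x v) \<in> (pull_arcs \<Gamma> p S')\<^sup>*}"
    using finite_subset by blast
qed (auto simp: pull_arcs_def)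

text \<open>With \<open>collapsible_pull\<close> this matches the collapsible sets of the quotient
  with those of \<open>\<Gamma>\<close> that contain the collapsed arcs. Finiteness transfers
  because a path in the pushed set lifts to a path in \<open>S\<close>.\<close>

lemma collapsible_push:
  assumes g: "collapse_map H \<Gamma> \<Gamma>' p" and S: "collapsible H \<Gamma> S" "collapsed_arcs \<Gamma> p \<subseteq> S"
  shows "collapsible H \<Gamma>' (map_prod p p ` (S - collapsed_arcs \<Gamma> p))"
proof -
  let ?S' = "map_prod p p ` (S - collapsed_arcs \<Gamma> p)"
  have eq: "p (act \<Gamma> x v) = act \<Gamma>' x (p v)" if "x \<in> carrier H" "v \<in> verts \<Gamma>" for x v
    using g that by (simp add: collapse_map_def equivariant_def)
  have S'I: "(p u, p v) \<in> ?S'" if "(u, v) \<in> S" "p u \<noteq> p v" for u v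
    using that by (intro image_eqI[of _ _ "(u, v)"]) (auto simp: collapsed_arcs_def)
  have S'E: "\<exists>u v. (u, v) \<in> S \<and> p u \<noteq> p v \<and> a = p u \<and> b = p v" if "(a, b) \<in> ?S'" for a b
  proof -
    obtain u v where "(u, v) \<in> S" "(u, v) \<notin> collapsed_arcs \<Gamma> p" "a = p u" "b = p v"
      using \<open>(a, b) \<in> ?S'\<close> by auto
    then show ?thesis using collapsibleD(1)[OF S(1)] by (auto simp: collapsed_arcs_def)
  qed
  have sub: "?S' \<subseteq> arcs \<Gamma>'"
  proof
    fix e assume "e \<in> ?S'"
    then obtain u v where "e = (p u, p v)" "(u, v) \<in> S" "p u \<noteq> p v" using S'E by (metis surj_pair)
    then show "e \<in> arcs \<Gamma>'" using collapse_map_arc[OF g] collapsibleD(1)[OF S(1)] by blast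
  qed
  \<comment> \<open>Arcs have unique lifts, so pulling back the pushed set yields nothing beyond
    \<open>S\<close>.\<close>
  have pull: "pull_arcs \<Gamma> p ?S' \<subseteq> S"
  proof
    fix e assume "e \<in> pull_arcs \<Gamma> p ?S'"
    moreover obtain u v where "e = (u, v)" by (cases e)
    ultimately have e: "e = (u, v)" "(u, v) \<in> arcs \<Gamma>" "p u = p v \<or> (p u, p v) \<in> ?S'"
      by (simp_all add: pull_arcs_def)
    show "e \<in> S"
    proof (cases "p u = p v")
      case True
      then show ?thesis using e S(2) by (auto simp: collapsed_arcs_def)
    next
      case False
      then obtain u' v' where "(u', v') \<in> S" "p u = p u'" "p v = p v'" using S'E e(3) by metis
      then show ?thesis using collapse_map_arc_inj[OF g e(2) _ False] collapsibleD(1)[OF S(1)] e(1) by blast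
    qed
  qed
  show ?thesis
    unfolding collapsible_def
  proof (intro conjI ballI allI impI)
    show "?S' \<subseteq> arcs \<Gamma>'" by (rule sub)
    show "(b, a) \<in> ?S'" if "(a, b) \<in> ?S'" for a b
      using S'E[OF that] S'I collapsibleD(2)[OF S(1)] by metis
    show "invariant_arcs H \<Gamma>' ?S'"
      unfolding invariant_arcs_def
    proof (intro ballI allI impI)
      fix x a b assume x: "x \<in> carrier H" and "(a, b) \<in> ?S'"
      then obtain u v where uv: "(u, v) \<in> S" "p u \<noteq> p v" "a = p u" "b = p v" using S'E by blast
      have V: "u \<in> verts \<Gamma>" "v \<in> verts \<Gamma>" using uv(1) collapsibleD(1)[OF S(1)] arcs_in by blast+
      have "(act \<Gamma> x u, act \<Gamma> x v) \<in> S" using collapsibleD(3)[OF S(1)] x uv(1) by (simp add: invariant_arcs_def)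
      moreover have "p (act \<Gamma> x u) \<noteq> p (act \<Gamma> x v)"
      proof
        assume "p (act \<Gamma> x u) = p (act \<Gamma> x v)"
        then have "(act \<Gamma> x u, act \<Gamma> x v) \<in> collapsed_arcs \<Gamma> p"
          using \<open>(act \<Gamma> x u, act \<Gamma> x v) \<in> S\<close> collapsibleD(1)[OF S(1)] by (auto simp: collapsed_arcs_def)
        then have "(act \<Gamma> (inv x) (act \<Gamma> x u), act \<Gamma> (inv x) (act \<Gamma> x v)) \<in> collapsed_arcs \<Gamma> p"
          using collapsibleD(3)[OF collapsible_collapsed[OF g]] x by (simp add: invariant_arcs_def)
        then show False using uv V x by (simp add: act_inv1 collapsed_arcs_def)
      qed
      ultimately have "(p (act \<Gamma> x u), p (act \<Gamma> x v)) \<in> ?S'" by (rule S'I)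
      then show "(act \<Gamma>' x a, act \<Gamma>' x b) \<in> ?S'" using eq x V uv by simp
    qed
    fix w assume "w \<in> verts \<Gamma>'"
    moreover have "p ` verts \<Gamma> = verts \<Gamma>'" using g by (simp add: collapse_map_def)
    ultimately obtain v where v: "v \<in> verts \<Gamma>" "w = p v" by blast
    have "{x \<in> carrier H. (w, act \<Gamma>' x w) \<in> ?S'\<^sup>*} \<subseteq> {x \<in> carrier H. (v, act \<Gamma> x v) \<in> S\<^sup>*}"
    proof (intro Collect_mono impI conjI, elim conjE)
      fix x assume x: "x \<in> carrier H \<and> (w, act \<Gamma>' x w) \<in> ?S'\<^sup>*"
      then have "(v, act \<Gamma> x v) \<in> (pull_arcs \<Gamma> p ?S')\<^sup>*"
        using lift_path[OF g sub, of v "act \<Gamma>' x w"] v eq act_closed by auto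
      then show "(v, act \<Gamma> x v) \<in> S\<^sup>*" using rtrancl_mono[OF pull] by blast
    qed simp
    then show "finite {x \<in> carrier H. (w, act \<Gamma>' x w) \<in> ?S'\<^sup>*}"
      using collapsibleD(4)[OF S(1) v(1)] finite_subset by blast
  qed
qed

text \<open>Components of \<open>S\<close> are full: an arc joining two of their vertices and
  missing from \<open>S\<close> would be bypassed by a path in \<open>S\<close>.\<close>

lemma collapsible_class:
  assumes S: "collapsible H \<Gamma> S" and a: "(u, v) \<in> arcs \<Gamma>" "(u, v) \<in> S\<^sup>*"
  shows "(u, v) \<in> S"
proof (rule ccontr)
  assume "(u, v) \<notin> S"
  then have "S \<subseteq> arcs \<Gamma> - {(u, v), (v, u)}" using collapsibleD(1,2)[OF S] by blast
  then have "(v, u) \<in> (arcs \<Gamma> - {(u, v), (v, u)})\<^sup>*"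
    using rtrancl_sym_closed[of S, OF collapsibleD(2)[OF S] a(2)] rtrancl_mono by (metis subsetD)
  with bridge[OF a(1)] show False by blast
qed

text \<open>The quotient by \<open>S\<close>: each component of \<open>S\<close> is represented by its least vertex.\<close>

lemma collapse_exists:
  assumes S: "collapsible H \<Gamma> S"
  obtains \<Gamma>' p where "collapse_map H \<Gamma> \<Gamma>' p" "collapsed_arcs \<Gamma> p = S"
proof -
  note SA = collapsibleD(1)[OF S] and S_sym = collapsibleD(2)[OF S] and S_inv = collapsibleD(3)[OF S]
  define p where "p v = (LEAST w. (v, w) \<in> S\<^sup>*)" for v
  have p_rep: "(v, p v) \<in> S\<^sup>*" for v unfolding p_def by (rule LeastI[of _ v]) simp
  have sym: "(v, u) \<in> S\<^sup>*" if "(u, v) \<in> S\<^sup>*" for u v using rtrancl_sym_closed[OF S_sym that] .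
  have p_eq: "p u = p v \<longleftrightarrow> (u, v) \<in> S\<^sup>*" for u v
  proof
    assume "p u = p v"
    then have "(p u, v) \<in> S\<^sup>*" using sym[OF p_rep[of v]] by simp
    with p_rep[of u] show "(u, v) \<in> S\<^sup>*" by (rule rtrancl_trans)
  next
    assume uv: "(u, v) \<in> S\<^sup>*"
    then have "(u, w) \<in> S\<^sup>* \<longleftrightarrow> (v, w) \<in> S\<^sup>*" for w using sym rtrancl_trans by metis
    then show "p u = p v" by (simp add: p_def)
  qed
  have S_verts: "w \<in> verts \<Gamma>" if "(v, w) \<in> S\<^sup>*" "v \<in> verts \<Gamma>" for v w
    using that SA arcs_in by (induction rule: rtrancl_induct) auto
  have p_in: "p v \<in> verts \<Gamma>" if "v \<in> verts \<Gamma>" for v using S_verts[OF p_rep that] .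
  have p_p: "p (p v) = p v" for v using p_eq[of "p v" v] sym[OF p_rep] by simp
  have p_act: "p (act \<Gamma> x (p v)) = p (act \<Gamma> x v)" if "x \<in> carrier H" for x v
    unfolding p_eq by (rule sym) (rule invariant_rtrancl[OF S_inv that p_rep])
  have p_act_cong: "p (act \<Gamma> x u) = p (act \<Gamma> x v)" if "x \<in> carrier H" "p u = p v" for x u v
    using p_act[OF that(1)] that(2) by metis
  have coll: "collapsed_arcs \<Gamma> p = S"
    using collapsible_class[OF S] SA by (auto simp: collapsed_arcs_def p_eq)
  \<comment> \<open>If two uncollapsed arcs had the same image, the second one together with paths
    in \<open>S\<close> would bypass the first.\<close>
  have arc_inj: "u = u' \<and> v = v'"
    if uv: "(u, v) \<in> arcs \<Gamma>" "(u', v') \<in> arcs \<Gamma>" "p u \<noteq> p v" "p u = p u'" "p v = p v'" for u v u' v'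
  proof (rule ccontr)
    assume n: "\<not> (u = u' \<and> v = v')"
    let ?R = "arcs \<Gamma> - {(u, v), (v, u)}"
    have "(u, v) \<notin> S" using uv(3) p_eq by blast
    then have SR: "S\<^sup>* \<subseteq> ?R\<^sup>*" using SA S_sym by (intro rtrancl_mono) blast
    have "(v, v') \<in> ?R\<^sup>*" "(u', u) \<in> ?R\<^sup>*" using uv p_eq SR by (metis subsetD)+
    moreover have "(v', u') \<in> ?R" using n uv arcs_sym by auto
    ultimately have "(v, u) \<in> ?R\<^sup>*" by (meson rtrancl.rtrancl_into_rtrancl rtrancl_trans)
    then show False using bridge[OF uv(1)] by blast
  qed
  \<comment> \<open>The action is cut down to the new vertices because \<open>group_action\<close>
    asks for extensional maps.\<close>
  define \<Gamma>' :: "'a gtree" where "\<Gamma>' = \<lparr>verts = p ` verts \<Gamma>, arcs = map_prod p p ` (arcs \<Gamma> - S),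
     act = (\<lambda>x. \<lambda>v\<in>p ` verts \<Gamma>. p (act \<Gamma> x v))\<rparr>"
  let ?V = "p ` verts \<Gamma>" and ?A = "map_prod p p ` (arcs \<Gamma> - S)"
  have sel [simp]: "verts \<Gamma>' = ?V" "arcs \<Gamma>' = ?A" by (simp_all add: \<Gamma>'_def)
  have act': "act \<Gamma>' x (p v) = p (act \<Gamma> x v)" if "x \<in> carrier H" "v \<in> verts \<Gamma>" for x v
    using that p_act by (simp add: \<Gamma>'_def)
  have AI: "(p u, p v) \<in> ?A" if "(u, v) \<in> arcs \<Gamma>" "p u \<noteq> p v" for u v
    using that p_eq by (intro image_eqI[of _ _ "(u, v)"]) auto
  have AE: "\<exists>u v. (u, v) \<in> arcs \<Gamma> \<and> p u \<noteq> p v \<and> a = p u \<and> b = p v" if "(a, b) \<in> ?A" for a b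
  proof -
    obtain u v where uv: "(u, v) \<in> arcs \<Gamma>" "(u, v) \<notin> S" "a = p u" "b = p v" using \<open>(a, b) \<in> ?A\<close> by auto
    moreover have "p u \<noteq> p v" using collapsible_class[OF S uv(1)] uv(2) p_eq by blast
    ultimately show ?thesis by blast
  qed
  have lf': "loopfree \<Gamma>'" unfolding loopfree_def sel using AE by metis
  have tree': "tree_arcs ?V ?A"
  proof
    show "?A \<subseteq> ?V \<times> ?V" using arcs_in by auto
    show "(b, a) \<in> ?A" if "(a, b) \<in> ?A" for a b using AE[OF that] AI arcs_sym by metis
    show "(a, b) \<in> ?A\<^sup>*" if "a \<in> ?V" "b \<in> ?V" for a b
    proof -
      obtain u v where uv: "a = p u" "b = p v" "u \<in> verts \<Gamma>" "v \<in> verts \<Gamma>" using \<open>a \<in> ?V\<close> \<open>b \<in> ?V\<close> by blast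
      then have "(u, v) \<in> (arcs \<Gamma>)\<^sup>*" using connected by blast
      then show ?thesis unfolding uv(1,2)
      proof (rule rtrancl_image)
        show "(p x, p y) \<in> ?A\<^sup>*" if "(x, y) \<in> arcs \<Gamma>" for x y
          using AI[OF that] by (cases "p x = p y") auto
      qed
    qed
    \<comment> \<open>A bypass in the quotient lifts to a bypass of \<open>(u, v)\<close>: its arcs
      lift, and consecutive lifts are joined by paths in \<open>S\<close>, which avoid
      \<open>(u, v)\<close>.\<close>
    show "(b, a) \<notin> (?A - {(a, b), (b, a)})\<^sup>*" if ab: "(a, b) \<in> ?A" for a b
    proof
      assume path: "(b, a) \<in> (?A - {(a, b), (b, a)})\<^sup>*"
      obtain u v where uv: "(u, v) \<in> arcs \<Gamma>" "p u \<noteq> p v" "a = p u" "b = p v" using AE[OF ab] by blast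
      let ?R = "arcs \<Gamma> - {(u, v), (v, u)}"
      have "(u, v) \<notin> S" using uv(2) p_eq by blast
      then have SR: "S\<^sup>* \<subseteq> ?R\<^sup>*" using SA S_sym by (intro rtrancl_mono) blast
      from path have "\<forall>w. p w = a \<longrightarrow> (v, w) \<in> ?R\<^sup>*"
      proof (induction rule: rtrancl_induct)
        case base
        then show ?case using SR uv(4) p_eq by (metis subsetD)
      next
        case (step y z)
        obtain c d where cd: "(c, d) \<in> arcs \<Gamma>" "p c \<noteq> p d" "y = p c" "z = p d" using AE step.hyps(2) by blast
        have "(v, c) \<in> ?R\<^sup>*" using step.IH cd(3) by simp
        moreover have "(c, d) \<in> ?R" using cd step.hyps(2) uv by auto
        ultimately have "(v, d) \<in> ?R\<^sup>*" by (rule rtrancl.rtrancl_into_rtrancl)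
        moreover have "(d, w) \<in> ?R\<^sup>*" if "p w = z" for w
        proof -
          have "(d, w) \<in> S\<^sup>*" using that cd(4) p_eq[of d w] by simp
          then show ?thesis using SR by (rule rev_subsetD)
        qed
        ultimately show ?case using rtrancl_trans[of v d ?R] by simp
      qed
      then show False using bridge[OF uv(1)] uv(3) by blast
    qed
  qed
  have simp': "simplicial_tree \<Gamma>'"
    using simplicial_tree_iff_tree_arcs[OF lf'] tree' verts_nonempty by simp
  have ga': "group_action H ?V (act \<Gamma>')"
  proof (rule group_actionI[OF is_group])
    show "act \<Gamma>' x \<in> extensional ?V" for x by (simp add: \<Gamma>'_def)
    show "act \<Gamma>' x w \<in> ?V" if "x \<in> carrier H" "w \<in> ?V" for x w
      using that act' act_closed by auto
    show "act \<Gamma>' \<one> w = w" if "w \<in> ?V" for w using that act' act_one by auto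
    show "act \<Gamma>' (x \<otimes> y) w = act \<Gamma>' x (act \<Gamma>' y w)"
      if "x \<in> carrier H" "y \<in> carrier H" "w \<in> ?V" for x y w
      using that act' act_mult act_closed by auto
  qed
  have acts': "acts_simplicially H \<Gamma>'"
  proof -
    have "(act \<Gamma>' x a, act \<Gamma>' x b) \<in> ?A" if x: "x \<in> carrier H" and ab: "(a, b) \<in> ?A" for x a b
    proof -
      obtain u v where uv: "(u, v) \<in> arcs \<Gamma>" "p u \<noteq> p v" "a = p u" "b = p v" using AE[OF ab] by blast
      have V: "u \<in> verts \<Gamma>" "v \<in> verts \<Gamma>" using arcs_in uv by blast+
      have "p (act \<Gamma> x u) \<noteq> p (act \<Gamma> x v)"
        using p_act_cong[of "inv x" "act \<Gamma> x u" "act \<Gamma> x v"] x uv(2) V by (auto simp: act_inv1)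
      then have "(p (act \<Gamma> x u), p (act \<Gamma> x v)) \<in> ?A" using AI act_arcs_closed[OF x uv(1)] by blast
      then show ?thesis using act' x V uv by simp
    qed
    then have "\<forall>x\<in>carrier H. \<forall>e\<in>?A. (act \<Gamma>' x (fst e), act \<Gamma>' x (snd e)) \<in> ?A"
      by (metis prod.collapse)
    then show ?thesis using ga' by (simp add: acts_simplicially_def case_prod_beta)
  qed
  have fin': "finite (stabilizer H (act \<Gamma>') w)" if "w \<in> ?V" for w
  proof -
    obtain v where v: "v \<in> verts \<Gamma>" "w = p v" using \<open>w \<in> ?V\<close> by blast
    have "stabilizer H (act \<Gamma>') w \<subseteq> {x \<in> carrier H. (v, act \<Gamma> x v) \<in> S\<^sup>*}"
    proof
      fix x assume "x \<in> stabilizer H (act \<Gamma>') w"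
      then have "x \<in> carrier H" "p v = p (act \<Gamma> x v)" using v act' by (auto simp: stabilizer_def)
      then show "x \<in> {x \<in> carrier H. (v, act \<Gamma> x v) \<in> S\<^sup>*}" using p_eq by simp
    qed
    then show ?thesis using collapsibleD(4)[OF S v(1)] finite_subset by blast
  qed
  have fins': "finite_stabilizers H \<Gamma>'"
  proof (rule finite_stabilizersI[OF is_group])
    show "arcs \<Gamma>' \<subseteq> verts \<Gamma>' \<times> verts \<Gamma>'" using tree' by (simp add: tree_arcs_def)
  qed (use ga' fin' in simp_all)
  have min': "minimal_action H \<Gamma>'"
    unfolding minimal_action_def sel
  proof (intro allI impI, elim conjE)
    fix W assume W: "W \<subseteq> ?V" "W \<noteq> {}" "\<forall>x\<in>carrier H. act \<Gamma>' x ` W \<subseteq> W"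
      "\<forall>u\<in>W. \<forall>v\<in>W. (u, v) \<in> (?A \<inter> W \<times> W)\<^sup>*"
    \<comment> \<open>The preimage of an invariant subtree is an invariant subtree, so minimality of
      \<open>\<Gamma>\<close> applies to it.\<close>
    let ?U = "{v \<in> verts \<Gamma>. p v \<in> W}"
    have fib: "(u, v) \<in> (arcs \<Gamma> \<inter> ?U \<times> ?U)\<^sup>*" if "u \<in> ?U" "p u = p v" for u v
    proof (rule rtrancl_stays[OF _ _ SA])
      show "(u, v) \<in> S\<^sup>*" using that p_eq by blast
      show "z \<in> ?U" if "(u, z) \<in> S\<^sup>*" for z
        using that S_verts \<open>u \<in> ?U\<close> p_eq by (metis (mono_tags, lifting) mem_Collect_eq)
    qed
    have "?U = verts \<Gamma>"
    proof (rule minimal)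
      show "?U \<noteq> {}" using W(1,2) by blast
      show "act \<Gamma> x v \<in> ?U" if "x \<in> carrier H" "v \<in> ?U" for x v
        using that W(3) act' act_closed by (auto simp: image_subset_iff) (metis act')
      show "subtree (arcs \<Gamma>) ?U"
        unfolding subtree_def
      proof (intro ballI)
        fix u v assume u: "u \<in> ?U" and v: "v \<in> ?U"
        then have "(p u, p v) \<in> (?A \<inter> W \<times> W)\<^sup>*" using W(4) by simp
        then have "\<forall>w. p w = p v \<longrightarrow> (u, w) \<in> (arcs \<Gamma> \<inter> ?U \<times> ?U)\<^sup>*"
        proof (induction rule: rtrancl_induct)
          case base
          show ?case by (intro allI impI fib[OF u]) simp
        next
          case (step y z)
          obtain c d where cd: "(c, d) \<in> arcs \<Gamma>" "p c \<noteq> p d" "y = p c" "z = p d" using AE step.hyps(2) by blast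
          have "(u, c) \<in> (arcs \<Gamma> \<inter> ?U \<times> ?U)\<^sup>*" using step.IH cd(3) by simp
          moreover have d: "(c, d) \<in> arcs \<Gamma> \<inter> ?U \<times> ?U" using cd step.hyps(2) arcs_in by auto
          ultimately have ud: "(u, d) \<in> (arcs \<Gamma> \<inter> ?U \<times> ?U)\<^sup>*" by (rule rtrancl.rtrancl_into_rtrancl)
          have "(d, w) \<in> (arcs \<Gamma> \<inter> ?U \<times> ?U)\<^sup>*" if "p w = z" for w
          proof (rule fib)
            show "d \<in> ?U" using d by simp
            show "p d = p w" using cd(4) that by simp
          qed
          then show ?case using rtrancl_trans[OF ud] by simp
        qed
        then show "(u, v) \<in> (arcs \<Gamma> \<inter> ?U \<times> ?U)\<^sup>*" by simp
      qed
    qed simp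
    then have "?V \<subseteq> W" by blast
    then show "W = ?V" using W(1) by blast
  qed
  \<comment> \<open>The arcs at a quotient vertex correspond to the boundary arcs of its fibre. The
    fibre is finite, so \<open>card_boundary_ge_3\<close> gives the bound.\<close>
  have branch': "branching \<Gamma>'"
    unfolding branching_def sel
  proof (intro ballI impI)
    fix w assume w: "w \<in> ?V" and fin: "finite (?A `` {w})"
    let ?K = "{v \<in> verts \<Gamma>. p v = w}"
    have K: "finite ?K" "?K \<noteq> {}" using w finite_fiber[OF ga' fin', of p w] act' by auto
    have bd: "boundary (arcs \<Gamma>) ?K = {(x, y) \<in> arcs \<Gamma>. p x = w \<and> p y \<noteq> w}"
      unfolding boundary_def using arcs_in by auto
    have inj: "inj_on (p \<circ> snd) (boundary (arcs \<Gamma>) ?K)"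
      unfolding bd
    proof (rule inj_onI, clarify)
      fix u v u' v' assume "(u, v) \<in> arcs \<Gamma>" "(u', v') \<in> arcs \<Gamma>" "p v \<noteq> p u" "p u' = p u"
        "(p \<circ> snd) (u, v) = (p \<circ> snd) (u', v')"
      then show "u = u' \<and> v = v'" by (intro arc_inj) simp_all
    qed
    have im: "(p \<circ> snd) ` boundary (arcs \<Gamma>) ?K = ?A `` {w}"
    proof (rule subset_antisym; rule subsetI)
      fix y assume "y \<in> (p \<circ> snd) ` boundary (arcs \<Gamma>) ?K"
      then obtain u v where "(u, v) \<in> arcs \<Gamma>" "p u = w" "p v \<noteq> w" "y = p v" unfolding bd by auto
      then show "y \<in> ?A `` {w}" using AI[of u v] by (metis Image_singleton_iff)
    next
      fix y assume "y \<in> ?A `` {w}"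
      then have "(w, y) \<in> ?A" by (simp only: Image_singleton_iff)
      then obtain u v where "(u, v) \<in> arcs \<Gamma>" "p u \<noteq> p v" "w = p u" "y = p v" using AE by blast
      then show "y \<in> (p \<circ> snd) ` boundary (arcs \<Gamma>) ?K" unfolding bd
        by (intro image_eqI[of _ _ "(u, v)"]) auto
    qed
    have "card (boundary (arcs \<Gamma>) ?K) = card (?A `` {w})"
      unfolding im[symmetric] using inj by (rule card_image[symmetric])
    moreover have "finite ((p \<circ> snd) ` boundary (arcs \<Gamma>) ?K)" unfolding im by (rule fin)
    then have "finite (boundary (arcs \<Gamma>) ?K)" using inj by (rule finite_imageD)
    ultimately have c: "card (boundary (arcs \<Gamma>) ?K) = card (?A `` {w})" "finite (boundary (arcs \<Gamma>) ?K)" .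
    have "3 \<le> card (boundary (arcs \<Gamma>) ?K)"
    proof (rule card_boundary_ge_3[OF K])
      show "3 \<le> card (arcs \<Gamma> `` {v})" if "v \<in> ?K" "finite (arcs \<Gamma> `` {v})" for v
        using branch[of v] that by simp
    qed (use c(2) in auto)
    then show "3 \<le> card (?A `` {w})" using c(1) by simp
  qed
  have "\<Gamma>' \<in> Trees H" using simp' acts' min' fins' branch' by (simp add: Trees_def)
  moreover have "bij_betw (map_prod p p) (arcs \<Gamma> - S) ?A"
  proof -
    have "inj_on (map_prod p p) (arcs \<Gamma> - S)"
    proof (rule inj_onI, clarsimp)
      fix u v u' v' assume *: "(u, v) \<in> arcs \<Gamma>" "(u, v) \<notin> S" "(u', v') \<in> arcs \<Gamma>" "p u = p u'" "p v = p v'"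
      then have "p u \<noteq> p v" using collapsible_class[OF S] p_eq by blast
      with * arc_inj show "u = u' \<and> v = v'" by blast
    qed
    then show ?thesis by (simp add: bij_betw_def)
  qed
  ultimately have "collapse_map H \<Gamma> \<Gamma>' p"
    using tree act' p_eq by (simp add: collapse_map_def coll equivariant_def)
  with coll that show ?thesis by blast
qed

section \<open>Decomposition of a collapse map into single-orbit collapses\<close>

lemma invariant_arcs_act_iff:
  assumes "invariant_arcs H \<Gamma> S" "x \<in> carrier H" "u \<in> verts \<Gamma>" "v \<in> verts \<Gamma>"
  shows "(act \<Gamma> x u, act \<Gamma> x v) \<in> S \<longleftrightarrow> (u, v) \<in> S"
  using assms act_inv1[OF assms(2)] inv_closed[OF assms(2)] unfolding invariant_arcs_def by metis

text \<open>Induction on the number of arc representatives that are collapsed, removing one orbit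
  each time. The resulting map agrees with \<open>p\<close> only on vertices, since
  \<open>collapses\<close> fixes its map as a composition.\<close>

lemma collapse_map_collapses:
  assumes "collapse_map H \<Gamma> \<Gamma>' p"
  shows "\<exists>p'. collapses H \<Gamma> \<Gamma>' p' \<and> (\<forall>v\<in>verts \<Gamma>. p' v = p v)"
proof -
  obtain B where B: "finite B" "B \<subseteq> arcs \<Gamma>" "translates H \<Gamma> B = arcs \<Gamma>"
    using cocompact[OF tree loopfree] by blast
  from assms show ?thesis
  proof (induction "card (B \<inter> collapsed_arcs \<Gamma> p)" arbitrary: \<Gamma>' p rule: less_induct)
    case less
    note g = less.prems
    let ?S = "collapsed_arcs \<Gamma> p"
    have S: "collapsible H \<Gamma> ?S" using collapsible_collapsed[OF g] .
    have in_Trees: "\<Gamma>' \<in> Trees H" "equivariant H \<Gamma> \<Gamma>' p" using g by (simp_all add: collapse_map_def)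
    show ?case
    proof (cases "?S = {}")
      case True
      have "bij_betw p (verts \<Gamma>) (verts \<Gamma>')"
        using g True by (auto simp: collapse_map_def bij_betw_def inj_on_def)
      moreover have "(u, v) \<in> arcs \<Gamma> \<longleftrightarrow> (p u, p v) \<in> arcs \<Gamma>'" if "u \<in> verts \<Gamma>" "v \<in> verts \<Gamma>" for u v
      proof
        assume "(u, v) \<in> arcs \<Gamma>"
        then show "(p u, p v) \<in> arcs \<Gamma>'" using collapse_map_arc[OF g] True by (auto simp: collapsed_arcs_def)
      next
        assume "(p u, p v) \<in> arcs \<Gamma>'"
        then obtain c d where cd: "(c, d) \<in> arcs \<Gamma>" "p c = p u" "p d = p v"
          using collapse_map_lift_arc[OF g] by metis
        then have "c = u" "d = v" using \<open>bij_betw p _ _\<close> that arcs_in[OF cd(1)] by (auto simp: bij_betw_def inj_on_def)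
        with cd show "(u, v) \<in> arcs \<Gamma>" by simp
      qed
      ultimately have "tree_iso \<Gamma> \<Gamma>' p" by (simp add: tree_iso_def)
      then show ?thesis using collapses.iso[OF tree in_Trees(1) _ in_Trees(2)] by blast
    next
      case False
      then obtain a b where ab: "(a, b) \<in> ?S" by auto
      have abA: "(a, b) \<in> arcs \<Gamma>" and pab: "p a = p b" using ab by (auto simp: collapsed_arcs_def)
      have abV: "a \<in> verts \<Gamma>" "b \<in> verts \<Gamma>" using abA arcs_in by auto
      \<comment> \<open>Both orientations are included, matching the orbit clause of
        \<open>orbit_collapse\<close>.\<close>
      define Orb where "Orb = (\<Union>x\<in>carrier H. {(act \<Gamma> x a, act \<Gamma> x b), (act \<Gamma> x b, act \<Gamma> x a)})"
      have OrbI: "(act \<Gamma> x a, act \<Gamma> x b) \<in> Orb" "(act \<Gamma> x b, act \<Gamma> x a) \<in> Orb" if "x \<in> carrier H" for x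
        using that by (auto simp: Orb_def)
      have Orb_sym: "(v, u) \<in> Orb" if "(u, v) \<in> Orb" for u v using that by (auto simp: Orb_def)
      have O_S: "Orb \<subseteq> ?S" using collapsibleD(2,3)[OF S] ab by (auto simp: invariant_arcs_def Orb_def)
      have O_inv: "(act \<Gamma> x u, act \<Gamma> x v) \<in> Orb" if x: "x \<in> carrier H" and uv: "(u, v) \<in> Orb" for x u v
      proof -
        obtain y where y: "y \<in> carrier H"
          "(u = act \<Gamma> y a \<and> v = act \<Gamma> y b) \<or> (u = act \<Gamma> y b \<and> v = act \<Gamma> y a)"
          using uv by (auto simp: Orb_def)
        have "x \<otimes> y \<in> carrier H" using x y by simp
        then show ?thesis using y x abV OrbI[of "x \<otimes> y"] by (auto simp: act_mult)
      qed
      then have O_invariant: "invariant_arcs H \<Gamma> Orb" by (simp add: invariant_arcs_def)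
      \<comment> \<open>The rest is collapsed before the chosen orbit, because
        \<open>collapses.step\<close> appends a single orbit at the end.\<close>
      let ?Rest = "?S - Orb"
      have "collapsible H \<Gamma> ?Rest"
      proof (rule collapsible_subset[OF S])
        show "invariant_arcs H \<Gamma> ?Rest"
          unfolding invariant_arcs_def
        proof (intro ballI allI impI)
          fix x u v assume x: "x \<in> carrier H" and uv: "(u, v) \<in> ?Rest"
          then have "u \<in> verts \<Gamma>" "v \<in> verts \<Gamma>" using collapsibleD(1)[OF S] arcs_in by auto
          then show "(act \<Gamma> x u, act \<Gamma> x v) \<in> ?Rest"
            using uv x invariant_arcs_act_iff[OF O_invariant] invariant_arcs_act_iff[OF collapsibleD(3)[OF S]]
            by simp
        qed
        show "(v, u) \<in> ?Rest" if "(u, v) \<in> ?Rest" for u v using that collapsibleD(2)[OF S] Orb_sym by blast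
      qed blast
      then obtain \<Gamma>0 p0 where p0: "collapse_map H \<Gamma> \<Gamma>0 p0" "collapsed_arcs \<Gamma> p0 = ?Rest"
        using collapse_exists by blast
      \<comment> \<open>\<open>B\<close> meets every orbit of arcs, so leaving out one orbit lowers
        the induction measure.\<close>
      have "B \<inter> Orb \<noteq> {}"
      proof -
        obtain x c d where x: "x \<in> carrier H" "(c, d) \<in> B" "a = act \<Gamma> x c" "b = act \<Gamma> x d"
        proof -
          have "(a, b) \<in> translates H \<Gamma> B" using abA B(3) by simp
          with that show ?thesis by (auto simp: translates_def)
        qed
        have "c \<in> verts \<Gamma>" "d \<in> verts \<Gamma>" using x(2) B(2) arcs_in by blast+
        then have "c = act \<Gamma> (inv x) a" "d = act \<Gamma> (inv x) b" using x act_inv1 by auto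
        moreover have "inv x \<in> carrier H" using x by simp
        ultimately have "(c, d) \<in> Orb" using OrbI by metis
        with x(2) show ?thesis by blast
      qed
      then obtain e where "e \<in> B" "e \<in> Orb" by blast
      have eS: "e \<in> ?S" using \<open>e \<in> Orb\<close> O_S by (rule rev_subsetD)
      have "e \<in> B \<inter> ?S" using eS \<open>e \<in> B\<close> by simp
      moreover have "e \<notin> B \<inter> ?Rest" using \<open>e \<in> Orb\<close> by simp
      ultimately
      have "B \<inter> ?Rest \<subset> B \<inter> ?S" by (intro psubsetI) auto
      then have "card (B \<inter> collapsed_arcs \<Gamma> p0) < card (B \<inter> ?S)"
        unfolding p0(2) using B(1) by (intro psubset_card_mono) auto
      then obtain p0' where p0': "collapses H \<Gamma> \<Gamma>0 p0'" "\<And>v. v \<in> verts \<Gamma> \<Longrightarrow> p0' v = p0 v"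
        using less.hyps p0(1) by blast
      have "collapsed_arcs \<Gamma> p0 \<subseteq> ?S" unfolding p0(2) by blast
      then obtain q where q: "collapse_map H \<Gamma>0 \<Gamma>' q" "\<And>v. v \<in> verts \<Gamma> \<Longrightarrow> q (p0 v) = p v"
        "collapsed_arcs \<Gamma>0 q = map_prod p0 p0 ` (?S - collapsed_arcs \<Gamma> p0)"
        using collapse_map_factor[OF p0(1) g] by blast
      have "?S - collapsed_arcs \<Gamma> p0 = Orb" unfolding p0(2) using O_S by blast
      then have c: "collapsed_arcs \<Gamma>0 q = map_prod p0 p0 ` Orb" using q(3) by simp
      have eq0: "p0 (act \<Gamma> x v) = act \<Gamma>0 x (p0 v)" if "x \<in> carrier H" "v \<in> verts \<Gamma>" for x v
        using p0(1) that by (simp add: collapse_map_def equivariant_def)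
      have "map_prod p0 p0 ` Orb =
          (\<Union>x\<in>carrier H. {(act \<Gamma>0 x (p0 a), act \<Gamma>0 x (p0 b)), (act \<Gamma>0 x (p0 b), act \<Gamma>0 x (p0 a))})"
        unfolding image_UN Orb_def using eq0 abV by (intro SUP_cong) auto
      moreover have "(p0 a, p0 b) \<in> arcs \<Gamma>0"
      proof -
        have "(a, b) = (act \<Gamma> \<one> a, act \<Gamma> \<one> b)" using abV act_one by simp
        then have "(a, b) \<in> Orb" using OrbI(1)[OF one_closed] by metis
        then have "(a, b) \<notin> collapsed_arcs \<Gamma> p0" unfolding p0(2) by blast
        then show ?thesis using collapse_map_arc[OF p0(1) abA] abA by (auto simp: collapsed_arcs_def)
      qed
      ultimately have "\<exists>(u, v)\<in>arcs \<Gamma>0. collapsed_arcs \<Gamma>0 q =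
          (\<Union>x\<in>carrier H. {(act \<Gamma>0 x u, act \<Gamma>0 x v), (act \<Gamma>0 x v, act \<Gamma>0 x u)})"
        using c by (intro bexI[of _ "(p0 a, p0 b)"]) simp_all
      then have "orbit_collapse H \<Gamma>0 \<Gamma>' q" using q(1) by (simp add: orbit_collapse_def collapse_map_def)
      then have "collapses H \<Gamma> \<Gamma>' (q \<circ> p0')" using p0'(1) by (rule collapses.step[rotated])
      moreover have "\<forall>v\<in>verts \<Gamma>. (q \<circ> p0') v = p v" using p0'(2) q(2) by simp
      ultimately show ?thesis by blast
    qed
  qed
qed

end


section \<open>Reduced trees and uniqueness of collapse maps\<close>

lemma (in cocompact_group) cocompact_treeI:
  "\<lbrakk>\<Gamma> \<in> Trees H; loopfree \<Gamma>\<rbrakk> \<Longrightarrow> cocompact_tree H \<Gamma>"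
  by (simp add: cocompact_tree_def tree_action_def tree_action_axioms_def cocompact_group_axioms is_group)

context cocompact_tree
begin

lemma collapse_map_cocompact_tree: "collapse_map H \<Gamma> \<Gamma>' p \<Longrightarrow> cocompact_tree H \<Gamma>'"
  using cocompact_treeI[of \<Gamma>'] collapse_map_in_Trees[of H \<Gamma> \<Gamma>' p] collapse_map_loopfree[of H \<Gamma> \<Gamma>' p] by simp

text \<open>A collapse onto itself cannot lower the least number of arc orbits.\<close>

lemma collapse_map_self:
  assumes g: "collapse_map H \<Gamma> \<Gamma> q"
  shows "collapsed_arcs \<Gamma> q = {}"
proof (rule ccontr)
  let ?S = "collapsed_arcs \<Gamma> q"
  let ?P = "\<lambda>B. finite B \<and> B \<subseteq> arcs \<Gamma> \<and> translates H \<Gamma> B = arcs \<Gamma>"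
  assume "?S \<noteq> {}"
  then obtain a b where ab: "(a, b) \<in> ?S" by auto
  obtain B1 where "?P B1" using cocompact[OF tree loopfree] by blast
  then obtain B where B: "?P B" "\<And>C. ?P C \<Longrightarrow> card B \<le> card C"
    using ex_has_least_nat[of ?P B1 card] by blast
  note S_inv = collapsibleD(3)[OF collapsible_collapsed[OF g]]
  have "(a, b) \<in> translates H \<Gamma> B" using ab B by (auto simp: collapsed_arcs_def)
  then obtain x c d where x: "x \<in> carrier H" "(c, d) \<in> B" "a = act \<Gamma> x c" "b = act \<Gamma> x d"
    by (auto simp: translates_def)
  then have "c \<in> verts \<Gamma>" "d \<in> verts \<Gamma>" using B(1) arcs_in by blast+
  then have "(c, d) \<in> ?S" using invariant_arcs_act_iff[OF S_inv x(1)] ab x by simp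
  then have "card (B - ?S) < card B"
    using x(2) B(1) by (intro psubset_card_mono) auto
  \<comment> \<open>The images of the uncollapsed representatives again represent all orbits, which
    contradicts the minimality of \<open>B\<close>.\<close>
  let ?C = "map_prod q q ` (B - ?S)"
  have "?P ?C"
  proof (intro conjI)
    show "finite ?C" using B(1) by simp
    show C: "?C \<subseteq> arcs \<Gamma>"
    proof
      fix e assume "e \<in> ?C"
      then obtain u v where "e = (q u, q v)" "(u, v) \<in> arcs \<Gamma>" "(u, v) \<notin> ?S" using B(1) by auto
      then show "e \<in> arcs \<Gamma>" using collapse_map_arc[OF g] by (auto simp: collapsed_arcs_def)
    qed
    have "e \<in> translates H \<Gamma> ?C" if e: "e \<in> arcs \<Gamma>" for e
    proof -
      obtain u v where uv: "(u, v) \<in> arcs \<Gamma>" "e = (q u, q v)" "q u \<noteq> q v"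
        using collapse_map_lift_arc[OF g, of "fst e" "snd e"] e by (metis prod.collapse)
      then have "(u, v) \<in> translates H \<Gamma> B" using B(1) by simp
      then obtain x c d where x: "x \<in> carrier H" "(c, d) \<in> B" "u = act \<Gamma> x c" "v = act \<Gamma> x d"
        by (auto simp: translates_def)
      then have V: "c \<in> verts \<Gamma>" "d \<in> verts \<Gamma>" using B(1) arcs_in by blast+
      have "(c, d) \<notin> ?S"
        using invariant_arcs_act_iff[OF S_inv x(1) V] uv x by (auto simp: collapsed_arcs_def)
      then have "(q c, q d) \<in> ?C" using x(2) by (intro image_eqI[of _ _ "(c, d)"]) auto
      moreover have "e = act_arcs \<Gamma> x (q c, q d)"
        using uv(2) x V g by (simp add: collapse_map_def equivariant_def)
      ultimately have "e \<in> act_arcs \<Gamma> x ` ?C" by (rule rev_image_eqI)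
      then show ?thesis unfolding translates_def using x(1) by (rule UN_I[rotated])
    qed
    then show "translates H \<Gamma> ?C = arcs \<Gamma>"      by (intro subset_antisym translates_subset[OF invariant_arcs C] subsetI)
  qed
  then have "card B \<le> card ?C" by (rule B(2))
  also have "\<dots> \<le> card (B - ?S)" using B(1) by (intro card_image_le) simp
  finally show False using \<open>card (B - ?S) < card B\<close> by simp
qed

text \<open>\<open>reduced\<close> only says that a collapse stays in the same class. A nonempty
  collapse onto an isomorphic tree must be excluded, which is \<open>collapse_map_self\<close> for
  the composite with the isomorphism.\<close>

lemma reduced_iff: "reduced H \<Gamma> \<longleftrightarrow> (\<forall>S. collapsible H \<Gamma> S \<longrightarrow> S = {})"
proof (intro iffI allI impI)
  fix S assume red: "reduced H \<Gamma>" and S: "collapsible H \<Gamma> S"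
  obtain \<Gamma>' p where g: "collapse_map H \<Gamma> \<Gamma>' p" "collapsed_arcs \<Gamma> p = S" using collapse_exists[OF S] .
  have T': "\<Gamma>' \<in> Trees H" using collapse_map_in_Trees[OF g(1)] by simp
  obtain p' where "collapses H \<Gamma> \<Gamma>' p'" using collapse_map_collapses[OF g(1)] by blast
  then have "spine_le H (tree_class H \<Gamma>') (tree_class H \<Gamma>)"
    unfolding spine_le_def using tree_class_self[OF tree] tree_class_self[OF T'] by blast
  moreover have "tree_class H \<Gamma>' \<in> spine_vertices H" using T' by (simp add: spine_vertices_def)
  ultimately have "tree_class H \<Gamma>' = tree_class H \<Gamma>" using red by (simp add: reduced_def)
  then have "\<Gamma> \<in> tree_class H \<Gamma>'" using tree_class_self[OF tree] by simp
  then obtain h where h: "tree_iso \<Gamma>' \<Gamma> h" "equivariant H \<Gamma>' \<Gamma> h" by (auto simp: tree_class_def)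
  note gh = collapse_map_iso[OF T' tree h collapse_map_loopfree[OF g(1)]]
  have "collapsed_arcs \<Gamma> (h \<circ> p) = pull_arcs \<Gamma> p {}" using collapse_map_comp(2)[OF g(1) gh(1)] gh(2) by simp
  also have "\<dots> = S" using g(2) by (auto simp: pull_arcs_def collapsed_arcs_def)
  finally show "S = {}" using collapse_map_self[OF collapse_map_comp(1)[OF g(1) gh(1)]] by simp
next
  assume max: "\<forall>S. collapsible H \<Gamma> S \<longrightarrow> S = {}"
  show "reduced H \<Gamma>"
    unfolding reduced_def
  proof (intro conjI ballI impI tree)
    fix C assume C: "C \<in> spine_vertices H" and "spine_le H C (tree_class H \<Gamma>)"
    then obtain \<Gamma>1 \<Gamma>2 p where *: "\<Gamma>1 \<in> tree_class H \<Gamma>" "\<Gamma>2 \<in> C" "collapses H \<Gamma>1 \<Gamma>2 p"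
      by (auto simp: spine_le_def)
    obtain h where h: "tree_iso \<Gamma> \<Gamma>1 h" "equivariant H \<Gamma> \<Gamma>1 h" "\<Gamma>1 \<in> Trees H"
      using *(1) by (auto simp: tree_class_def)
    have g1: "collapse_map H \<Gamma> \<Gamma>1 h" using collapse_map_iso(1)[OF tree h(3,1,2) loopfree] .
    have g2: "collapse_map H \<Gamma>1 \<Gamma>2 p" using collapses_collapse_map[OF *(3) tree_class_loopfree[OF *(1) loopfree]] .
    note g = collapse_map_comp(1)[OF g1 g2]
    have e: "collapsed_arcs \<Gamma> (p \<circ> h) = {}" using max collapsible_collapsed[OF g] by blast
    obtain q where "collapses H \<Gamma> \<Gamma>2 q" using collapse_map_collapses[OF g] by blast
    have "tree_iso \<Gamma> \<Gamma>2 (p \<circ> h)"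
      unfolding tree_iso_def
    proof (intro conjI ballI)
      have inj: "inj_on (p \<circ> h) (verts \<Gamma>)"
        using g unfolding collapse_map_def e by (auto simp: inj_on_def)
      then show "bij_betw (p \<circ> h) (verts \<Gamma>) (verts \<Gamma>2)"
        using g unfolding collapse_map_def bij_betw_def by blast
      fix u v assume uv: "u \<in> verts \<Gamma>" "v \<in> verts \<Gamma>"
      show "(u, v) \<in> arcs \<Gamma> \<longleftrightarrow> ((p \<circ> h) u, (p \<circ> h) v) \<in> arcs \<Gamma>2"
      proof
        assume a: "(u, v) \<in> arcs \<Gamma>"
        then show "((p \<circ> h) u, (p \<circ> h) v) \<in> arcs \<Gamma>2"
          using collapse_map_arc[OF g a] e by (auto simp: collapsed_arcs_def)
      next
        assume "((p \<circ> h) u, (p \<circ> h) v) \<in> arcs \<Gamma>2"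
        then obtain c d where cd: "(c, d) \<in> arcs \<Gamma>" "(p \<circ> h) c = (p \<circ> h) u" "(p \<circ> h) d = (p \<circ> h) v"
          using collapse_map_lift_arc[OF g] by metis
        then have "c = u" "d = v" using inj_onD[OF inj] uv arcs_in[OF cd(1)] by auto
        with cd show "(u, v) \<in> arcs \<Gamma>" by simp
      qed
    qed
    moreover have "\<Gamma>2 \<in> Trees H" "equivariant H \<Gamma> \<Gamma>2 (p \<circ> h)" using g by (simp_all add: collapse_map_def)
    ultimately have "\<Gamma>2 \<in> tree_class H \<Gamma>" by (auto simp: tree_class_def)
    then show "C = tree_class H \<Gamma>"
      using spine_vertexD(2)[OF C *(2)] tree_class_eq[OF tree] by simp
  qed
qed

text \<open>Pushing and pulling along a collapse matches the collapsible sets of the quotient with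
  those above the collapsed set. So the quotient is reduced precisely when the collapsed set is
  maximal.\<close>

lemma surviving_iff:
  assumes a: "(a, b) \<in> arcs \<Gamma>"
  shows "surviving H \<Gamma> (a, b) \<longleftrightarrow> (\<exists>S. max_collapsible H \<Gamma> S \<and> (a, b) \<notin> S)"
proof
  assume "surviving H \<Gamma> (a, b)"
  then obtain \<Gamma>' p where *: "collapses H \<Gamma> \<Gamma>' p" "reduced H \<Gamma>'" "p a \<noteq> p b"
    by (auto simp: surviving_def)
  have g: "collapse_map H \<Gamma> \<Gamma>' p" using collapses_collapse_map[OF *(1) loopfree] .
  interpret T': cocompact_tree H \<Gamma>' by (rule collapse_map_cocompact_tree[OF g])
  let ?S = "collapsed_arcs \<Gamma> p"
  have "S' = ?S" if S': "collapsible H \<Gamma> S'" "?S \<subseteq> S'" for S'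
  proof -
    have "map_prod p p ` (S' - ?S) = {}"
      using collapsible_push[OF g S'] *(2) unfolding T'.reduced_iff by blast
    then show ?thesis using S'(2) by auto
  qed
  then have "max_collapsible H \<Gamma> ?S" using collapsible_collapsed[OF g] by (simp add: max_collapsible_def)
  moreover have "(a, b) \<notin> ?S" using *(3) by (simp add: collapsed_arcs_def)
  ultimately show "\<exists>S. max_collapsible H \<Gamma> S \<and> (a, b) \<notin> S" by blast
next
  assume "\<exists>S. max_collapsible H \<Gamma> S \<and> (a, b) \<notin> S"
  then obtain S where S: "collapsible H \<Gamma> S" "(a, b) \<notin> S"
    and max: "\<And>S'. \<lbrakk>collapsible H \<Gamma> S'; S \<subseteq> S'\<rbrakk> \<Longrightarrow> S' = S" by (auto simp: max_collapsible_def)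
  obtain \<Gamma>' p where g: "collapse_map H \<Gamma> \<Gamma>' p" "collapsed_arcs \<Gamma> p = S" using collapse_exists[OF S(1)] .
  interpret T': cocompact_tree H \<Gamma>' by (rule collapse_map_cocompact_tree[OF g(1)])
  obtain p' where p': "collapses H \<Gamma> \<Gamma>' p'" "\<forall>v\<in>verts \<Gamma>. p' v = p v"
    using collapse_map_collapses[OF g(1)] by blast
  have "p a \<noteq> p b" using S(2) a g(2) by (auto simp: collapsed_arcs_def)
  then have "p' (fst (a, b)) \<noteq> p' (snd (a, b))" using p'(2) arcs_in[OF a] by simp
  moreover have "reduced H \<Gamma>'"
    unfolding T'.reduced_iff
  proof (intro allI impI)
    fix S2 assume S2: "collapsible H \<Gamma>' S2"
    have "S \<subseteq> pull_arcs \<Gamma> p S2" using g(2) by (auto simp: pull_arcs_def collapsed_arcs_def)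
    then have eq: "pull_arcs \<Gamma> p S2 = S" using max collapsible_pull[OF g(1) S2] by simp
    have "(x, y) \<notin> S2" for x y
    proof
      assume xy: "(x, y) \<in> S2"
      then obtain u v where "(u, v) \<in> arcs \<Gamma>" "p u = x" "p v = y" "p u \<noteq> p v"
        using collapse_map_lift_arc[OF g(1)] T'.collapsibleD(1)[OF S2] by (metis subsetD)
      with xy have "(u, v) \<in> pull_arcs \<Gamma> p S2" by (simp add: pull_arcs_def)
      then show False using \<open>p u \<noteq> p v\<close> eq g(2) by (auto simp: collapsed_arcs_def)
    qed
    then show "S2 = {}" by auto
  qed
  ultimately show "surviving H \<Gamma> (a, b)" unfolding surviving_def using p'(1) by blast
qed

text \<open>The displacement between two equivariant collapse maps is bounded by cocompactness; but where
  it is maximal and positive, moving away along a suitable infinite branch increases it.\<close>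

lemma collapse_map_unique:
  assumes g: "collapse_map H \<Gamma> \<Gamma>' p" and g': "collapse_map H \<Gamma> \<Gamma>' p'" and v: "v \<in> verts \<Gamma>"
  shows "p v = p' v"
proof (rule ccontr)
  assume ne: "p v \<noteq> p' v"
  interpret T': cocompact_tree H \<Gamma>' by (rule collapse_map_cocompact_tree[OF g])
  have in_V: "p y \<in> verts \<Gamma>'" "p' y \<in> verts \<Gamma>'" if "y \<in> verts \<Gamma>" for y
    using g g' that by (auto simp: collapse_map_def)
  define D where "D y = T'.tdist (p y) (p' y)" for y
  have D_act: "D (act \<Gamma> x y) = D y" if "x \<in> carrier H" "y \<in> verts \<Gamma>" for x y
    using g g' that in_V[OF that(2)] by (simp add: D_def collapse_map_def equivariant_def T'.tdist_act)
  obtain R where R: "finite R" "R \<subseteq> verts \<Gamma>"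
    "\<And>y. y \<in> verts \<Gamma> \<Longrightarrow> \<exists>x\<in>carrier H. \<exists>r\<in>R. y = act \<Gamma> x r"
    using vertex_representatives by blast
  \<comment> \<open>The displacement is constant on orbits, so it takes finitely many values and has
    a maximum.\<close>
  have "D ` verts \<Gamma> \<subseteq> D ` R"
  proof
    fix d assume "d \<in> D ` verts \<Gamma>"
    then obtain y where y: "y \<in> verts \<Gamma>" "d = D y" by blast
    then obtain x r where "x \<in> carrier H" "r \<in> R" "y = act \<Gamma> x r" using R(3) by blast
    then have "d = D r" using D_act y(2) subsetD[OF R(2)] by simp
    with \<open>r \<in> R\<close> show "d \<in> D ` R" by blast
  qed
  then have fin: "finite (D ` verts \<Gamma>)" using R(1) finite_subset by blast
  then have "Max (D ` verts \<Gamma>) \<in> D ` verts \<Gamma>" using v by (intro Max_in) auto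
  then obtain v0 where v0: "v0 \<in> verts \<Gamma>" "D v0 = Max (D ` verts \<Gamma>)" by auto
  have max: "D y \<le> D v0" if "y \<in> verts \<Gamma>" for y using fin that v0(2) by simp
  let ?a = "p v0" and ?b = "p' v0"
  have V: "?a \<in> verts \<Gamma>'" "?b \<in> verts \<Gamma>'" using in_V[OF v0(1)] by auto
  have "D v > 0" using ne in_V[OF v] by (simp add: D_def T'.tdist_eq_0 flip: neq0_conv)
  then have "D v0 > 0" using max[OF v] by simp
  then have ab: "?a \<noteq> ?b" using V by (simp add: D_def T'.tdist_eq_0 flip: neq0_conv)
  \<comment> \<open>\<open>a1\<close> is the first vertex from \<open>?a\<close> towards
    \<open>?b\<close>, and \<open>b1\<close> the first from \<open>?b\<close> towards
    \<open>?a\<close>.\<close>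
  obtain a1 where a1: "(?a, a1) \<in> arcs \<Gamma>'" "?b \<in> T'.half ?a a1"
    using T'.first_step[OF V ab] .
  obtain b1 where b1: "(?b, b1) \<in> arcs \<Gamma>'" "?a \<in> T'.half ?b b1"
    using T'.first_step[OF V(2,1)] ab by metis
  obtain u u1 where u: "(u, u1) \<in> arcs \<Gamma>" "p u = ?a" "p u1 = a1" "p u \<noteq> p u1"
    using collapse_map_lift_arc[OF g a1(1)] .
  obtain w w1 where w: "(w, w1) \<in> arcs \<Gamma>" "p' w = ?b" "p' w1 = b1" "p' w \<noteq> p' w1"
    using collapse_map_lift_arc[OF g' b1(1)] .
  \<comment> \<open>The vertices that \<open>p\<close> sends behind \<open>?a\<close>, as seen from
    \<open>?b\<close>, and that \<open>p'\<close> sends behind \<open>?b\<close>, as seen from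
    \<open>?a\<close>.\<close>
  define W where "W = {y \<in> verts \<Gamma>. p y \<notin> T'.half ?a a1 \<and> p' y \<notin> T'.half ?b b1}"
  have W_sub: "W \<subseteq> verts \<Gamma>" and "v0 \<in> W"
    using v0(1) T'.half_notin[OF a1(1)] T'.half_notin[OF b1(1)] by (auto simp: W_def)
  \<comment> \<open>Leaving \<open>W\<close> means crossing the arc at \<open>?a\<close> under
    \<open>p\<close> or the arc at \<open>?b\<close> under \<open>p'\<close>. Each has a unique
    lift, so there are at most two ways out, too few for a finite \<open>W\<close>.\<close>
  have bd: "boundary (arcs \<Gamma>) W \<subseteq> {(u, u1), (w, w1)}"
  proof
    fix e assume "e \<in> boundary (arcs \<Gamma>) W"
    then obtain y z where e: "e = (y, z)" "(y, z) \<in> arcs \<Gamma>" "y \<in> W" "z \<notin> W" by (auto simp: boundary_def)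
    then have y: "p y \<notin> T'.half ?a a1" "p' y \<notin> T'.half ?b b1" and z: "z \<in> verts \<Gamma>"
      using arcs_in by (auto simp: W_def)
    then consider "p z \<in> T'.half ?a a1" | "p' z \<in> T'.half ?b b1" using e(4) by (auto simp: W_def)
    then show "e \<in> {(u, u1), (w, w1)}"
    proof cases
      case 1
      then have "p y \<noteq> p z" using y by auto
      then have "(p y, p z) \<in> arcs \<Gamma>'" using collapse_map_arc[OF g e(2)] by simp
      then have "p y = ?a \<and> p z = a1" using T'.half_enter[OF a1(1) y(1) _ 1] by simp
      then show ?thesis using collapse_map_arc_inj[OF g e(2) u(1) \<open>p y \<noteq> p z\<close>] u e(1) by simp
    next
      case 2
      then have "p' y \<noteq> p' z" using y by auto
      then have "(p' y, p' z) \<in> arcs \<Gamma>'" using collapse_map_arc[OF g' e(2)] by simp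
      then have "p' y = ?b \<and> p' z = b1" using T'.half_enter[OF b1(1) y(2) _ 2] by simp
      then show ?thesis using collapse_map_arc_inj[OF g' e(2) w(1) \<open>p' y \<noteq> p' z\<close>] w e(1) by simp
    qed
  qed
  have "infinite W"
  proof
    assume "finite W"
    have "3 \<le> card (boundary (arcs \<Gamma>) W)"
    proof (rule card_boundary_ge_3[OF \<open>finite W\<close> _ W_sub])
      show "3 \<le> card (arcs \<Gamma> `` {y})" if "y \<in> W" "finite (arcs \<Gamma> `` {y})" for y
        using branch[of y] that W_sub by auto
    qed (use \<open>v0 \<in> W\<close> bd finite_subset in auto)
    moreover have "card (boundary (arcs \<Gamma>) W) \<le> card {(u, u1), (w, w1)}"
      using bd by (intro card_mono) auto
    ultimately show False using card_insert_le_m1[of 2 "{(w, w1)}" "(u, u1)"] by simp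
  qed
  \<comment> \<open>Fibres are finite, so some \<open>y\<close> in \<open>W\<close> has
    \<open>p y\<close> different from \<open>?a\<close>. This makes the increase of the displacement
    strict.\<close>
  moreover have "finite {y \<in> verts \<Gamma>. p y = ?a}" by (rule collapse_map_finite_fiber[OF g])
  ultimately obtain y where y: "y \<in> W" "y \<notin> {y \<in> verts \<Gamma>. p y = ?a}"
    by (meson finite_subset subsetI)
  then have yV: "y \<in> verts \<Gamma>" and pya: "p y \<noteq> ?a" using W_sub by auto
  have hy: "p y \<notin> T'.half ?a a1" "p' y \<notin> T'.half ?b b1" using y by (auto simp: W_def)
  \<comment> \<open>Hence the path from \<open>p y\<close> to \<open>p' y\<close> runs through
    \<open>?a\<close> and \<open>?b\<close>, and its length exceeds the displacement at
    \<open>v0\<close> by at least the distance from \<open>p y\<close> to \<open>?a\<close>.\<close>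
  have "p' y \<in> T'.half b1 ?b" using T'.half_compl[OF b1(1)] in_V[OF yV] hy(2) by blast
  then have "p' y \<in> T'.half ?a a1" using T'.half_nested[OF a1(1) b1(1) a1(2) b1(2)] by blast
  then have "T'.tdist (p y) ?a + T'.tdist ?a (p' y) \<le> D y"
    using T'.tdist_through[OF a1(1) in_V(1)[OF yV] hy(1)] by (simp add: D_def)
  moreover have "T'.tdist (p' y) ?b + T'.tdist ?b ?a \<le> T'.tdist (p' y) ?a"
    by (rule T'.tdist_through[OF b1(1) in_V(2)[OF yV] hy(2) b1(2)])
  moreover have "T'.tdist (p y) ?a > 0" using pya in_V[OF yV] V
    by (simp add: T'.tdist_eq_0 flip: neq0_conv)
  ultimately have "D y > D v0" by (simp add: D_def T'.tdist_sym)
  with max[OF yV] show False by simp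
qed

end


section \<open>Extending actions to finite extensions\<close>

context normal_ext
begin

lemma cocompact_group_F: "cocompact_group F"
  by (simp add: cocompact_group_def cocompact_group_axioms_def F.is_group cocompact_F)

lemma cocompact_group_E: "cocompact_group E"
  by (simp add: cocompact_group_def cocompact_group_axioms_def E.is_group cocompact_E)

lemma extends_loopfree: "extends \<Delta> \<Gamma> \<Longrightarrow> loopfree \<Delta> \<longleftrightarrow> loopfree \<Gamma>"
  by (simp add: extends_def loopfree_def)

lemma conj_eq':
  assumes "\<psi> \<in> carrier E" "x \<in> carrier F"
  shows "inv\<^bsub>E\<^esub> \<psi> \<otimes>\<^bsub>E\<^esub> j (c \<psi> x) = j x \<otimes>\<^bsub>E\<^esub> inv\<^bsub>E\<^esub> \<psi>"
proof -
  have cl: "j x \<in> carrier E" "j (c \<psi> x) \<in> carrier E" using assms conj_closed by auto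
  have "inv\<^bsub>E\<^esub> \<psi> \<otimes>\<^bsub>E\<^esub> (\<psi> \<otimes>\<^bsub>E\<^esub> j x) \<otimes>\<^bsub>E\<^esub> inv\<^bsub>E\<^esub> \<psi> =
      inv\<^bsub>E\<^esub> \<psi> \<otimes>\<^bsub>E\<^esub> (j (c \<psi> x) \<otimes>\<^bsub>E\<^esub> \<psi>) \<otimes>\<^bsub>E\<^esub> inv\<^bsub>E\<^esub> \<psi>"
    using conj_eq[OF assms] by simp
  moreover have "inv\<^bsub>E\<^esub> \<psi> \<otimes>\<^bsub>E\<^esub> (\<psi> \<otimes>\<^bsub>E\<^esub> j x) = j x"
    using assms cl by (simp add: E.m_assoc[symmetric])
  ultimately show ?thesis using assms cl by (simp add: E.m_assoc)
qed

lemma conj_unique: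
  assumes "\<psi> \<in> carrier E" "x \<in> carrier F" "y \<in> carrier F" "\<psi> \<otimes>\<^bsub>E\<^esub> j x = j y \<otimes>\<^bsub>E\<^esub> \<psi>"
  shows "c \<psi> x = y"
proof -
  have "j (c \<psi> x) \<otimes>\<^bsub>E\<^esub> \<psi> = j y \<otimes>\<^bsub>E\<^esub> \<psi>" using assms conj_eq by metis
  then have "j (c \<psi> x) = j y" using assms conj_closed by (metis E.right_cancel j_closed)
  then show ?thesis using j_inj assms conj_closed by (auto dest: inj_onD)
qed

lemma conj_mult:
  assumes "\<psi> \<in> carrier E" "\<phi> \<in> carrier E" "x \<in> carrier F"
  shows "c (\<psi> \<otimes>\<^bsub>E\<^esub> \<phi>) x = c \<psi> (c \<phi> x)"
proof (rule conj_unique)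
  have "\<psi> \<otimes>\<^bsub>E\<^esub> \<phi> \<otimes>\<^bsub>E\<^esub> j x = \<psi> \<otimes>\<^bsub>E\<^esub> (j (c \<phi> x) \<otimes>\<^bsub>E\<^esub> \<phi>)"
    using assms conj_eq[OF assms(2,3)] by (simp add: E.m_assoc)
  also have "\<dots> = \<psi> \<otimes>\<^bsub>E\<^esub> j (c \<phi> x) \<otimes>\<^bsub>E\<^esub> \<phi>" using assms conj_closed by (simp add: E.m_assoc)
  also have "\<dots> = j (c \<psi> (c \<phi> x)) \<otimes>\<^bsub>E\<^esub> \<psi> \<otimes>\<^bsub>E\<^esub> \<phi>" using assms conj_closed conj_eq by simp
  finally show "\<psi> \<otimes>\<^bsub>E\<^esub> \<phi> \<otimes>\<^bsub>E\<^esub> j x = j (c \<psi> (c \<phi> x)) \<otimes>\<^bsub>E\<^esub> (\<psi> \<otimes>\<^bsub>E\<^esub> \<phi>)"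
    using assms conj_closed by (simp add: E.m_assoc)
qed (use assms conj_closed in auto)

lemma conj_one: "x \<in> carrier F \<Longrightarrow> c \<one>\<^bsub>E\<^esub> x = x"
  by (rule conj_unique) auto

lemma conj_j:
  assumes "x \<in> carrier F" "y \<in> carrier F"
  shows "c (j y) x = y \<otimes>\<^bsub>F\<^esub> x \<otimes>\<^bsub>F\<^esub> inv\<^bsub>F\<^esub> y"
proof (rule conj_unique)
  have "j (y \<otimes>\<^bsub>F\<^esub> x \<otimes>\<^bsub>F\<^esub> inv\<^bsub>F\<^esub> y) \<otimes>\<^bsub>E\<^esub> j y = j (y \<otimes>\<^bsub>F\<^esub> x \<otimes>\<^bsub>F\<^esub> inv\<^bsub>F\<^esub> y \<otimes>\<^bsub>F\<^esub> y)"
    using assms by (intro j_mult[symmetric]) auto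
  also have "y \<otimes>\<^bsub>F\<^esub> x \<otimes>\<^bsub>F\<^esub> inv\<^bsub>F\<^esub> y \<otimes>\<^bsub>F\<^esub> y = y \<otimes>\<^bsub>F\<^esub> x" using assms by (simp add: F.m_assoc)
  finally show "j y \<otimes>\<^bsub>E\<^esub> j x = j (y \<otimes>\<^bsub>F\<^esub> x \<otimes>\<^bsub>F\<^esub> inv\<^bsub>F\<^esub> y) \<otimes>\<^bsub>E\<^esub> j y"
    using assms by (simp add: j_mult)
qed (use assms in auto)

lemma act_extension_conj:
  assumes \<Delta>: "\<Delta> \<in> Trees E" "loopfree \<Delta>" "extends \<Delta> \<Gamma>"
    and x: "\<psi> \<in> carrier E" "x \<in> carrier F" "v \<in> verts \<Gamma>"
  shows "act \<Delta> \<psi> (act \<Gamma> x v) = act \<Gamma> (c \<psi> x) (act \<Delta> \<psi> v)"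
proof -
  interpret D: tree_action E \<Delta> by unfold_locales (rule \<Delta>(1,2))+
  have e: "verts \<Delta> = verts \<Gamma>" "\<And>x v. \<lbrakk>x \<in> carrier F; v \<in> verts \<Gamma>\<rbrakk> \<Longrightarrow> act \<Delta> (j x) v = act \<Gamma> x v"
    using \<Delta>(3) by (auto simp: extends_def)
  have "act \<Delta> \<psi> (act \<Gamma> x v) = act \<Delta> (\<psi> \<otimes>\<^bsub>E\<^esub> j x) v" using x e by (simp add: D.act_mult)
  also have "\<dots> = act \<Delta> (j (c \<psi> x)) (act \<Delta> \<psi> v)" using x e conj_closed by (simp add: conj_eq D.act_mult)
  also have "\<dots> = act \<Gamma> (c \<psi> x) (act \<Delta> \<psi> v)" using x e conj_closed D.act_closed[of \<psi> v] by simp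
  finally show ?thesis .
qed

text \<open>Conjugating an \<open>F\<close>-equivariant collapse map by an element of \<open>E\<close> gives another one,
  hence the same one by uniqueness.\<close>

lemma collapse_map_extension:
  assumes \<Delta>: "\<Delta> \<in> Trees E" "loopfree \<Delta>" "extends \<Delta> \<Gamma>"
    and \<Delta>': "\<Delta>' \<in> Trees E" "extends \<Delta>' \<Gamma>'" and g: "collapse_map F \<Gamma> \<Gamma>' p"
  shows "collapse_map E \<Delta> \<Delta>' p"
proof -
  have lf: "loopfree \<Gamma>" using \<Delta> extends_loopfree by simp
  have \<Gamma>: "\<Gamma> \<in> Trees F" "\<Gamma>' \<in> Trees F" using g by (simp_all add: collapse_map_def)
  have lf': "loopfree \<Delta>'" using extends_loopfree[OF \<Delta>'(2)] collapse_map_loopfree[OF g] by simp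
  interpret D: tree_action E \<Delta> by unfold_locales (rule \<Delta>(1,2))+
  interpret D': tree_action E \<Delta>' by unfold_locales (rule \<Delta>' lf')+
  interpret G: cocompact_tree F \<Gamma> by (rule cocompact_group.cocompact_treeI[OF cocompact_group_F \<Gamma>(1) lf])
  have e: "verts \<Delta> = verts \<Gamma>" "arcs \<Delta> = arcs \<Gamma>" "verts \<Delta>' = verts \<Gamma>'" "arcs \<Delta>' = arcs \<Gamma>'"
    using \<Delta>(3) \<Delta>'(2) by (auto simp: extends_def)
  have act': "act \<Delta>' (j x) v = act \<Gamma>' x v" if "x \<in> carrier F" "v \<in> verts \<Gamma>'" for x v
    using \<Delta>'(2) that by (simp add: extends_def)
  have pV: "p v \<in> verts \<Gamma>'" if "v \<in> verts \<Gamma>" for v using g that by (auto simp: collapse_map_def)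
  have "p (act \<Delta> \<psi> v) = act \<Delta>' \<psi> (p v)" if \<psi>: "\<psi> \<in> carrier E" and v: "v \<in> verts \<Gamma>" for \<psi> v
  proof -
    have i\<psi>: "inv\<^bsub>E\<^esub> \<psi> \<in> carrier E" using \<psi> by simp
    define q where "q u = act \<Delta>' (inv\<^bsub>E\<^esub> \<psi>) (p (act \<Delta> \<psi> u))" for u
    have aV: "act \<Delta> \<psi> u \<in> verts \<Gamma>" if "u \<in> verts \<Gamma>" for u using D.act_closed[OF \<psi>] e that by simp
    have q_eq: "q u = q w \<longleftrightarrow> p (act \<Delta> \<psi> u) = p (act \<Delta> \<psi> w)" if "u \<in> verts \<Gamma>" "w \<in> verts \<Gamma>" for u w
      using D'.act_inj[OF i\<psi>, of "p (act \<Delta> \<psi> u)" "p (act \<Delta> \<psi> w)"] aV[OF that(1)] aV[OF that(2)] pV e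
      by (auto simp: q_def)
    have "collapse_map F \<Gamma> \<Gamma>' q"
      unfolding collapse_map_def
    proof (intro conjI \<Gamma>)
      have "act \<Delta> \<psi> ` verts \<Gamma> = verts \<Gamma>" using D.surj_prop[OF \<psi>] e by simp
      moreover have "act \<Delta>' (inv\<^bsub>E\<^esub> \<psi>) ` verts \<Gamma>' = verts \<Gamma>'" using D'.surj_prop[OF i\<psi>] e by simp
      moreover have "p ` verts \<Gamma> = verts \<Gamma>'" using g by (simp add: collapse_map_def)
      ultimately show "q ` verts \<Gamma> = verts \<Gamma>'" unfolding q_def by (metis image_image)
      show "equivariant F \<Gamma> \<Gamma>' q"
        unfolding equivariant_def
      proof (intro ballI)
        fix x u assume x: "x \<in> carrier F" and u: "u \<in> verts \<Gamma>"
        let ?w = "p (act \<Delta> \<psi> u)"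
        have w: "?w \<in> verts \<Delta>'" using pV aV[OF u] e by simp
        have cx: "c \<psi> x \<in> carrier F" using conj_closed \<psi> x by simp
        have "p (act \<Delta> \<psi> (act \<Gamma> x u)) = act \<Gamma>' (c \<psi> x) ?w"
          using act_extension_conj[OF \<Delta> \<psi> x u] g cx aV[OF u] by (simp add: collapse_map_def equivariant_def)
        also have "\<dots> = act \<Delta>' (j (c \<psi> x)) ?w" using act' cx w e by simp
        finally have "q (act \<Gamma> x u) = act \<Delta>' (inv\<^bsub>E\<^esub> \<psi>) (act \<Delta>' (j (c \<psi> x)) ?w)" by (simp add: q_def)
        also have "\<dots> = act \<Delta>' (inv\<^bsub>E\<^esub> \<psi> \<otimes>\<^bsub>E\<^esub> j (c \<psi> x)) ?w" using w cx i\<psi> by (simp add: D'.act_mult)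
        also have "\<dots> = act \<Delta>' (j x \<otimes>\<^bsub>E\<^esub> inv\<^bsub>E\<^esub> \<psi>) ?w" using conj_eq'[OF \<psi> x] by simp
        also have "\<dots> = act \<Delta>' (j x) (q u)" using w x i\<psi> by (simp add: D'.act_mult q_def)
        also have "\<dots> = act \<Gamma>' x (q u)" using act' x D'.act_closed[OF i\<psi> w] e by (simp add: q_def)
        finally show "q (act \<Gamma> x u) = act \<Gamma>' x (q u)" .
      qed
      have lift: "(act \<Delta> (inv\<^bsub>E\<^esub> \<psi>) u, act \<Delta> (inv\<^bsub>E\<^esub> \<psi>) w) \<in> collapsed_arcs \<Gamma> q"
        if "(u, w) \<in> collapsed_arcs \<Gamma> p" for u w
      proof -
        have uw: "(u, w) \<in> arcs \<Delta>" "p u = p w" using that e by (auto simp: collapsed_arcs_def)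
        then have V: "u \<in> verts \<Delta>" "w \<in> verts \<Delta>" using D.arcs_in by blast+
        have "(act \<Delta> (inv\<^bsub>E\<^esub> \<psi>) u, act \<Delta> (inv\<^bsub>E\<^esub> \<psi>) w) \<in> arcs \<Gamma>"
          using D.act_arcs_closed[OF i\<psi> uw(1)] e by simp
        then show ?thesis using uw V \<psi> by (simp add: collapsed_arcs_def q_def D.act_inv2)
      qed
      show "\<forall>u\<in>verts \<Gamma>. \<forall>w\<in>verts \<Gamma>. q u = q w \<longrightarrow> (u, w) \<in> (collapsed_arcs \<Gamma> q)\<^sup>*"
      proof (intro ballI impI)
        fix u w assume uw: "u \<in> verts \<Gamma>" "w \<in> verts \<Gamma>" "q u = q w"
        then have "(act \<Delta> \<psi> u, act \<Delta> \<psi> w) \<in> (collapsed_arcs \<Gamma> p)\<^sup>*"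
          using g aV q_eq by (simp add: collapse_map_def)
        then have "(act \<Delta> (inv\<^bsub>E\<^esub> \<psi>) (act \<Delta> \<psi> u), act \<Delta> (inv\<^bsub>E\<^esub> \<psi>) (act \<Delta> \<psi> w)) \<in> (collapsed_arcs \<Gamma> q)\<^sup>*"
          by (rule rtrancl_image) (intro r_into_rtrancl lift)
        then show "(u, w) \<in> (collapsed_arcs \<Gamma> q)\<^sup>*" using uw \<psi> e by (simp add: D.act_inv1)
      qed
      have fwd: "(act \<Delta> \<psi> u, act \<Delta> \<psi> w) \<in> arcs \<Gamma>" "p (act \<Delta> \<psi> u) \<noteq> p (act \<Delta> \<psi> w)"
          "u \<in> verts \<Gamma>" "w \<in> verts \<Gamma>"
        if "(u, w) \<in> arcs \<Gamma> - collapsed_arcs \<Gamma> q" for u w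
        using D.act_arcs_closed[OF \<psi>, of u w] e that D.arcs_in[of u w]
        by (auto simp: collapsed_arcs_def q_def)
      show "bij_betw (map_prod q q) (arcs \<Gamma> - collapsed_arcs \<Gamma> q) (arcs \<Gamma>')"
        unfolding bij_betw_def
      proof
        show "inj_on (map_prod q q) (arcs \<Gamma> - collapsed_arcs \<Gamma> q)"
        proof (rule inj_onI)
          fix a b assume ab: "a \<in> arcs \<Gamma> - collapsed_arcs \<Gamma> q" "b \<in> arcs \<Gamma> - collapsed_arcs \<Gamma> q"
            "map_prod q q a = map_prod q q b"
          obtain u w u' w' where [simp]: "a = (u, w)" "b = (u', w')" by (cases a; cases b)
          have "p (act \<Delta> \<psi> u) = p (act \<Delta> \<psi> u')" "p (act \<Delta> \<psi> w) = p (act \<Delta> \<psi> w')"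
            using ab q_eq fwd(3,4) by auto
          then have "act \<Delta> \<psi> u = act \<Delta> \<psi> u'" "act \<Delta> \<psi> w = act \<Delta> \<psi> w'"
            using collapse_map_arc_inj[OF g fwd(1) fwd(1) fwd(2), of u w u' w'] ab by auto
          then show "a = b" using D.act_inj[OF \<psi>] fwd(3,4) ab e by auto
        qed
        show "map_prod q q ` (arcs \<Gamma> - collapsed_arcs \<Gamma> q) = arcs \<Gamma>'"
        proof (rule subset_antisym; rule subsetI)
          fix b assume "b \<in> map_prod q q ` (arcs \<Gamma> - collapsed_arcs \<Gamma> q)"
          then obtain u w where uw: "(u, w) \<in> arcs \<Gamma> - collapsed_arcs \<Gamma> q" "b = (q u, q w)" by auto
          then have "(p (act \<Delta> \<psi> u), p (act \<Delta> \<psi> w)) \<in> arcs \<Gamma>'" using collapse_map_arc[OF g fwd(1,2)] by simp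
          then show "b \<in> arcs \<Gamma>'" using D'.act_arcs_closed[OF i\<psi>] e uw(2) by (simp add: q_def)
        next
          fix b assume "b \<in> arcs \<Gamma>'"
          then obtain y z where b: "b = (y, z)" "(y, z) \<in> arcs \<Delta>'" using e by (cases b) auto
          then have "(act \<Delta>' \<psi> y, act \<Delta>' \<psi> z) \<in> arcs \<Gamma>'" using D'.act_arcs_closed[OF \<psi>] e by simp
          then obtain u w where uw: "(u, w) \<in> arcs \<Delta>" "p u = act \<Delta>' \<psi> y" "p w = act \<Delta>' \<psi> z" "p u \<noteq> p w"
            using collapse_map_lift_arc[OF g] e by metis
          let ?u = "act \<Delta> (inv\<^bsub>E\<^esub> \<psi>) u" and ?w = "act \<Delta> (inv\<^bsub>E\<^esub> \<psi>) w"
          have V: "u \<in> verts \<Delta>" "w \<in> verts \<Delta>" "y \<in> verts \<Delta>'" "z \<in> verts \<Delta>'"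
            using D.arcs_in[OF uw(1)] D'.arcs_in[OF b(2)] by auto
          have q: "q ?u = y" "q ?w = z" using uw V \<psi> by (simp_all add: q_def D.act_inv2 D'.act_inv1)
          have "y \<noteq> z" using uw by auto
          then have "(?u, ?w) \<in> arcs \<Gamma> - collapsed_arcs \<Gamma> q"
            using D.act_arcs_closed[OF i\<psi> uw(1)] e q by (simp add: collapsed_arcs_def)
          then show "b \<in> map_prod q q ` (arcs \<Gamma> - collapsed_arcs \<Gamma> q)"
            using b q by (intro image_eqI[of _ _ "(?u, ?w)"]) auto
        qed
      qed
    qed
    then have "q v = p v" using G.collapse_map_unique[OF _ g v] by blast
    then show ?thesis using D'.act_inv2[OF \<psi>, of "p (act \<Delta> \<psi> v)"] pV[OF aV[OF v]] e by (simp add: q_def)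
  qed
  then have "equivariant E \<Delta> \<Delta>' p" using e by (simp add: equivariant_def)
  moreover have "collapsed_arcs \<Delta> p = collapsed_arcs \<Gamma> p" using e by (simp add: collapsed_arcs_def)
  ultimately show ?thesis using g \<Delta> \<Delta>' e by (simp add: collapse_map_def)
qed

lemma collapse_map_restriction:
  assumes g: "collapse_map E \<Delta> \<Delta>' p" and ext: "extends \<Delta> \<Gamma>" "extends \<Delta>' \<Gamma>'"
    and \<Gamma>: "\<Gamma> \<in> Trees F" "\<Gamma>' \<in> Trees F"
  shows "collapse_map F \<Gamma> \<Gamma>' p"
proof -
  have e: "verts \<Delta> = verts \<Gamma>" "arcs \<Delta> = arcs \<Gamma>" "verts \<Delta>' = verts \<Gamma>'" "arcs \<Delta>' = arcs \<Gamma>'"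
    using ext by (auto simp: extends_def)
  have pV: "p v \<in> verts \<Gamma>'" if "v \<in> verts \<Gamma>" for v using g e that by (auto simp: collapse_map_def)
  have "p (act \<Gamma> x v) = act \<Gamma>' x (p v)" if x: "x \<in> carrier F" and v: "v \<in> verts \<Gamma>" for x v
  proof -
    have "p (act \<Delta> (j x) v) = act \<Delta>' (j x) (p v)"
      using g e v j_closed[OF x] by (simp add: collapse_map_def equivariant_def)
    then show ?thesis using ext x v pV[OF v] by (simp add: extends_def)
  qed
  then have "equivariant F \<Gamma> \<Gamma>' p" by (simp add: equivariant_def)
  moreover have "collapsed_arcs \<Delta> p = collapsed_arcs \<Gamma> p" using e by (simp add: collapsed_arcs_def)
  ultimately show ?thesis using g \<Gamma> e by (simp add: collapse_map_def)
qed

lemma tree_iso_extends: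
  "\<lbrakk>extends \<Delta> \<Gamma>; extends \<Delta>' \<Gamma>'\<rbrakk> \<Longrightarrow> tree_iso \<Delta> \<Delta>' h \<longleftrightarrow> tree_iso \<Gamma> \<Gamma>' h"
  by (simp add: extends_def tree_iso_def)

text \<open>An isomorphism is a collapse map, so rigidity makes an \<open>F\<close>-isomorphism
  \<open>E\<close>-equivariant. The equivalence yields that restriction is well defined on classes
  and that it is injective.\<close>

lemma extension_class_iff:
  assumes \<Delta>: "\<Delta> \<in> Trees E" "loopfree \<Delta>" "extends \<Delta> \<Gamma>" and \<Delta>': "\<Delta>' \<in> Trees E" "extends \<Delta>' \<Gamma>'"
    and \<Gamma>: "\<Gamma> \<in> Trees F" "\<Gamma>' \<in> Trees F"
  shows "\<Delta>' \<in> tree_class E \<Delta> \<longleftrightarrow> \<Gamma>' \<in> tree_class F \<Gamma>"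
proof
  assume *: "\<Delta>' \<in> tree_class E \<Delta>"
  then obtain h where h: "tree_iso \<Delta> \<Delta>' h" "equivariant E \<Delta> \<Delta>' h" by (auto simp: tree_class_def)
  have "collapse_map E \<Delta> \<Delta>' h" using collapse_map_iso(1)[OF \<Delta>(1) \<Delta>'(1) h \<Delta>(2)] .
  then have "collapse_map F \<Gamma> \<Gamma>' h" using collapse_map_restriction \<Delta>(3) \<Delta>'(2) \<Gamma> by blast
  then show "\<Gamma>' \<in> tree_class F \<Gamma>"
    using h(1) tree_iso_extends[OF \<Delta>(3) \<Delta>'(2)] by (auto simp: tree_class_def collapse_map_def)
next
  assume *: "\<Gamma>' \<in> tree_class F \<Gamma>"
  then obtain h where h: "tree_iso \<Gamma> \<Gamma>' h" "equivariant F \<Gamma> \<Gamma>' h" by (auto simp: tree_class_def)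
  have "collapse_map F \<Gamma> \<Gamma>' h" using collapse_map_iso(1)[OF \<Gamma> h] extends_loopfree[OF \<Delta>(3)] \<Delta>(2) by simp
  then have "collapse_map E \<Delta> \<Delta>' h" by (rule collapse_map_extension[OF \<Delta> \<Delta>'])
  then show "\<Delta>' \<in> tree_class E \<Delta>"
    using h(1) tree_iso_extends[OF \<Delta>(3) \<Delta>'(2)] by (auto simp: tree_class_def collapse_map_def)
qed

text \<open>A candidate for the action of \<open>\<psi>\<close> on an extension of
  \<open>\<Gamma>\<close>. When \<open>E\<close> consists of automorphisms of \<open>F\<close>, this
  is exactly the kind of lift that \<open>realizes\<close> demands.\<close>

definition twisted_aut :: "'a gtree \<Rightarrow> 'e \<Rightarrow> (nat \<Rightarrow> nat) \<Rightarrow> bool" where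
  "twisted_aut \<Gamma> \<psi> h \<longleftrightarrow> tree_iso \<Gamma> \<Gamma> h \<and>
     (\<forall>x\<in>carrier F. \<forall>v\<in>verts \<Gamma>. h (act \<Gamma> x v) = act \<Gamma> (c \<psi> x) (h v))"

lemma twisted_aut_closed: "\<lbrakk>twisted_aut \<Gamma> \<psi> h; v \<in> verts \<Gamma>\<rbrakk> \<Longrightarrow> h v \<in> verts \<Gamma>"
  by (auto simp: twisted_aut_def tree_iso_def bij_betw_def)

text \<open>The twists cancel in the composite of \<open>h\<close> with the inverse of
  \<open>k\<close>. It is an \<open>F\<close>-equivariant automorphism and hence the identity by
  \<open>collapse_map_unique\<close>.\<close>

lemma twisted_aut_unique:
  assumes \<Gamma>: "\<Gamma> \<in> Trees F" "loopfree \<Gamma>" and \<psi>: "\<psi> \<in> carrier E"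
    and h: "twisted_aut \<Gamma> \<psi> h" and k: "twisted_aut \<Gamma> \<psi> k" and v: "v \<in> verts \<Gamma>"
  shows "h v = k v"
proof -
  interpret G: cocompact_tree F \<Gamma> by (rule cocompact_group.cocompact_treeI[OF cocompact_group_F \<Gamma>])
  let ?k = "inv_into (verts \<Gamma>) k"
  have kb: "bij_betw k (verts \<Gamma>) (verts \<Gamma>)" using k by (simp add: twisted_aut_def tree_iso_def)
  have "tree_iso \<Gamma> \<Gamma> (?k \<circ> h)"
    using tree_iso_comp[of \<Gamma> \<Gamma> h \<Gamma> ?k] tree_iso_inv[of \<Gamma> \<Gamma> k] h k by (simp add: twisted_aut_def)
  moreover have "equivariant F \<Gamma> \<Gamma> (?k \<circ> h)"
    unfolding equivariant_def
  proof (intro ballI)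
    fix x u assume x: "x \<in> carrier F" and u: "u \<in> verts \<Gamma>"
    have hu: "h u \<in> verts \<Gamma>" using twisted_aut_closed[OF h u] .
    then obtain w where w: "w \<in> verts \<Gamma>" "h u = k w" using kb by (auto simp: bij_betw_def)
    have kw: "?k (k w') = w'" if "w' \<in> verts \<Gamma>" for w' using kb that by (simp add: bij_betw_def)
    have "h (act \<Gamma> x u) = act \<Gamma> (c \<psi> x) (k w)" using h x u w by (simp add: twisted_aut_def)
    also have "\<dots> = k (act \<Gamma> x w)" using k x w by (simp add: twisted_aut_def)
    finally show "(?k \<circ> h) (act \<Gamma> x u) = act \<Gamma> x ((?k \<circ> h) u)"
      using kw w G.act_closed[OF x] by simp
  qed
  ultimately have 1: "collapse_map F \<Gamma> \<Gamma> (?k \<circ> h)" using collapse_map_iso(1) \<Gamma> by blast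
  have 2: "collapse_map F \<Gamma> \<Gamma> id"
    using collapse_map_iso(1)[OF \<Gamma>(1,1) _ _ \<Gamma>(2), of id] tree_iso_id[of \<Gamma> id \<Gamma>] by (simp add: equivariant_def)
  have "?k (h v) = v" using G.collapse_map_unique[OF 1 2 v] by simp
  then show ?thesis using kb twisted_aut_closed[OF h v] by (metis bij_betw_inv_into_right)
qed

lemma twisted_aut_comp:
  assumes h: "twisted_aut \<Gamma> \<psi> h" and k: "twisted_aut \<Gamma> \<phi> k" and c: "\<psi> \<in> carrier E" "\<phi> \<in> carrier E"
  shows "twisted_aut \<Gamma> (\<psi> \<otimes>\<^bsub>E\<^esub> \<phi>) (h \<circ> k)"
  using h k c tree_iso_comp[of \<Gamma> \<Gamma> k \<Gamma> h] twisted_aut_closed[OF k] conj_closed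
  by (simp add: twisted_aut_def conj_mult)

lemma twisted_aut_j:
  assumes \<Gamma>: "\<Gamma> \<in> Trees F" and y: "y \<in> carrier F"
  shows "twisted_aut \<Gamma> (j y) (act \<Gamma> y)"
proof -
  have ga: "group_action F (verts \<Gamma>) (act \<Gamma>)" using \<Gamma> by (simp add: Trees_def acts_simplicially_def)
  interpret G: action_on F "verts \<Gamma>" "act \<Gamma>" using ga by (simp add: action_on_def action_on_axioms_def F.is_group)
  have closed: "(act \<Gamma> x u, act \<Gamma> x v) \<in> arcs \<Gamma>" if "x \<in> carrier F" "(u, v) \<in> arcs \<Gamma>" for x u v
    using \<Gamma> that by (auto simp: Trees_def acts_simplicially_def)
  have "(u, v) \<in> arcs \<Gamma> \<longleftrightarrow> (act \<Gamma> y u, act \<Gamma> y v) \<in> arcs \<Gamma>" if "u \<in> verts \<Gamma>" "v \<in> verts \<Gamma>" for u v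
    using closed[OF y, of u v] closed[of "inv\<^bsub>F\<^esub> y" "act \<Gamma> y u" "act \<Gamma> y v"] y that by (auto simp: G.act_inv1)
  then have "tree_iso \<Gamma> \<Gamma> (act \<Gamma> y)"
    using G.bij_prop0[OF y] by (simp add: tree_iso_def Bij_def)
  moreover have "act \<Gamma> y (act \<Gamma> x v) = act \<Gamma> (c (j y) x) (act \<Gamma> y v)"
    if x: "x \<in> carrier F" and v: "v \<in> verts \<Gamma>" for x v
  proof -
    have "act \<Gamma> (c (j y) x) (act \<Gamma> y v) = act \<Gamma> (y \<otimes>\<^bsub>F\<^esub> x \<otimes>\<^bsub>F\<^esub> inv\<^bsub>F\<^esub> y \<otimes>\<^bsub>F\<^esub> y) v"
      using x y v by (simp add: conj_j G.act_mult)
    also have "y \<otimes>\<^bsub>F\<^esub> x \<otimes>\<^bsub>F\<^esub> inv\<^bsub>F\<^esub> y \<otimes>\<^bsub>F\<^esub> y = y \<otimes>\<^bsub>F\<^esub> x" using x y by (simp add: F.m_assoc)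
    finally show ?thesis using x y v by (simp add: G.act_mult)
  qed
  ultimately show ?thesis by (simp add: twisted_aut_def)
qed

lemma twisted_aut_extension:
  assumes \<Delta>: "\<Delta> \<in> Trees E" "loopfree \<Delta>" "extends \<Delta> \<Gamma>" and \<psi>: "\<psi> \<in> carrier E"
  shows "twisted_aut \<Gamma> \<psi> (act \<Delta> \<psi>)"
proof -
  interpret D: tree_action E \<Delta> by unfold_locales (rule \<Delta>(1,2))+
  have e: "verts \<Delta> = verts \<Gamma>" "arcs \<Delta> = arcs \<Gamma>" using \<Delta>(3) by (auto simp: extends_def)
  have "tree_iso \<Gamma> \<Gamma> (act \<Delta> \<psi>)"
    using D.bij_prop0[OF \<psi>] D.act_arcs_iff[OF \<psi>] e
    by (simp add: tree_iso_def Bij_def)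
  then show ?thesis using act_extension_conj[OF \<Delta> \<psi>] by (simp add: twisted_aut_def)
qed

text \<open>The lifts are chosen independently of each other. Uniqueness nevertheless forces the
  group law, because a product of lifts is twisted by the product, and it forces \<open>j x\<close>
  to act as \<open>x\<close> does.\<close>

lemma extension_exists:
  assumes \<Gamma>: "\<Gamma> \<in> Trees F" "loopfree \<Gamma>"
    and real: "\<And>\<psi>. \<psi> \<in> carrier E \<Longrightarrow> \<exists>h. twisted_aut \<Gamma> \<psi> h"
  obtains \<Delta> where "\<Delta> \<in> Trees E" "extends \<Delta> \<Gamma>"
proof -
  define h where "h \<psi> = (SOME h. twisted_aut \<Gamma> \<psi> h)" for \<psi>
  have h: "twisted_aut \<Gamma> \<psi> (h \<psi>)" if "\<psi> \<in> carrier E" for \<psi>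
    unfolding h_def by (rule someI_ex[OF real[OF that]])
  define \<Delta> :: "'e gtree" where
    "\<Delta> = \<lparr>verts = verts \<Gamma>, arcs = arcs \<Gamma>, act = (\<lambda>\<psi>. restrict (h \<psi>) (verts \<Gamma>))\<rparr>"
  have sel [simp]: "verts \<Delta> = verts \<Gamma>" "arcs \<Delta> = arcs \<Gamma>" by (simp_all add: \<Delta>_def)
  have act: "act \<Delta> \<psi> v = h \<psi> v" if "v \<in> verts \<Gamma>" for \<psi> v using that by (simp add: \<Delta>_def)
  have ext: "extends \<Delta> \<Gamma>"
    using twisted_aut_unique[OF \<Gamma> _ h twisted_aut_j[OF \<Gamma>(1)]] act by (simp add: extends_def)
  have "group_action E (verts \<Delta>) (act \<Delta>)"
  proof (rule group_actionI[OF E.is_group])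
    show "act \<Delta> \<psi> \<in> extensional (verts \<Delta>)" for \<psi> by (simp add: \<Delta>_def)
    show "act \<Delta> \<psi> v \<in> verts \<Delta>" if "\<psi> \<in> carrier E" "v \<in> verts \<Delta>" for \<psi> v
      using that twisted_aut_closed[OF h] act by simp
    have "twisted_aut \<Gamma> \<one>\<^bsub>E\<^esub> id"
      using tree_iso_id[of \<Gamma> id \<Gamma>] by (simp add: twisted_aut_def conj_one)
    then show "act \<Delta> \<one>\<^bsub>E\<^esub> v = v" if "v \<in> verts \<Delta>" for v
      using twisted_aut_unique[OF \<Gamma> _ h, of "\<one>\<^bsub>E\<^esub>" id v] that act by simp
    show "act \<Delta> (\<psi> \<otimes>\<^bsub>E\<^esub> \<phi>) v = act \<Delta> \<psi> (act \<Delta> \<phi> v)"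
      if c: "\<psi> \<in> carrier E" "\<phi> \<in> carrier E" and v: "v \<in> verts \<Delta>" for \<psi> \<phi> v
      using twisted_aut_unique[OF \<Gamma> _ h twisted_aut_comp[OF h h c]] c v act twisted_aut_closed[OF h]
      by simp
  qed
  moreover have "(act \<Delta> \<psi> u, act \<Delta> \<psi> v) \<in> arcs \<Delta>" if "\<psi> \<in> carrier E" "(u, v) \<in> arcs \<Delta>" for \<psi> u v
  proof -
    have "u \<in> verts \<Gamma>" "v \<in> verts \<Gamma>" using that Trees_arcs_sub[OF \<Gamma>(1)] by auto
    then show ?thesis using h[OF that(1)] that(2) act by (simp add: twisted_aut_def tree_iso_def)
  qed
  ultimately have "acts_simplicially E \<Delta>" by (auto simp: acts_simplicially_def)
  then show ?thesis using extension_in_Trees[OF \<Gamma>(1) ext] ext that by blast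
qed

lemma twisted_aut_transport:
  assumes h: "tree_iso \<Gamma> \<Gamma>' h" "equivariant F \<Gamma> \<Gamma>' h" and k: "twisted_aut \<Gamma> \<psi> k"
    and \<Gamma>: "\<Gamma> \<in> Trees F" and \<psi>: "\<psi> \<in> carrier E"
  shows "twisted_aut \<Gamma>' \<psi> (h \<circ> k \<circ> inv_into (verts \<Gamma>) h)"
proof -
  let ?i = "inv_into (verts \<Gamma>) h"
  note i = tree_iso_inv[OF h(1)]
  have cl: "act \<Gamma> x v \<in> verts \<Gamma>" if "x \<in> carrier F" "v \<in> verts \<Gamma>" for x v
    using Trees_act_closed[OF \<Gamma> that] .
  note ie = equivariant_inv[OF h cl]
  have "tree_iso \<Gamma>' \<Gamma>' (h \<circ> k \<circ> ?i)"
    using tree_iso_comp[OF i tree_iso_comp[OF _ h(1)]] k by (simp add: twisted_aut_def)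
  moreover have "?i v \<in> verts \<Gamma>" if "v \<in> verts \<Gamma>'" for v
    using i that by (auto simp: tree_iso_def bij_betw_def)
  ultimately show ?thesis
    using h(2) ie k conj_closed[OF \<psi>] twisted_aut_closed[OF k]
    by (simp add: twisted_aut_def equivariant_def)
qed

text \<open>A class contains all isomorphic \<open>F\<close>-trees, and the conditions defining the
  subcomplexes speak about each of them. The \<open>E\<close>-action is therefore transported along
  the isomorphism.\<close>

lemma class_of_restriction_extends:
  assumes \<Delta>: "\<Delta> \<in> Trees E" "loopfree \<Delta>" and \<Gamma>': "\<Gamma>' \<in> tree_class F (pullback j \<Delta>)"
  obtains \<Delta>' where "\<Delta>' \<in> tree_class E \<Delta>" "extends \<Delta>' \<Gamma>'"
proof -
  let ?\<Gamma> = "pullback j \<Delta>"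
  have \<Gamma>: "?\<Gamma> \<in> Trees F" using pullback_in_Trees[OF \<Delta>] .
  obtain h where h: "tree_iso ?\<Gamma> \<Gamma>' h" "equivariant F ?\<Gamma> \<Gamma>' h" and T': "\<Gamma>' \<in> Trees F"
    using \<Gamma>' by (auto simp: tree_class_def)
  have "loopfree ?\<Gamma>" using extends_loopfree[OF extends_pullback] \<Delta>(2) by blast
  then have lf': "loopfree \<Gamma>'" using tree_class_loopfree[OF \<Gamma>'] by blast
  have "\<exists>k. twisted_aut \<Gamma>' \<psi> k" if "\<psi> \<in> carrier E" for \<psi>
    using twisted_aut_transport[OF h twisted_aut_extension[OF \<Delta> extends_pullback that] \<Gamma> that] by blast
  then obtain \<Delta>' where \<Delta>': "\<Delta>' \<in> Trees E" "extends \<Delta>' \<Gamma>'"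
    using extension_exists[OF T' lf'] by blast
  then have "\<Delta>' \<in> tree_class E \<Delta>"
    using extension_class_iff[OF \<Delta> extends_pullback \<Delta>' \<Gamma> T'] \<Gamma>' by simp
  with \<Delta>'(2) that show ?thesis by blast
qed

end


section \<open>Forests in quotient graphs\<close>

abbreviation arc_orbit :: "('g, 'b) monoid_scheme \<Rightarrow> 'g gtree \<Rightarrow> nat \<times> nat \<Rightarrow> (nat \<times> nat) set" where
  "arc_orbit H \<Gamma> \<equiv> orbit H (act_arcs \<Gamma>)"

lemma darts_quotient: "darts (quotient_graph H \<Gamma>) = arc_orbit H \<Gamma> ` arcs \<Gamma>"
  by (auto simp: quotient_graph_def orbits_def)

lemma src_quotient: "src (quotient_graph H \<Gamma>) (arc_orbit H \<Gamma> (u, v)) = orbit H (act \<Gamma>) u"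
  by (force simp: quotient_graph_def orbit_def)

lemma rev_quotient: "rev_dart (quotient_graph H \<Gamma>) (arc_orbit H \<Gamma> (u, v)) = arc_orbit H \<Gamma> (v, u)"
  by (force simp: quotient_graph_def orbit_def)

lemma tgt_quotient: "tgt (quotient_graph H \<Gamma>) (arc_orbit H \<Gamma> (u, v)) = orbit H (act \<Gamma>) v"
  by (simp add: rev_quotient src_quotient)

lemma Trees_action_on: "\<lbrakk>group H; \<Gamma> \<in> Trees H\<rbrakk> \<Longrightarrow> action_on H (verts \<Gamma>) (act \<Gamma>)"
  by (simp add: action_on_def action_on_axioms_def Trees_def acts_simplicially_def)

lemma vertex_orbit_eq:
  assumes "group H" "\<Gamma> \<in> Trees H" "u \<in> verts \<Gamma>" "v \<in> verts \<Gamma>"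
  shows "orbit H (act \<Gamma>) u = orbit H (act \<Gamma>) v \<longleftrightarrow> (\<exists>x\<in>carrier H. v = act \<Gamma> x u)"
proof -
  interpret action_on H "verts \<Gamma>" "act \<Gamma>" by (rule Trees_action_on[OF assms(1,2)])
  have sub: "orbit H (act \<Gamma>) (act \<Gamma> x w) \<subseteq> orbit H (act \<Gamma>) w"
    if "x \<in> carrier H" "w \<in> verts \<Gamma>" for x w
  proof
    fix y assume "y \<in> orbit H (act \<Gamma>) (act \<Gamma> x w)"
    then obtain z where "z \<in> carrier H" "y = act \<Gamma> z (act \<Gamma> x w)" by (auto simp: orbit_def)
    then have "y = act \<Gamma> (z \<otimes>\<^bsub>H\<^esub> x) w" "z \<otimes>\<^bsub>H\<^esub> x \<in> carrier H" using that by (simp_all add: act_mult)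
    then show "y \<in> orbit H (act \<Gamma>) w" by (auto simp: orbit_def)
  qed
  show ?thesis
  proof
    assume "orbit H (act \<Gamma>) u = orbit H (act \<Gamma>) v"
    moreover have "v \<in> orbit H (act \<Gamma>) v" using orbit_refl assms by blast
    ultimately have "v \<in> orbit H (act \<Gamma>) u" by simp
    then show "\<exists>x\<in>carrier H. v = act \<Gamma> x u" by (auto simp: orbit_def)
  next
    assume "\<exists>x\<in>carrier H. v = act \<Gamma> x u"
    then obtain x where x: "x \<in> carrier H" "v = act \<Gamma> x u" by blast
    then have "u = act \<Gamma> (inv\<^bsub>H\<^esub> x) v" "inv\<^bsub>H\<^esub> x \<in> carrier H" using assms by (simp_all add: act_inv1)
    then show "orbit H (act \<Gamma>) u = orbit H (act \<Gamma>) v"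
      using sub[OF x(1) assms(3)] sub[of "inv\<^bsub>H\<^esub> x" v] x(2) assms(4) by auto
  qed
qed

lemma arc_orbit_eq:
  assumes "group H" "\<Gamma> \<in> Trees H" "a \<in> arcs \<Gamma>" "b \<in> arcs \<Gamma>"
  shows "arc_orbit H \<Gamma> a = arc_orbit H \<Gamma> b \<longleftrightarrow> (\<exists>x\<in>carrier H. b = act_arcs \<Gamma> x a)"
proof -
  interpret action_on H "verts \<Gamma>" "act \<Gamma>" by (rule Trees_action_on[OF assms(1,2)])
  have A: "fst e \<in> verts \<Gamma> \<and> snd e \<in> verts \<Gamma>" if "e \<in> arcs \<Gamma>" for e
    using Trees_arcs_sub[OF assms(2)] that by auto
  have sub: "arc_orbit H \<Gamma> (act_arcs \<Gamma> x e) \<subseteq> arc_orbit H \<Gamma> e"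
    if "x \<in> carrier H" "e \<in> arcs \<Gamma>" for x e
  proof
    fix y assume "y \<in> arc_orbit H \<Gamma> (act_arcs \<Gamma> x e)"
    then obtain z where z: "z \<in> carrier H" "y = act_arcs \<Gamma> z (act_arcs \<Gamma> x e)" by (auto simp: orbit_def)
    have "act_arcs \<Gamma> z (act_arcs \<Gamma> x e) = act_arcs \<Gamma> (z \<otimes>\<^bsub>H\<^esub> x) e"
      using A[OF that(2)] z(1) that(1) by (cases e) (simp add: act_mult)
    moreover have "z \<otimes>\<^bsub>H\<^esub> x \<in> carrier H" using that z by simp
    ultimately show "y \<in> arc_orbit H \<Gamma> e" using z(2) unfolding orbit_def by blast
  qed
  have self: "e \<in> arc_orbit H \<Gamma> e" if "e \<in> arcs \<Gamma>" for e
  proof -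
    have "e = act_arcs \<Gamma> \<one>\<^bsub>H\<^esub> e" using A[OF that] by (cases e) (simp add: act_one)
    then show ?thesis unfolding orbit_def using one_closed by blast
  qed
  show ?thesis
  proof
    assume "arc_orbit H \<Gamma> a = arc_orbit H \<Gamma> b"
    then have "b \<in> arc_orbit H \<Gamma> a" using self[OF assms(4)] by simp
    then show "\<exists>x\<in>carrier H. b = act_arcs \<Gamma> x a" by (auto simp: orbit_def)
  next
    assume "\<exists>x\<in>carrier H. b = act_arcs \<Gamma> x a"
    then obtain x where x: "x \<in> carrier H" "b = act_arcs \<Gamma> x a" by blast
    then have "a = act_arcs \<Gamma> (inv\<^bsub>H\<^esub> x) b" "inv\<^bsub>H\<^esub> x \<in> carrier H"
      using A[OF assms(3)] by (cases a, simp add: act_inv1, simp)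
    then show "arc_orbit H \<Gamma> a = arc_orbit H \<Gamma> b"
      using sub[OF x(1) assms(3)] sub[of "inv\<^bsub>H\<^esub> x" b] x(2) assms(4) by auto
  qed
qed

lemma arc_orbit_self:
  assumes "group H" "\<Gamma> \<in> Trees H" "e \<in> arcs \<Gamma>"
  shows "e \<in> arc_orbit H \<Gamma> e"
proof -
  obtain x where "x \<in> carrier H" "e = act_arcs \<Gamma> x e" using arc_orbit_eq[OF assms(1-3,3)] by blast
  then show ?thesis unfolding orbit_def by blast
qed

section \<open>Forests in the quotient by a free action\<close>

context normal_ext
begin

text \<open>Vertex stabilizers are finite subgroups of a torsion-free group.\<close>

lemma free_action:
  assumes \<Gamma>: "\<Gamma> \<in> Trees F" and x: "x \<in> carrier F" and v: "v \<in> verts \<Gamma>" "act \<Gamma> x v = v"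
  shows "x = \<one>\<^bsub>F\<^esub>"
proof -
  interpret action_on F "verts \<Gamma>" "act \<Gamma>" by (rule Trees_action_on[OF F.is_group \<Gamma>])
  have "subgroup (stabilizer F (act \<Gamma>) v) F" using stabilizer_subgroup v(1) .
  moreover have "finite (stabilizer F (act \<Gamma>) v)"
    using \<Gamma> v(1) by (simp add: Trees_def finite_stabilizers_def)
  ultimately have "stabilizer F (act \<Gamma>) v = {\<one>\<^bsub>F\<^esub>}"
    using torsion_free by (intro F.torsion_free_finite_subgroup) auto
  moreover have "x \<in> stabilizer F (act \<Gamma>) v" using x v by (simp add: stabilizer_def)
  ultimately show ?thesis by simp
qed

text \<open>A circuit in the quotient lifts dart by dart to a path in \<open>S\<close>. Its end is a
  translate of its origin, hence equal to it by \<open>triv\<close>, so the lift closes up to a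
  circuit in the tree.\<close>

lemma quotient_forest_if:
  assumes \<Gamma>: "\<Gamma> \<in> Trees F" and S: "S \<subseteq> arcs \<Gamma>" "invariant_arcs F \<Gamma> S" "\<And>u v. (u, v) \<in> S \<Longrightarrow> (v, u) \<in> S"
    and triv: "\<And>x v. \<lbrakk>x \<in> carrier F; v \<in> verts \<Gamma>; (v, act \<Gamma> x v) \<in> S\<^sup>*\<rbrakk> \<Longrightarrow> x = \<one>\<^bsub>F\<^esub>"
  shows "forest (quotient_graph F \<Gamma>) (arc_orbit F \<Gamma> ` S)"
proof -
  let ?X = "quotient_graph F \<Gamma>" and ?o = "arc_orbit F \<Gamma>"
  interpret action_on F "verts \<Gamma>" "act \<Gamma>" by (rule Trees_action_on[OF F.is_group \<Gamma>])
  have orb_S: "e \<in> S" if "e \<in> ?o s" "s \<in> S" for e s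
    using that S(2) by (cases s) (auto simp: orbit_def invariant_arcs_def)
  have orb_eq: "?o e = Q" if eQ: "e \<in> Q" "Q \<in> ?o ` S" for e Q
  proof -
    obtain s where s: "s \<in> S" "Q = ?o s" using eQ(2) by blast
    then have "e \<in> S" using orb_S[of e s] eQ(1) by simp
    moreover have "\<exists>x\<in>carrier F. e = act_arcs \<Gamma> x s" using eQ(1) s(2) by (auto simp: orbit_def)
    ultimately show ?thesis
      using arc_orbit_eq[OF F.is_group \<Gamma> subsetD[OF S(1) s(1)] subsetD[OF S(1)], of e] s(2) by simp
  qed
  have no_circuit: False if p: "set p \<subseteq> ?o ` S" "circuit ?X p" for p
  proof -
    let ?n = "length p"
    have n: "?n > 0" using p(2) by (simp add: circuit_def)
    have cond: "tgt ?X (p ! i) = src ?X (p ! (Suc i mod ?n))"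
        "p ! (Suc i mod ?n) \<noteq> rev_dart ?X (p ! i)" if "i < ?n" for i
      using p(2) that by (auto simp: circuit_def Let_def)
    have pS: "p ! (i mod ?n) \<in> ?o ` S" for i using p(1) n by (meson mod_less_divisor nth_mem subsetD)
    have src: "src ?X = image fst" and rev: "rev_dart ?X = image prod.swap" by (simp_all add: quotient_graph_def)
    have "\<exists>e. e \<in> p ! (0 mod ?n)" using pS[of 0] orb_eq arc_orbit_self[OF F.is_group \<Gamma>] S(1) by blast
    moreover have "\<exists>e'. e' \<in> p ! (Suc i mod ?n) \<and> fst e' = snd e" if "e \<in> p ! (i mod ?n)" for e i
    proof -
      have "snd e \<in> tgt ?X (p ! (i mod ?n))" unfolding src rev using that by (force simp: image_image)
      then have "snd e \<in> image fst (p ! (Suc i mod ?n))"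
        using cond(1)[of "i mod ?n"] n by (simp add: src mod_Suc_eq)
      then show ?thesis by force
    qed
    \<comment> \<open>The circuit is unwound into an infinite lift with indices modulo its length,
      so the step that wraps around needs no separate treatment here.\<close>
    ultimately obtain a where a: "\<And>i. a i \<in> p ! (i mod ?n)" "\<And>i. fst (a (Suc i)) = snd (a i)"
      using dependent_nat_choice[of "\<lambda>i e. e \<in> p ! (i mod ?n)" "\<lambda>i e e'. fst e' = snd e"] by blast
    have aS: "a i \<in> S" for i using a(1)[of i] pS[of i] orb_S by blast
    have ao: "p ! i = ?o (a i)" if "i < ?n" for i using orb_eq[OF a(1) pS, of i] that by simp
    define f where "f i = fst (a i)" for i
    have af: "a i = (f i, f (Suc i))" for i using a(2)[of i] by (simp add: f_def prod_eq_iff)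
    have fV: "f i \<in> verts \<Gamma>" for i using aS[of i] S(1) Trees_arcs_sub[OF \<Gamma>] by (auto simp: f_def)
    have path: "(f 0, f i) \<in> S\<^sup>*" for i
    proof (induction i)
      case (Suc i)
      then show ?case using aS[of i] af by (auto intro: rtrancl.rtrancl_into_rtrancl)
    qed simp
    have srcp: "src ?X (p ! i) = orbit F (act \<Gamma>) (f i)" if "i < ?n" for i
      using ao[OF that] af[of i] by (simp add: src_quotient)
    \<comment> \<open>After one full turn the lift lies over the initial dart again, which produces
      the translating element \<open>x\<close>.\<close>
    have "?o (a ?n) = ?o (a 0)" using orb_eq[OF a(1) pS, of ?n] orb_eq[OF a(1) pS, of 0] n by simp
    then have "orbit F (act \<Gamma>) (f ?n) = orbit F (act \<Gamma>) (f 0)" using src_quotient[of F \<Gamma>] af by metis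
    then obtain x where x: "x \<in> carrier F" "f ?n = act \<Gamma> x (f 0)"
      using vertex_orbit_eq[OF F.is_group \<Gamma> fV fV] by metis
    then have "x = \<one>\<^bsub>F\<^esub>" using triv[OF x(1) fV] path[of ?n] by metis
    then have fn: "f ?n = f 0" using x(2) act_one fV by simp
    let ?q = "map a [0..<?n]"
    have "circuit (tree_graph \<Gamma>) ?q"
      unfolding circuit_tree_graph
    proof (intro conjI allI impI)
      show "?q \<noteq> []" using n by auto
      have d: "distinct (map (src ?X) p)" using p(2) by (simp add: circuit_def)
      have "i = k" if "i < ?n" "k < ?n" "f i = f k" for i k
        using nth_eq_iff_index_eq[OF d, of i k] that srcp by simp
      then show "distinct (map fst ?q)" by (auto simp: distinct_map inj_on_def f_def)
      fix i assume i: "i < length ?q"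
      then have i': "i < ?n" by simp
      have m: "Suc i mod ?n < ?n" using n by simp
      have qi: "?q ! i = a i" "?q ! (Suc i mod length ?q) = a (Suc i mod ?n)" using i' m by simp_all
      show "snd (?q ! i) = fst (?q ! (Suc i mod length ?q))"
      proof (cases "Suc i = ?n")
        case True
        then show ?thesis unfolding qi using a(2)[of i] fn by (simp add: f_def)
      next
        case False
        then show ?thesis unfolding qi using a(2)[of i] i' by simp
      qed
      show "?q ! (Suc i mod length ?q) \<noteq> prod.swap (?q ! i)"
      proof
        assume "?q ! (Suc i mod length ?q) = prod.swap (?q ! i)"
        then have "a (Suc i mod ?n) = (f (Suc i), f i)" unfolding qi using af[of i] by simp
        then have "p ! (Suc i mod ?n) = rev_dart ?X (p ! i)"
          using ao[OF m] ao[OF i'] af[of i] by (simp add: rev_quotient)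
        then show False using cond(2)[OF i'] by simp
      qed
    qed
    moreover have "set ?q \<subseteq> arcs \<Gamma>" using aS S(1) by auto
    moreover have "forest (tree_graph \<Gamma>) (arcs \<Gamma>)" using \<Gamma> by (simp add: Trees_def simplicial_tree_def)
    ultimately show False by (auto simp: forest_def)
  qed
  have "rev_dart ?X ` (?o ` S) = ?o ` S"
  proof (rule subset_antisym; rule subsetI)
    fix Q assume "Q \<in> rev_dart ?X ` (?o ` S)"
    then obtain u v where "(u, v) \<in> S" "Q = rev_dart ?X (?o (u, v))" by auto
    then show "Q \<in> ?o ` S" using S(3) by (auto simp: rev_quotient)
  next
    fix Q assume "Q \<in> ?o ` S"
    then obtain u v where "(u, v) \<in> S" "Q = ?o (u, v)" by auto
    then have "?o (v, u) \<in> ?o ` S" "Q = rev_dart ?X (?o (v, u))" using S(3) by (auto simp: rev_quotient)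
    then show "Q \<in> rev_dart ?X ` (?o ` S)" by blast
  qed
  moreover have "?o ` S \<subseteq> darts ?X" using S(1) by (auto simp: darts_quotient)
  ultimately show ?thesis using no_circuit by (auto simp: forest_def)
qed

text \<open>A shortest path in \<open>S\<close> from a vertex to a different translate of it projects to a circuit.\<close>

lemma quotient_forest_only_if:
  assumes \<Gamma>: "\<Gamma> \<in> Trees F" and S: "S \<subseteq> arcs \<Gamma>" "invariant_arcs F \<Gamma> S"
    and forest: "forest (quotient_graph F \<Gamma>) (arc_orbit F \<Gamma> ` S)"
    and x: "x \<in> carrier F" and v: "v \<in> verts \<Gamma>" "(v, act \<Gamma> x v) \<in> S\<^sup>*"
  shows "x = \<one>\<^bsub>F\<^esub>"
proof (rule ccontr)
  let ?X = "quotient_graph F \<Gamma>" and ?o = "arc_orbit F \<Gamma>"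
  interpret action_on F "verts \<Gamma>" "act \<Gamma>" by (rule Trees_action_on[OF F.is_group \<Gamma>])
  assume "x \<noteq> \<one>\<^bsub>F\<^esub>"
  \<comment> \<open>The length is minimized over all nontrivial translations and all base vertices
    simultaneously.\<close>
  define P where "P k \<longleftrightarrow> (\<exists>x v. x \<in> carrier F \<and> x \<noteq> \<one>\<^bsub>F\<^esub> \<and> v \<in> verts \<Gamma> \<and> (v, act \<Gamma> x v) \<in> S ^^ k)" for k
  obtain k0 where "(v, act \<Gamma> x v) \<in> S ^^ k0" using rtrancl_imp_relpow[OF v(2)] by blast
  then have "P k0" using x v(1) \<open>x \<noteq> \<one>\<^bsub>F\<^esub>\<close> unfolding P_def by blast
  define k where "k = (LEAST k. P k)"
  have "P k" unfolding k_def by (rule LeastI[of P, OF \<open>P k0\<close>])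
  have min: "k \<le> l" if "P l" for l unfolding k_def using that by (rule Least_le)
  obtain y w where y: "y \<in> carrier F" "y \<noteq> \<one>\<^bsub>F\<^esub>" "w \<in> verts \<Gamma>" "(w, act \<Gamma> y w) \<in> S ^^ k"
    using \<open>P k\<close> unfolding P_def by blast
  obtain f where f: "f 0 = w" "f k = act \<Gamma> y w" "\<And>i. i < k \<Longrightarrow> (f i, f (Suc i)) \<in> S"
    using y(4) by (auto simp: relpow_fun_conv)
  have seg: "(f i, f (i + l)) \<in> S ^^ l" if "i + l \<le> k" for i l
  proof -
    have "\<forall>m<l. (f (i + m), f (i + Suc m)) \<in> S" using f(3) that by simp
    then show ?thesis unfolding relpow_fun_conv by (intro exI[of _ "\<lambda>m. f (i + m)"]) simp
  qed
  have free: "z = \<one>\<^bsub>F\<^esub>" if "z \<in> carrier F" "u \<in> verts \<Gamma>" "act \<Gamma> z u = u" for z u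
    using free_action[OF \<Gamma> that] .
  have k0: "k > 0"
  proof (rule ccontr)
    assume "\<not> k > 0"
    then have "act \<Gamma> y w = w" using f by simp
    then show False using free[OF y(1,3)] y(2) by simp
  qed
  have fV: "f i \<in> verts \<Gamma>" if "i \<le> k" for i
  proof (cases "i = k")
    case True
    then show ?thesis using f(2) act_closed y by simp
  next
    case False
    then show ?thesis using f(3)[of i] that S(1) Trees_arcs_sub[OF \<Gamma>] by auto
  qed
  \<comment> \<open>Two vertices of the minimal path lie in one orbit only if they are its ends. A
    trivial \<open>z\<close> would allow a piece to be cut out, and a nontrivial \<open>z\<close>
    would give a shorter path of the same kind.\<close>
  have star: "i = 0 \<and> l = k" if il: "i < l" "l \<le> k" "z \<in> carrier F" "f l = act \<Gamma> z (f i)" for i l z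
  proof (cases "z = \<one>\<^bsub>F\<^esub>")
    case True
    then have eq: "f l = f i" using il act_one[OF fV] by simp
    have "(f 0, f i) \<in> S ^^ i" "(f l, f k) \<in> S ^^ (k - l)" using seg[of 0 i] seg[of l "k - l"] il by auto
    then have "(f 0, f k) \<in> S ^^ (i + (k - l))" unfolding eq by (rule relpow_trans)
    then have "P (i + (k - l))" using y f unfolding P_def by auto
    then have "k \<le> i + (k - l)" by (rule min)
    then show ?thesis using il(1,2) by arith
  next
    case False
    have "(f i, act \<Gamma> z (f i)) \<in> S ^^ (l - i)" using seg[of i "l - i"] il by simp
    then have "P (l - i)" using False il fV[of i] unfolding P_def by (meson less_imp_le order_trans)
    then have "k \<le> l - i" by (rule min)
    then show ?thesis using il(1,2) by arith
  qed
  define p where "p = map (\<lambda>i. ?o (f i, f (Suc i))) [0..<k]"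
  have len: "length p = k" by (simp add: p_def)
  have pi: "p ! i = ?o (f i, f (Suc i))" if "i < k" for i using that by (simp add: p_def)
  have "circuit ?X p"
    unfolding circuit_def Let_def len
  proof (intro conjI allI impI)
    show "p \<noteq> []" using len k0 by auto
    have "i = l" if il: "i < k" "l < k" "orbit F (act \<Gamma>) (f i) = orbit F (act \<Gamma>) (f l)" for i l
    proof (rule ccontr)
      assume "i \<noteq> l"
      moreover have *: "False" if il': "i < l" "l < k" "orbit F (act \<Gamma>) (f i) = orbit F (act \<Gamma>) (f l)" for i l
      proof -
        obtain z where "z \<in> carrier F" "f l = act \<Gamma> z (f i)"
          using vertex_orbit_eq[OF F.is_group \<Gamma> fV fV, of i l] il' by auto
        then show False using star[of i l z] il' by simp
      qed
      ultimately show False using *[of i l] *[of l i] il by (metis linorder_neqE_nat)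
    qed
    then show "distinct (map (src ?X) p)"
      by (auto simp: p_def distinct_map inj_on_def src_quotient)
    fix i assume i: "i < k"
    have m: "Suc i mod k < k" using k0 by simp
    have fk: "orbit F (act \<Gamma>) (f k) = orbit F (act \<Gamma>) (f 0)"
      using vertex_orbit_eq[OF F.is_group \<Gamma> fV fV, of 0 k] y(1) f by auto
    show "tgt ?X (p ! i) = src ?X (p ! (Suc i mod k))"
      unfolding pi[OF i] pi[OF m] tgt_quotient src_quotient
      using i fk by (cases "Suc i = k") auto
    show "p ! (Suc i mod k) \<noteq> rev_dart ?X (p ! i)"
    proof
      assume "p ! (Suc i mod k) = rev_dart ?X (p ! i)"
      then have eq: "?o (f (Suc i), f i) = ?o (f (Suc i mod k), f (Suc (Suc i mod k)))"
        unfolding pi[OF i] pi[OF m] rev_quotient by simp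
      have "(f i, f (Suc i)) \<in> arcs \<Gamma>" using f(3)[OF i] S(1) by blast
      moreover have "prod.swap ` arcs \<Gamma> = arcs \<Gamma>"
        using \<Gamma> by (simp add: Trees_def simplicial_tree_def forest_def tree_graph_def)
      ultimately have a1: "(f (Suc i), f i) \<in> arcs \<Gamma>" by (metis image_eqI swap_simp)
      have a2: "(f (Suc i mod k), f (Suc (Suc i mod k))) \<in> arcs \<Gamma>" using f(3)[OF m] S(1) by blast
      obtain z where z: "z \<in> carrier F" "f (Suc i mod k) = act \<Gamma> z (f (Suc i))" "f (Suc (Suc i mod k)) = act \<Gamma> z (f i)"
        using arc_orbit_eq[OF F.is_group \<Gamma> a1 a2] eq by auto
      \<comment> \<open>The element \<open>z\<close> carries the reversed dart to the next one. At
        an inner turn it fixes a vertex and is trivial, so the path backtracks, against minimality.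
        At the closing turn it is the inverse of \<open>y\<close>.\<close>
      show False
      proof (cases "Suc i = k")
        case False
        then have si: "Suc i < k" using i by simp
        then have "z = \<one>\<^bsub>F\<^esub>" using z(2) free[OF z(1), of "f (Suc i)"] fV[of "Suc i"] by simp
        then have "f (Suc (Suc i)) = f i" using z(3) si act_one[OF fV, of i] i by simp
        moreover from this have "i = 0 \<and> Suc (Suc i) = k"
          using star[of i "Suc (Suc i)" "\<one>\<^bsub>F\<^esub>"] si act_one[OF fV, of i] by simp
        ultimately have "f k = f 0" by auto
        then have "act \<Gamma> y w = w" using f(1,2) by simp
        then show False using free[OF y(1,3)] y(2) by simp
      next
        case True
        have z0: "w = act \<Gamma> z (act \<Gamma> y w)" "f 1 = act \<Gamma> z (f i)" using z True f by auto
        have "act \<Gamma> (z \<otimes>\<^bsub>F\<^esub> y) w = w" using z(1) y(1,3) z0(1)[symmetric] by (simp add: act_mult)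
        then have "z \<otimes>\<^bsub>F\<^esub> y = \<one>\<^bsub>F\<^esub>" using free[of "z \<otimes>\<^bsub>F\<^esub> y" w] z(1) y(1,3) by simp
        then have zy: "z = inv\<^bsub>F\<^esub> y" using F.inv_equality[OF _ y(1) z(1)] by simp
        have f1: "f i = act \<Gamma> y (f 1)"
          using z0(2) act_inv2[OF y(1), of "f i"] fV[of i] i unfolding zy by simp
        show False
        proof (cases "i = 0")
          \<comment> \<open>The path is one edge, which \<open>y\<close> inverts. Then the square of
            \<open>y\<close> fixes a vertex, and torsion-freeness makes \<open>y\<close>
            trivial.\<close>
          case True
          then have "k = 1" using \<open>Suc i = k\<close> by simp
          then have "act \<Gamma> y (act \<Gamma> y w) = w" using f1[symmetric] f(1,2) True by simp
          then have "act \<Gamma> (y \<otimes>\<^bsub>F\<^esub> y) w = w" using y(1,3) by (simp add: act_mult)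
          then have "y \<otimes>\<^bsub>F\<^esub> y = \<one>\<^bsub>F\<^esub>" using free[of "y \<otimes>\<^bsub>F\<^esub> y" w] y by simp
          then have "y [^]\<^bsub>F\<^esub> (2::nat) = \<one>\<^bsub>F\<^esub>" using y(1) by (simp add: numeral_2_eq_2)
          then show False using torsion_free[of y 2] y by simp
        next
          case False
          show False
          proof (cases "i = 1")
            case True
            then have "act \<Gamma> y (f 1) = f 1" using f1[symmetric] by simp
            then have "y = \<one>\<^bsub>F\<^esub>" using free[OF y(1), of "f 1"] fV[of 1] i True by simp
            then show False using y(2) by simp
          next
            case False
            then have "1 < i" using \<open>i \<noteq> 0\<close> by simp
            then show False using star[of 1 i y] f1 y(1) i by simp
          qed
        qed
      qed
    qed
  qed
  moreover have "set p \<subseteq> ?o ` S" using f(3) by (auto simp: p_def)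
  ultimately show False using forest by (auto simp: forest_def)
qed

text \<open>The stabilizer in \<open>E\<close> of a component of \<open>S\<close> is finite iff its
  intersection with \<open>F\<close> is finite, by finite index, and iff that intersection is
  trivial, by torsion-freeness. Triviality is what the two forest lemmas test.\<close>

lemma collapsible_iff_quotient_forest:
  assumes \<Delta>: "\<Delta> \<in> Trees E" and ext: "extends \<Delta> \<Gamma>" and \<Gamma>: "\<Gamma> \<in> Trees F"
    and S: "S \<subseteq> arcs \<Gamma>" "invariant_arcs E \<Delta> S" "\<And>u v. (u, v) \<in> S \<Longrightarrow> (v, u) \<in> S"
  shows "collapsible E \<Delta> S \<longleftrightarrow> forest (quotient_graph F \<Gamma>) (arc_orbit F \<Gamma> ` S)"
proof -
  interpret D: action_on E "verts \<Delta>" "act \<Delta>" by (rule Trees_action_on[OF E.is_group \<Delta>])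
  have e: "verts \<Delta> = verts \<Gamma>" "arcs \<Delta> = arcs \<Gamma>"
    "\<And>x v. \<lbrakk>x \<in> carrier F; v \<in> verts \<Gamma>\<rbrakk> \<Longrightarrow> act \<Delta> (j x) v = act \<Gamma> x v"
    using ext by (auto simp: extends_def)
  have inv: "invariant_arcs F \<Gamma> S"
    unfolding invariant_arcs_def
  proof (intro ballI allI impI)
    fix x u v assume "x \<in> carrier F" "(u, v) \<in> S"
    moreover from this have "u \<in> verts \<Gamma>" "v \<in> verts \<Gamma>" using S(1) Trees_arcs_sub[OF \<Gamma>] by auto
    moreover have "(act \<Delta> (j x) u, act \<Delta> (j x) v) \<in> S"
      using S(2) \<open>(u, v) \<in> S\<close> j_closed[OF \<open>x \<in> carrier F\<close>] by (simp add: invariant_arcs_def)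
    ultimately show "(act \<Gamma> x u, act \<Gamma> x v) \<in> S" using e by simp
  qed
  have Einv: "(act \<Delta> \<psi> u, act \<Delta> \<psi> v) \<in> S\<^sup>*" if "\<psi> \<in> carrier E" "(u, v) \<in> S\<^sup>*" for \<psi> u v
    by (rule rtrancl_image[OF that(2)]) (use S(2) that(1) in \<open>auto simp: invariant_arcs_def\<close>)
  have sym: "(v, u) \<in> S\<^sup>*" if "(u, v) \<in> S\<^sup>*" for u v using rtrancl_sym_closed[OF S(3) that] .
  define K where "K v = {\<psi> \<in> carrier E. (v, act \<Delta> \<psi> v) \<in> S\<^sup>*}" for v
  have K_diff: "\<psi> \<otimes>\<^bsub>E\<^esub> inv\<^bsub>E\<^esub> \<phi> \<in> K v" if \<psi>: "\<psi> \<in> K v" and \<phi>: "\<phi> \<in> K v" and v: "v \<in> verts \<Delta>" for \<psi> \<phi> v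
  proof -
    have c: "\<psi> \<in> carrier E" "\<phi> \<in> carrier E" using \<psi> \<phi> by (auto simp: K_def)
    have "(act \<Delta> (inv\<^bsub>E\<^esub> \<phi>) v, act \<Delta> (inv\<^bsub>E\<^esub> \<phi>) (act \<Delta> \<phi> v)) \<in> S\<^sup>*"
      using Einv[of "inv\<^bsub>E\<^esub> \<phi>" v "act \<Delta> \<phi> v"] \<phi> c by (simp add: K_def)
    then have "(v, act \<Delta> (inv\<^bsub>E\<^esub> \<phi>) v) \<in> S\<^sup>*" using sym v c by (simp add: D.act_inv1)
    then have "(act \<Delta> \<psi> v, act \<Delta> \<psi> (act \<Delta> (inv\<^bsub>E\<^esub> \<phi>) v)) \<in> S\<^sup>*" using Einv c by blast
    moreover have "(v, act \<Delta> \<psi> v) \<in> S\<^sup>*" using \<psi> by (simp add: K_def)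
    ultimately have "(v, act \<Delta> (\<psi> \<otimes>\<^bsub>E\<^esub> inv\<^bsub>E\<^esub> \<phi>) v) \<in> S\<^sup>*"
      using c v by (auto simp: D.act_mult intro: rtrancl_trans)
    then show ?thesis using c by (simp add: K_def)
  qed
  have K_F: "{x \<in> carrier F. j x \<in> K v} = {x \<in> carrier F. (v, act \<Gamma> x v) \<in> S\<^sup>*}" if "v \<in> verts \<Gamma>" for v
    using e that by (auto simp: K_def)
  have fin_iff: "finite (K v) \<longleftrightarrow> (\<forall>x\<in>carrier F. (v, act \<Gamma> x v) \<in> S\<^sup>* \<longrightarrow> x = \<one>\<^bsub>F\<^esub>)"
    if v: "v \<in> verts \<Gamma>" for v
  proof
    assume "finite (K v)"
    then have "finite {x \<in> carrier F. j x \<in> K v}" by (rule finite_vimage)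
    moreover have "subgroup {x \<in> carrier F. j x \<in> K v} F"
    proof (rule F.subgroupI)
      have one: "\<one>\<^bsub>E\<^esub> \<in> K v" using v e D.act_one by (simp add: K_def)
      then show "{x \<in> carrier F. j x \<in> K v} \<noteq> {}" using j.hom_one F.one_closed by force
      have inv: "inv\<^bsub>E\<^esub> \<psi> \<in> K v" if "\<psi> \<in> K v" for \<psi>
        using K_diff[OF one that] v e that by (simp add: K_def)
      show "inv\<^bsub>F\<^esub> a \<in> {x \<in> carrier F. j x \<in> K v}" if "a \<in> {x \<in> carrier F. j x \<in> K v}" for a
        using that inv[of "j a"] by simp
      show "a \<otimes>\<^bsub>F\<^esub> b \<in> {x \<in> carrier F. j x \<in> K v}"
        if "a \<in> {x \<in> carrier F. j x \<in> K v}" "b \<in> {x \<in> carrier F. j x \<in> K v}" for a b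
        using that K_diff[of "j a" v "inv\<^bsub>E\<^esub> (j b)"] inv[of "j b"] v e by simp
    qed auto
    ultimately have "{x \<in> carrier F. j x \<in> K v} = {\<one>\<^bsub>F\<^esub>}"
      using torsion_free by (intro F.torsion_free_finite_subgroup) auto
    then show "\<forall>x\<in>carrier F. (v, act \<Gamma> x v) \<in> S\<^sup>* \<longrightarrow> x = \<one>\<^bsub>F\<^esub>" using K_F[OF v] by blast
  next
    assume "\<forall>x\<in>carrier F. (v, act \<Gamma> x v) \<in> S\<^sup>* \<longrightarrow> x = \<one>\<^bsub>F\<^esub>"
    then have "{x \<in> carrier F. j x \<in> K v} \<subseteq> {\<one>\<^bsub>F\<^esub>}" using K_F[OF v] by blast
    then have "finite {x \<in> carrier F. j x \<in> K v}" using finite_subset by blast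
    then show "finite (K v)"
      by (rule finite_if_finite_vimage[rotated 2]) (use K_diff v e in \<open>auto simp: K_def\<close>)
  qed
  have "collapsible E \<Delta> S \<longleftrightarrow> (\<forall>v\<in>verts \<Gamma>. finite (K v))"
    using S e by (auto simp: collapsible_def K_def)
  also have "\<dots> \<longleftrightarrow> (\<forall>v\<in>verts \<Gamma>. \<forall>x\<in>carrier F. (v, act \<Gamma> x v) \<in> S\<^sup>* \<longrightarrow> x = \<one>\<^bsub>F\<^esub>)"
    using fin_iff by simp
  also have "\<dots> \<longleftrightarrow> forest (quotient_graph F \<Gamma>) (arc_orbit F \<Gamma> ` S)"
    using quotient_forest_if[OF \<Gamma> S(1) inv S(3)] quotient_forest_only_if[OF \<Gamma> S(1) inv] by blast
  finally show ?thesis .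
qed

end


section \<open>Automorphisms and the normalizer\<close>

locale centerless_group = group F for F :: "('a, 'b) monoid_scheme" (structure) +
  assumes center_trivial: "\<lbrakk>x \<in> carrier F; \<And>y. y \<in> carrier F \<Longrightarrow> x \<otimes> y = y \<otimes> x\<rbrakk> \<Longrightarrow> x = \<one>"
begin

sublocale A: group "AutoGroup F" by (rule AutoGroup)

lemma carrier_AutoGroup [simp]: "carrier (AutoGroup F) = auto F"
  by (simp add: AutoGroup_def)

lemma auto_m_closed [simp]: "\<lbrakk>\<phi> \<in> auto F; \<psi> \<in> auto F\<rbrakk> \<Longrightarrow> \<phi> \<otimes>\<^bsub>AutoGroup F\<^esub> \<psi> \<in> auto F"
  using A.m_closed by simp

lemma auto_inv_closed [simp]: "\<phi> \<in> auto F \<Longrightarrow> inv\<^bsub>AutoGroup F\<^esub> \<phi> \<in> auto F"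
  using A.inv_closed by simp

lemma auto_one_closed [simp]: "\<one>\<^bsub>AutoGroup F\<^esub> \<in> auto F"
  using A.one_closed by simp

lemma autoD:
  assumes "\<phi> \<in> auto F"
  shows "x \<in> carrier F \<Longrightarrow> \<phi> x \<in> carrier F"
    and "\<lbrakk>x \<in> carrier F; y \<in> carrier F\<rbrakk> \<Longrightarrow> \<phi> (x \<otimes> y) = \<phi> x \<otimes> \<phi> y"
    and "bij_betw \<phi> (carrier F) (carrier F)"
    and "\<phi> \<in> extensional (carrier F)"
  using assms by (auto simp: auto_def hom_def Bij_def)

lemma auto_group_hom: "\<phi> \<in> auto F \<Longrightarrow> group_hom F F \<phi>"
  by (simp add: group_hom_def group_hom_axioms_def is_group auto_def)

lemma auto_mult: "\<lbrakk>\<phi> \<in> auto F; \<psi> \<in> auto F\<rbrakk> \<Longrightarrow> \<phi> \<otimes>\<^bsub>AutoGroup F\<^esub> \<psi> = compose (carrier F) \<phi> \<psi>"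
  by (simp add: AutoGroup_def BijGroup_def auto_def)

lemma auto_apply:
  "\<lbrakk>\<phi> \<in> auto F; \<psi> \<in> auto F; x \<in> carrier F\<rbrakk> \<Longrightarrow> (\<phi> \<otimes>\<^bsub>AutoGroup F\<^esub> \<psi>) x = \<phi> (\<psi> x)"
  by (simp add: auto_mult compose_def)

lemma auto_one_apply: "x \<in> carrier F \<Longrightarrow> \<one>\<^bsub>AutoGroup F\<^esub> x = x"
  by (simp add: AutoGroup_def BijGroup_def)

lemma auto_eqI:
  "\<lbrakk>\<phi> \<in> auto F; \<psi> \<in> auto F; \<And>x. x \<in> carrier F \<Longrightarrow> \<phi> x = \<psi> x\<rbrakk> \<Longrightarrow> \<phi> = \<psi>"
  using autoD(4) extensionalityI by blast

lemma inner_apply: "y \<in> carrier F \<Longrightarrow> inner F x y = x \<otimes> y \<otimes> inv x"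
  by (simp add: inner_def)

lemma inner_auto:
  assumes x: "x \<in> carrier F"
  shows "inner F x \<in> auto F"
proof -
  have "inner F x \<in> hom F F"
  proof (rule homI)
    fix y z assume yz: "y \<in> carrier F" "z \<in> carrier F"
    have "inv x \<otimes> (x \<otimes> (z \<otimes> inv x)) = z \<otimes> inv x" using x yz by (simp add: m_assoc[symmetric])
    then show "inner F x (y \<otimes> z) = inner F x y \<otimes> inner F x z"
      using x yz by (simp add: inner_apply m_assoc)
  qed (use x in \<open>simp add: inner_apply\<close>)
  moreover have "bij_betw (inner F x) (carrier F) (carrier F)"
    unfolding inner_def using conjugation_is_bij[OF x] by simp
  ultimately show ?thesis by (simp add: auto_def Bij_def inner_def)
qed

lemma inner_mult:
  assumes "x \<in> carrier F" "y \<in> carrier F"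
  shows "inner F (x \<otimes> y) = inner F x \<otimes>\<^bsub>AutoGroup F\<^esub> inner F y"
proof (rule auto_eqI)
  show "inner F x \<otimes>\<^bsub>AutoGroup F\<^esub> inner F y \<in> auto F"
    using A.m_closed inner_auto assms by simp
  show "inner F (x \<otimes> y) z = (inner F x \<otimes>\<^bsub>AutoGroup F\<^esub> inner F y) z" if "z \<in> carrier F" for z
    using assms that by (simp add: auto_apply inner_auto inner_apply inv_mult_group m_assoc)
qed (use inner_auto assms in simp)

lemma inner_hom: "inner F \<in> hom F (AutoGroup F)"
  using inner_auto inner_mult by (simp add: hom_def)

sublocale I: group_hom F "AutoGroup F" "inner F"
  by unfold_locales (rule inner_hom)

lemma auto_inner:
  assumes "\<phi> \<in> auto F" "x \<in> carrier F"
  shows "\<phi> \<otimes>\<^bsub>AutoGroup F\<^esub> inner F x = inner F (\<phi> x) \<otimes>\<^bsub>AutoGroup F\<^esub> \<phi>"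
proof (rule auto_eqI)
  interpret \<phi>: group_hom F F \<phi> by (rule auto_group_hom[OF assms(1)])
  show "(\<phi> \<otimes>\<^bsub>AutoGroup F\<^esub> inner F x) z = (inner F (\<phi> x) \<otimes>\<^bsub>AutoGroup F\<^esub> \<phi>) z" if "z \<in> carrier F" for z
    using assms that by (simp add: auto_apply inner_auto inner_apply)
  show "\<phi> \<otimes>\<^bsub>AutoGroup F\<^esub> inner F x \<in> auto F" "inner F (\<phi> x) \<otimes>\<^bsub>AutoGroup F\<^esub> \<phi> \<in> auto F"
    using A.m_closed assms inner_auto by simp_all
qed

lemma inner_inj: "inj_on (inner F) (carrier F)"
proof (rule I.inj_on_one_iff[THEN iffD2], intro allI impI)
  fix x assume x: "x \<in> carrier F" and e: "inner F x = \<one>\<^bsub>AutoGroup F\<^esub>"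
  show "x = \<one>"
  proof (rule center_trivial[OF x])
    fix y assume y: "y \<in> carrier F"
    have "x \<otimes> y \<otimes> inv x = y" using e y inner_apply auto_one_apply by metis
    then show "x \<otimes> y = y \<otimes> x" using x y by (metis inv_closed inv_inv inv_solve_right m_closed)
  qed
qed

lemma Inn_normal: "Inn F \<lhd> AutoGroup F"
proof (rule A.normal_inv_iff[THEN iffD2], intro conjI ballI)
  show "subgroup (Inn F) (AutoGroup F)" unfolding Inn_def by (rule I.img_is_subgroup)
  fix \<phi> h assume \<phi>: "\<phi> \<in> carrier (AutoGroup F)" and "h \<in> Inn F"
  then obtain x where x: "x \<in> carrier F" "h = inner F x" by (auto simp: Inn_def)
  have "\<phi> \<otimes>\<^bsub>AutoGroup F\<^esub> h \<otimes>\<^bsub>AutoGroup F\<^esub> inv\<^bsub>AutoGroup F\<^esub> \<phi> = inner F (\<phi> x)"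
    using \<phi> x auto_inner[of \<phi> x] inner_auto[of "\<phi> x"] autoD(1)[of \<phi> x] by (simp add: A.m_assoc)
  then show "\<phi> \<otimes>\<^bsub>AutoGroup F\<^esub> h \<otimes>\<^bsub>AutoGroup F\<^esub> inv\<^bsub>AutoGroup F\<^esub> \<phi> \<in> Inn F"
    using \<phi> x autoD(1) by (simp add: Inn_def)
qed

sublocale N: normal "Inn F" "AutoGroup F" by (rule Inn_normal)

sublocale Out: group "OutGroup F"
  unfolding OutGroup_def by (rule N.factorgroup_is_group)

lemma carrier_OutGroup: "carrier (OutGroup F) = out_class F ` auto F"
  by (simp add: OutGroup_def out_class_def carrier_FactGroup)

lemma out_class_mult:
  "\<lbrakk>\<phi> \<in> auto F; \<psi> \<in> auto F\<rbrakk>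
     \<Longrightarrow> out_class F (\<phi> \<otimes>\<^bsub>AutoGroup F\<^esub> \<psi>) = out_class F \<phi> \<otimes>\<^bsub>OutGroup F\<^esub> out_class F \<psi>"
  by (simp add: OutGroup_def out_class_def N.rcos_sum)

lemma out_class_group_hom: "group_hom (AutoGroup F) (OutGroup F) (out_class F)"
  by (simp add: group_hom_def group_hom_axioms_def A.is_group Out.is_group hom_def carrier_OutGroup
      out_class_mult Pi_def)

sublocale OC: group_hom "AutoGroup F" "OutGroup F" "out_class F" by (rule out_class_group_hom)

lemma one_OutGroup: "\<one>\<^bsub>OutGroup F\<^esub> = Inn F"
  by (simp add: OutGroup_def)

lemma out_class_iff: "\<lbrakk>\<phi> \<in> auto F; \<psi> \<in> auto F\<rbrakk> \<Longrightarrow>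
   \<psi> \<in> out_class F \<phi> \<longleftrightarrow> (\<exists>x\<in>carrier F. \<psi> = inner F x \<otimes>\<^bsub>AutoGroup F\<^esub> \<phi>)"
  by (auto simp: out_class_def r_coset_def Inn_def)

lemma out_class_self: "\<phi> \<in> auto F \<Longrightarrow> \<phi> \<in> out_class F \<phi>"
  using out_class_iff[of \<phi> \<phi>] by (auto intro!: bexI[of _ \<one>])

lemma out_class_subset: "\<phi> \<in> auto F \<Longrightarrow> out_class F \<phi> \<subseteq> auto F"
  using A.m_closed inner_auto by (auto simp: out_class_def r_coset_def Inn_def)

lemma out_class_eq: "\<lbrakk>\<phi> \<in> auto F; \<psi> \<in> out_class F \<phi>\<rbrakk> \<Longrightarrow> out_class F \<psi> = out_class F \<phi>"
  unfolding out_class_def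
  using A.repr_independence[of \<psi> "Inn F" \<phi>] N.is_subgroup by simp

lemma OutGroup_memD:
  assumes "\<nu> \<in> carrier (OutGroup F)" "\<phi> \<in> \<nu>"
  shows "\<phi> \<in> auto F" "out_class F \<phi> = \<nu>"
  using assms out_class_subset out_class_eq unfolding carrier_OutGroup by blast+

lemma OutGroup_nonempty: "\<nu> \<in> carrier (OutGroup F) \<Longrightarrow> \<exists>\<phi>. \<phi> \<in> \<nu>"
  using out_class_self unfolding carrier_OutGroup by blast

end

section \<open>The full preimage, its automorphisms and the exact sequence\<close>

locale outer_subgroup = centerless_group F for F :: "('a, 'b) monoid_scheme" (structure) +
  fixes G :: "('a \<Rightarrow> 'a) set set"
  assumes G: "subgroup G (OutGroup F)" and finite_G: "finite G"
begin

abbreviation "Au \<equiv> AutoGroup F"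

abbreviation "E \<equiv> full_preimage F G"

abbreviation "GG \<equiv> (OutGroup F)\<lparr>carrier := G\<rparr>"

lemma carrier_E: "carrier E = {\<phi> \<in> auto F. out_class F \<phi> \<in> G}"
  by (simp add: full_preimage_def)

lemma mult_E [simp]: "x \<otimes>\<^bsub>E\<^esub> y = x \<otimes>\<^bsub>Au\<^esub> y"
  by (simp add: full_preimage_def)

lemma one_E [simp]: "\<one>\<^bsub>E\<^esub> = \<one>\<^bsub>Au\<^esub>"
  by (simp add: full_preimage_def)

lemma subgroup_E: "subgroup (carrier E) Au"
proof (rule A.subgroupI)
  have "\<one>\<^bsub>Au\<^esub> \<in> carrier E" using subgroup.one_closed[OF G] by (simp add: carrier_E)
  then show "carrier E \<noteq> {}" by blast
qed (auto simp: carrier_E out_class_mult subgroup.m_closed[OF G] subgroup.m_inv_closed[OF G])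

lemma E_eq: "E = Au\<lparr>carrier := carrier E\<rparr>"
  by (simp add: full_preimage_def)

sublocale E: group E
  by (subst E_eq) (rule A.subgroup_imp_group[OF subgroup_E])

lemma E_auto: "\<phi> \<in> carrier E \<Longrightarrow> \<phi> \<in> auto F"
  by (simp add: carrier_E)

lemma inv_E: "\<phi> \<in> carrier E \<Longrightarrow> inv\<^bsub>E\<^esub> \<phi> = inv\<^bsub>Au\<^esub> \<phi>"
  by (subst E_eq) (rule A.m_inv_consistent[OF subgroup_E])

lemma G_carrier: "g \<in> G \<Longrightarrow> g \<in> carrier (OutGroup F)"
  using subgroup.subset[OF G] by blast

lemma G_memD: "\<lbrakk>g \<in> G; \<phi> \<in> g\<rbrakk> \<Longrightarrow> \<phi> \<in> carrier E \<and> out_class F \<phi> = g"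
  using OutGroup_memD[OF G_carrier] by (simp add: carrier_E)

lemma inner_E: "x \<in> carrier F \<Longrightarrow> inner F x \<in> carrier E"
proof -
  assume x: "x \<in> carrier F"
  then have "out_class F (inner F x) = \<one>\<^bsub>OutGroup F\<^esub>"
    unfolding one_OutGroup out_class_def
    using A.coset_join3[of "inner F x" "Inn F"] A.coset_join2[of "inner F x" "Inn F"] N.is_subgroup inner_auto
    by (simp add: Inn_def)
  then show ?thesis using subgroup.one_closed[OF G] inner_auto[OF x] by (simp add: carrier_E)
qed

lemma GG_group: "group GG"
  by (rule Out.subgroup_imp_group[OF G])

lemma E_group_hom_inner: "inner F \<in> hom F E"
  using inner_E inner_mult by (simp add: hom_def)

text \<open>The conjugating element need not belong to \<open>E\<close>. The restriction to
  \<open>carrier E\<close> is needed for membership in \<open>auto E\<close>, whose elements are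
  extensional.\<close>

definition conj_by :: "('a \<Rightarrow> 'a) \<Rightarrow> ('a \<Rightarrow> 'a) \<Rightarrow> 'a \<Rightarrow> 'a" where
  "conj_by \<phi> = (\<lambda>\<psi>\<in>carrier E. \<phi> \<otimes>\<^bsub>Au\<^esub> \<psi> \<otimes>\<^bsub>Au\<^esub> inv\<^bsub>Au\<^esub> \<phi>)"

abbreviation "NG \<equiv> normalizer (OutGroup F) G"

lemma NG_subgroup: "subgroup NG (OutGroup F)"
  by (rule Out.normalizer_imp_subgroup[OF subgroup.subset[OF G]])

lemma normalizer_iff:
  "\<nu> \<in> NG \<longleftrightarrow> \<nu> \<in> carrier (OutGroup F) \<and>
     (\<lambda>g. \<nu> \<otimes>\<^bsub>OutGroup F\<^esub> g \<otimes>\<^bsub>OutGroup F\<^esub> inv\<^bsub>OutGroup F\<^esub> \<nu>) ` G = G"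
proof -
  have "\<nu> <#\<^bsub>OutGroup F\<^esub> G #>\<^bsub>OutGroup F\<^esub> inv\<^bsub>OutGroup F\<^esub> \<nu> =
      (\<lambda>g. \<nu> \<otimes>\<^bsub>OutGroup F\<^esub> g \<otimes>\<^bsub>OutGroup F\<^esub> inv\<^bsub>OutGroup F\<^esub> \<nu>) ` G"
    by (auto simp: l_coset_def r_coset_def)
  then show ?thesis
    using subgroup.subset[OF G] by (simp add: normalizer_def stabilizer_def)
qed

lemma NG_conj: "\<lbrakk>\<nu> \<in> NG; g \<in> G\<rbrakk> \<Longrightarrow> \<nu> \<otimes>\<^bsub>OutGroup F\<^esub> g \<otimes>\<^bsub>OutGroup F\<^esub> inv\<^bsub>OutGroup F\<^esub> \<nu> \<in> G"
  unfolding normalizer_iff by blast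

lemma NG_carrier: "\<nu> \<in> NG \<Longrightarrow> \<nu> \<in> carrier (OutGroup F)"
  by (simp add: normalizer_iff)

lemma G_le_NG: "G \<subseteq> NG"
proof
  fix g assume g: "g \<in> G"
  have "(\<lambda>h. g \<otimes>\<^bsub>OutGroup F\<^esub> h \<otimes>\<^bsub>OutGroup F\<^esub> inv\<^bsub>OutGroup F\<^esub> g) ` G = G"
  proof (rule subset_antisym; rule subsetI)
    fix h assume h: "h \<in> G"
    let ?k = "inv\<^bsub>OutGroup F\<^esub> g \<otimes>\<^bsub>OutGroup F\<^esub> h \<otimes>\<^bsub>OutGroup F\<^esub> g"
    have "?k \<in> G" using g h by (intro subgroup.m_closed[OF G] subgroup.m_inv_closed[OF G])
    moreover have "h = g \<otimes>\<^bsub>OutGroup F\<^esub> ?k \<otimes>\<^bsub>OutGroup F\<^esub> inv\<^bsub>OutGroup F\<^esub> g"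
      using Out.conjugation_is_surj[of g h] G_carrier g h by simp
    ultimately show "h \<in> (\<lambda>h. g \<otimes>\<^bsub>OutGroup F\<^esub> h \<otimes>\<^bsub>OutGroup F\<^esub> inv\<^bsub>OutGroup F\<^esub> g) ` G" by blast
  qed (use g in \<open>auto intro!: subgroup.m_closed[OF G] subgroup.m_inv_closed[OF G]\<close>)
  then show "g \<in> NG" using G_carrier[OF g] by (simp add: normalizer_iff)
qed

lemma NG_auto: "\<lbrakk>\<nu> \<in> NG; \<phi> \<in> \<nu>\<rbrakk> \<Longrightarrow> \<phi> \<in> auto F \<and> out_class F \<phi> = \<nu>"
  using OutGroup_memD NG_carrier by blast

lemma conj_E:
  assumes "\<phi> \<in> auto F" "out_class F \<phi> \<in> NG" "\<psi> \<in> carrier E"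
  shows "\<phi> \<otimes>\<^bsub>Au\<^esub> \<psi> \<otimes>\<^bsub>Au\<^esub> inv\<^bsub>Au\<^esub> \<phi> \<in> carrier E"
proof -
  have c: "\<phi> \<in> carrier Au" "\<psi> \<in> carrier Au" using assms E_auto by auto
  have "out_class F (\<phi> \<otimes>\<^bsub>Au\<^esub> \<psi> \<otimes>\<^bsub>Au\<^esub> inv\<^bsub>Au\<^esub> \<phi>) =
      out_class F \<phi> \<otimes>\<^bsub>OutGroup F\<^esub> out_class F \<psi> \<otimes>\<^bsub>OutGroup F\<^esub> inv\<^bsub>OutGroup F\<^esub> out_class F \<phi>"
    using c by simp
  also have "\<dots> \<in> G" using NG_conj[OF assms(2)] assms(3) by (simp add: carrier_E)
  finally show ?thesis using c A.m_closed A.inv_closed by (simp add: carrier_E)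
qed

lemma inv_NG: "\<lbrakk>\<phi> \<in> auto F; out_class F \<phi> \<in> NG\<rbrakk> \<Longrightarrow> inv\<^bsub>Au\<^esub> \<phi> \<in> auto F \<and> out_class F (inv\<^bsub>Au\<^esub> \<phi>) \<in> NG"
  using A.inv_closed[of \<phi>] subgroup.m_inv_closed[OF NG_subgroup] OC.hom_inv[of \<phi>] by simp

lemma auto_conj_by:
  assumes \<phi>: "\<phi> \<in> auto F" "out_class F \<phi> \<in> NG"
  shows "conj_by \<phi> \<in> auto E"
proof -
  note i = inv_NG[OF \<phi>]
  have c: "\<phi> \<in> carrier Au" "inv\<^bsub>Au\<^esub> \<phi> \<in> carrier Au" using \<phi> A.inv_closed by auto
  have "conj_by \<phi> \<in> hom E E"
  proof (rule homI)
    fix \<psi> \<chi> assume h: "\<psi> \<in> carrier E" "\<chi> \<in> carrier E"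
    then have hc: "\<psi> \<in> carrier Au" "\<chi> \<in> carrier Au" using E_auto by auto
    have "inv\<^bsub>Au\<^esub> \<phi> \<otimes>\<^bsub>Au\<^esub> (\<phi> \<otimes>\<^bsub>Au\<^esub> (\<chi> \<otimes>\<^bsub>Au\<^esub> inv\<^bsub>Au\<^esub> \<phi>)) = \<chi> \<otimes>\<^bsub>Au\<^esub> inv\<^bsub>Au\<^esub> \<phi>"
      using hc c by (simp add: A.m_assoc[symmetric] del: carrier_AutoGroup)
    then show "conj_by \<phi> (\<psi> \<otimes>\<^bsub>E\<^esub> \<chi>) = conj_by \<phi> \<psi> \<otimes>\<^bsub>E\<^esub> conj_by \<phi> \<chi>"
      using h hc c E.m_closed[OF h] by (simp add: conj_by_def A.m_assoc del: carrier_AutoGroup)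
  qed (use conj_E[OF \<phi>] in \<open>simp add: conj_by_def\<close>)
  moreover have "bij_betw (conj_by \<phi>) (carrier E) (carrier E)"
  proof (rule bij_betw_byWitness[where f' = "conj_by (inv\<^bsub>Au\<^esub> \<phi>)"])
    have *: "conj_by (inv\<^bsub>Au\<^esub> \<phi>) (conj_by \<phi> \<psi>) = \<psi>"
      if \<phi>: "\<phi> \<in> auto F" "out_class F \<phi> \<in> NG" and \<psi>: "\<psi> \<in> carrier E" for \<phi> \<psi>
    proof -
      have c: "\<phi> \<in> carrier Au" "\<psi> \<in> carrier Au" using \<phi> E_auto[OF \<psi>] by auto
      then have "inv\<^bsub>Au\<^esub> \<phi> \<otimes>\<^bsub>Au\<^esub> (\<phi> \<otimes>\<^bsub>Au\<^esub> \<psi> \<otimes>\<^bsub>Au\<^esub> inv\<^bsub>Au\<^esub> \<phi>) \<otimes>\<^bsub>Au\<^esub> inv\<^bsub>Au\<^esub> (inv\<^bsub>Au\<^esub> \<phi>) = \<psi>"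
        by (simp add: A.m_assoc[symmetric] del: carrier_AutoGroup) (simp add: A.m_assoc del: carrier_AutoGroup)
      then show ?thesis using conj_E[OF \<phi> \<psi>] \<psi> by (simp add: conj_by_def)
    qed
    show "\<forall>\<psi>\<in>carrier E. conj_by (inv\<^bsub>Au\<^esub> \<phi>) (conj_by \<phi> \<psi>) = \<psi>" using *[OF \<phi>] by blast
    show "\<forall>\<psi>\<in>carrier E. conj_by \<phi> (conj_by (inv\<^bsub>Au\<^esub> \<phi>) \<psi>) = \<psi>"
      using *[of "inv\<^bsub>Au\<^esub> \<phi>"] i c(1) by simp
    show "conj_by \<phi> ` carrier E \<subseteq> carrier E" "conj_by (inv\<^bsub>Au\<^esub> \<phi>) ` carrier E \<subseteq> carrier E"
      using conj_E[OF \<phi>] conj_E[of "inv\<^bsub>Au\<^esub> \<phi>"] i by (auto simp: conj_by_def)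
  qed
  ultimately show ?thesis by (simp add: auto_def Bij_def conj_by_def)
qed

lemma conj_by_inner:
  assumes "\<phi> \<in> auto F" "x \<in> carrier F"
  shows "conj_by \<phi> (inner F x) = inner F (\<phi> x)"
  using assms inner_E auto_inner[OF assms] inner_auto[of "\<phi> x"] autoD(1)[OF assms]
  by (simp add: conj_by_def A.m_assoc)

lemma conj_by_Inn: "\<phi> \<in> auto F \<Longrightarrow> conj_by \<phi> ` Inn F = Inn F"
proof -
  assume \<phi>: "\<phi> \<in> auto F"
  have "conj_by \<phi> ` Inn F = inner F ` (\<phi> ` carrier F)"
    unfolding Inn_def image_image using conj_by_inner[OF \<phi>] by (intro image_cong) auto
  then show ?thesis using autoD(3)[OF \<phi>] by (simp add: Inn_def bij_betw_def)
qed

text \<open>An automorphism commuting with all inner automorphisms is trivial; this recovers an element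
  of \<open>Aut(F)\<close> from the conjugation it induces.\<close>

lemma auto_eq_if_conj_inner_eq:
  assumes "\<phi> \<in> auto F" "\<psi> \<in> auto F"
    and "\<And>x. x \<in> carrier F \<Longrightarrow> conj_by \<phi> (inner F x) = conj_by \<psi> (inner F x)"
  shows "\<phi> = \<psi>"
proof (rule auto_eqI[OF assms(1,2)])
  fix x assume x: "x \<in> carrier F"
  have "inner F (\<phi> x) = inner F (\<psi> x)" using assms(3)[OF x] conj_by_inner assms(1,2) x by simp
  then show "\<phi> x = \<psi> x"
    by (rule inj_onD[OF inner_inj _ autoD(1)[OF assms(1) x] autoD(1)[OF assms(2) x]])
qed

text \<open>An element of \<open>E\<close> that commutes with all inner automorphisms is the
  identity, since \<open>F\<close> has trivial centre. Thus the facts on inner automorphisms and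
  outer classes are available for \<open>E\<close> as well.\<close>

lemma centerless_E: "centerless_group E"
proof -
  have "\<phi> = \<one>\<^bsub>E\<^esub>" if \<phi>: "\<phi> \<in> carrier E"
    and c: "\<And>\<psi>. \<psi> \<in> carrier E \<Longrightarrow> \<phi> \<otimes>\<^bsub>E\<^esub> \<psi> = \<psi> \<otimes>\<^bsub>E\<^esub> \<phi>" for \<phi>
    unfolding one_E
  proof (rule auto_eq_if_conj_inner_eq)
    show "\<phi> \<in> auto F" "\<one>\<^bsub>Au\<^esub> \<in> auto F" using E_auto[OF \<phi>] A.one_closed by auto
    fix x assume x: "x \<in> carrier F"
    have "\<phi> \<otimes>\<^bsub>Au\<^esub> inner F x \<otimes>\<^bsub>Au\<^esub> inv\<^bsub>Au\<^esub> \<phi> = inner F x"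
      using c[OF inner_E[OF x]] E_auto[OF \<phi>] inner_auto[OF x] by (simp add: A.m_assoc)
    then show "conj_by \<phi> (inner F x) = conj_by \<one>\<^bsub>Au\<^esub> (inner F x)"
      using inner_E[OF x] inner_auto[OF x] by (simp add: conj_by_def)
  qed
  then show ?thesis by (simp add: centerless_group_def centerless_group_axioms_def E.is_group)
qed

sublocale EE: centerless_group E by (rule centerless_E)

lemma conj_by_mult:
  assumes \<phi>: "\<phi> \<in> auto F" "out_class F \<phi> \<in> NG" and \<psi>: "\<psi> \<in> auto F" "out_class F \<psi> \<in> NG"
  shows "conj_by (\<phi> \<otimes>\<^bsub>Au\<^esub> \<psi>) = conj_by \<phi> \<otimes>\<^bsub>AutoGroup E\<^esub> conj_by \<psi>"
proof (rule EE.auto_eqI)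
  have c: "\<phi> \<in> carrier Au" "\<psi> \<in> carrier Au" using \<phi> \<psi> by auto
  have "\<phi> \<otimes>\<^bsub>Au\<^esub> \<psi> \<in> auto F" using A.m_closed[OF c] by simp
  moreover have "out_class F (\<phi> \<otimes>\<^bsub>Au\<^esub> \<psi>) \<in> NG"
    using \<phi> \<psi> subgroup.m_closed[OF NG_subgroup] by (simp add: out_class_mult)
  ultimately show "conj_by (\<phi> \<otimes>\<^bsub>Au\<^esub> \<psi>) \<in> auto E" by (rule auto_conj_by)
  show "conj_by \<phi> \<otimes>\<^bsub>AutoGroup E\<^esub> conj_by \<psi> \<in> auto E"
    using EE.A.m_closed auto_conj_by[OF \<phi>] auto_conj_by[OF \<psi>] by simp
  fix \<chi> assume \<chi>: "\<chi> \<in> carrier E"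
  then have "\<chi> \<in> carrier Au" using E_auto by simp
  then show "conj_by (\<phi> \<otimes>\<^bsub>Au\<^esub> \<psi>) \<chi> = (conj_by \<phi> \<otimes>\<^bsub>AutoGroup E\<^esub> conj_by \<psi>) \<chi>"
    using c \<chi> conj_E[OF \<psi> \<chi>] auto_conj_by[OF \<phi>] auto_conj_by[OF \<psi>]
    by (simp add: EE.auto_apply conj_by_def A.inv_mult_group A.m_assoc del: carrier_AutoGroup)
qed

lemma conj_by_E: "\<phi> \<in> carrier E \<Longrightarrow> conj_by \<phi> = inner E \<phi>"
  by (simp add: conj_by_def inner_def inv_E)

lemma Aut0_subgroup: "subgroup (Aut0 E (Inn F)) (AutoGroup E)"
proof (rule EE.A.subgroupI)
  have I_E: "Inn F \<subseteq> carrier E" using inner_E by (auto simp: Inn_def)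
  show "Aut0 E (Inn F) \<noteq> {}"
  proof -
    have "\<one>\<^bsub>AutoGroup E\<^esub> ` Inn F = Inn F"
      using EE.auto_one_apply I_E by (auto simp: image_iff subset_iff)
    then have "\<one>\<^bsub>AutoGroup E\<^esub> \<in> Aut0 E (Inn F)" using EE.A.one_closed by (simp add: Aut0_def)
    then show ?thesis by blast
  qed
  show "inv\<^bsub>AutoGroup E\<^esub> \<theta> \<in> Aut0 E (Inn F)" if "\<theta> \<in> Aut0 E (Inn F)" for \<theta>
  proof -
    have \<theta>: "\<theta> \<in> auto E" "\<theta> ` Inn F = Inn F" using that by (auto simp: Aut0_def)
    have i: "inv\<^bsub>AutoGroup E\<^esub> \<theta> \<in> auto E" using EE.A.inv_closed[of \<theta>] \<theta> by simp
    have "(inv\<^bsub>AutoGroup E\<^esub> \<theta>) (\<theta> \<psi>) = \<psi>" if "\<psi> \<in> carrier E" for \<psi>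
      using EE.auto_apply[OF i \<theta>(1) that] EE.A.l_inv[of \<theta>] \<theta> EE.auto_one_apply[OF that] by simp
    then have "(inv\<^bsub>AutoGroup E\<^esub> \<theta>) ` (\<theta> ` Inn F) = (\<lambda>\<psi>. \<psi>) ` Inn F"
      unfolding image_image using I_E by (intro image_cong) auto
    then show ?thesis using i \<theta> by (simp add: Aut0_def)
  qed
  show "\<theta> \<otimes>\<^bsub>AutoGroup E\<^esub> \<eta> \<in> Aut0 E (Inn F)" if "\<theta> \<in> Aut0 E (Inn F)" "\<eta> \<in> Aut0 E (Inn F)" for \<theta> \<eta>
  proof -
    have t: "\<theta> \<in> auto E" "\<eta> \<in> auto E" "\<theta> ` Inn F = Inn F" "\<eta> ` Inn F = Inn F" using that by (auto simp: Aut0_def)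
    have "(\<theta> \<otimes>\<^bsub>AutoGroup E\<^esub> \<eta>) ` Inn F = \<theta> ` (\<eta> ` Inn F)"
      unfolding image_image using EE.auto_apply t I_E by (intro image_cong) auto
    then show ?thesis using t EE.A.m_closed[of \<theta> \<eta>] by (simp add: Aut0_def)
  qed
qed (auto simp: Aut0_def)

lemma Out0_subgroup: "subgroup (out_class E ` Aut0 E (Inn F)) (OutGroup E)"
  by (rule EE.OC.subgroup_img_is_subgroup[OF Aut0_subgroup])

definition normalizer_map :: "('a \<Rightarrow> 'a) set \<Rightarrow> (('a \<Rightarrow> 'a) \<Rightarrow> 'a \<Rightarrow> 'a) set" where
  "normalizer_map \<nu> = out_class E (conj_by (SOME \<phi>. \<phi> \<in> \<nu>))"

text \<open>Two representatives of \<open>\<nu>\<close> differ by an inner automorphism of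
  \<open>F\<close>. It lies in \<open>E\<close>, so the two conjugations differ by an inner
  automorphism of \<open>E\<close>.\<close>

lemma normalizer_map_eq:
  assumes \<nu>: "\<nu> \<in> NG" and \<phi>: "\<phi> \<in> \<nu>"
  shows "normalizer_map \<nu> = out_class E (conj_by \<phi>)"
proof -
  let ?\<psi> = "SOME \<phi>. \<phi> \<in> \<nu>"
  have \<psi>: "?\<psi> \<in> \<nu>" by (rule someI[of "\<lambda>\<phi>. \<phi> \<in> \<nu>", OF \<phi>])
  note a = NG_auto[OF \<nu> \<phi>] and b = NG_auto[OF \<nu> \<psi>]
  obtain x where x: "x \<in> carrier F" "?\<psi> = inner F x \<otimes>\<^bsub>Au\<^esub> \<phi>"
    using out_class_iff[of \<phi> ?\<psi>] a b \<psi> by auto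
  have ix: "inner F x \<in> auto F" "out_class F (inner F x) \<in> NG"
    using inner_auto inner_E G_le_NG x(1) by (auto simp: carrier_E)
  have "conj_by ?\<psi> = inner E (inner F x) \<otimes>\<^bsub>AutoGroup E\<^esub> conj_by \<phi>"
    unfolding x(2) using conj_by_mult[OF ix, of \<phi>] a \<nu> conj_by_E[OF inner_E[OF x(1)]] by simp
  moreover have "inner E (inner F x) \<otimes>\<^bsub>AutoGroup E\<^esub> conj_by \<phi> \<in> auto E"
    using EE.A.m_closed EE.inner_auto[OF inner_E[OF x(1)]] auto_conj_by[of \<phi>] a \<nu> by simp
  ultimately have "conj_by ?\<psi> \<in> out_class E (conj_by \<phi>)"
    using EE.out_class_iff[of "conj_by \<phi>"] auto_conj_by[of \<phi>] a \<nu> inner_E[OF x(1)] by auto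
  then show ?thesis unfolding normalizer_map_def
    using EE.out_class_eq auto_conj_by[of \<phi>] a \<nu> by simp
qed

lemma short_exact_normalizer:
  "short_exact GG (\<lambda>g. g) ((OutGroup F)\<lparr>carrier := NG\<rparr>) normalizer_map (Out0 E (Inn F))"
  unfolding short_exact_def
proof (intro conjI)
  let ?NG = "(OutGroup F)\<lparr>carrier := NG\<rparr>" and ?O = "Out0 E (Inn F)"
  have NGg: "group ?NG" by (rule Out.subgroup_imp_group[OF NG_subgroup])
  have Og: "group ?O" unfolding Out0_def by (rule EE.Out.subgroup_imp_group[OF Out0_subgroup])
  have O_one: "\<one>\<^bsub>?O\<^esub> = Inn E" by (simp add: Out0_def EE.one_OutGroup)
  have Aut0: "conj_by \<phi> \<in> Aut0 E (Inn F)" if "\<nu> \<in> NG" "\<phi> \<in> \<nu>" for \<nu> \<phi>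
    using auto_conj_by conj_by_Inn NG_auto[OF that] that(1) by (simp add: Aut0_def)
  show "group_hom GG ?NG (\<lambda>g. g)"
    using GG_group NGg G_le_NG by (auto simp: group_hom_def group_hom_axioms_def hom_def)
  show "group_hom ?NG ?O normalizer_map"
    unfolding group_hom_def group_hom_axioms_def
  proof (intro conjI NGg Og homI)
    show "normalizer_map \<nu> \<in> carrier ?O" if "\<nu> \<in> carrier ?NG" for \<nu>
    proof -
      have \<nu>: "\<nu> \<in> NG" using that by simp
      obtain \<phi> where "\<phi> \<in> \<nu>" using OutGroup_nonempty NG_carrier[OF \<nu>] by blast
      then show ?thesis using normalizer_map_eq[OF \<nu>] Aut0[OF \<nu>] by (simp add: Out0_def)
    qed
    show "normalizer_map (\<nu> \<otimes>\<^bsub>?NG\<^esub> \<mu>) = normalizer_map \<nu> \<otimes>\<^bsub>?O\<^esub> normalizer_map \<mu>"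
      if "\<nu> \<in> carrier ?NG" "\<mu> \<in> carrier ?NG" for \<nu> \<mu>
    proof -
      have n: "\<nu> \<in> NG" "\<mu> \<in> NG" using that by simp_all
      obtain \<phi> \<psi> where p: "\<phi> \<in> \<nu>" "\<psi> \<in> \<mu>"
        using OutGroup_nonempty[OF NG_carrier[OF n(1)]] OutGroup_nonempty[OF NG_carrier[OF n(2)]] by blast
      note a = NG_auto[OF n(1) p(1)] and b = NG_auto[OF n(2) p(2)]
      have m: "\<phi> \<otimes>\<^bsub>Au\<^esub> \<psi> \<in> auto F" using A.m_closed[of \<phi> \<psi>] a b by simp
      have eq: "out_class F (\<phi> \<otimes>\<^bsub>Au\<^esub> \<psi>) = \<nu> \<otimes>\<^bsub>OutGroup F\<^esub> \<mu>" using a b by (simp add: out_class_mult)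
      have "\<nu> \<otimes>\<^bsub>OutGroup F\<^esub> \<mu> \<in> NG" using n by (rule subgroup.m_closed[OF NG_subgroup])
      then have "normalizer_map (\<nu> \<otimes>\<^bsub>OutGroup F\<^esub> \<mu>) = out_class E (conj_by (\<phi> \<otimes>\<^bsub>Au\<^esub> \<psi>))"
        using normalizer_map_eq out_class_self[OF m] eq by simp
      also have "\<dots> = out_class E (conj_by \<phi>) \<otimes>\<^bsub>OutGroup E\<^esub> out_class E (conj_by \<psi>)"
        using conj_by_mult[of \<phi> \<psi>] a b n auto_conj_by[of \<phi>] auto_conj_by[of \<psi>] by (simp add: EE.out_class_mult)
      finally show ?thesis using normalizer_map_eq n p by (simp add: Out0_def)
    qed
  qed
  show "inj_on (\<lambda>g. g) (carrier GG)" by simp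
  show "normalizer_map ` carrier ?NG = carrier ?O"
  proof (rule subset_antisym; rule subsetI)
    fix X assume "X \<in> normalizer_map ` carrier ?NG"
    then obtain \<nu> where \<nu>: "\<nu> \<in> NG" "X = normalizer_map \<nu>" by auto
    obtain \<phi> where "\<phi> \<in> \<nu>" using OutGroup_nonempty NG_carrier[OF \<nu>(1)] by blast
    then show "X \<in> carrier ?O" using normalizer_map_eq[OF \<nu>(1)] Aut0[OF \<nu>(1)] \<nu>(2) by (simp add: Out0_def)
  next
    fix X assume "X \<in> carrier ?O"
    then obtain \<theta> where \<theta>: "\<theta> \<in> auto E" "\<theta> ` Inn F = Inn F" "X = out_class E \<theta>"
      by (auto simp: Out0_def Aut0_def)
    interpret \<theta>: group_hom E E \<theta> by (rule EE.auto_group_hom[OF \<theta>(1)])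
    have \<theta>_inj: "inj_on \<theta> (carrier E)" using EE.autoD(3)[OF \<theta>(1)] by (simp add: bij_betw_def)
    \<comment> \<open>The restriction of \<open>\<theta>\<close> to \<open>Inn F\<close>, read on
      \<open>F\<close> through the injective map \<open>inner F\<close>.\<close>
    define \<phi> where "\<phi> = (\<lambda>x\<in>carrier F. inv_into (carrier F) (inner F) (\<theta> (inner F x)))"
    have \<phi>: "\<phi> x \<in> carrier F \<and> inner F (\<phi> x) = \<theta> (inner F x)" if x: "x \<in> carrier F" for x
    proof -
      have "\<theta> (inner F x) \<in> inner F ` carrier F" using \<theta>(2) x unfolding Inn_def by blast
      then show ?thesis using x by (simp add: \<phi>_def inv_into_into f_inv_into_f)
    qed
    have \<phi>_auto: "\<phi> \<in> auto F"
    proof -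
      have "\<phi> \<in> hom F F"
      proof (rule homI)
        fix x y assume xy: "x \<in> carrier F" "y \<in> carrier F"
        have "inner F (\<phi> (x \<otimes> y)) = inner F (\<phi> x \<otimes> \<phi> y)"
          using \<phi> xy inner_E by (simp add: inner_mult) (metis \<theta>.hom_mult mult_E)
        then show "\<phi> (x \<otimes> y) = \<phi> x \<otimes> \<phi> y"
          using inj_onD[OF inner_inj] \<phi> xy by simp
      qed (use \<phi> in blast)
      moreover have "inj_on \<phi> (carrier F)"
      proof (rule inj_onI)
        fix x y assume xy: "x \<in> carrier F" "y \<in> carrier F" "\<phi> x = \<phi> y"
        then have "\<theta> (inner F x) = \<theta> (inner F y)" using \<phi> by metis
        then have "inner F x = inner F y" using inj_onD[OF \<theta>_inj] inner_E xy by blast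
        then show "x = y" using inj_onD[OF inner_inj] xy by blast
      qed
      moreover have "\<phi> ` carrier F = carrier F"
      proof (rule subset_antisym; rule subsetI)
        fix y assume y: "y \<in> carrier F"
        then have "inner F y \<in> \<theta> ` Inn F" using \<theta>(2) by (simp add: Inn_def)
        then obtain x where x: "x \<in> carrier F" "inner F y = \<theta> (inner F x)" by (auto simp: Inn_def)
        then have "\<phi> x = y" using \<phi>[OF x(1)] inj_onD[OF inner_inj] y by metis
        then show "y \<in> \<phi> ` carrier F" using x(1) by blast
      qed (use \<phi> in blast)
      ultimately show ?thesis by (simp add: auto_def Bij_def bij_betw_def \<phi>_def)
    qed
    \<comment> \<open>Apply \<open>\<theta>\<close> to the relation between \<open>\<psi>\<close>
      and an inner automorphism. This shows that \<open>\<theta> \<psi>\<close> composed with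
      \<open>\<phi>\<close> and \<open>\<phi>\<close> composed with \<open>\<psi>\<close> agree on
      every \<open>x\<close>, so \<open>\<theta>\<close> is conjugation by \<open>\<phi>\<close> on
      all of \<open>E\<close>, not only on \<open>Inn F\<close>.\<close>
    have key: "\<theta> \<psi> = \<phi> \<otimes>\<^bsub>Au\<^esub> \<psi> \<otimes>\<^bsub>Au\<^esub> inv\<^bsub>Au\<^esub> \<phi>" if \<psi>: "\<psi> \<in> carrier E" for \<psi>
    proof -
      have \<theta>\<psi>: "\<theta> \<psi> \<in> carrier E" using \<psi> by simp
      note au = E_auto[OF \<psi>] E_auto[OF \<theta>\<psi>]
      have "\<theta> \<psi> \<otimes>\<^bsub>Au\<^esub> \<phi> = \<phi> \<otimes>\<^bsub>Au\<^esub> \<psi>"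
      proof (rule auto_eqI)
        show "\<theta> \<psi> \<otimes>\<^bsub>Au\<^esub> \<phi> \<in> auto F" "\<phi> \<otimes>\<^bsub>Au\<^esub> \<psi> \<in> auto F"
          using A.m_closed[of "\<theta> \<psi>" \<phi>] A.m_closed[of \<phi> \<psi>] au \<phi>_auto by simp_all
        fix x assume x: "x \<in> carrier F"
        have \<psi>x: "\<psi> x \<in> carrier F" using autoD(1)[OF au(1) x] .
        have "\<theta> (\<psi> \<otimes>\<^bsub>Au\<^esub> inner F x) = \<theta> (inner F (\<psi> x) \<otimes>\<^bsub>Au\<^esub> \<psi>)" using auto_inner[OF au(1) x] by simp
        then have "\<theta> \<psi> \<otimes>\<^bsub>Au\<^esub> inner F (\<phi> x) = inner F (\<phi> (\<psi> x)) \<otimes>\<^bsub>Au\<^esub> \<theta> \<psi>"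
          using \<theta>.hom_mult[OF \<psi> inner_E[OF x]] \<theta>.hom_mult[OF inner_E[OF \<psi>x] \<psi>] \<phi>[OF x] \<phi>[OF \<psi>x] by simp
        moreover have "\<theta> \<psi> \<otimes>\<^bsub>Au\<^esub> inner F (\<phi> x) = inner F (\<theta> \<psi> (\<phi> x)) \<otimes>\<^bsub>Au\<^esub> \<theta> \<psi>"
          using auto_inner[OF au(2) conjunct1[OF \<phi>[OF x]]] .
        ultimately have "inner F (\<theta> \<psi> (\<phi> x)) \<otimes>\<^bsub>Au\<^esub> \<theta> \<psi> = inner F (\<phi> (\<psi> x)) \<otimes>\<^bsub>Au\<^esub> \<theta> \<psi>" by simp
        moreover have "inner F (\<theta> \<psi> (\<phi> x)) \<in> carrier Au" "inner F (\<phi> (\<psi> x)) \<in> carrier Au" "\<theta> \<psi> \<in> carrier Au"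
          using inner_auto[OF autoD(1)[OF au(2) conjunct1[OF \<phi>[OF x]]]] inner_auto[OF conjunct1[OF \<phi>[OF \<psi>x]]] au(2)
          by simp_all
        ultimately have "inner F (\<theta> \<psi> (\<phi> x)) = inner F (\<phi> (\<psi> x))" by (metis A.right_cancel)
        then have "\<theta> \<psi> (\<phi> x) = \<phi> (\<psi> x)"
          using inj_onD[OF inner_inj] \<phi>[OF x] \<phi>[OF \<psi>x] autoD(1)[OF au(2)] by simp
        then show "(\<theta> \<psi> \<otimes>\<^bsub>Au\<^esub> \<phi>) x = (\<phi> \<otimes>\<^bsub>Au\<^esub> \<psi>) x" using au \<phi>_auto x by (simp add: auto_apply)
      qed
      then have "\<theta> \<psi> \<otimes>\<^bsub>Au\<^esub> \<phi> \<otimes>\<^bsub>Au\<^esub> inv\<^bsub>Au\<^esub> \<phi> = \<phi> \<otimes>\<^bsub>Au\<^esub> \<psi> \<otimes>\<^bsub>Au\<^esub> inv\<^bsub>Au\<^esub> \<phi>" by simp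
      then show ?thesis using au \<phi>_auto by (simp add: A.m_assoc)
    qed
    let ?\<nu> = "out_class F \<phi>"
    have conj_G: "?\<nu> \<otimes>\<^bsub>OutGroup F\<^esub> out_class F \<psi> \<otimes>\<^bsub>OutGroup F\<^esub> inv\<^bsub>OutGroup F\<^esub> ?\<nu> = out_class F (\<theta> \<psi>)"
      if "\<psi> \<in> carrier E" for \<psi>
      using key[OF that] \<phi>_auto E_auto[OF that] by simp
    have G_eq: "out_class F ` carrier E = G"
    proof (rule subset_antisym; rule subsetI)
      fix g assume g: "g \<in> G"
      then obtain \<psi> where "\<psi> \<in> g" using OutGroup_nonempty[OF G_carrier] by blast
      then show "g \<in> out_class F ` carrier E" using G_memD[OF g] by blast
    qed (auto simp: carrier_E)
    have "(\<lambda>g. ?\<nu> \<otimes>\<^bsub>OutGroup F\<^esub> g \<otimes>\<^bsub>OutGroup F\<^esub> inv\<^bsub>OutGroup F\<^esub> ?\<nu>) ` (out_class F ` carrier E) =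
        out_class F ` (\<theta> ` carrier E)"
      unfolding image_image using conj_G by (rule image_cong[OF refl])
    moreover have "\<theta> ` carrier E = carrier E" using EE.autoD(3)[OF \<theta>(1)] by (simp add: bij_betw_def)
    ultimately have "(\<lambda>g. ?\<nu> \<otimes>\<^bsub>OutGroup F\<^esub> g \<otimes>\<^bsub>OutGroup F\<^esub> inv\<^bsub>OutGroup F\<^esub> ?\<nu>) ` G = G"
      using G_eq by metis
    then have "?\<nu> \<in> NG" using \<phi>_auto by (simp add: normalizer_iff carrier_OutGroup)
    moreover have "conj_by \<phi> = \<theta>"
      using auto_conj_by[OF \<phi>_auto \<open>?\<nu> \<in> NG\<close>] \<theta>(1) key by (intro EE.auto_eqI) (simp_all add: conj_by_def)
    ultimately have "normalizer_map ?\<nu> = X" using normalizer_map_eq out_class_self[OF \<phi>_auto] \<theta>(3) by simp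
    then show "X \<in> normalizer_map ` carrier ?NG" using \<open>?\<nu> \<in> NG\<close> by force
  qed
  show "(\<lambda>g. g) ` carrier GG = kernel ?NG ?O normalizer_map"
  proof (rule subset_antisym; rule subsetI)
    fix g assume "g \<in> (\<lambda>g. g) ` carrier GG"
    then have g: "g \<in> G" by simp
    obtain \<phi> where \<phi>: "\<phi> \<in> g" using OutGroup_nonempty G_carrier[OF g] by blast
    then have \<phi>E: "\<phi> \<in> carrier E" using G_memD[OF g] by simp
    have gN: "g \<in> NG" using g G_le_NG by blast
    \<comment> \<open>Conjugation by an element of \<open>E\<close> is inner in \<open>E\<close>, so
      \<open>G\<close> is contained in the kernel.\<close>
    have "normalizer_map g = out_class E (inner E \<phi>)" using normalizer_map_eq[OF gN \<phi>] conj_by_E[OF \<phi>E] by simp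
    also have "\<dots> = Inn E" unfolding out_class_def
      using EE.A.coset_join2[of "inner E \<phi>" "Inn E"] EE.N.is_subgroup EE.inner_auto[OF \<phi>E] \<phi>E
      by (simp add: Inn_def)
    finally show "g \<in> kernel ?NG ?O normalizer_map" using gN O_one by (simp add: kernel_def)
  next
    fix \<nu> assume "\<nu> \<in> kernel ?NG ?O normalizer_map"
    then have \<nu>: "\<nu> \<in> NG" "normalizer_map \<nu> = Inn E" using O_one by (auto simp: kernel_def)
    obtain \<phi> where \<phi>: "\<phi> \<in> \<nu>" using OutGroup_nonempty NG_carrier[OF \<nu>(1)] by blast
    note a = NG_auto[OF \<nu>(1) \<phi>]
    have "conj_by \<phi> \<in> auto E" using auto_conj_by a \<nu>(1) by simp
    then have "conj_by \<phi> \<in> Inn E"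
      using EE.out_class_self normalizer_map_eq[OF \<nu>(1) \<phi>] \<nu>(2) by simp
    \<comment> \<open>A class in the kernel acts on \<open>E\<close> like some \<open>\<psi>\<close>
      in \<open>E\<close>. Agreement on inner automorphisms forces the representative to equal
      \<open>\<psi>\<close>.\<close>
    then obtain \<psi> where \<psi>: "\<psi> \<in> carrier E" "conj_by \<phi> = conj_by \<psi>"
      using conj_by_E by (auto simp: Inn_def)
    then have "\<phi> = \<psi>" using auto_eq_if_conj_inner_eq[of \<phi> \<psi>] a E_auto by simp
    then have "\<nu> \<in> G" using a \<psi>(1) by (simp add: carrier_E)
    then show "\<nu> \<in> (\<lambda>g. g) ` carrier GG" by simp
  qed
qed

end


section \<open>Essential and surviving edges\<close>

lemma (in group) free_basis_nontrivial:
  assumes "free_basis G B" "b \<in> B"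
  shows "b \<noteq> \<one>"
proof -
  have "fst ` set [(b, True)] \<subseteq> B \<and> reduced_word [(b, True)] \<and> [(b, True)] \<noteq> []"
    using assms(2) reduced_word_singleton by simp
  then have "eval_word G [(b, True)] \<noteq> \<one>" using assms(1) unfolding free_basis_def by blast
  moreover have "b \<in> carrier G" using assms by (auto simp: free_basis_def)
  ultimately show ?thesis by simp
qed

text \<open>The orbit of the loop can be added to any invariant forest, because its members lie on
  no circuit. A maximal invariant forest therefore contains it.\<close>

lemma quotient_loop_inessential:
  assumes \<Gamma>: "group F" "\<Gamma> \<in> Trees F" and v: "(v, v) \<in> arcs \<Gamma>" and real: "realizes F \<Gamma> K \<alpha> \<theta>V \<theta>E"
    and K: "group K"
  shows "\<not> essential K (quotient_graph F \<Gamma>) \<theta>E (arc_orbit F \<Gamma> (v, v))"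
proof
  let ?X = "quotient_graph F \<Gamma>" and ?o = "arc_orbit F \<Gamma>"
  assume "essential K ?X \<theta>E (?o (v, v))"
  then obtain S where S: "forest ?X S" "\<And>g. g \<in> carrier K \<Longrightarrow> \<theta>E g ` S = S" "?o (v, v) \<notin> S"
    and max: "\<And>S'. \<lbrakk>invariant_forest K ?X \<theta>E S'; S \<subseteq> S'\<rbrakk> \<Longrightarrow> S' = S"
    by (auto simp: essential_def maximal_invariant_forest_def invariant_forest_def)
  have ga: "group_action K (darts ?X) \<theta>E" using real by (simp add: realizes_def graph_action_def)
  interpret K: group K by (rule K)
  interpret group_action K "darts ?X" \<theta>E by (rule ga)
  have vX: "?o (v, v) \<in> darts ?X" using v by (auto simp: darts_quotient)
  define L where "L = (\<lambda>g. \<theta>E g (?o (v, v))) ` carrier K"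
  have L_loop: "\<exists>w. (w, w) \<in> arcs \<Gamma> \<and> Q = ?o (w, w)" if Q: "Q \<in> L" for Q
  proof -
    obtain g where g: "g \<in> carrier K" "Q = \<theta>E g (?o (v, v))" using Q by (auto simp: L_def)
    then obtain h where h: "tree_iso \<Gamma> \<Gamma> h" "\<forall>a\<in>arcs \<Gamma>. ?o (map_prod h h a) = \<theta>E g (?o a)"
      using real unfolding realizes_def by blast
    have "v \<in> verts \<Gamma>" using v Trees_arcs_sub[OF \<Gamma>(2)] by auto
    then have "(h v, h v) \<in> arcs \<Gamma>" using h(1) v by (simp add: tree_iso_def)
    moreover have "Q = ?o (h v, h v)" using h(2) v g(2) by force
    ultimately show ?thesis by blast
  qed
  have "invariant_forest K ?X \<theta>E (S \<union> L)"
    unfolding invariant_forest_def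
  proof (intro conjI ballI)
    show "forest ?X (S \<union> L)"
      unfolding forest_def
    proof (intro conjI notI)
      show "S \<union> L \<subseteq> darts ?X" using S(1) L_loop by (auto simp: forest_def darts_quotient)
      have "rev_dart ?X Q = Q" if "Q \<in> L" for Q using L_loop[OF that] by (auto simp: rev_quotient)
      then have "rev_dart ?X ` L = L" by force
      then show "rev_dart ?X ` (S \<union> L) = S \<union> L" using S(1) by (simp add: forest_def image_Un)
      assume "\<exists>p. set p \<subseteq> S \<union> L \<and> circuit ?X p"
      then obtain p where p: "set p \<subseteq> S \<union> L" "circuit ?X p" by blast
      \<comment> \<open>A dart of \<open>L\<close> starts and ends at the same vertex. Distinct
        sources make it its own successor in the circuit, and it is its own reverse, which the
        circuit condition forbids.\<close>
      have "Q \<notin> L" if Qp: "Q \<in> set p" for Q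
      proof
        assume "Q \<in> L"
        then obtain w where w: "Q = ?o (w, w)" using L_loop by blast
        obtain i where i: "i < length p" "p ! i = Q" using Qp by (metis in_set_conv_nth)
        let ?n = "Suc i mod length p"
        have n: "?n < length p" using i by (metis mod_less_divisor less_nat_zero_code not_gr_zero)
        have c: "tgt ?X (p ! i) = src ?X (p ! ?n)" "p ! ?n \<noteq> rev_dart ?X (p ! i)" "distinct (map (src ?X) p)"
          using p(2) i(1) by (auto simp: circuit_def Let_def)
        have "src ?X (p ! i) = src ?X (p ! ?n)"
          using c(1) unfolding i(2) w by (simp add: rev_quotient)
        then have "i = ?n" using nth_eq_iff_index_eq[OF c(3), of i ?n] i(1) n by simp
        then show False using c(2) unfolding i(2) w by (metis i(2) rev_quotient w)
      qed
      then have "set p \<subseteq> S" using p(1) by blast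
      then show False using S(1) p(2) by (auto simp: forest_def)
    qed
    fix g assume g: "g \<in> carrier K"
    have "\<theta>E g ` L = L"
    proof (rule subset_antisym; rule subsetI)
      fix Q assume "Q \<in> \<theta>E g ` L"
      then obtain k where k: "k \<in> carrier K" "Q = \<theta>E g (\<theta>E k (?o (v, v)))" by (auto simp: L_def)
      then have "Q = \<theta>E (g \<otimes>\<^bsub>K\<^esub> k) (?o (v, v))" using composition_rule[OF vX g k(1)] by simp
      then show "Q \<in> L" using g k(1) unfolding L_def by blast
    next
      fix Q assume "Q \<in> L"
      then obtain k where k: "k \<in> carrier K" "Q = \<theta>E k (?o (v, v))" by (auto simp: L_def)
      have ik: "inv\<^bsub>K\<^esub> g \<otimes>\<^bsub>K\<^esub> k \<in> carrier K" using g k by simp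
      have "g \<otimes>\<^bsub>K\<^esub> (inv\<^bsub>K\<^esub> g \<otimes>\<^bsub>K\<^esub> k) = k" using g k by (simp add: K.m_assoc[symmetric])
      then have "Q = \<theta>E g (\<theta>E (inv\<^bsub>K\<^esub> g \<otimes>\<^bsub>K\<^esub> k) (?o (v, v)))"
        using composition_rule[OF vX g ik] k(2) by simp
      then show "Q \<in> \<theta>E g ` L" using ik unfolding L_def by blast
    qed
    then show "\<theta>E g ` (S \<union> L) = S \<union> L" using S(2)[OF g] by (simp add: image_Un)
  qed
  then have "S \<union> L = S" using max by blast
  moreover have "?o (v, v) \<in> L"
  proof -
    have "\<theta>E \<one>\<^bsub>K\<^esub> (?o (v, v)) = ?o (v, v)" using vX by (simp flip: id_eq_one)
    then show ?thesis unfolding L_def by (rule image_eqI[OF sym]) (rule K.one_closed)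
  qed
  ultimately show False using S(3) by blast
qed

section \<open>Actions of \<open>G\<close> on quotient graphs and actions of \<open>E\<close> on
  trees\<close>

locale free_outer_subgroup = outer_subgroup F G
  for F :: "('a, 'b) monoid_scheme" (structure) and G +
  fixes B :: "'a set"
  assumes basis: "free_basis F B" "finite B" "card B \<ge> 2"
begin

definition reps :: "('a \<Rightarrow> 'a) set" where
  "reps = (\<lambda>g. SOME \<phi>. \<phi> \<in> g) ` G"

text \<open>Conjugating the inner automorphism of \<open>x\<close> by \<open>\<psi>\<close> gives
  that of \<open>\<psi> x\<close>, which is why the conjugation map is \<open>\<psi>\<close>
  itself.\<close>

sublocale X: normal_ext F E "inner F" "\<lambda>\<psi>. \<psi>" reps B
proof (unfold_locales)
  have rep: "(SOME \<phi>. \<phi> \<in> g) \<in> g" if "g \<in> G" for g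
    using OutGroup_nonempty[OF G_carrier[OF that]] by (rule someI_ex)
  show "inner F \<in> hom F E" by (rule E_group_hom_inner)
  show "inj_on (inner F) (carrier F)" by (rule inner_inj)
  show "\<psi> x \<in> carrier F" if "\<psi> \<in> carrier E" "x \<in> carrier F" for \<psi> x
    using autoD(1) E_auto that by blast
  show "\<psi> \<otimes>\<^bsub>E\<^esub> inner F x = inner F (\<psi> x) \<otimes>\<^bsub>E\<^esub> \<psi>" if "\<psi> \<in> carrier E" "x \<in> carrier F" for \<psi> x
    using auto_inner E_auto that by simp
  show "finite reps" using finite_G by (simp add: reps_def)
  show "reps \<subseteq> carrier E" using rep G_memD by (auto simp: reps_def)
  show "\<exists>x\<in>carrier F. \<exists>t\<in>reps. \<psi> = inner F x \<otimes>\<^bsub>E\<^esub> t" if \<psi>: "\<psi> \<in> carrier E" for \<psi>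
  proof -
    have g: "out_class F \<psi> \<in> G" using \<psi> by (simp add: carrier_E)
    let ?t = "SOME \<phi>. \<phi> \<in> out_class F \<psi>"
    have t: "?t \<in> out_class F \<psi>" using rep[OF g] .
    then have "?t \<in> auto F" "out_class F ?t = out_class F \<psi>" using G_memD[OF g t] E_auto by auto
    then obtain x where "x \<in> carrier F" "\<psi> = inner F x \<otimes>\<^bsub>Au\<^esub> ?t"
      using out_class_iff[of ?t \<psi>] out_class_self[of \<psi>] E_auto[OF \<psi>] by auto
    moreover have "?t \<in> reps" using g by (auto simp: reps_def)
    ultimately show ?thesis by auto
  qed
  show "finite B" "B \<subseteq> carrier F" "generate F B = carrier F" using basis by (auto simp: free_basis_def)
  show tf: "x = \<one>" if "x \<in> carrier F" "x [^] (k::nat) = \<one>" "k > 0" for x k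
    using free_basis_torsion_free[OF basis(1) that] .
  show "infinite (carrier F)"
  proof
    assume "finite (carrier F)"
    with tf have "carrier F = {\<one>}" by (intro torsion_free_finite_subgroup subgroup_self)
    moreover obtain b where "b \<in> B" using basis(3) by fastforce
    ultimately show False using free_basis_nontrivial[OF basis(1)] basis(1) by (auto simp: free_basis_def)
  qed
qed

lemma twisted_aut_iff:
  "X.twisted_aut \<Gamma> \<phi> h \<longleftrightarrow> tree_iso \<Gamma> \<Gamma> h \<and> equivariant F \<Gamma> (pullback \<phi> \<Gamma>) h"
  by (simp add: X.twisted_aut_def equivariant_def pullback_def)

lemma realizesD:
  assumes "realizes F \<Gamma> GG (\<lambda>g. g) \<theta>V \<theta>E" "g \<in> G"
  shows "\<exists>h. \<exists>\<phi>\<in>g. X.twisted_aut \<Gamma> \<phi> h \<and>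
    (\<forall>a\<in>arcs \<Gamma>. arc_orbit F \<Gamma> (map_prod h h a) = \<theta>E g (arc_orbit F \<Gamma> a))"
proof -
  have "\<forall>g\<in>G. \<exists>h. \<exists>\<phi>\<in>g. X.twisted_aut \<Gamma> \<phi> h \<and>
    (\<forall>v\<in>verts \<Gamma>. orbit F (act \<Gamma>) (h v) = \<theta>V g (orbit F (act \<Gamma>) v)) \<and>
    (\<forall>a\<in>arcs \<Gamma>. arc_orbit F \<Gamma> (map_prod h h a) = \<theta>E g (arc_orbit F \<Gamma> a))"
    using assms(1) by (simp add: realizes_def twisted_aut_iff)
  from bspec[OF this assms(2)] show ?thesis by (elim exE bexE conjE) (intro exI bexI conjI)
qed

lemma arc_orbit_shift:
  assumes "\<Gamma> \<in> Trees F" "y \<in> carrier F" "a \<in> arcs \<Gamma>"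
  shows "arc_orbit F \<Gamma> (act_arcs \<Gamma> y a) = arc_orbit F \<Gamma> a"
proof -
  have "act_arcs \<Gamma> y a \<in> arcs \<Gamma>"
    using assms by (cases a) (auto simp: Trees_def acts_simplicially_def)
  then show ?thesis using arc_orbit_eq[OF is_group assms(1,3)] assms(2) by blast
qed

text \<open>The realization gives a lift for one representative of each outer class. Composing with
  elements of \<open>F\<close> gives lifts for the other representatives.\<close>

lemma realized_extension:
  assumes \<Gamma>: "\<Gamma> \<in> Trees F" "loopfree \<Gamma>" and real: "realizes F \<Gamma> GG (\<lambda>g. g) \<theta>V \<theta>E"
  obtains \<Delta> where "\<Delta> \<in> Trees E" "X.extends \<Delta> \<Gamma>"
proof -
  have "\<exists>h. X.twisted_aut \<Gamma> \<psi> h" if \<psi>: "\<psi> \<in> carrier E" for \<psi>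
  proof -
    have "out_class F \<psi> \<in> G" using \<psi> by (simp add: carrier_E)
    then obtain h \<phi> where h: "\<phi> \<in> out_class F \<psi>" "X.twisted_aut \<Gamma> \<phi> h"
      using realizesD[OF real] by blast
    have \<phi>: "\<phi> \<in> carrier E" "out_class F \<phi> = out_class F \<psi>" using G_memD[OF _ h(1)] \<psi> by (auto simp: carrier_E)
    then obtain y where y: "y \<in> carrier F" "\<psi> = inner F y \<otimes>\<^bsub>Au\<^esub> \<phi>"
      using out_class_iff[of \<phi> \<psi>] out_class_self[of \<psi>] E_auto[OF \<phi>(1)] E_auto[OF \<psi>] by auto
    have "X.twisted_aut \<Gamma> (inner F y \<otimes>\<^bsub>E\<^esub> \<phi>) (act \<Gamma> y \<circ> h)"
      by (rule X.twisted_aut_comp[OF X.twisted_aut_j[OF \<Gamma>(1) y(1)] h(2) inner_E[OF y(1)] \<phi>(1)])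
    then show ?thesis using y(2) by auto
  qed
  then show ?thesis using X.extension_exists[OF \<Gamma>] that by blast
qed

text \<open>By uniqueness of lifts any realization is the action induced by \<open>\<Delta>\<close>,
  so essentiality does not depend on which realization is chosen.\<close>

lemma realizes_arc_orbit:
  assumes \<Gamma>: "\<Gamma> \<in> Trees F" and \<Delta>: "\<Delta> \<in> Trees E" "loopfree \<Delta>" "X.extends \<Delta> \<Gamma>"
    and real: "realizes F \<Gamma> GG (\<lambda>g. g) \<theta>V \<theta>E" and \<psi>: "\<psi> \<in> carrier E" and a: "a \<in> arcs \<Gamma>"
  shows "\<theta>E (out_class F \<psi>) (arc_orbit F \<Gamma> a) = arc_orbit F \<Gamma> (act_arcs \<Delta> \<psi> a)"
proof -
  have lf: "loopfree \<Gamma>" using X.extends_loopfree[OF \<Delta>(3)] \<Delta>(2) by simp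
  have "out_class F \<psi> \<in> G" using \<psi> by (simp add: carrier_E)
  then obtain h \<phi> where h: "\<phi> \<in> out_class F \<psi>" "X.twisted_aut \<Gamma> \<phi> h"
    "\<forall>a\<in>arcs \<Gamma>. arc_orbit F \<Gamma> (map_prod h h a) = \<theta>E (out_class F \<psi>) (arc_orbit F \<Gamma> a)"
    using realizesD[OF real] by blast
  have \<phi>: "\<phi> \<in> carrier E" "out_class F \<phi> = out_class F \<psi>" using G_memD[OF _ h(1)] \<psi> by (auto simp: carrier_E)
  then obtain y where y: "y \<in> carrier F" "\<psi> = inner F y \<otimes>\<^bsub>Au\<^esub> \<phi>"
    using out_class_iff[of \<phi> \<psi>] out_class_self[of \<psi>] E_auto[OF \<phi>(1)] E_auto[OF \<psi>] by auto
  obtain u v where uv: "a = (u, v)" "u \<in> verts \<Gamma>" "v \<in> verts \<Gamma>"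
    using a Trees_arcs_sub[OF \<Gamma>] by (cases a) auto
  interpret D: tree_action E \<Delta> by (simp add: tree_action_def tree_action_axioms_def E.is_group \<Delta>)
  have e: "verts \<Delta> = verts \<Gamma>" "arcs \<Delta> = arcs \<Gamma>"
    "\<And>x v. \<lbrakk>x \<in> carrier F; v \<in> verts \<Gamma>\<rbrakk> \<Longrightarrow> act \<Delta> (inner F x) v = act \<Gamma> x v"
    using \<Delta>(3) by (auto simp: X.extends_def)
  have hD: "h w = act \<Delta> \<phi> w" if "w \<in> verts \<Gamma>" for w
    using X.twisted_aut_unique[OF \<Gamma> lf \<phi>(1) h(2) X.twisted_aut_extension[OF \<Delta> \<phi>(1)] that] .
  have \<psi>D: "act \<Delta> \<psi> w = act \<Gamma> y (h w)" if "w \<in> verts \<Gamma>" for w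
    using D.act_mult[OF inner_E[OF y(1)] \<phi>(1), of w] e(3)[OF y(1)] D.act_closed[OF \<phi>(1), of w] that hD e(1) y(2)
    by simp
  have ha: "map_prod h h a \<in> arcs \<Gamma>" using D.act_arcs_closed[OF \<phi>(1), of u v] uv hD a e by simp
  have "act_arcs \<Delta> \<psi> a = act_arcs \<Gamma> y (map_prod h h a)" using uv \<psi>D by simp
  then show ?thesis using arc_orbit_shift[OF \<Gamma> y(1) ha] h(3) a by simp
qed

text \<open>By normality \<open>E\<close> permutes the \<open>F\<close>-orbits, and inner
  automorphisms act trivially on them. So \<open>G\<close>, the quotient of \<open>E\<close> by
  \<open>Inn F\<close>, acts on the quotient graph.\<close>

lemma realization_exists:
  assumes \<Gamma>: "\<Gamma> \<in> Trees F" and \<Delta>: "\<Delta> \<in> Trees E" "loopfree \<Delta>" "X.extends \<Delta> \<Gamma>"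
  shows "\<exists>\<theta>V \<theta>E. realizes F \<Gamma> GG (\<lambda>g. g) \<theta>V \<theta>E"
proof -
  let ?X = "quotient_graph F \<Gamma>" and ?o = "arc_orbit F \<Gamma>" and ?vo = "orbit F (act \<Gamma>)"
  interpret D: tree_action E \<Delta> by (simp add: tree_action_def tree_action_axioms_def E.is_group \<Delta>)
  have e: "verts \<Delta> = verts \<Gamma>" "arcs \<Delta> = arcs \<Gamma>"
    "\<And>x v. \<lbrakk>x \<in> carrier F; v \<in> verts \<Gamma>\<rbrakk> \<Longrightarrow> act \<Delta> (inner F x) v = act \<Gamma> x v"
    using \<Delta>(3) by (auto simp: X.extends_def)
  have nodes: "nodes ?X = ?vo ` verts \<Gamma>" by (auto simp: quotient_graph_def orbits_def)
  have \<psi>F: "\<psi> ` carrier F = carrier F" if "\<psi> \<in> carrier E" for \<psi>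
    using autoD(3)[OF E_auto[OF that]] by (simp add: bij_betw_def)
  have aV: "act \<Delta> \<psi> v \<in> verts \<Gamma>" if "\<psi> \<in> carrier E" "v \<in> verts \<Gamma>" for \<psi> v
    using D.act_closed[of \<psi> v] that e by simp
  have aA: "act_arcs \<Delta> \<psi> a \<in> arcs \<Gamma>" if "\<psi> \<in> carrier E" "a \<in> arcs \<Gamma>" for \<psi> a
    using D.act_arcs_closed[OF that(1), of "fst a" "snd a"] that(2) e by (cases a) simp
  have orb_img: "orbit F f s = (\<lambda>x. f x s) ` carrier F" for f :: "'a \<Rightarrow> 's \<Rightarrow> 's" and s
    by (auto simp: orbit_def)
  have img_v: "act \<Delta> \<psi> ` ?vo v = ?vo (act \<Delta> \<psi> v)" if \<psi>: "\<psi> \<in> carrier E" and v: "v \<in> verts \<Gamma>" for \<psi> v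
  proof -
    have "act \<Delta> \<psi> ` ?vo v = (\<lambda>x. act \<Gamma> (\<psi> x) (act \<Delta> \<psi> v)) ` carrier F"
      unfolding orb_img image_image using X.act_extension_conj[OF \<Delta> \<psi> _ v] by (intro image_cong) auto
    also have "\<dots> = (\<lambda>x. act \<Gamma> x (act \<Delta> \<psi> v)) ` (\<psi> ` carrier F)" by (simp add: image_image)
    finally show ?thesis unfolding \<psi>F[OF \<psi>] orb_img .
  qed
  have img_a: "act_arcs \<Delta> \<psi> ` ?o a = ?o (act_arcs \<Delta> \<psi> a)" if \<psi>: "\<psi> \<in> carrier E" and a: "a \<in> arcs \<Gamma>" for \<psi> a
  proof -
    obtain u v where uv: "a = (u, v)" "u \<in> verts \<Gamma>" "v \<in> verts \<Gamma>"
      using a Trees_arcs_sub[OF \<Gamma>] by (cases a) auto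
    have "act_arcs \<Delta> \<psi> ` ?o a = (\<lambda>x. act_arcs \<Gamma> (\<psi> x) (act_arcs \<Delta> \<psi> a)) ` carrier F"
      unfolding orb_img image_image using X.act_extension_conj[OF \<Delta> \<psi>] uv by (intro image_cong) auto
    also have "\<dots> = (\<lambda>x. act_arcs \<Gamma> x (act_arcs \<Delta> \<psi> a)) ` (\<psi> ` carrier F)" by (simp add: image_image)
    finally show ?thesis unfolding \<psi>F[OF \<psi>] orb_img .
  qed
  have related: "\<exists>y\<in>carrier F. \<psi> = inner F y \<otimes>\<^bsub>E\<^esub> \<phi>" if g: "g \<in> G" "\<phi> \<in> g" "\<psi> \<in> g" for g \<phi> \<psi>
    using out_class_iff[of \<phi> \<psi>] G_memD[OF g(1,2)] G_memD[OF g(1,3)] E_auto g(3) by auto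
  \<comment> \<open>Representatives of one class differ by an element of \<open>F\<close>, which
    does not change orbits.\<close>
  have indep_v: "?vo (act \<Delta> \<psi> v) = ?vo (act \<Delta> \<phi> v)"
    if g: "g \<in> G" "\<phi> \<in> g" "\<psi> \<in> g" and v: "v \<in> verts \<Gamma>" for g \<phi> \<psi> v
  proof -
    have c: "\<phi> \<in> carrier E" "\<psi> \<in> carrier E" using G_memD g by auto
    obtain y where y: "y \<in> carrier F" "\<psi> = inner F y \<otimes>\<^bsub>E\<^esub> \<phi>" using related[OF g] by blast
    have "act \<Delta> \<psi> v = act \<Gamma> y (act \<Delta> \<phi> v)"
      using D.act_mult[OF inner_E[OF y(1)] c(1), of v] e(3)[OF y(1) aV[OF c(1) v]] v e(1) y(2) by simp
    then show ?thesis
      using vertex_orbit_eq[OF is_group \<Gamma> aV[OF c(1) v] aV[OF c(2) v]] y(1) by auto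
  qed
  have indep_a: "?o (act_arcs \<Delta> \<psi> a) = ?o (act_arcs \<Delta> \<phi> a)"
    if g: "g \<in> G" "\<phi> \<in> g" "\<psi> \<in> g" and a: "a \<in> arcs \<Gamma>" for g \<phi> \<psi> a
  proof -
    have c: "\<phi> \<in> carrier E" "\<psi> \<in> carrier E" using G_memD g by auto
    obtain y where y: "y \<in> carrier F" "\<psi> = inner F y \<otimes>\<^bsub>E\<^esub> \<phi>" using related[OF g] by blast
    obtain u v where uv: "a = (u, v)" "u \<in> verts \<Gamma>" "v \<in> verts \<Gamma>"
      using a Trees_arcs_sub[OF \<Gamma>] by (cases a) auto
    have "act \<Delta> \<psi> w = act \<Gamma> y (act \<Delta> \<phi> w)" if "w \<in> verts \<Gamma>" for w
      using D.act_mult[OF inner_E[OF y(1)] c(1), of w] e(3)[OF y(1) aV[OF c(1) that]] that e(1) y(2) by simp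
    then have "act_arcs \<Delta> \<psi> a = act_arcs \<Gamma> y (act_arcs \<Delta> \<phi> a)" using uv by simp
    then show ?thesis using arc_orbit_shift[OF \<Gamma> y(1) aA[OF c(1) a]] by simp
  qed
  define rep where "rep g = (SOME \<phi>. \<phi> \<in> g)" for g :: "('a \<Rightarrow> 'a) set"
  have rep: "rep g \<in> g" if "g \<in> G" for g
    unfolding rep_def using OutGroup_nonempty[OF G_carrier[OF that]] by (rule someI_ex)
  define \<theta>V where "\<theta>V g = (\<lambda>Q\<in>nodes ?X. act \<Delta> (rep g) ` Q)" for g
  define \<theta>E where "\<theta>E g = (\<lambda>Q\<in>darts ?X. act_arcs \<Delta> (rep g) ` Q)" for g
  have \<theta>V: "\<theta>V g (?vo v) = ?vo (act \<Delta> \<phi> v)" if "g \<in> G" "\<phi> \<in> g" "v \<in> verts \<Gamma>" for g \<phi> v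
    using that img_v[of "rep g" v] indep_v[OF that(1) rep[OF that(1)] that(2,3)] G_memD[OF that(1) rep[OF that(1)]]
    by (simp add: \<theta>V_def nodes)
  have \<theta>E: "\<theta>E g (?o a) = ?o (act_arcs \<Delta> \<phi> a)" if "g \<in> G" "\<phi> \<in> g" "a \<in> arcs \<Gamma>" for g \<phi> a
    using that img_a[of "rep g" a] indep_a[OF that(1) rep[OF that(1)] that(2,3)] G_memD[OF that(1) rep[OF that(1)]]
    by (simp add: \<theta>E_def darts_quotient)
  \<comment> \<open>This and \<open>mult_mem\<close> replace the chosen representatives of a unit or
    product by the identity or the product of representatives. The choice itself is not
    multiplicative.\<close>
  have one_mem: "\<one>\<^bsub>E\<^esub> \<in> \<one>\<^bsub>GG\<^esub>"
  proof -
    have "\<one>\<^bsub>Au\<^esub> \<in> out_class F \<one>\<^bsub>Au\<^esub>" by (rule out_class_self) simp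
    then show ?thesis by simp
  qed
  have mult_mem: "\<phi> \<otimes>\<^bsub>E\<^esub> \<psi> \<in> g \<otimes>\<^bsub>GG\<^esub> k" if "g \<in> G" "k \<in> G" "\<phi> \<in> g" "\<psi> \<in> k" for g k \<phi> \<psi>
  proof -
    have c: "\<phi> \<in> auto F" "\<psi> \<in> auto F" "out_class F \<phi> = g" "out_class F \<psi> = k"
      using G_memD that E_auto by blast+
    then show ?thesis using out_class_self[of "\<phi> \<otimes>\<^bsub>Au\<^esub> \<psi>"] out_class_mult[of \<phi> \<psi>] by simp
  qed
  have GG_closed: "g \<otimes>\<^bsub>GG\<^esub> k \<in> G" if "g \<in> G" "k \<in> G" for g k
    using subgroup.m_closed[OF G] that by simp
  have "group_action GG (nodes ?X) \<theta>V"
  proof (rule group_actionI[OF GG_group])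
    show "\<theta>V g \<in> extensional (nodes ?X)" for g by (simp add: \<theta>V_def)
    show "\<theta>V g Q \<in> nodes ?X" if "g \<in> carrier GG" "Q \<in> nodes ?X" for g Q
    proof -
      obtain v where v: "v \<in> verts \<Gamma>" "Q = ?vo v" using \<open>Q \<in> nodes ?X\<close> nodes by blast
      have g: "g \<in> G" using that(1) by simp
      have "\<theta>V g Q = ?vo (act \<Delta> (rep g) v)" using \<theta>V[OF g rep[OF g] v(1)] v(2) by simp
      then show ?thesis unfolding nodes using aV[OF _ v(1), of "rep g"] G_memD[OF g rep[OF g]] by blast
    qed
    show "\<theta>V \<one>\<^bsub>GG\<^esub> Q = Q" if "Q \<in> nodes ?X" for Q
    proof -
      obtain v where v: "v \<in> verts \<Gamma>" "Q = ?vo v" using \<open>Q \<in> nodes ?X\<close> nodes by blast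
      have "\<theta>V \<one>\<^bsub>GG\<^esub> (?vo v) = ?vo (act \<Delta> \<one>\<^bsub>E\<^esub> v)"
        by (rule \<theta>V[OF _ one_mem v(1)]) (simp add: subgroup.one_closed[OF G])
      also have "act \<Delta> \<one>\<^bsub>E\<^esub> v = v" by (rule D.act_one) (simp add: e v)
      finally show ?thesis using v(2) by simp
    qed
    show "\<theta>V (g \<otimes>\<^bsub>GG\<^esub> k) Q = \<theta>V g (\<theta>V k Q)"
      if gk: "g \<in> carrier GG" "k \<in> carrier GG" and Q: "Q \<in> nodes ?X" for g k Q
    proof -
      obtain v where v: "v \<in> verts \<Gamma>" "Q = ?vo v" using Q nodes by blast
      have g: "g \<in> G" and k: "k \<in> G" using gk by simp_all
      note r = rep[OF g] rep[OF k]
      have c: "rep g \<in> carrier E" "rep k \<in> carrier E" using G_memD g k r by auto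
      have "\<theta>V (g \<otimes>\<^bsub>GG\<^esub> k) Q = ?vo (act \<Delta> (rep g \<otimes>\<^bsub>E\<^esub> rep k) v)"
        unfolding v(2) by (rule \<theta>V[OF GG_closed[OF g k] mult_mem[OF g k r] v(1)])
      also have "\<dots> = ?vo (act \<Delta> (rep g) (act \<Delta> (rep k) v))" using D.act_mult[OF c] v e by simp
      also have "\<dots> = \<theta>V g (\<theta>V k Q)"
        unfolding v(2) \<theta>V[OF k r(2) v(1)] \<theta>V[OF g r(1) aV[OF c(2) v(1)]] ..
      finally show ?thesis .
    qed
  qed
  moreover have "group_action GG (darts ?X) \<theta>E"
  proof (rule group_actionI[OF GG_group])
    show "\<theta>E g \<in> extensional (darts ?X)" for g by (simp add: \<theta>E_def)
    show "\<theta>E g Q \<in> darts ?X" if "g \<in> carrier GG" "Q \<in> darts ?X" for g Q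
    proof -
      obtain a where a: "a \<in> arcs \<Gamma>" "Q = ?o a" using \<open>Q \<in> darts ?X\<close> darts_quotient by blast
      have g: "g \<in> G" using that(1) by simp
      have "\<theta>E g Q = ?o (act_arcs \<Delta> (rep g) a)" using \<theta>E[OF g rep[OF g] a(1)] a(2) by simp
      then show ?thesis unfolding darts_quotient using aA[OF _ a(1), of "rep g"] G_memD[OF g rep[OF g]] by blast
    qed
    show "\<theta>E \<one>\<^bsub>GG\<^esub> Q = Q" if "Q \<in> darts ?X" for Q
    proof -
      obtain a where a: "a \<in> arcs \<Gamma>" "Q = ?o a" using \<open>Q \<in> darts ?X\<close> darts_quotient by blast
      have "\<theta>E \<one>\<^bsub>GG\<^esub> (?o a) = ?o (act_arcs \<Delta> \<one>\<^bsub>E\<^esub> a)"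
        by (rule \<theta>E[OF _ one_mem a(1)]) (simp add: subgroup.one_closed[OF G])
      also have "act_arcs \<Delta> \<one>\<^bsub>E\<^esub> a = a"
        using a(1) Trees_arcs_sub[OF \<Gamma>] D.act_one unfolding e by (cases a) auto
      finally show ?thesis using a(2) by simp
    qed
    show "\<theta>E (g \<otimes>\<^bsub>GG\<^esub> k) Q = \<theta>E g (\<theta>E k Q)"
      if gk: "g \<in> carrier GG" "k \<in> carrier GG" and Q: "Q \<in> darts ?X" for g k Q
    proof -
      obtain a where a: "a \<in> arcs \<Gamma>" "Q = ?o a" using Q darts_quotient by blast
      have g: "g \<in> G" and k: "k \<in> G" using gk by simp_all
      note r = rep[OF g] rep[OF k]
      have c: "rep g \<in> carrier E" "rep k \<in> carrier E" using G_memD g k r by auto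
      obtain u v where uv: "a = (u, v)" "u \<in> verts \<Gamma>" "v \<in> verts \<Gamma>"
        using a(1) Trees_arcs_sub[OF \<Gamma>] by (cases a) auto
      have "\<theta>E (g \<otimes>\<^bsub>GG\<^esub> k) Q = ?o (act_arcs \<Delta> (rep g \<otimes>\<^bsub>E\<^esub> rep k) a)"
        unfolding a(2) by (rule \<theta>E[OF GG_closed[OF g k] mult_mem[OF g k r] a(1)])
      also have "\<dots> = ?o (act_arcs \<Delta> (rep g) (act_arcs \<Delta> (rep k) a))" using D.act_mult[OF c] uv e by simp
      also have "\<dots> = \<theta>E g (\<theta>E k Q)"
        unfolding a(2) \<theta>E[OF k r(2) a(1)] \<theta>E[OF g r(1) aA[OF c(2) a(1)]] ..
      finally show ?thesis .
    qed
  qed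
  moreover have "src ?X (\<theta>E g Q) = \<theta>V g (src ?X Q) \<and> rev_dart ?X (\<theta>E g Q) = \<theta>E g (rev_dart ?X Q)"
    if "g \<in> carrier GG" "Q \<in> darts ?X" for g Q
  proof -
    obtain a where a: "a \<in> arcs \<Gamma>" "Q = ?o a" using \<open>Q \<in> darts ?X\<close> darts_quotient by blast
    obtain u v where uv: "a = (u, v)" "u \<in> verts \<Gamma>" "v \<in> verts \<Gamma>"
      using a(1) Trees_arcs_sub[OF \<Gamma>] by (cases a) auto
    have g: "g \<in> G" using that(1) by simp
    note r = rep[OF g]
    have vu: "(v, u) \<in> arcs \<Gamma>" using D.arcs_sym[of u v] a uv e by simp
    have "\<theta>E g Q = ?o (act \<Delta> (rep g) u, act \<Delta> (rep g) v)" using \<theta>E[OF g r a(1)] a(2) uv(1) by simp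
    then show ?thesis
      using \<theta>V[OF g r uv(2)] \<theta>E[OF g r vu] a(2) uv(1) by (simp add: src_quotient rev_quotient)
  qed
  ultimately have "graph_action GG ?X \<theta>V \<theta>E" by (simp add: graph_action_def)
  moreover have "\<exists>h. \<exists>\<phi>\<in>g. tree_iso \<Gamma> \<Gamma> h \<and> equivariant F \<Gamma> (pullback \<phi> \<Gamma>) h \<and>
        (\<forall>v\<in>verts \<Gamma>. ?vo (h v) = \<theta>V g (?vo v)) \<and> (\<forall>a\<in>arcs \<Gamma>. ?o (map_prod h h a) = \<theta>E g (?o a))"
    if "g \<in> carrier GG" for g
  proof -
    have g: "g \<in> G" using that by simp
    have "X.twisted_aut \<Gamma> (rep g) (act \<Delta> (rep g))"
      using X.twisted_aut_extension[OF \<Delta>] G_memD[OF g rep[OF g]] by blast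
    then have t: "tree_iso \<Gamma> \<Gamma> (act \<Delta> (rep g))" "equivariant F \<Gamma> (pullback (rep g) \<Gamma>) (act \<Delta> (rep g))"
      unfolding twisted_aut_iff by simp_all
    show ?thesis
    proof (rule exI[of _ "act \<Delta> (rep g)"], rule bexI[OF _ rep[OF g]], intro conjI t ballI)
      show "?vo (act \<Delta> (rep g) v) = \<theta>V g (?vo v)" if "v \<in> verts \<Gamma>" for v
        using \<theta>V[OF g rep[OF g] that] by simp
      show "?o (act_arcs \<Delta> (rep g) a) = \<theta>E g (?o a)" if "a \<in> arcs \<Gamma>" for a
        using \<theta>E[OF g rep[OF g] that] by simp
    qed
  qed
  ultimately have "realizes F \<Gamma> GG (\<lambda>g. g) \<theta>V \<theta>E" unfolding realizes_def by blast
  then show ?thesis by blast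
qed

text \<open>Taking images in the quotient and preimages \<open>pre\<close> gives mutually inverse,
  inclusion-preserving maps between collapsible sets of \<open>\<Delta>\<close> and invariant
  forests. Maximal ones correspond, and \<open>surviving_iff\<close> finishes.\<close>

lemma essential_iff_surviving:
  assumes \<Gamma>: "\<Gamma> \<in> Trees F" and \<Delta>: "\<Delta> \<in> Trees E" "loopfree \<Delta>" "X.extends \<Delta> \<Gamma>"
    and real: "realizes F \<Gamma> GG (\<lambda>g. g) \<theta>V \<theta>E" and a: "a \<in> arcs \<Gamma>"
  shows "essential GG (quotient_graph F \<Gamma>) \<theta>E (arc_orbit F \<Gamma> a) \<longleftrightarrow> surviving E \<Delta> a"
proof -
  let ?X = "quotient_graph F \<Gamma>" and ?o = "arc_orbit F \<Gamma>"
  interpret D: cocompact_tree E \<Delta> by (rule cocompact_group.cocompact_treeI[OF X.cocompact_group_E \<Delta>(1,2)])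
  have e: "verts \<Delta> = verts \<Gamma>" "arcs \<Delta> = arcs \<Gamma>"
    "\<And>x v. \<lbrakk>x \<in> carrier F; v \<in> verts \<Gamma>\<rbrakk> \<Longrightarrow> act \<Delta> (inner F x) v = act \<Gamma> x v"
    using \<Delta>(3) by (auto simp: X.extends_def)
  define pre where "pre Q = {b \<in> arcs \<Gamma>. ?o b \<in> Q}" for Q
  have \<theta>E: "\<theta>E (out_class F \<psi>) (?o b) = ?o (act_arcs \<Delta> \<psi> b)" if "\<psi> \<in> carrier E" "b \<in> arcs \<Gamma>" for \<psi> b
    using realizes_arc_orbit[OF \<Gamma> \<Delta> real that] .
  have pre_orb: "pre (?o ` S) = S" if S: "collapsible E \<Delta> S" for S
  proof (rule subset_antisym; rule subsetI)
    fix b assume "b \<in> pre (?o ` S)"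
    then obtain s where s: "b \<in> arcs \<Gamma>" "s \<in> S" "?o b = ?o s" by (auto simp: pre_def)
    have sA: "s \<in> arcs \<Gamma>" using D.collapsibleD(1)[OF S] s(2) e by blast
    obtain x where x: "x \<in> carrier F" "b = act_arcs \<Gamma> x s"
      using arc_orbit_eq[OF is_group \<Gamma> sA s(1)] s(3) by auto
    obtain u v where uv: "s = (u, v)" "u \<in> verts \<Gamma>" "v \<in> verts \<Gamma>"
      using sA Trees_arcs_sub[OF \<Gamma>] by (cases s) auto
    have "(act \<Delta> (inner F x) u, act \<Delta> (inner F x) v) \<in> S"
      using D.collapsibleD(3)[OF S] inner_E[OF x(1)] s(2) uv(1) by (simp add: invariant_arcs_def)
    then show "b \<in> S" using x uv e(3) by simp
  next
    fix b assume "b \<in> S"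
    then show "b \<in> pre (?o ` S)" using D.collapsibleD(1)[OF S] e by (auto simp: pre_def)
  qed
  have inv_forest: "invariant_forest GG ?X \<theta>E (?o ` S)" if S: "collapsible E \<Delta> S" for S
    unfolding invariant_forest_def
  proof (intro conjI ballI)
    note S' = D.collapsibleD[OF S]
    have SA: "S \<subseteq> arcs \<Gamma>" using S'(1) e by simp
    show "forest ?X (?o ` S)"
      using X.collapsible_iff_quotient_forest[OF \<Delta>(1,3) \<Gamma> SA S'(3,2)] S by blast
    fix g assume "g \<in> carrier GG"
    then have g: "g \<in> G" by simp
    then obtain \<psi> where "\<psi> \<in> g" using OutGroup_nonempty[OF G_carrier] by blast
    then have \<psi>: "\<psi> \<in> carrier E" "out_class F \<psi> = g" using G_memD[OF g] by auto
    have act_S: "act_arcs \<Delta> \<psi> s \<in> S" if "\<psi> \<in> carrier E" "s \<in> S" for \<psi> s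
      using S'(3) that by (cases s) (auto simp: invariant_arcs_def)
    show "\<theta>E g ` (?o ` S) = ?o ` S"
    proof (rule subset_antisym; rule subsetI)
      fix Q assume "Q \<in> \<theta>E g ` (?o ` S)"
      then obtain s where s: "s \<in> S" "Q = \<theta>E g (?o s)" by blast
      then have "Q = ?o (act_arcs \<Delta> \<psi> s)" using \<theta>E[OF \<psi>(1) subsetD[OF SA s(1)]] \<psi>(2) by simp
      then show "Q \<in> ?o ` S" using act_S[OF \<psi>(1) s(1)] by blast
    next
      fix Q assume "Q \<in> ?o ` S"
      then obtain s where s: "s \<in> S" "Q = ?o s" by blast
      let ?t = "act_arcs \<Delta> (inv\<^bsub>E\<^esub> \<psi>) s"
      have t: "?t \<in> S" using act_S[OF E.inv_closed[OF \<psi>(1)] s(1)] .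
      have "fst s \<in> verts \<Delta> \<and> snd s \<in> verts \<Delta>" using S'(1) s(1) D.arcs_sub by auto
      then have "act_arcs \<Delta> \<psi> ?t = s" using D.act_inv2[OF \<psi>(1)] by (cases s) auto
      then have "Q = \<theta>E g (?o ?t)" using \<theta>E[OF \<psi>(1) subsetD[OF SA t]] \<psi>(2) s(2) by simp
      then show "Q \<in> \<theta>E g ` (?o ` S)" using t by blast
    qed
  qed
  have coll_pre: "collapsible E \<Delta> (pre Q) \<and> ?o ` pre Q = Q" if Q: "invariant_forest GG ?X \<theta>E Q" for Q
  proof -
    have QF: "forest ?X Q" and Q_inv: "\<And>g. g \<in> G \<Longrightarrow> \<theta>E g ` Q = Q"
      using Q by (auto simp: invariant_forest_def)
    have Q_sub: "Q \<subseteq> ?o ` arcs \<Gamma>" and Q_rev: "rev_dart ?X ` Q = Q"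
      using QF by (auto simp: forest_def darts_quotient)
    have img: "?o ` pre Q = Q" using Q_sub by (auto simp: pre_def)
    have sub: "pre Q \<subseteq> arcs \<Gamma>" by (auto simp: pre_def)
    have inv: "invariant_arcs E \<Delta> (pre Q)"
      unfolding invariant_arcs_def
    proof (intro ballI allI impI)
      fix \<psi> u v assume \<psi>: "\<psi> \<in> carrier E" and uv: "(u, v) \<in> pre Q"
      then have "(u, v) \<in> arcs \<Gamma>" "?o (u, v) \<in> Q" by (auto simp: pre_def)
      then have "?o (act_arcs \<Delta> \<psi> (u, v)) \<in> \<theta>E (out_class F \<psi>) ` Q"
        using \<theta>E[OF \<psi> \<open>(u, v) \<in> arcs \<Gamma>\<close>] by (intro image_eqI[OF sym])
      then have "?o (act_arcs \<Delta> \<psi> (u, v)) \<in> Q" using Q_inv \<psi> by (simp add: carrier_E)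
      then show "(act \<Delta> \<psi> u, act \<Delta> \<psi> v) \<in> pre Q"
        using D.act_arcs_closed[OF \<psi>] \<open>(u, v) \<in> arcs \<Gamma>\<close> e by (simp add: pre_def)
    qed
    have sym: "(v, u) \<in> pre Q" if "(u, v) \<in> pre Q" for u v
    proof -
      have "(u, v) \<in> arcs \<Gamma>" "?o (u, v) \<in> Q" using that by (auto simp: pre_def)
      then have "(v, u) \<in> arcs \<Gamma>" "?o (v, u) \<in> rev_dart ?X ` Q"
        using D.arcs_sym e rev_quotient[of F \<Gamma> u v] by (auto intro: rev_image_eqI)
      then show ?thesis using Q_rev by (simp add: pre_def)
    qed
    show ?thesis
      using X.collapsible_iff_quotient_forest[OF \<Delta>(1,3) \<Gamma> sub inv sym] QF img by simp
  qed
  have mono: "pre Q \<subseteq> pre Q'" if "Q \<subseteq> Q'" for Q Q' using that by (auto simp: pre_def)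
  have "essential GG ?X \<theta>E (?o a) \<longleftrightarrow> (\<exists>S. max_collapsible E \<Delta> S \<and> a \<notin> S)"
  proof
    assume "essential GG ?X \<theta>E (?o a)"
    then obtain Q where Q: "invariant_forest GG ?X \<theta>E Q" "?o a \<notin> Q"
      and max: "\<And>Q'. \<lbrakk>invariant_forest GG ?X \<theta>E Q'; Q \<subseteq> Q'\<rbrakk> \<Longrightarrow> Q' = Q"
      by (auto simp: essential_def maximal_invariant_forest_def)
    note cp = coll_pre[OF Q(1)]
    have "S' = pre Q" if S': "collapsible E \<Delta> S'" "pre Q \<subseteq> S'" for S'
    proof -
      have "Q \<subseteq> ?o ` S'" using cp S'(2) by blast
      then have "?o ` S' = Q" using max inv_forest[OF S'(1)] by blast
      then show ?thesis using pre_orb[OF S'(1)] by simp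
    qed
    then have "max_collapsible E \<Delta> (pre Q)" using cp by (auto simp: max_collapsible_def)
    moreover have "a \<notin> pre Q" using Q(2) by (simp add: pre_def)
    ultimately show "\<exists>S. max_collapsible E \<Delta> S \<and> a \<notin> S" by blast
  next
    assume "\<exists>S. max_collapsible E \<Delta> S \<and> a \<notin> S"
    then obtain S where S: "collapsible E \<Delta> S" "a \<notin> S"
      and max: "\<And>S'. \<lbrakk>collapsible E \<Delta> S'; S \<subseteq> S'\<rbrakk> \<Longrightarrow> S' = S" by (auto simp: max_collapsible_def)
    have "Q' = ?o ` S" if Q': "invariant_forest GG ?X \<theta>E Q'" "?o ` S \<subseteq> Q'" for Q'
    proof -
      have "S \<subseteq> pre Q'" using mono[OF Q'(2)] pre_orb[OF S(1)] by simp
      then have "pre Q' = S" using max coll_pre[OF Q'(1)] by blast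
      then show ?thesis using coll_pre[OF Q'(1)] by simp
    qed
    then have "maximal_invariant_forest GG ?X \<theta>E (?o ` S)"
      using inv_forest[OF S(1)] by (auto simp: maximal_invariant_forest_def)
    moreover have "?o a \<notin> ?o ` S"
    proof
      assume "?o a \<in> ?o ` S"
      then have "a \<in> pre (?o ` S)" using a by (simp add: pre_def)
      then show False using pre_orb[OF S(1)] S(2) by simp
    qed
    ultimately show "essential GG ?X \<theta>E (?o a)" by (auto simp: essential_def)
  qed
  then show ?thesis using D.surviving_iff[of "fst a" "snd a"] a e by simp
qed

end


section \<open>The isomorphism of spines\<close>

lemma pullback_sel [simp]:
  "verts (pullback f \<Gamma>) = verts \<Gamma>" "arcs (pullback f \<Gamma>) = arcs \<Gamma>"
  "act (pullback f \<Gamma>) x = act \<Gamma> (f x)"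
  by (simp_all add: pullback_def)

lemma tree_iso_pullback [simp]:
  "tree_iso (pullback f \<Gamma>) \<Gamma>' h \<longleftrightarrow> tree_iso \<Gamma> \<Gamma>' h"
  "tree_iso \<Gamma> (pullback f' \<Gamma>') h \<longleftrightarrow> tree_iso \<Gamma> \<Gamma>' h"
  by (simp_all add: tree_iso_def)

lemma tree_class_congI:
  assumes "\<Gamma> \<in> Trees F" "\<Gamma>' \<in> Trees F" "verts \<Gamma>' = verts \<Gamma>" "arcs \<Gamma>' = arcs \<Gamma>"
    "\<And>x v. \<lbrakk>x \<in> carrier F; v \<in> verts \<Gamma>\<rbrakk> \<Longrightarrow> act \<Gamma> x v = act \<Gamma>' x v"
  shows "\<Gamma>' \<in> tree_class F \<Gamma>"
  using assms tree_iso_id[of \<Gamma> id \<Gamma>'] by (auto simp: tree_class_def equivariant_def)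

lemma collapses_iso_self: "\<Gamma> \<in> Trees F \<Longrightarrow> collapses F \<Gamma> \<Gamma> id"
  using tree_iso_id[of \<Gamma> id \<Gamma>] by (intro collapses.iso) (auto simp: equivariant_def)

lemma spine_le_refl: "C \<in> spine_vertices F \<Longrightarrow> spine_le F C C"
  unfolding spine_vertices_def spine_le_def using tree_class_self collapses_iso_self by blast

text \<open>The order is reflexive, so every admissible vertex spans a simplex by itself.\<close>

lemma Union_reduced_spine:
  "\<Union>(reduced_spine F) = {C \<in> spine_vertices F. \<forall>\<Gamma>\<in>C. \<forall>a\<in>arcs \<Gamma>. surviving F \<Gamma> a}"
  (is "_ = ?V")
proof (rule subset_antisym; rule subsetI)
  fix C assume "C \<in> ?V"
  then have "{C} \<in> reduced_spine F"
    using spine_le_refl[of C F] by (simp add: reduced_spine_def spanned_def spine_def order_complex_def)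
  then show "C \<in> \<Union>(reduced_spine F)" by blast
qed (auto simp: reduced_spine_def spanned_def)

lemma mem_reduced_spine:
  "\<sigma> \<in> reduced_spine F \<longleftrightarrow> \<sigma> \<subseteq> \<Union>(reduced_spine F) \<and> finite \<sigma> \<and> \<sigma> \<noteq> {} \<and>
     (\<forall>a\<in>\<sigma>. \<forall>b\<in>\<sigma>. spine_le F a b \<or> spine_le F b a)"
  unfolding Union_reduced_spine by (auto simp: reduced_spine_def spanned_def spine_def order_complex_def)

lemma surviving_loopfree:
  assumes "\<And>a. a \<in> arcs \<Gamma> \<Longrightarrow> surviving F \<Gamma> a"
  shows "loopfree \<Gamma>"
  unfolding loopfree_def using assms by (force simp: surviving_def)

section \<open>The right action of outer automorphisms on the spine\<close>

context centerless_group
begin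

lemma auto_image: "\<phi> \<in> auto F \<Longrightarrow> \<phi> ` carrier F = carrier F"
  using autoD(3) by (simp add: bij_betw_def)

lemma pullback_in_Trees:
  assumes \<phi>: "\<phi> \<in> auto F" and \<Gamma>: "\<Gamma> \<in> Trees F"
  shows "pullback \<phi> \<Gamma> \<in> Trees F"
proof -
  have \<phi>h: "\<phi> \<in> hom F F" using \<phi> by (simp add: auto_def)
  have ga: "group_action F (verts \<Gamma>) (\<lambda>x. act \<Gamma> (\<phi> x))"
    by (rule group_action_hom[OF _ \<phi>h is_group]) (use \<Gamma> in \<open>simp add: Trees_def acts_simplicially_def\<close>)
  have "\<forall>x\<in>carrier F. \<forall>(u, v)\<in>arcs \<Gamma>. (act \<Gamma> x u, act \<Gamma> x v) \<in> arcs \<Gamma>"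
    using \<Gamma> by (simp add: Trees_def acts_simplicially_def)
  then have "acts_simplicially F (pullback \<phi> \<Gamma>)"
    using ga autoD(1)[OF \<phi>] by (simp add: acts_simplicially_def pullback_def)
  moreover have "simplicial_tree (pullback \<phi> \<Gamma>)" "branching (pullback \<phi> \<Gamma>)"
    using \<Gamma> by (simp_all add: Trees_def simplicial_tree_def branching_def tree_graph_def)
  moreover have "finite_stabilizers F (pullback \<phi> \<Gamma>)"
  proof (rule finite_stabilizersI[OF is_group])
    show "group_action F (verts (pullback \<phi> \<Gamma>)) (act (pullback \<phi> \<Gamma>))"
      using ga by (simp add: pullback_def)
    show "arcs (pullback \<phi> \<Gamma>) \<subseteq> verts (pullback \<phi> \<Gamma>) \<times> verts (pullback \<phi> \<Gamma>)"
      using Trees_arcs_sub[OF \<Gamma>] by simp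
    fix v assume "v \<in> verts (pullback \<phi> \<Gamma>)"
    then have "finite (stabilizer F (act \<Gamma>) v)" using \<Gamma> by (simp add: Trees_def finite_stabilizers_def)
    moreover have "\<phi> ` stabilizer F (act (pullback \<phi> \<Gamma>)) v \<subseteq> stabilizer F (act \<Gamma>) v"
      using autoD(1)[OF \<phi>] by (auto simp: stabilizer_def)
    moreover have "inj_on \<phi> (stabilizer F (act (pullback \<phi> \<Gamma>)) v)"
      using autoD(3)[OF \<phi>] by (auto simp: stabilizer_def bij_betw_def intro: inj_on_subset)
    ultimately show "finite (stabilizer F (act (pullback \<phi> \<Gamma>)) v)" by (meson finite_imageD finite_subset)
  qed
  moreover have "minimal_action F (pullback \<phi> \<Gamma>)"
    unfolding minimal_action_def
  proof (intro allI impI, elim conjE)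
    fix W assume W: "W \<subseteq> verts (pullback \<phi> \<Gamma>)" "W \<noteq> {}" "\<forall>x\<in>carrier F. act (pullback \<phi> \<Gamma>) x ` W \<subseteq> W"
      "\<forall>u\<in>W. \<forall>v\<in>W. (u, v) \<in> (arcs (pullback \<phi> \<Gamma>) \<inter> W \<times> W)\<^sup>*"
    have "act \<Gamma> y ` W \<subseteq> W" if y: "y \<in> carrier F" for y
    proof -
      obtain x where "x \<in> carrier F" "y = \<phi> x" using auto_image[OF \<phi>] y by blast
      then show ?thesis using W(3) by simp
    qed
    moreover have "minimal_action F \<Gamma>" using \<Gamma> by (simp add: Trees_def)
    ultimately show "W = verts (pullback \<phi> \<Gamma>)" using W(1,2,4) by (simp add: minimal_action_def)
  qed
  ultimately show ?thesis by (simp add: Trees_def)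
qed

lemma equivariant_pullback:
  "\<lbrakk>\<phi> \<in> auto F; equivariant F \<Gamma> \<Gamma>' h\<rbrakk> \<Longrightarrow> equivariant F (pullback \<phi> \<Gamma>) (pullback \<phi> \<Gamma>') h"
  using autoD(1) by (simp add: equivariant_def)

lemma tree_class_pullback:
  "\<lbrakk>\<phi> \<in> auto F; \<Gamma>' \<in> tree_class F \<Gamma>\<rbrakk> \<Longrightarrow> pullback \<phi> \<Gamma>' \<in> tree_class F (pullback \<phi> \<Gamma>)"
  using pullback_in_Trees equivariant_pullback by (auto simp: tree_class_def)

text \<open>If \<open>\<psi>\<close> differs from \<open>\<phi>\<close> by conjugation with
  \<open>y\<close>, then the action of \<open>y\<close> is an isomorphism between the two twisted
  trees.\<close>

lemma tree_class_pullback_cong: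
  assumes \<Gamma>: "\<Gamma> \<in> Trees F" and \<phi>: "\<phi> \<in> auto F" and \<psi>: "\<psi> \<in> out_class F \<phi>"
  shows "pullback \<psi> \<Gamma> \<in> tree_class F (pullback \<phi> \<Gamma>)"
proof -
  interpret action_on F "verts \<Gamma>" "act \<Gamma>" by (rule Trees_action_on[OF is_group \<Gamma>])
  have \<psi>a: "\<psi> \<in> auto F" using out_class_subset[OF \<phi>] \<psi> by blast
  obtain y where y: "y \<in> carrier F" "\<psi> = inner F y \<otimes>\<^bsub>AutoGroup F\<^esub> \<phi>"
    using out_class_iff[OF \<phi> \<psi>a] \<psi> by blast
  have \<psi>x: "\<psi> x = y \<otimes> \<phi> x \<otimes> inv y" if "x \<in> carrier F" for x
    using that y \<phi> autoD(1)[OF \<phi> that] by (simp add: auto_apply inner_auto inner_apply)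
  have c: "(act \<Gamma> x u, act \<Gamma> x v) \<in> arcs \<Gamma>" if "x \<in> carrier F" "(u, v) \<in> arcs \<Gamma>" for x u v
    using \<Gamma> that by (auto simp: Trees_def acts_simplicially_def)
  have "(u, v) \<in> arcs \<Gamma> \<longleftrightarrow> (act \<Gamma> y u, act \<Gamma> y v) \<in> arcs \<Gamma>" if "u \<in> verts \<Gamma>" "v \<in> verts \<Gamma>" for u v
    using c[OF y(1), of u v] c[of "inv y" "act \<Gamma> y u" "act \<Gamma> y v"] y(1) that by (auto simp: act_inv1)
  then have "tree_iso \<Gamma> \<Gamma> (act \<Gamma> y)" using bij_prop0[OF y(1)] by (simp add: tree_iso_def Bij_def)
  moreover have "equivariant F (pullback \<phi> \<Gamma>) (pullback \<psi> \<Gamma>) (act \<Gamma> y)"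
    unfolding equivariant_def
  proof (intro ballI)
    fix x v assume x: "x \<in> carrier F" and v: "v \<in> verts (pullback \<phi> \<Gamma>)"
    have "act \<Gamma> (\<psi> x) (act \<Gamma> y v) = act \<Gamma> (y \<otimes> \<phi> x \<otimes> inv y \<otimes> y) v"
      using x v y(1) autoD(1)[OF \<phi> x] by (simp add: \<psi>x act_mult)
    also have "y \<otimes> \<phi> x \<otimes> inv y \<otimes> y = y \<otimes> \<phi> x" using x y(1) autoD(1)[OF \<phi> x] by (simp add: m_assoc)
    finally show "act \<Gamma> y (act (pullback \<phi> \<Gamma>) x v) = act (pullback \<psi> \<Gamma>) x (act \<Gamma> y v)"
      using x v y(1) autoD(1)[OF \<phi> x] by (simp add: act_mult)
  qed
  ultimately show ?thesis using pullback_in_Trees[OF \<psi>a \<Gamma>] by (auto simp: tree_class_def)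
qed

lemma out_act_tree_class:
  assumes \<nu>: "\<nu> \<in> carrier (OutGroup F)" "\<phi> \<in> \<nu>" and \<Gamma>: "\<Gamma> \<in> Trees F"
  shows "out_act F \<nu> (tree_class F \<Gamma>) = tree_class F (pullback \<phi> \<Gamma>)"
proof -
  have \<phi>: "\<phi> \<in> auto F" "out_class F \<phi> = \<nu>" using OutGroup_memD[OF \<nu>] by auto
  have "tree_class F (pullback \<psi> \<Gamma>') = tree_class F (pullback \<phi> \<Gamma>)"
    if \<psi>: "\<psi> \<in> \<nu>" and \<Gamma>': "\<Gamma>' \<in> tree_class F \<Gamma>" for \<psi> \<Gamma>'
  proof -
    have \<psi>a: "\<psi> \<in> auto F" using OutGroup_memD(1)[OF \<nu>(1) \<psi>] .
    have "pullback \<psi> \<Gamma>' \<in> tree_class F (pullback \<psi> \<Gamma>)" using tree_class_pullback[OF \<psi>a \<Gamma>'] .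
    moreover have "pullback \<psi> \<Gamma> \<in> tree_class F (pullback \<phi> \<Gamma>)"
      using tree_class_pullback_cong[OF \<Gamma> \<phi>(1)] \<psi> \<phi>(2) by simp
    ultimately have "pullback \<psi> \<Gamma>' \<in> tree_class F (pullback \<phi> \<Gamma>)" by (rule tree_class_trans[rotated])
    then show ?thesis by (rule tree_class_eq[OF pullback_in_Trees[OF \<phi>(1) \<Gamma>]])
  qed
  then show ?thesis unfolding out_act_def using \<nu>(2) tree_class_self[OF \<Gamma>] by blast
qed

lemma out_act_vertex:
  assumes "\<nu> \<in> carrier (OutGroup F)" "C \<in> spine_vertices F"
  shows "out_act F \<nu> C \<in> spine_vertices F"
proof -
  obtain \<Gamma> where \<Gamma>: "\<Gamma> \<in> Trees F" "C = tree_class F \<Gamma>" using assms(2) by (auto simp: spine_vertices_def)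
  obtain \<phi> where \<phi>: "\<phi> \<in> \<nu>" using OutGroup_nonempty[OF assms(1)] by blast
  show ?thesis unfolding \<Gamma>(2) out_act_tree_class[OF assms(1) \<phi> \<Gamma>(1)] spine_vertices_def
    using pullback_in_Trees[OF OutGroup_memD(1)[OF assms(1) \<phi>] \<Gamma>(1)] by blast
qed

text \<open>Precomposition reverses the order of the factors, as befits a right action.\<close>

lemma out_act_mult:
  assumes "\<mu> \<in> carrier (OutGroup F)" "\<nu> \<in> carrier (OutGroup F)" "C \<in> spine_vertices F"
  shows "out_act F \<mu> (out_act F \<nu> C) = out_act F (\<nu> \<otimes>\<^bsub>OutGroup F\<^esub> \<mu>) C"
proof -
  obtain \<Gamma> where \<Gamma>: "\<Gamma> \<in> Trees F" "C = tree_class F \<Gamma>" using assms(3) by (auto simp: spine_vertices_def)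
  obtain \<phi> \<psi> where p: "\<phi> \<in> \<nu>" "\<psi> \<in> \<mu>"
    using OutGroup_nonempty[OF assms(1)] OutGroup_nonempty[OF assms(2)] by blast
  note a = OutGroup_memD[OF assms(2) p(1)] and b = OutGroup_memD[OF assms(1) p(2)]
  have m: "\<phi> \<otimes>\<^bsub>AutoGroup F\<^esub> \<psi> \<in> \<nu> \<otimes>\<^bsub>OutGroup F\<^esub> \<mu>"
    using out_class_self[of "\<phi> \<otimes>\<^bsub>AutoGroup F\<^esub> \<psi>"] out_class_mult[OF a(1) b(1)] a b by simp
  have T: "pullback \<phi> \<Gamma> \<in> Trees F" "pullback \<psi> (pullback \<phi> \<Gamma>) \<in> Trees F"
    "pullback (\<phi> \<otimes>\<^bsub>AutoGroup F\<^esub> \<psi>) \<Gamma> \<in> Trees F"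
    using pullback_in_Trees a(1) b(1) \<Gamma>(1) by simp_all
  have "out_act F \<mu> (out_act F \<nu> C) = tree_class F (pullback \<psi> (pullback \<phi> \<Gamma>))"
    unfolding \<Gamma>(2) out_act_tree_class[OF assms(2) p(1) \<Gamma>(1)]
    by (rule out_act_tree_class[OF assms(1) p(2) T(1)])
  also have "\<dots> = tree_class F (pullback (\<phi> \<otimes>\<^bsub>AutoGroup F\<^esub> \<psi>) \<Gamma>)"
    by (rule tree_class_eq[OF T(3)], rule tree_class_congI[OF T(3,2)]) (simp_all add: auto_apply a b)
  also have "\<dots> = out_act F (\<nu> \<otimes>\<^bsub>OutGroup F\<^esub> \<mu>) C"
    unfolding \<Gamma>(2) using out_act_tree_class[OF Out.m_closed[OF assms(2,1)] m \<Gamma>(1)] by simp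
  finally show ?thesis .
qed

lemma out_act_one:
  assumes "C \<in> spine_vertices F"
  shows "out_act F \<one>\<^bsub>OutGroup F\<^esub> C = C"
proof -
  obtain \<Gamma> where \<Gamma>: "\<Gamma> \<in> Trees F" "C = tree_class F \<Gamma>" using assms by (auto simp: spine_vertices_def)
  have m: "\<one>\<^bsub>AutoGroup F\<^esub> \<in> \<one>\<^bsub>OutGroup F\<^esub>" using out_class_self[of "\<one>\<^bsub>AutoGroup F\<^esub>"] by simp
  have "pullback \<one>\<^bsub>AutoGroup F\<^esub> \<Gamma> \<in> tree_class F \<Gamma>"
    using pullback_in_Trees[of "\<one>\<^bsub>AutoGroup F\<^esub>"] \<Gamma>(1)
    by (intro tree_class_congI) (simp_all add: auto_one_apply)
  then show ?thesis
    unfolding \<Gamma>(2) out_act_tree_class[OF Out.one_closed m \<Gamma>(1)] by (rule tree_class_eq[OF \<Gamma>(1)])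
qed

lemma orbit_collapse_pullback:
  assumes \<phi>: "\<phi> \<in> auto F" and c: "orbit_collapse F \<Gamma> \<Gamma>' p"
  shows "orbit_collapse F (pullback \<phi> \<Gamma>) (pullback \<phi> \<Gamma>') p"
proof -
  have U: "(\<Union>x\<in>carrier F. f (\<phi> x)) = (\<Union>x\<in>carrier F. f x)" for f :: "'a \<Rightarrow> (nat \<times> nat) set"
    using auto_image[OF \<phi>] by (metis image_image)
  have ca: "collapsed_arcs (pullback \<phi> \<Gamma>) p = collapsed_arcs \<Gamma> p" by (simp add: collapsed_arcs_def)
  have "(\<Union>x\<in>carrier F. {(act \<Gamma> (\<phi> x) u, act \<Gamma> (\<phi> x) v), (act \<Gamma> (\<phi> x) v, act \<Gamma> (\<phi> x) u)}) =
     (\<Union>x\<in>carrier F. {(act \<Gamma> x u, act \<Gamma> x v), (act \<Gamma> x v, act \<Gamma> x u)})" for u v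
    by (rule U)
  then show ?thesis
    using c pullback_in_Trees[OF \<phi>] equivariant_pullback[OF \<phi>]
    by (simp add: orbit_collapse_def ca)
qed

lemma collapses_pullback:
  assumes \<phi>: "\<phi> \<in> auto F"
  shows "collapses F \<Gamma> \<Gamma>' p \<Longrightarrow> collapses F (pullback \<phi> \<Gamma>) (pullback \<phi> \<Gamma>') p"
proof (induction rule: collapses.induct)
  case (iso \<Gamma>' h)
  then show ?case
    using pullback_in_Trees[OF \<phi>] equivariant_pullback[OF \<phi>] by (intro collapses.iso) simp_all
next
  case (step \<Gamma>' p \<Gamma>'' q)
  show ?case by (rule collapses.step[OF step.IH orbit_collapse_pullback[OF \<phi> step.hyps(2)]])
qed

lemma spine_le_out_act:
  assumes \<nu>: "\<nu> \<in> carrier (OutGroup F)" and C: "C \<in> spine_vertices F" "C' \<in> spine_vertices F"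
    and le: "spine_le F C' C"
  shows "spine_le F (out_act F \<nu> C') (out_act F \<nu> C)"
proof -
  obtain \<Gamma> \<Gamma>' p where *: "\<Gamma> \<in> C" "\<Gamma>' \<in> C'" "collapses F \<Gamma> \<Gamma>' p" using le by (auto simp: spine_le_def)
  obtain \<phi> where \<phi>: "\<phi> \<in> \<nu>" using OutGroup_nonempty[OF \<nu>] by blast
  have \<phi>a: "\<phi> \<in> auto F" using OutGroup_memD(1)[OF \<nu> \<phi>] .
  note d = spine_vertexD[OF C(1) *(1)] and d' = spine_vertexD[OF C(2) *(2)]
  have "out_act F \<nu> C = tree_class F (pullback \<phi> \<Gamma>)" "out_act F \<nu> C' = tree_class F (pullback \<phi> \<Gamma>')"
    using out_act_tree_class[OF \<nu> \<phi>] d d' by simp_all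
  then have "pullback \<phi> \<Gamma> \<in> out_act F \<nu> C" "pullback \<phi> \<Gamma>' \<in> out_act F \<nu> C'"
    using tree_class_self[OF pullback_in_Trees[OF \<phi>a d(1)]]
      tree_class_self[OF pullback_in_Trees[OF \<phi>a d'(1)]] by simp_all
  then show ?thesis unfolding spine_le_def using collapses_pullback[OF \<phi>a *(3)] by blast
qed

text \<open>An automorphism permutes the group elements and so leaves each orbit unchanged as a
  set.\<close>

lemma quotient_graph_pullback:
  assumes \<phi>: "\<phi> \<in> auto F"
  shows "quotient_graph F (pullback \<phi> \<Gamma>) = quotient_graph F \<Gamma>"
    and "orbit F (act (pullback \<phi> \<Gamma>)) v = orbit F (act \<Gamma>) v"
    and "arc_orbit F (pullback \<phi> \<Gamma>) a = arc_orbit F \<Gamma> a"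
proof -
  have o: "orbit F (\<lambda>x. f (\<phi> x)) s = orbit F f s" for f :: "'a \<Rightarrow> 's \<Rightarrow> 's" and s
  proof -
    have "orbit F f s = (\<lambda>x. f x s) ` (\<phi> ` carrier F)" by (auto simp: orbit_def auto_image[OF \<phi>])
    then show ?thesis by (auto simp: orbit_def)
  qed
  have 1: "orbit F (act (pullback \<phi> \<Gamma>)) v = orbit F (act \<Gamma>) v" for v
    using o[of "act \<Gamma>" v] by (simp add: pullback_def)
  have 2: "arc_orbit F (pullback \<phi> \<Gamma>) a = arc_orbit F \<Gamma> a" for a
    using o[of "act_arcs \<Gamma>" a] by (simp add: pullback_def)
  show "orbit F (act (pullback \<phi> \<Gamma>)) v = orbit F (act \<Gamma>) v" "arc_orbit F (pullback \<phi> \<Gamma>) a = arc_orbit F \<Gamma> a"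
    by (rule 1, rule 2)
  show "quotient_graph F (pullback \<phi> \<Gamma>) = quotient_graph F \<Gamma>"
    using 1 2 by (simp add: quotient_graph_def orbits_def)
qed

end

section \<open>Invariance of the essential fixed spine under the normalizer\<close>

context outer_subgroup
begin

lemma Union_essential_fixed_spine:
  "\<Union>(essential_fixed_spine F GG (\<lambda>g. g)) = {C \<in> spine_vertices F. (\<forall>g\<in>G. out_act F g C = C) \<and>
     (\<forall>\<Gamma>\<in>C. \<exists>\<theta>V \<theta>E. realizes F \<Gamma> GG (\<lambda>g. g) \<theta>V \<theta>E \<and>
        (\<forall>a\<in>darts (quotient_graph F \<Gamma>). essential GG (quotient_graph F \<Gamma>) \<theta>E a))}"
  (is "_ = ?V")
proof (rule subset_antisym; rule subsetI)
  fix C assume "C \<in> ?V"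
  then have "{C} \<in> essential_fixed_spine F GG (\<lambda>g. g)"
    using spine_le_refl[of C F]
    by (simp add: essential_fixed_spine_def fixed_spine_def spanned_def spine_def order_complex_def)
  then show "C \<in> \<Union>(essential_fixed_spine F GG (\<lambda>g. g))" by blast
qed (auto simp: essential_fixed_spine_def fixed_spine_def spanned_def)

lemma essential_vertexD:
  assumes "C \<in> \<Union>(essential_fixed_spine F GG (\<lambda>g. g))"
  shows "C \<in> spine_vertices F" and "\<And>g. g \<in> G \<Longrightarrow> out_act F g C = C"
    and "\<And>\<Gamma>. \<Gamma> \<in> C \<Longrightarrow> \<exists>\<theta>V \<theta>E. realizes F \<Gamma> GG (\<lambda>g. g) \<theta>V \<theta>E \<and>
        (\<forall>a\<in>darts (quotient_graph F \<Gamma>). essential GG (quotient_graph F \<Gamma>) \<theta>E a)"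
  using assms unfolding Union_essential_fixed_spine mem_Collect_eq by simp_all

lemma mem_essential_fixed_spine:
  "\<sigma> \<in> essential_fixed_spine F GG (\<lambda>g. g) \<longleftrightarrow>
     \<sigma> \<subseteq> \<Union>(essential_fixed_spine F GG (\<lambda>g. g)) \<and> finite \<sigma> \<and> \<sigma> \<noteq> {} \<and>
     (\<forall>a\<in>\<sigma>. \<forall>b\<in>\<sigma>. spine_le F a b \<or> spine_le F b a)"
  unfolding Union_essential_fixed_spine
  by (auto simp: essential_fixed_spine_def fixed_spine_def spanned_def spine_def order_complex_def)

text \<open>The graph and its automorphisms stay the same, only their labels are conjugated by
  \<open>\<nu>\<close>. A lift for \<open>\<kappa> g\<close> that is twisted by
  \<open>\<psi>\<close> over the pulled-back tree serves for \<open>g\<close> over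
  \<open>\<Gamma>\<close>, twisted by \<open>\<psi>\<close> conjugated with the inverse of
  \<open>\<phi>\<close>.\<close>

lemma realizes_pullback:
  assumes \<nu>: "\<nu> \<in> NG" and \<phi>: "\<phi> \<in> \<nu>"
    and real: "realizes F (pullback (inv\<^bsub>Au\<^esub> \<phi>) \<Gamma>) GG (\<lambda>g. g) \<theta>V \<theta>E"
  defines "\<kappa> \<equiv> \<lambda>g. \<nu> \<otimes>\<^bsub>OutGroup F\<^esub> g \<otimes>\<^bsub>OutGroup F\<^esub> inv\<^bsub>OutGroup F\<^esub> \<nu>"
  shows "realizes F \<Gamma> GG (\<lambda>g. g) (\<lambda>g. \<theta>V (\<kappa> g)) (\<lambda>g. \<theta>E (\<kappa> g))"
proof -
  let ?P = "pullback (inv\<^bsub>Au\<^esub> \<phi>) \<Gamma>"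
  note a = NG_auto[OF \<nu> \<phi>]
  have i\<phi>: "inv\<^bsub>Au\<^esub> \<phi> \<in> auto F" using a by simp
  have \<nu>c: "\<nu> \<in> carrier (OutGroup F)" using NG_carrier[OF \<nu>] .
  have \<kappa>G: "\<kappa> g \<in> G" if "g \<in> G" for g using NG_conj[OF \<nu> that] by (simp add: \<kappa>_def)
  have \<kappa>_hom: "\<kappa> \<in> hom GG GG"
  proof (rule homI)
    fix g k assume "g \<in> carrier GG" "k \<in> carrier GG"
    then have gk: "g \<in> carrier (OutGroup F)" "k \<in> carrier (OutGroup F)" using G_carrier by simp_all
    have "inv\<^bsub>OutGroup F\<^esub> \<nu> \<otimes>\<^bsub>OutGroup F\<^esub> (\<nu> \<otimes>\<^bsub>OutGroup F\<^esub> (k \<otimes>\<^bsub>OutGroup F\<^esub> inv\<^bsub>OutGroup F\<^esub> \<nu>)) =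
        k \<otimes>\<^bsub>OutGroup F\<^esub> inv\<^bsub>OutGroup F\<^esub> \<nu>"
      using gk \<nu>c by (simp add: Out.m_assoc[symmetric])
    then show "\<kappa> (g \<otimes>\<^bsub>GG\<^esub> k) = \<kappa> g \<otimes>\<^bsub>GG\<^esub> \<kappa> k"
      using gk \<nu>c by (simp add: \<kappa>_def Out.m_assoc)
  qed (use \<kappa>G in simp)
  note q = quotient_graph_pullback[OF i\<phi>, of \<Gamma>]
  have ga: "graph_action GG (quotient_graph F \<Gamma>) \<theta>V \<theta>E" using real by (simp add: realizes_def q(1))
  have "graph_action GG (quotient_graph F \<Gamma>) (\<lambda>g. \<theta>V (\<kappa> g)) (\<lambda>g. \<theta>E (\<kappa> g))"
    using ga group_action_hom[of GG _ \<theta>V, OF _ \<kappa>_hom GG_group] group_action_hom[of GG _ \<theta>E, OF _ \<kappa>_hom GG_group] \<kappa>G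
    by (simp add: graph_action_def)
  moreover have "\<exists>h. \<exists>\<chi>\<in>g. tree_iso \<Gamma> \<Gamma> h \<and> equivariant F \<Gamma> (pullback \<chi> \<Gamma>) h \<and>
        (\<forall>v\<in>verts \<Gamma>. orbit F (act \<Gamma>) (h v) = \<theta>V (\<kappa> g) (orbit F (act \<Gamma>) v)) \<and>
        (\<forall>a\<in>arcs \<Gamma>. arc_orbit F \<Gamma> (map_prod h h a) = \<theta>E (\<kappa> g) (arc_orbit F \<Gamma> a))"
    if g: "g \<in> G" for g
  proof -
    have "\<forall>g\<in>G. \<exists>h. \<exists>\<psi>\<in>g. tree_iso \<Gamma> \<Gamma> h \<and> equivariant F ?P (pullback \<psi> ?P) h \<and>
        (\<forall>v\<in>verts \<Gamma>. orbit F (act \<Gamma>) (h v) = \<theta>V g (orbit F (act \<Gamma>) v)) \<and>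
        (\<forall>a\<in>arcs \<Gamma>. arc_orbit F \<Gamma> (map_prod h h a) = \<theta>E g (arc_orbit F \<Gamma> a))"
      using real by (simp add: realizes_def q(2,3) del: pullback_sel(3))
    from bspec[OF this \<kappa>G[OF g]] obtain h \<psi> where h: "\<psi> \<in> \<kappa> g" "tree_iso \<Gamma> \<Gamma> h" "equivariant F ?P (pullback \<psi> ?P) h"
      "\<forall>v\<in>verts \<Gamma>. orbit F (act \<Gamma>) (h v) = \<theta>V (\<kappa> g) (orbit F (act \<Gamma>) v)"
      "\<forall>a\<in>arcs \<Gamma>. arc_orbit F \<Gamma> (map_prod h h a) = \<theta>E (\<kappa> g) (arc_orbit F \<Gamma> a)"
      by (elim exE bexE conjE)
    have \<psi>: "\<psi> \<in> auto F" "out_class F \<psi> = \<kappa> g" using G_memD[OF \<kappa>G[OF g] h(1)] E_auto by auto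
    define \<chi> where "\<chi> = inv\<^bsub>Au\<^esub> \<phi> \<otimes>\<^bsub>Au\<^esub> \<psi> \<otimes>\<^bsub>Au\<^esub> \<phi>"
    have \<chi>: "\<chi> \<in> auto F" using a \<psi> by (simp add: \<chi>_def)
    have "out_class F \<chi> = inv\<^bsub>OutGroup F\<^esub> \<nu> \<otimes>\<^bsub>OutGroup F\<^esub> \<kappa> g \<otimes>\<^bsub>OutGroup F\<^esub> \<nu>"
      using a \<psi> by (simp add: \<chi>_def)
    also have "\<dots> = g"
      using \<nu>c G_carrier[OF g] by (simp add: \<kappa>_def Out.m_assoc) (simp add: Out.m_assoc[symmetric])
    finally have "\<chi> \<in> g" using out_class_self[OF \<chi>] by simp
    moreover have "equivariant F \<Gamma> (pullback \<chi> \<Gamma>) h"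
      unfolding equivariant_def
    proof (intro ballI)
      fix y v assume y: "y \<in> carrier F" and v: "v \<in> verts \<Gamma>"
      have \<phi>y: "\<phi> y \<in> carrier F" using autoD(1) a y by blast
      have "(inv\<^bsub>Au\<^esub> \<phi>) (\<phi> y) = y"
        using auto_apply[OF i\<phi> _ y, of \<phi>] a A.l_inv[of \<phi>] auto_one_apply[OF y] by simp
      moreover have "(inv\<^bsub>Au\<^esub> \<phi>) (\<psi> (\<phi> y)) = \<chi> y"
        using a \<psi> i\<phi> y \<phi>y by (simp add: \<chi>_def auto_apply)
      moreover have "h (act ?P (\<phi> y) v) = act (pullback \<psi> ?P) (\<phi> y) (h v)"
        using h(3) \<phi>y v by (simp add: equivariant_def)
      ultimately show "h (act \<Gamma> y v) = act (pullback \<chi> \<Gamma>) y (h v)" by simp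
    qed
    ultimately show ?thesis using h by blast
  qed
  ultimately show ?thesis by (simp add: realizes_def)
qed

text \<open>Invariant forests depend only on the set of graph automorphisms and not on its labelling
  by \<open>G\<close>.\<close>

lemma essential_reindex:
  assumes "\<kappa> ` G = G"
  shows "essential GG X (\<lambda>g. \<theta>E (\<kappa> g)) a \<longleftrightarrow> essential GG X \<theta>E a"
proof -
  have "(\<forall>g\<in>G. \<theta>E (\<kappa> g) ` S = S) \<longleftrightarrow> (\<forall>g\<in>\<kappa> ` G. \<theta>E g ` S = S)" for S by simp
  then have "invariant_forest GG X (\<lambda>g. \<theta>E (\<kappa> g)) S \<longleftrightarrow> invariant_forest GG X \<theta>E S" for S
    unfolding assms by (simp add: invariant_forest_def)
  then show ?thesis by (simp add: essential_def maximal_invariant_forest_def)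
qed

lemma out_act_essential_vertex:
  assumes \<nu>: "\<nu> \<in> NG" and C: "C \<in> \<Union>(essential_fixed_spine F GG (\<lambda>g. g))"
  shows "out_act F \<nu> C \<in> \<Union>(essential_fixed_spine F GG (\<lambda>g. g))"
proof -
  note Cv = essential_vertexD(1)[OF C] and fix_C = essential_vertexD(2)[OF C]
    and ess = essential_vertexD(3)[OF C]
  have \<nu>c: "\<nu> \<in> carrier (OutGroup F)" and i\<nu>: "inv\<^bsub>OutGroup F\<^esub> \<nu> \<in> carrier (OutGroup F)"
    using NG_carrier[OF \<nu>] by simp_all
  have "out_act F g (out_act F \<nu> C) = out_act F \<nu> C" if g: "g \<in> G" for g
  proof -
    \<comment> \<open>Moving by \<open>\<nu>\<close> and acting with \<open>g\<close> equals acting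
      with the conjugate \<open>?k\<close> and moving by \<open>\<nu>\<close>, and \<open>?k\<close>
      fixes \<open>C\<close>.\<close>
    let ?k = "\<nu> \<otimes>\<^bsub>OutGroup F\<^esub> g \<otimes>\<^bsub>OutGroup F\<^esub> inv\<^bsub>OutGroup F\<^esub> \<nu>"
    have k: "?k \<in> G" using NG_conj[OF \<nu> g] .
    have "?k \<otimes>\<^bsub>OutGroup F\<^esub> \<nu> = \<nu> \<otimes>\<^bsub>OutGroup F\<^esub> g" using \<nu>c G_carrier[OF g] by (simp add: Out.m_assoc)
    then have "out_act F g (out_act F \<nu> C) = out_act F \<nu> (out_act F ?k C)"
      using out_act_mult[OF G_carrier[OF g] \<nu>c Cv] out_act_mult[OF \<nu>c G_carrier[OF k] Cv] by simp
    then show ?thesis using fix_C[OF k] by simp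
  qed
  moreover have "\<exists>\<theta>V \<theta>E. realizes F \<Gamma>2 GG (\<lambda>g. g) \<theta>V \<theta>E \<and>
        (\<forall>a\<in>darts (quotient_graph F \<Gamma>2). essential GG (quotient_graph F \<Gamma>2) \<theta>E a)"
    if \<Gamma>2: "\<Gamma>2 \<in> out_act F \<nu> C" for \<Gamma>2
  proof -
    obtain \<phi> where \<phi>: "\<phi> \<in> \<nu>" using OutGroup_nonempty[OF \<nu>c] by blast
    note a = NG_auto[OF \<nu> \<phi>]
    have vert: "out_act F \<nu> C \<in> spine_vertices F" using out_act_vertex[OF \<nu>c Cv] .
    note d = spine_vertexD[OF vert \<Gamma>2]
    have im: "inv\<^bsub>Au\<^esub> \<phi> \<in> inv\<^bsub>OutGroup F\<^esub> \<nu>"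
      using out_class_self[of "inv\<^bsub>Au\<^esub> \<phi>"] OC.hom_inv[of \<phi>] a by simp
    have "tree_class F (pullback (inv\<^bsub>Au\<^esub> \<phi>) \<Gamma>2) = out_act F (inv\<^bsub>OutGroup F\<^esub> \<nu>) (out_act F \<nu> C)"
      using out_act_tree_class[OF i\<nu> im d(1)] d(2) by simp
    also have "\<dots> = C" using out_act_mult[OF i\<nu> \<nu>c Cv] out_act_one[OF Cv] \<nu>c by simp
    \<comment> \<open>A member of the moved class is untwisted into \<open>C\<close>, where a
      realization with essential edges is known.\<close>
    finally have "pullback (inv\<^bsub>Au\<^esub> \<phi>) \<Gamma>2 \<in> C"
      using tree_class_self[OF pullback_in_Trees[OF _ d(1)]] a by auto
    from ess[OF this] obtain \<theta>V \<theta>E where \<theta>: "realizes F (pullback (inv\<^bsub>Au\<^esub> \<phi>) \<Gamma>2) GG (\<lambda>g. g) \<theta>V \<theta>E"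
      "\<forall>a\<in>darts (quotient_graph F \<Gamma>2). essential GG (quotient_graph F \<Gamma>2) \<theta>E a"
      unfolding quotient_graph_pullback(1)[OF auto_inv_closed[OF conjunct1[OF a]]] by (elim exE conjE)
    have "(\<lambda>g. \<nu> \<otimes>\<^bsub>OutGroup F\<^esub> g \<otimes>\<^bsub>OutGroup F\<^esub> inv\<^bsub>OutGroup F\<^esub> \<nu>) ` G = G"
      using \<nu> normalizer_iff by blast
    note re = essential_reindex[OF this, where X = "quotient_graph F \<Gamma>2" and \<theta>E = \<theta>E]
    show ?thesis
    proof (intro exI conjI ballI)
      show "realizes F \<Gamma>2 GG (\<lambda>g. g)
          (\<lambda>g. \<theta>V (\<nu> \<otimes>\<^bsub>OutGroup F\<^esub> g \<otimes>\<^bsub>OutGroup F\<^esub> inv\<^bsub>OutGroup F\<^esub> \<nu>))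
          (\<lambda>g. \<theta>E (\<nu> \<otimes>\<^bsub>OutGroup F\<^esub> g \<otimes>\<^bsub>OutGroup F\<^esub> inv\<^bsub>OutGroup F\<^esub> \<nu>))"
        by (rule realizes_pullback[OF \<nu> \<phi> \<theta>(1)])
    qed (use re \<theta>(2) in simp)
  qed
  ultimately show ?thesis using out_act_vertex[OF \<nu>c Cv] unfolding Union_essential_fixed_spine by simp
qed

lemma out_act_essential_simplex:
  assumes \<nu>: "\<nu> \<in> NG" and \<sigma>: "\<sigma> \<in> essential_fixed_spine F GG (\<lambda>g. g)"
  shows "out_act F \<nu> ` \<sigma> \<in> essential_fixed_spine F GG (\<lambda>g. g)"
proof -
  note s = \<sigma>[unfolded mem_essential_fixed_spine]
  have sv: "C \<in> spine_vertices F" if "C \<in> \<sigma>" for C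
    using essential_vertexD(1)[OF UnionI[OF \<sigma> that]] .
  have "spine_le F (out_act F \<nu> a) (out_act F \<nu> b) \<or> spine_le F (out_act F \<nu> b) (out_act F \<nu> a)"
    if "a \<in> \<sigma>" "b \<in> \<sigma>" for a b
    using s that spine_le_out_act[OF NG_carrier[OF \<nu>] sv[OF that(1)] sv[OF that(2)]]
      spine_le_out_act[OF NG_carrier[OF \<nu>] sv[OF that(2)] sv[OF that(1)]] by blast
  moreover have "out_act F \<nu> ` \<sigma> \<subseteq> \<Union>(essential_fixed_spine F GG (\<lambda>g. g))"
    using out_act_essential_vertex[OF \<nu>] s by blast
  ultimately show ?thesis using s by (subst mem_essential_fixed_spine) auto
qed

text \<open>One inclusion holds for every element of the normalizer; applied to the inverse of
  \<open>\<nu>\<close> it gives the other.\<close>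

lemma normalizer_preserves_essential_fixed_spine:
  assumes \<nu>: "\<nu> \<in> NG"
  shows "image (out_act F \<nu>) ` essential_fixed_spine F GG (\<lambda>g. g) = essential_fixed_spine F GG (\<lambda>g. g)"
proof (rule subset_antisym; rule subsetI)
  let ?L = "essential_fixed_spine F GG (\<lambda>g. g)" and ?i = "inv\<^bsub>OutGroup F\<^esub> \<nu>"
  fix \<sigma> assume \<sigma>: "\<sigma> \<in> ?L"
  have \<nu>c: "\<nu> \<in> carrier (OutGroup F)" using NG_carrier[OF \<nu>] .
  have i: "?i \<in> NG" using subgroup.m_inv_closed[OF NG_subgroup \<nu>] .
  have "out_act F \<nu> (out_act F ?i C) = C" if "C \<in> \<sigma>" for C
  proof -
    have "C \<in> spine_vertices F" using essential_vertexD(1)[OF UnionI[OF \<sigma> that]] .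
    then show ?thesis using out_act_mult[OF \<nu>c NG_carrier[OF i]] out_act_one \<nu>c by simp
  qed
  then have "out_act F \<nu> ` (out_act F ?i ` \<sigma>) = \<sigma>" by (simp add: image_image)
  moreover have "out_act F ?i ` \<sigma> \<in> ?L" using out_act_essential_simplex[OF i \<sigma>] .
  ultimately show "\<sigma> \<in> image (out_act F \<nu>) ` ?L" by (metis image_eqI)
qed (use out_act_essential_simplex[OF \<nu>] in auto)

end

section \<open>The vertex map induced by restricting the action\<close>

context free_outer_subgroup
begin

definition spine_map :: "('a \<Rightarrow> 'a) gtree set \<Rightarrow> 'a gtree set" where
  "spine_map C = (\<Union>\<Delta>\<in>C. tree_class F (pullback (inner F) \<Delta>))"

abbreviation "LE \<equiv> reduced_spine E"

abbreviation "L\<alpha> \<equiv> essential_fixed_spine F GG (\<lambda>g. g)"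

lemma LE_vertexD:
  assumes "C \<in> \<Union>LE" "\<Delta> \<in> C"
  shows "\<Delta> \<in> Trees E" "C = tree_class E \<Delta>" "loopfree \<Delta>" "\<And>a. a \<in> arcs \<Delta> \<Longrightarrow> surviving E \<Delta> a"
proof -
  have C: "C \<in> spine_vertices E" "\<And>a. a \<in> arcs \<Delta> \<Longrightarrow> surviving E \<Delta> a"
    using assms unfolding Union_reduced_spine by blast+
  show "\<Delta> \<in> Trees E" "C = tree_class E \<Delta>" using spine_vertexD[OF C(1) assms(2)] by auto
  show "\<And>a. a \<in> arcs \<Delta> \<Longrightarrow> surviving E \<Delta> a" by (rule C(2))
  then show "loopfree \<Delta>" by (rule surviving_loopfree)
qed

lemma spine_map_tree_class:
  assumes "\<Delta> \<in> Trees E" "loopfree \<Delta>"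
  shows "spine_map (tree_class E \<Delta>) = tree_class F (pullback (inner F) \<Delta>)"
proof -
  have T: "pullback (inner F) \<Delta> \<in> Trees F" using X.pullback_in_Trees[OF assms] .
  have "tree_class F (pullback (inner F) \<Delta>') = tree_class F (pullback (inner F) \<Delta>)"
    if \<Delta>': "\<Delta>' \<in> tree_class E \<Delta>" for \<Delta>'
  proof -
    have T': "\<Delta>' \<in> Trees E" using \<Delta>' by (simp add: tree_class_def)
    have "pullback (inner F) \<Delta>' \<in> Trees F"
      using X.pullback_in_Trees[OF T' tree_class_loopfree[OF \<Delta>' assms(2)]] .
    then have "pullback (inner F) \<Delta>' \<in> tree_class F (pullback (inner F) \<Delta>)"
      using X.extension_class_iff[OF assms X.extends_pullback T' X.extends_pullback T] \<Delta>' by simp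
    then show ?thesis by (rule tree_class_eq[OF T])
  qed
  then show ?thesis unfolding spine_map_def using tree_class_self[OF assms(1)] by blast
qed

text \<open>Every member of the image class, not only the literal restrictions, carries an
  \<open>E\<close>-action belonging to \<open>C\<close>.\<close>

lemma spine_map_extension:
  assumes C: "C \<in> \<Union>LE" and \<Gamma>: "\<Gamma> \<in> spine_map C"
  obtains \<Delta> where "\<Delta> \<in> C" "X.extends \<Delta> \<Gamma>"
proof -
  obtain \<Delta>0 where \<Delta>0: "\<Delta>0 \<in> C" "\<Gamma> \<in> tree_class F (pullback (inner F) \<Delta>0)"
    using \<Gamma> by (auto simp: spine_map_def)
  note d = LE_vertexD[OF C \<Delta>0(1)]
  show ?thesis using X.class_of_restriction_extends[OF d(1,3) \<Delta>0(2)] d(2) that by blast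
qed

lemma LE_nonempty: "C \<in> \<Union>LE \<Longrightarrow> \<exists>\<Delta>. \<Delta> \<in> C"
  unfolding Union_reduced_spine spine_vertices_def using tree_class_self by blast

text \<open>For a representative \<open>\<phi>\<close> of an element of \<open>G\<close>, its action
  on the \<open>E\<close>-tree is an isomorphism to the tree twisted by \<open>\<phi>\<close>, so
  the class is fixed. Surviving edges become essential by
  \<open>essential_iff_surviving\<close>.\<close>

lemma spine_map_vertex:
  assumes C: "C \<in> \<Union>LE"
  shows "spine_map C \<in> \<Union>L\<alpha>"
proof -
  obtain \<Delta>0 where \<Delta>0: "\<Delta>0 \<in> C" using LE_nonempty[OF C] by blast
  note d0 = LE_vertexD[OF C \<Delta>0]
  have T0: "pullback (inner F) \<Delta>0 \<in> Trees F" using X.pullback_in_Trees[OF d0(1,3)] .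
  have fC: "spine_map C = tree_class F (pullback (inner F) \<Delta>0)"
    using spine_map_tree_class[OF d0(1,3)] d0(2) by simp
  then have fv: "spine_map C \<in> spine_vertices F" using T0 by (simp add: spine_vertices_def)
  have "out_act F g (spine_map C) = spine_map C" if g: "g \<in> G" for g
  proof -
    obtain \<phi> where \<phi>: "\<phi> \<in> g" using OutGroup_nonempty[OF G_carrier[OF g]] by blast
    have \<phi>E: "\<phi> \<in> carrier E" using G_memD[OF g \<phi>] by simp
    let ?\<Gamma> = "pullback (inner F) \<Delta>0"
    have "X.twisted_aut ?\<Gamma> \<phi> (act \<Delta>0 \<phi>)"
      using X.twisted_aut_extension[OF d0(1,3) X.extends_pullback \<phi>E] .
    then have "pullback \<phi> ?\<Gamma> \<in> tree_class F ?\<Gamma>"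
      unfolding twisted_aut_iff using pullback_in_Trees[OF E_auto[OF \<phi>E] T0] by (auto simp: tree_class_def)
    then show ?thesis
      unfolding fC out_act_tree_class[OF G_carrier[OF g] \<phi> T0] by (rule tree_class_eq[OF T0])
  qed
  moreover have "\<exists>\<theta>V \<theta>E. realizes F \<Gamma> GG (\<lambda>g. g) \<theta>V \<theta>E \<and>
        (\<forall>a\<in>darts (quotient_graph F \<Gamma>). essential GG (quotient_graph F \<Gamma>) \<theta>E a)"
    if \<Gamma>: "\<Gamma> \<in> spine_map C" for \<Gamma>
  proof -
    obtain \<Delta> where \<Delta>: "\<Delta> \<in> C" "X.extends \<Delta> \<Gamma>" using spine_map_extension[OF C \<Gamma>] .
    note d = LE_vertexD[OF C \<Delta>(1)]
    have T: "\<Gamma> \<in> Trees F" using spine_vertexD(1)[OF fv \<Gamma>] .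
    obtain \<theta>V \<theta>E where r: "realizes F \<Gamma> GG (\<lambda>g. g) \<theta>V \<theta>E"
      using realization_exists[OF T d(1,3) \<Delta>(2)] by blast
    have "arcs \<Delta> = arcs \<Gamma>" using \<Delta>(2) by (simp add: X.extends_def)
    then have "\<forall>a\<in>darts (quotient_graph F \<Gamma>). essential GG (quotient_graph F \<Gamma>) \<theta>E a"
      using essential_iff_surviving[OF T d(1,3) \<Delta>(2) r] d(4) by (simp add: darts_quotient)
    with r show ?thesis by blast
  qed
  ultimately show ?thesis using fv unfolding Union_essential_fixed_spine by simp
qed

text \<open>Essential edges rule out loops, so the realization on one member extends to an
  \<open>E\<close>-tree. All trees in the class of that extension restrict to members of
  \<open>C\<close>, and hence all their edges survive.\<close>

lemma spine_map_surj:
  assumes C: "C \<in> \<Union>L\<alpha>"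
  shows "\<exists>D\<in>\<Union>LE. spine_map D = C"
proof -
  note Cv = essential_vertexD(1)[OF C]
  have ess: "\<exists>\<theta>V \<theta>E. realizes F \<Gamma> GG (\<lambda>g. g) \<theta>V \<theta>E \<and>
        (\<forall>a\<in>arcs \<Gamma>. essential GG (quotient_graph F \<Gamma>) \<theta>E (arc_orbit F \<Gamma> a))" if "\<Gamma> \<in> C" for \<Gamma>
    using essential_vertexD(3)[OF C that] by (simp add: darts_quotient)
  have lf: "loopfree \<Gamma>" if \<Gamma>: "\<Gamma> \<in> C" for \<Gamma>
    unfolding loopfree_def
  proof (intro allI notI)
    fix v assume v: "(v, v) \<in> arcs \<Gamma>"
    obtain \<theta>V \<theta>E where r: "realizes F \<Gamma> GG (\<lambda>g. g) \<theta>V \<theta>E"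
      "essential GG (quotient_graph F \<Gamma>) \<theta>E (arc_orbit F \<Gamma> (v, v))"
      using ess[OF \<Gamma>] v by blast
    show False
      using quotient_loop_inessential[OF is_group spine_vertexD(1)[OF Cv \<Gamma>] v r(1) GG_group] r(2) by blast
  qed
  obtain \<Gamma> where \<Gamma>: "\<Gamma> \<in> C" using Cv tree_class_self unfolding spine_vertices_def by blast
  note d = spine_vertexD[OF Cv \<Gamma>]
  obtain \<theta>V \<theta>E where "realizes F \<Gamma> GG (\<lambda>g. g) \<theta>V \<theta>E" using ess[OF \<Gamma>] by blast
  then obtain \<Delta> where \<Delta>: "\<Delta> \<in> Trees E" "X.extends \<Delta> \<Gamma>"
    using realized_extension[OF d(1) lf[OF \<Gamma>]] by blast
  have lfD: "loopfree \<Delta>" using X.extends_loopfree[OF \<Delta>(2)] lf[OF \<Gamma>] by simp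
  have "surviving E \<Delta>1 a" if \<Delta>1: "\<Delta>1 \<in> tree_class E \<Delta>" and a: "a \<in> arcs \<Delta>1" for \<Delta>1 a
  proof -
    let ?\<Gamma> = "pullback (inner F) \<Delta>1"
    have T1: "\<Delta>1 \<in> Trees E" using \<Delta>1 by (simp add: tree_class_def)
    have lf1: "loopfree \<Delta>1" using tree_class_loopfree[OF \<Delta>1 lfD] .
    have T: "?\<Gamma> \<in> Trees F" using X.pullback_in_Trees[OF T1 lf1] .
    have "?\<Gamma> \<in> C"
      using X.extension_class_iff[OF \<Delta>(1) lfD \<Delta>(2) T1 X.extends_pullback d(1) T] \<Delta>1 d(2) by simp
    from ess[OF this] obtain \<theta>V \<theta>E where r: "realizes F ?\<Gamma> GG (\<lambda>g. g) \<theta>V \<theta>E"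
      "\<forall>a\<in>arcs ?\<Gamma>. essential GG (quotient_graph F ?\<Gamma>) \<theta>E (arc_orbit F ?\<Gamma> a)"
      by (elim exE conjE)
    have a': "a \<in> arcs ?\<Gamma>" using a by simp
    from essential_iff_surviving[OF T T1 lf1 X.extends_pullback r(1) a'] bspec[OF r(2) a']
    show ?thesis by (rule iffD1)
  qed
  then have "tree_class E \<Delta> \<in> \<Union>LE" unfolding Union_reduced_spine using \<Delta>(1) by (simp add: spine_vertices_def)
  moreover have "spine_map (tree_class E \<Delta>) = C"
  proof -
    have T: "pullback (inner F) \<Delta> \<in> Trees F" using X.pullback_in_Trees[OF \<Delta>(1) lfD] .
    have "pullback (inner F) \<Delta> \<in> tree_class F \<Gamma>"
      using X.extension_class_iff[OF \<Delta>(1) lfD \<Delta>(2,1) X.extends_pullback d(1) T] tree_class_self[OF \<Delta>(1)] by simp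
    then show ?thesis
      using spine_map_tree_class[OF \<Delta>(1) lfD] tree_class_eq[OF d(1)] d(2) by simp
  qed
  ultimately show ?thesis by blast
qed

text \<open>An \<open>F\<close>-isomorphism between restrictions of \<open>E\<close>-trees is
  already \<open>E\<close>-equivariant.\<close>

lemma spine_map_inj: "inj_on spine_map (\<Union>LE)"
proof (rule inj_onI)
  fix C D assume C: "C \<in> \<Union>LE" and D: "D \<in> \<Union>LE" and eq: "spine_map C = spine_map D"
  obtain \<Delta> \<Delta>' where m: "\<Delta> \<in> C" "\<Delta>' \<in> D" using LE_nonempty[OF C] LE_nonempty[OF D] by blast
  note d = LE_vertexD[OF C m(1)] and d' = LE_vertexD[OF D m(2)]
  have T: "pullback (inner F) \<Delta> \<in> Trees F" "pullback (inner F) \<Delta>' \<in> Trees F"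
    using X.pullback_in_Trees d(1,3) d'(1,3) by blast+
  have "tree_class F (pullback (inner F) \<Delta>) = tree_class F (pullback (inner F) \<Delta>')"
    using spine_map_tree_class[OF d(1,3)] spine_map_tree_class[OF d'(1,3)] d(2) d'(2) eq by simp
  then have "pullback (inner F) \<Delta>' \<in> tree_class F (pullback (inner F) \<Delta>)"
    using tree_class_self[OF T(2)] by simp
  then have "\<Delta>' \<in> tree_class E \<Delta>"
    using X.extension_class_iff[OF d(1,3) X.extends_pullback d'(1) X.extends_pullback T] by simp
  then show "C = D" using tree_class_eq[OF d(1)] d(2) d'(2) by simp
qed

text \<open>A chain of orbit collapses on one side is merged into one collapse map, carried to the
  other group, and decomposed there into a new chain. The numbers of steps may differ.\<close>

lemma spine_le_spine_map:
  assumes C: "C \<in> \<Union>LE" and D: "D \<in> \<Union>LE"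
  shows "spine_le F (spine_map C) (spine_map D) \<longleftrightarrow> spine_le E C D"
proof
  assume "spine_le E C D"
  then obtain \<Delta> \<Delta>' p where m: "\<Delta> \<in> D" "\<Delta>' \<in> C" "collapses E \<Delta> \<Delta>' p" by (auto simp: spine_le_def)
  note d = LE_vertexD[OF D m(1)] and d' = LE_vertexD[OF C m(2)]
  let ?\<Gamma> = "pullback (inner F) \<Delta>" and ?\<Gamma>' = "pullback (inner F) \<Delta>'"
  have T: "?\<Gamma> \<in> Trees F" "?\<Gamma>' \<in> Trees F"
    using X.pullback_in_Trees d(1,3) d'(1,3) by blast+
  have lf: "loopfree ?\<Gamma>" using X.extends_loopfree[OF X.extends_pullback] d(3) by blast
  interpret Ct: cocompact_tree F ?\<Gamma>
    by (rule cocompact_group.cocompact_treeI[OF X.cocompact_group_F T(1) lf])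
  have "collapse_map F ?\<Gamma> ?\<Gamma>' p"
    by (rule X.collapse_map_restriction[OF collapses_collapse_map[OF m(3) d(3)] X.extends_pullback X.extends_pullback T])
  then obtain q where "collapses F ?\<Gamma> ?\<Gamma>' q" using Ct.collapse_map_collapses by blast
  moreover have "?\<Gamma> \<in> spine_map D" "?\<Gamma>' \<in> spine_map C"
    using m(1,2) tree_class_self T by (auto simp: spine_map_def)
  ultimately show "spine_le F (spine_map C) (spine_map D)" unfolding spine_le_def by blast
next
  assume "spine_le F (spine_map C) (spine_map D)"
  then obtain \<Gamma> \<Gamma>' p where m: "\<Gamma> \<in> spine_map D" "\<Gamma>' \<in> spine_map C" "collapses F \<Gamma> \<Gamma>' p"
    by (auto simp: spine_le_def)
  obtain \<Delta> where \<Delta>: "\<Delta> \<in> D" "X.extends \<Delta> \<Gamma>" using spine_map_extension[OF D m(1)] .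
  obtain \<Delta>' where \<Delta>': "\<Delta>' \<in> C" "X.extends \<Delta>' \<Gamma>'" using spine_map_extension[OF C m(2)] .
  note d = LE_vertexD[OF D \<Delta>(1)] and d' = LE_vertexD[OF C \<Delta>'(1)]
  have lf: "loopfree \<Gamma>" using X.extends_loopfree[OF \<Delta>(2)] d(3) by simp
  interpret Ct: cocompact_tree E \<Delta>
    by (rule cocompact_group.cocompact_treeI[OF X.cocompact_group_E d(1,3)])
  have "collapse_map E \<Delta> \<Delta>' p"
    by (rule X.collapse_map_extension[OF d(1,3) \<Delta>(2) d'(1) \<Delta>'(2) collapses_collapse_map[OF m(3) lf]])
  then obtain q where "collapses E \<Delta> \<Delta>' q" using Ct.collapse_map_collapses by blast
  with \<Delta>(1) \<Delta>'(1) show "spine_le E C D" unfolding spine_le_def by blast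
qed

text \<open>On both sides the simplices are the nonempty finite sets of admissible vertices that are
  pairwise comparable. A bijection of vertices preserving and reflecting the order is therefore
  enough.\<close>

lemma spine_map_simplicial_iso: "simplicial_iso spine_map LE L\<alpha>"
  unfolding simplicial_iso_def
proof
  have im: "spine_map ` \<Union>LE = \<Union>L\<alpha>" using spine_map_vertex spine_map_surj by blast
  then show "bij_betw spine_map (\<Union>LE) (\<Union>L\<alpha>)" using spine_map_inj by (simp add: bij_betw_def)
  have chain: "(\<forall>a\<in>spine_map ` \<sigma>. \<forall>b\<in>spine_map ` \<sigma>. spine_le F a b \<or> spine_le F b a) \<longleftrightarrow>
      (\<forall>a\<in>\<sigma>. \<forall>b\<in>\<sigma>. spine_le E a b \<or> spine_le E b a)" if "\<sigma> \<subseteq> \<Union>LE" for \<sigma>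
    using spine_le_spine_map that by (auto simp: subset_iff)
  show "image spine_map ` LE = L\<alpha>"
  proof (rule subset_antisym; rule subsetI)
    fix \<tau> assume "\<tau> \<in> image spine_map ` LE"
    then obtain \<sigma> where \<sigma>: "\<sigma> \<in> LE" "\<tau> = spine_map ` \<sigma>" by blast
    note s = \<sigma>(1)[unfolded mem_reduced_spine]
    have "\<tau> \<subseteq> \<Union>L\<alpha>" using s im \<sigma>(2) by blast
    then show "\<tau> \<in> L\<alpha>" using s \<sigma>(2) chain[of \<sigma>] by (subst mem_essential_fixed_spine) simp
  next
    fix \<tau> assume \<tau>: "\<tau> \<in> L\<alpha>"
    note t = \<tau>[unfolded mem_essential_fixed_spine]
    let ?\<sigma> = "inv_into (\<Union>LE) spine_map ` \<tau>"
    have "\<tau> \<subseteq> spine_map ` \<Union>LE" using t im by simp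
    then have "spine_map ` ?\<sigma> = \<tau>" by (rule image_inv_into_cancel[OF refl])
    moreover have "?\<sigma> \<subseteq> \<Union>LE"
    proof
      fix D assume "D \<in> ?\<sigma>"
      then obtain C where "C \<in> \<tau>" "D = inv_into (\<Union>LE) spine_map C" by blast
      with \<open>\<tau> \<subseteq> spine_map ` \<Union>LE\<close> show "D \<in> \<Union>LE" by (simp only:) (rule inv_into_into, rule subsetD)
    qed
    ultimately have \<sigma>: "spine_map ` ?\<sigma> = \<tau>" "?\<sigma> \<subseteq> \<Union>LE" .
    have "?\<sigma> \<in> LE" using t \<sigma> chain[OF \<sigma>(2)] by (subst mem_reduced_spine) simp
    then show "\<tau> \<in> image spine_map ` LE" using \<sigma>(1) by (metis image_eqI)
  qed
qed

text \<open>\<open>restrict_metric\<close> divides lengths by this index. For an infinite set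
  \<open>card\<close> would be 0, and division by 0 would turn all lengths into 0; finiteness holds
  because the cosets are elements of \<open>G\<close>.\<close>

lemma card_cosets_pos: "card (rcosets\<^bsub>E\<^esub> (inner F ` carrier F)) > 0"
proof -
  have sub: "rcosets\<^bsub>E\<^esub> (inner F ` carrier F) \<subseteq> G"
  proof
    fix Q assume "Q \<in> rcosets\<^bsub>E\<^esub> (inner F ` carrier F)"
    then obtain \<phi> where \<phi>: "\<phi> \<in> carrier E" "Q = inner F ` carrier F #>\<^bsub>E\<^esub> \<phi>" by (auto simp: RCOSETS_def)
    then have "Q = out_class F \<phi>" by (simp add: out_class_def r_coset_def Inn_def)
    then show "Q \<in> G" using \<phi>(1) by (simp add: carrier_E)
  qed
  have "inner F ` carrier F #>\<^bsub>E\<^esub> \<one>\<^bsub>E\<^esub> \<in> rcosets\<^bsub>E\<^esub> (inner F ` carrier F)"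
    using E.one_closed unfolding RCOSETS_def by blast
  then show ?thesis using finite_subset[OF sub finite_G] by (auto simp: card_gt_0_iff)
qed

lemma forget_metric_class:
  assumes "\<Gamma> \<in> Trees K" "edge_lengths K \<Gamma> len"
  shows "forget_metric K (metric_class K (\<Gamma>, len)) = tree_class K \<Gamma>"
proof -
  have "(\<Gamma>, len) \<in> metric_class K (\<Gamma>, len)"
    using assms tree_iso_id[of \<Gamma> id \<Gamma>] by (auto simp: metric_class_def equivariant_def intro!: exI[of _ id])
  moreover have "tree_class K \<Gamma>' = tree_class K \<Gamma>" if "(\<Gamma>', len') \<in> metric_class K (\<Gamma>, len)" for \<Gamma>' len'
    using that by (intro tree_class_eq[OF assms(1)]) (auto simp: metric_class_def tree_class_def)
  ultimately show ?thesis unfolding forget_metric_def by blast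
qed

text \<open>Scaling by a positive factor keeps the lengths positive and invariant, so the restricted
  metric tree is legitimate and its underlying tree is the restriction.\<close>

lemma forget_restrict_metric:
  assumes X: "X \<in> PT E" and v: "forget_metric E X \<in> \<Union>LE"
  shows "spine_map (forget_metric E X) = forget_metric F (restrict_metric E F (inner F) X)"
proof -
  obtain \<Delta> len where \<Delta>: "X = metric_class E (\<Delta>, len)" "\<Delta> \<in> Trees E" "edge_lengths E \<Delta> len"
    using X by (auto simp: PT_def)
  have fX: "forget_metric E X = tree_class E \<Delta>" using forget_metric_class \<Delta> by simp
  have lf: "loopfree \<Delta>" using LE_vertexD(3)[OF v] fX tree_class_self[OF \<Delta>(2)] by simp
  let ?m = "card (rcosets\<^bsub>E\<^esub> (inner F ` carrier F))"
  have m: "?m > 0" by (rule card_cosets_pos)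
  have *: "forget_metric F (metric_class F (pullback (inner F) \<Delta>', \<lambda>e. len' e / real ?m)) =
      tree_class F (pullback (inner F) \<Delta>)"
    if X': "(\<Delta>', len') \<in> X" for \<Delta>' len'
  proof -
    have \<Delta>': "\<Delta>' \<in> tree_class E \<Delta>" "\<Delta>' \<in> Trees E" "edge_lengths E \<Delta>' len'"
      using X' \<Delta>(1) by (auto simp: metric_class_def tree_class_def)
    have lf': "loopfree \<Delta>'" using tree_class_loopfree[OF \<Delta>'(1) lf] .
    have T: "pullback (inner F) \<Delta>' \<in> Trees F" using X.pullback_in_Trees[OF \<Delta>'(2) lf'] .
    have "edge_lengths F (pullback (inner F) \<Delta>') (\<lambda>e. len' e / real ?m)"
      using \<Delta>'(3) m inner_E by (simp add: edge_lengths_def edges_def)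
    then have "forget_metric F (metric_class F (pullback (inner F) \<Delta>', \<lambda>e. len' e / real ?m)) =
        tree_class F (pullback (inner F) \<Delta>')"
      by (rule forget_metric_class[OF T])
    also have "\<dots> = spine_map (tree_class E \<Delta>')" using spine_map_tree_class[OF \<Delta>'(2) lf'] by simp
    also have "\<dots> = spine_map (tree_class E \<Delta>)" using tree_class_eq[OF \<Delta>(2) \<Delta>'(1)] by simp
    also have "\<dots> = tree_class F (pullback (inner F) \<Delta>)" by (rule spine_map_tree_class[OF \<Delta>(2) lf])
    finally show ?thesis .
  qed
  have UN: "forget_metric F (\<Union>p\<in>X. f p) = (\<Union>p\<in>X. forget_metric F (f p))"
    for f :: "('a \<Rightarrow> 'a) metric_tree \<Rightarrow> 'a metric_tree set"
    by (auto simp: forget_metric_def)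
  have "(\<Delta>, len) \<in> X"
    unfolding \<Delta>(1) using \<Delta>(2,3) tree_iso_id[of \<Delta> id \<Delta>]
    by (auto simp: metric_class_def equivariant_def intro!: exI[of _ id])
  then have "forget_metric F (restrict_metric E F (inner F) X) = tree_class F (pullback (inner F) \<Delta>)"
    unfolding restrict_metric_def Let_def UN using * by (force simp: case_prod_beta)
  then show ?thesis using fX spine_map_tree_class[OF \<Delta>(2) lf] by simp
qed

end

theorem theorem3:
  fixes F :: "('a, 'b) monoid_scheme" and n :: nat
    and G :: "('a \<Rightarrow> 'a) set set" and GG :: "('a \<Rightarrow> 'a) set monoid"
    and E :: "('a \<Rightarrow> 'a) monoid" and \<alpha> :: "('a \<Rightarrow> 'a) set \<Rightarrow> ('a \<Rightarrow> 'a) set"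
  assumes "n \<ge> 2" and "free_group_of_rank F n"
    and "subgroup G (OutGroup F)" and "finite G"
    and "GG = (OutGroup F)\<lparr>carrier := G\<rparr>"
    and "E = full_preimage F G"
    and "\<alpha> = (\<lambda>g. g)"
  shows "(\<exists>f. simplicial_iso f (reduced_spine E) (essential_fixed_spine F GG \<alpha>) \<and>
             (\<forall>X\<in>PT E. forget_metric E X \<in> \<Union>(reduced_spine E) \<longrightarrow>
                f (forget_metric E X) = forget_metric F (restrict_metric E F (inner F) X))) \<and>
         (\<forall>\<nu>\<in>normalizer (OutGroup F) G.
             image (out_act F \<nu>) ` essential_fixed_spine F GG \<alpha> = essential_fixed_spine F GG \<alpha>) \<and>
         (\<exists>q. short_exact GG (\<lambda>g. g) ((OutGroup F)\<lparr>carrier := normalizer (OutGroup F) G\<rparr>) q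
                (Out0 E (Inn F)))"
proof -
  interpret F: group F using assms(2) by (simp add: free_group_of_rank_def)
  obtain B where B: "finite B" "card B = n" "free_basis F B"
    using assms(2) by (auto simp: free_group_of_rank_def)
  \<comment> \<open>Rank at least two enters here: the centre of \<open>F\<close> is
    trivial.\<close>
  interpret centerless_group F
  proof
    show "x = \<one>\<^bsub>F\<^esub>" if "x \<in> carrier F" "\<And>y. y \<in> carrier F \<Longrightarrow> x \<otimes>\<^bsub>F\<^esub> y = y \<otimes>\<^bsub>F\<^esub> x" for x
      using F.free_basis_center_trivial[OF B(3,1) _ that] B(2) assms(1) by simp
  qed
  interpret free_outer_subgroup F G B
    by (intro free_outer_subgroup.intro outer_subgroup.intro centerless_group_axioms
        outer_subgroup_axioms.intro free_outer_subgroup_axioms.intro assms(3,4) B(1,3))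
      (use assms(1) B(2) in simp)
  show ?thesis
    unfolding assms(5-7)
    using spine_map_simplicial_iso forget_restrict_metric normalizer_preserves_essential_fixed_spine
      short_exact_normalizer by blast
qed

end
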